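(* Let $\mathcal P\subset\mathcal P_0$. Assume there exist constants $C,c>0$ such that for all $n\in\mathbb N$ and $P\in\mathcal P$ there exists $B\ge1$ such that either (A1a) and (A2) or (A1b) and (A2) hold, where (A1a): $\max_{r=1,2}\mathbb E_P[|\epsilon_P\xi_P|^{2+r}/B^r]+\mathbb E_P[\exp(|\epsilon_P\xi_P|/B)]\le4$; (A1b): $\max_{r=1,2}\mathbb E_P[|\epsilon_P\xi_P|^{2+r}/B^{r/2}]+\mathbb E_P[|\epsilon_P\xi_P|^4/B^2]\le4$; (A2): $B^2(\log(Kn))^7/n\le Cn^{-c}$. Assume there exist $C_1,c_1>0$ (independent of $n$) such that for all $k=1,\dots,K$ and $P\in\mathcal P$, $|w_k|\le C_1$ and $\mathbb E_P[\epsilon_P^2\xi_P^2w_k(Z)^2]\ge c_1$. Assume $A_fA_g=o_{\mathcal P}(n^{-1}\log(K)^{-2})$, $B_f=o_{\mathcal P}(\log(K)^{-4})$, $B_g=o_{\mathcal P}(\log(K)^{-4})$, and that there exist sequences of real numbers $(\tau_{f,n})$, $(\tau_{g,n})$ with $\max_{i=1,\dots,n}|\epsilon_{P,i}|=O_{\mathcal P}(\tau_{g,n})$, $A_g=o_{\mathcal P}(\tau_{g,n}^{-2}\log(K)^{-2})$, $\max_{i=1,\dots,n}|\xi_{P,i}|=O_{\mathcal P}(\tau_{f,n})$, $A_f=o_{\mathcal P}(\tau_{f,n}^{-2}\log(K)^{-2})$. Then $\sup_{P\in\mathcal P}\sup_{\alpha\in(0,1)}|\mathbb P_P(S_n\le\hat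 G_n(\alpha))-\alpha|\to0$.
   Context: Let $X,Y$ be real-valued random variables and $Z$ a random vector in $\mathbb R^{d_Z}$. $\mathcal E_0$ is the set of distributions of $(X,Y,Z)$ absolutely continuous with respect to Lebesgue measure, $\mathcal P_0\subseteq\mathcal E_0$ those under which $X$ and $Y$ are conditionally independent given $Z$. For $P\in\mathcal E_0$: $f_P(z)=\mathbb E_P[X\mid Z=z]$, $g_P(z)=\mathbb E_P[Y\mid Z=z]$, $\epsilon_P=X-f_P(Z)$, $\xi_P=Y-g_P(Z)$, $u_P(z)=\mathbb E_P[\epsilon_P^2\mid Z=z]$, $v_P(z)=\mathbb E_P[\xi_P^2\mid Z=z]$. Data $(x_i,y_i,z_i)$, $i=1,\dots,n$, i.i.d. copies of $(X,Y,Z)$; $\epsilon_{P,i}=x_i-f_P(z_i)$, $\xi_{P,i}=y_i-g_P(z_i)$; $\hat f$ is obtained by regressing $\mathbf X^{(n)}$ on $\mathbf Z^{(n)}$ and $\hat g$ by regressing $\mathbf Y^{(n)}$ on $\mathbf Z^{(n)}$. $A_f=\frac1n\sum_i(f_P(z_i)-\hat f(z_i))^2$, $A_g=\frac1n\sum_i(g_P(z_i)-\hat g(z_i))^2$, $B_f=\frac1n\sum_i(f_P(z_i)-\hat f(z_i))^2v_P(z_i)$, $B_g=\frac1n\sum_i(g_P(z_i)-\hat g(z_i))^2u_P(z_i)$. Let $K=K_n\ge3$ (allowed to depend on $n$) and $w_1,\dots,w_K:\mathbb R^{d_Z}\to\mathbb R$ fixed bounded measurable weight functions. For each $k$ let $\mathbf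 R_k\in\mathbb R^n$ with entries $R_{ki}=(x_i-\hat f(z_i))(y_i-\hat g(z_i))w_k(z_i)$, $\bar{\mathbf R}_k$ its coordinate mean, $T_k^{(n)}=\sqrt n\bar{\mathbf R}_k/(\frac1n\|\mathbf R_k\|_2^2-\bar{\mathbf R}_k^2)^{1/2}$, and $S_n=\max_k|T_k^{(n)}|$. Let $\hat\Sigma\in\mathbb R^{K\times K}$, $\hat\Sigma_{kl}=\frac{\frac1n\mathbf R_k^T\mathbf R_l-\bar{\mathbf R}_k\bar{\mathbf R}_l}{(\frac1n\|\mathbf R_k\|_2^2-\bar{\mathbf R}_k^2)^{1/2}(\frac1n\|\mathbf R_l\|_2^2-\bar{\mathbf R}_l^2)^{1/2}}$; given $\hat\Sigma$ let $\hat{\mathbf T}^{(n)}\sim\mathcal N_K(0,\hat\Sigma)$, $\hat S_n=\max_k|\hat T_k^{(n)}|$, and $\hat G_n$ the quantile function of $\hat S_n$ conditional on $\hat\Sigma$. For a family $\mathcal P$ and positive $W_n$: $V_n=o_{\mathcal P}(W_n)$ means $\sup_{P\in\mathcal P}\mathbb P_P(|V_n/W_n|>\delta)\to0$ for all $\delta>0$; $V_n=O_{\mathcal P}(W_n)$ means $\lim_{M\to\infty}\sup_{P\in\mathcal P}\sup_n\mathbb P_P(|V_n/W_n|>M)=0$. *)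

theory Defs
  imports "HOL-Probability.Probability"
begin

text \<open>Observations (X,Y,Z) take values in real x real x 'z, where 'z is a Euclidean
  space (playing the role of R^{d_Z}; its dimension is arbitrary).\<close>

type_synonym 'z obs = "real \<times> real \<times> 'z"

definition obsX :: "'z obs \<Rightarrow> real" where "obsX w = fst w"
definition obsY :: "'z obs \<Rightarrow> real" where "obsY w = fst (snd w)"
definition obsZ :: "'z obs \<Rightarrow> 'z" where "obsZ w = snd (snd w)"

definition E0 :: "('z::euclidean_space) obs measure set" where
  "E0 = {P. prob_space P \<and> sets P = sets borel \<and> absolutely_continuous lborel P}"

definition cond_mean :: "('z::euclidean_space) obs measure \<Rightarrow> ('z obs \<Rightarrow> real) \<Rightarrow> ('z \<Rightarrow> real) \<Rightarrow> bool" where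
  "cond_mean P h m \<longleftrightarrow> m \<in> borel_measurable borel \<and> integrable P h \<and>
     integrable P (\<lambda>w. m (obsZ w)) \<and>
     (\<forall>A\<in>sets (borel :: 'z measure).
        (\<integral>w. indicator A (obsZ w) * h w \<partial>P) = (\<integral>w. indicator A (obsZ w) * m (obsZ w) \<partial>P))"

definition cond_mean_nn :: "('z::euclidean_space) obs measure \<Rightarrow> ('z obs \<Rightarrow> real) \<Rightarrow> ('z \<Rightarrow> real) \<Rightarrow> bool" where
  "cond_mean_nn P h m \<longleftrightarrow> m \<in> borel_measurable borel \<and> (\<forall>z. 0 \<le> m z) \<and>
     (\<forall>A\<in>sets (borel :: 'z measure).
        (\<integral>\<^sup>+w. ennreal (indicator A (obsZ w) * h w) \<partial>P)
          = (\<integral>\<^sup>+w. ennreal (indicator A (obsZ w) * m (obsZ w)) \<partial>P))"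

definition cond_indep_XY_Z :: "('z::euclidean_space) obs measure \<Rightarrow> bool" where
  "cond_indep_XY_Z P \<longleftrightarrow>
     (\<forall>A\<in>sets (borel :: real measure). \<forall>B\<in>sets (borel :: real measure). \<forall>pA pB pAB.
        cond_mean P (\<lambda>w. indicator A (obsX w)) pA \<and>
        cond_mean P (\<lambda>w. indicator B (obsY w)) pB \<and>
        cond_mean P (\<lambda>w. indicator A (obsX w) * indicator B (obsY w)) pAB \<longrightarrow>
        (AE w in P. pAB (obsZ w) = pA (obsZ w) * pB (obsZ w)))"

definition P0 :: "('z::euclidean_space) obs measure set" where
  "P0 = {P \<in> E0. cond_indep_XY_Z P}"

definition sample :: "nat \<Rightarrow> 'z obs measure \<Rightarrow> (nat \<Rightarrow> 'z obs) measure" where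
  "sample n P = PiM {..<n} (\<lambda>_. P)"

definition probn :: "nat \<Rightarrow> 'z obs measure \<Rightarrow> ((nat \<Rightarrow> 'z obs) \<Rightarrow> bool) \<Rightarrow> real" where
  "probn n P E = measure (sample n P) {\<omega> \<in> space (sample n P). E \<omega>}"

text \<open>Uniform stochastic order symbols. V n P \<omega> is a statistic of the sample \<omega> of size n
  (which may also depend on P); W n is the positive normalising sequence.\<close>
definition smallo_P :: "'z obs measure set \<Rightarrow> (nat \<Rightarrow> 'z obs measure \<Rightarrow> (nat \<Rightarrow> 'z obs) \<Rightarrow> real)
    \<Rightarrow> (nat \<Rightarrow> real) \<Rightarrow> bool" where
  "smallo_P \<P> V W \<longleftrightarrow>
     (\<forall>\<delta>>0. \<forall>\<epsilon>>0. \<exists>N. \<forall>n\<ge>N. \<forall>P\<in>\<P>. probn n P (\<lambda>\<omega>. \<bar>V n P \<omega> / W n\<bar> > \<delta>) \<le> \<epsilon>)"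

definition bigO_P :: "'z obs measure set \<Rightarrow> (nat \<Rightarrow> 'z obs measure \<Rightarrow> (nat \<Rightarrow> 'z obs) \<Rightarrow> real)
    \<Rightarrow> (nat \<Rightarrow> real) \<Rightarrow> bool" where
  "bigO_P \<P> V W \<longleftrightarrow>
     (\<forall>\<epsilon>>0. \<exists>M. \<forall>n. \<forall>P\<in>\<P>. probn n P (\<lambda>\<omega>. \<bar>V n P \<omega> / W n\<bar> > M) \<le> \<epsilon>)"

text \<open>A regression procedure: given the sample size n, the responses and the covariates
  of the sample, it returns a fitted function of z.\<close>
type_synonym 'z regr = "nat \<Rightarrow> (nat \<Rightarrow> real) \<Rightarrow> (nat \<Rightarrow> 'z) \<Rightarrow> 'z \<Rightarrow> real"

definition fhat :: "'z regr \<Rightarrow> nat \<Rightarrow> (nat \<Rightarrow> 'z obs) \<Rightarrow> 'z \<Rightarrow> real" where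
  "fhat fh n \<omega> = fh n (\<lambda>j. obsX (\<omega> j)) (\<lambda>j. obsZ (\<omega> j))"

definition ghat :: "'z regr \<Rightarrow> nat \<Rightarrow> (nat \<Rightarrow> 'z obs) \<Rightarrow> 'z \<Rightarrow> real" where
  "ghat gh n \<omega> = gh n (\<lambda>j. obsY (\<omega> j)) (\<lambda>j. obsZ (\<omega> j))"

definition epsxi :: "('z obs measure \<Rightarrow> 'z \<Rightarrow> real) \<Rightarrow> ('z obs measure \<Rightarrow> 'z \<Rightarrow> real)
    \<Rightarrow> 'z obs measure \<Rightarrow> 'z obs \<Rightarrow> real" where
  "epsxi f g P w = (obsX w - f P (obsZ w)) * (obsY w - g P (obsZ w))"

definition Af :: "('z obs measure \<Rightarrow> 'z \<Rightarrow> real) \<Rightarrow> 'z regr \<Rightarrow> nat \<Rightarrow> 'z obs measure \<Rightarrow> (nat \<Rightarrow> 'z obs) \<Rightarrow> real" where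
  "Af f fh n P \<omega> = (1 / real n) * (\<Sum>i<n. (f P (obsZ (\<omega> i)) - fhat fh n \<omega> (obsZ (\<omega> i)))\<^sup>2)"

definition Ag :: "('z obs measure \<Rightarrow> 'z \<Rightarrow> real) \<Rightarrow> 'z regr \<Rightarrow> nat \<Rightarrow> 'z obs measure \<Rightarrow> (nat \<Rightarrow> 'z obs) \<Rightarrow> real" where
  "Ag g gh n P \<omega> = (1 / real n) * (\<Sum>i<n. (g P (obsZ (\<omega> i)) - ghat gh n \<omega> (obsZ (\<omega> i)))\<^sup>2)"

definition Bf :: "('z obs measure \<Rightarrow> 'z \<Rightarrow> real) \<Rightarrow> 'z regr \<Rightarrow> ('z obs measure \<Rightarrow> 'z \<Rightarrow> real)
    \<Rightarrow> nat \<Rightarrow> 'z obs measure \<Rightarrow> (nat \<Rightarrow> 'z obs) \<Rightarrow> real" where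
  "Bf f fh v n P \<omega> = (1 / real n) *
     (\<Sum>i<n. (f P (obsZ (\<omega> i)) - fhat fh n \<omega> (obsZ (\<omega> i)))\<^sup>2 * v P (obsZ (\<omega> i)))"

definition Bg :: "('z obs measure \<Rightarrow> 'z \<Rightarrow> real) \<Rightarrow> 'z regr \<Rightarrow> ('z obs measure \<Rightarrow> 'z \<Rightarrow> real)
    \<Rightarrow> nat \<Rightarrow> 'z obs measure \<Rightarrow> (nat \<Rightarrow> 'z obs) \<Rightarrow> real" where
  "Bg g gh u n P \<omega> = (1 / real n) *
     (\<Sum>i<n. (g P (obsZ (\<omega> i)) - ghat gh n \<omega> (obsZ (\<omega> i)))\<^sup>2 * u P (obsZ (\<omega> i)))"

definition Rk :: "'z regr \<Rightarrow> 'z regr \<Rightarrow> (nat \<Rightarrow> 'z \<Rightarrow> real) \<Rightarrow> nat \<Rightarrow> (nat \<Rightarrow> 'z obs) \<Rightarrow> nat \<Rightarrow> nat \<Rightarrow> real" where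
  "Rk fh gh w n \<omega> k i =
     (obsX (\<omega> i) - fhat fh n \<omega> (obsZ (\<omega> i))) * (obsY (\<omega> i) - ghat gh n \<omega> (obsZ (\<omega> i)))
       * w k (obsZ (\<omega> i))"

definition Rbar :: "'z regr \<Rightarrow> 'z regr \<Rightarrow> (nat \<Rightarrow> 'z \<Rightarrow> real) \<Rightarrow> nat \<Rightarrow> (nat \<Rightarrow> 'z obs) \<Rightarrow> nat \<Rightarrow> real" where
  "Rbar fh gh w n \<omega> k = (1 / real n) * (\<Sum>i<n. Rk fh gh w n \<omega> k i)"

definition Rsq :: "'z regr \<Rightarrow> 'z regr \<Rightarrow> (nat \<Rightarrow> 'z \<Rightarrow> real) \<Rightarrow> nat \<Rightarrow> (nat \<Rightarrow> 'z obs) \<Rightarrow> nat \<Rightarrow> nat \<Rightarrow> real" where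
  "Rsq fh gh w n \<omega> k l = (1 / real n) * (\<Sum>i<n. Rk fh gh w n \<omega> k i * Rk fh gh w n \<omega> l i)"

definition sdR :: "'z regr \<Rightarrow> 'z regr \<Rightarrow> (nat \<Rightarrow> 'z \<Rightarrow> real) \<Rightarrow> nat \<Rightarrow> (nat \<Rightarrow> 'z obs) \<Rightarrow> nat \<Rightarrow> real" where
  "sdR fh gh w n \<omega> k = sqrt (Rsq fh gh w n \<omega> k k - (Rbar fh gh w n \<omega> k)\<^sup>2)"

definition Tstat :: "'z regr \<Rightarrow> 'z regr \<Rightarrow> (nat \<Rightarrow> 'z \<Rightarrow> real) \<Rightarrow> nat \<Rightarrow> (nat \<Rightarrow> 'z obs) \<Rightarrow> nat \<Rightarrow> real" where
  "Tstat fh gh w n \<omega> k = sqrt (real n) * Rbar fh gh w n \<omega> k / sdR fh gh w n \<omega> k"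

definition Sstat :: "'z regr \<Rightarrow> 'z regr \<Rightarrow> (nat \<Rightarrow> 'z \<Rightarrow> real) \<Rightarrow> nat \<Rightarrow> nat \<Rightarrow> (nat \<Rightarrow> 'z obs) \<Rightarrow> real" where
  "Sstat fh gh w K n \<omega> = Max ((\<lambda>k. \<bar>Tstat fh gh w n \<omega> k\<bar>) ` {1..K})"

definition Sigma_hat :: "'z regr \<Rightarrow> 'z regr \<Rightarrow> (nat \<Rightarrow> 'z \<Rightarrow> real) \<Rightarrow> nat \<Rightarrow> (nat \<Rightarrow> 'z obs) \<Rightarrow> nat \<Rightarrow> nat \<Rightarrow> real" where
  "Sigma_hat fh gh w n \<omega> k l =
     (Rsq fh gh w n \<omega> k l - Rbar fh gh w n \<omega> k * Rbar fh gh w n \<omega> l)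
       / (sdR fh gh w n \<omega> k * sdR fh gh w n \<omega> l)"

text \<open>Centred K-variate Gaussian N_K(0,\<Sigma>) (coordinates 1..K): the law of L \<xi>, where \<xi> has
  i.i.d. standard normal coordinates and L is any K x K matrix with L L^T = \<Sigma>
  (such L exists since \<Sigma> is positive semidefinite; the law does not depend on the choice).\<close>
definition std_gauss_vec :: "nat \<Rightarrow> (nat \<Rightarrow> real) measure" where
  "std_gauss_vec K = PiM {1..K} (\<lambda>_. density lborel std_normal_density)"

definition gauss_vec :: "nat \<Rightarrow> (nat \<Rightarrow> nat \<Rightarrow> real) \<Rightarrow> (nat \<Rightarrow> real) measure" where
  "gauss_vec K \<Sigma> =
     (let L = (SOME L :: nat \<Rightarrow> nat \<Rightarrow> real.
                 \<forall>i\<in>{1..K}. \<forall>j\<in>{1..K}. (\<Sum>m\<in>{1..K}. L i m * L j m) = \<Sigma> i j)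
      in distr (std_gauss_vec K) (PiM {1..K} (\<lambda>_. borel))
           (\<lambda>\<xi>. \<lambda>k\<in>{1..K}. \<Sum>j\<in>{1..K}. L k j * \<xi> j))"

definition max_abs_law :: "nat \<Rightarrow> (nat \<Rightarrow> nat \<Rightarrow> real) \<Rightarrow> real measure" where
  "max_abs_law K \<Sigma> = distr (gauss_vec K \<Sigma>) borel (\<lambda>t. Max ((\<lambda>k. \<bar>t k\<bar>) ` {1..K}))"

definition quantile :: "real measure \<Rightarrow> real \<Rightarrow> real" where
  "quantile \<mu> \<alpha> = Inf {t. \<alpha> \<le> measure \<mu> {..t}}"

text \<open>\<hat>G_n(\<alpha>): the \<alpha>-quantile of \<hat>S_n conditional on \<hat>\<Sigma>.\<close>
definition Ghat :: "'z regr \<Rightarrow> 'z regr \<Rightarrow> (nat \<Rightarrow> 'z \<Rightarrow> real) \<Rightarrow> nat \<Rightarrow> nat \<Rightarrow> (nat \<Rightarrow> 'z obs) \<Rightarrow> real \<Rightarrow> real" where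
  "Ghat fh gh w K n \<omega> \<alpha> = quantile (max_abs_law K (Sigma_hat fh gh w n \<omega>)) \<alpha>"

definition A1a :: "('z obs measure \<Rightarrow> 'z \<Rightarrow> real) \<Rightarrow> ('z obs measure \<Rightarrow> 'z \<Rightarrow> real)
    \<Rightarrow> 'z obs measure \<Rightarrow> real \<Rightarrow> bool" where
  "A1a f g P B \<longleftrightarrow>
     max (\<integral>\<^sup>+w. ennreal (\<bar>epsxi f g P w\<bar> ^ 3 / B) \<partial>P)
         (\<integral>\<^sup>+w. ennreal (\<bar>epsxi f g P w\<bar> ^ 4 / B\<^sup>2) \<partial>P)
     + (\<integral>\<^sup>+w. ennreal (exp (\<bar>epsxi f g P w\<bar> / B)) \<partial>P) \<le> 4"

definition A1b :: "('z obs measure \<Rightarrow> 'z \<Rightarrow> real) \<Rightarrow> ('z obs measure \<Rightarrow> 'z \<Rightarrow> real)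
    \<Rightarrow> 'z obs measure \<Rightarrow> real \<Rightarrow> bool" where
  "A1b f g P B \<longleftrightarrow>
     max (\<integral>\<^sup>+w. ennreal (\<bar>epsxi f g P w\<bar> ^ 3 / B powr (1/2)) \<partial>P)
         (\<integral>\<^sup>+w. ennreal (\<bar>epsxi f g P w\<bar> ^ 4 / B powr 1) \<partial>P)
     + (\<integral>\<^sup>+w. ennreal (\<bar>epsxi f g P w\<bar> ^ 4 / B\<^sup>2) \<partial>P) \<le> 4"

end

theory Submission
  imports Defs
begin

text \<open>Under conditional independence the oracle products \<open>\<epsilon>\<^sub>i \<xi>\<^sub>i w\<^sub>k(z\<^sub>i)\<close> are centred, with covariance \<open>\<Sigma>\<close>
  after normalisation. The largest of their standardised sums is compared in law with the maximum
  of a centred Gaussian vector with covariance \<open>\<Sigma>\<close>: first the summands are multiplied by independent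
  standard Gaussians, by a Lindeberg argument with a smooth surrogate of the maximum whose
  derivatives grow only logarithmically in \<open>K\<close>; given the data the multiplier sums are exactly
  Gaussian with the empirical covariance, which concentrates around \<open>\<Sigma>\<close>. Anticoncentration of
  Gaussian maxima with unit variances removes the smoothing.

  The cross terms of the regression errors are averages of \<open>\<epsilon>\<^sub>i\<close> against functions of \<open>(Y, Z)\<close> and of
  \<open>\<xi>\<^sub>i\<close> against functions of \<open>(X, Z)\<close>. Such products are orthogonal by conditional independence, so a
  maximal inequality driven by \<open>B\<^sub>f\<close> and \<open>B\<^sub>g\<close> bounds their weighted sums, and Markov's inequality
  bounds their squares. Hence \<open>S\<^sub>n\<close> and the
  estimated covariance are close to their oracle versions, and the Gaussian comparison and
  anticoncentration bounds carry this over to the bootstrap quantile. All errors are controlled by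
  one small parameter \<open>s\<close>.\<close>

section \<open>Smooth approximation of the maximum\<close>

text \<open>The regression errors come from the same sample as the residuals. What replaces sample
  splitting is that the error of \<open>ghat\<close> ignores the X-responses: given (Y, Z), its
  products with the residuals of X remain centred, with second moments governed by \<open>u\<close>.
  The orders in \<open>s\<close> and \<open>l = ln K\<close> are forced, up to constants, as
  follows. Anticoncentration costs \<open>sqrt l\<close> per unit of threshold, so smoothing windows
  have width \<open>s / sqrt l\<close> and the statistics must agree to that accuracy. Second
  derivatives of the smooth maximum have total mass \<open>l / (s / sqrt l)^2\<close>, so
  covariances must be known up to \<open>s^3 / l^2\<close>. By Cauchy-Schwarz the squared cross
  terms must then stay below \<open>s^6 / l^4\<close>: this is the power 4 of the logarithm and,
  with room for Markov's inequality, the level \<open>s^8\<close> at which the stochastic orders are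
  evaluated. Third derivatives have order \<open>l^2 / (s / sqrt l)^3\<close>; against a third
  moment of order \<open>B\<close> and \<open>n^(-1/2)\<close> this asks for
  \<open>B l^(7/2) \<le> s^4 sqrt n\<close>, whose square is the seventh power in the moment
  condition.\<close>

definition clamp01 :: "real \<Rightarrow> real" where
  "clamp01 u = min 1 (max 0 u)"

lemma clamp01_bounds: "0 \<le> clamp01 u" "clamp01 u \<le> 1"
  by (auto simp: clamp01_def)

lemma clamp01_eq [simp]: "u \<le> 0 \<Longrightarrow> clamp01 u = 0" "1 \<le> u \<Longrightarrow> clamp01 u = 1"
  "0 \<le> u \<Longrightarrow> u \<le> 1 \<Longrightarrow> clamp01 u = u"
  by (auto simp: clamp01_def)

text \<open>Freezing a function outside [0,1] preserves differentiability as soon as its derivative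
  vanishes at both endpoints. Applied to a polynomial step and its first two derivatives, it gives a
  global function with three derivatives.\<close>

lemma DERIV_clamp01_comp:
  fixes s s' :: "real \<Rightarrow> real"
  assumes D: "\<And>u. (s has_real_derivative s' u) (at u)" and z: "s' 0 = 0" "s' 1 = 0"
  shows "((\<lambda>u. s (clamp01 u)) has_real_derivative s' (clamp01 u)) (at u)"
proof -
  consider "u < 0" | "u > 1" | "0 < u" "u < 1" | "u = 0" | "u = 1" by linarith
  then show ?thesis
  proof cases
    case 1
    have "((\<lambda>u. s 0) has_real_derivative s' (clamp01 u)) (at u)" using 1 z by auto
    then show ?thesis
      by (rule has_field_derivative_transform_within_open[of _ _ _ "{..<0}"]) (use 1 in auto)
  next
    case 2
    have "((\<lambda>u. s 1) has_real_derivative s' (clamp01 u)) (at u)" using 2 z by auto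
    then show ?thesis
      by (rule has_field_derivative_transform_within_open[of _ _ _ "{1<..}"]) (use 2 in auto)
  next
    case 3
    have "(s has_real_derivative s' (clamp01 u)) (at u)" using 3 D by auto
    then show ?thesis
      by (rule has_field_derivative_transform_within_open[of _ _ _ "{0<..<1}"]) (use 3 in auto)
  next
    case 4
    have "((\<lambda>h. (s h - s 0) / h) \<longlongrightarrow> 0) (at 0)"
      using D[of 0] z by (simp add: DERIV_def)
    \<comment> \<open>For small \<open>h\<close> the clamped difference quotient is either 0 or the
      unclamped one, so it is dominated by a quotient that tends to 0.\<close>
    then have "((\<lambda>h. (s (clamp01 h) - s 0) / h) \<longlongrightarrow> 0) (at 0)"
    proof (rule metric_tendsto_imp_tendsto)
      show "\<forall>\<^sub>F h in at 0. dist ((s (clamp01 h) - s 0) / h) 0 \<le> dist ((s h - s 0) / h) 0"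
        unfolding eventually_at
        by (intro exI[of _ 1]) (auto simp: clamp01_def min_def max_def divide_le_0_iff)
    qed
    then show ?thesis using 4 z by (simp add: DERIV_def)
  next
    case 5
    have "((\<lambda>h. (s (1 + h) - s 1) / h) \<longlongrightarrow> 0) (at 0)"
      using D[of 1] z by (simp add: DERIV_def)
    then have "((\<lambda>h. (s (clamp01 (1 + h)) - s 1) / h) \<longlongrightarrow> 0) (at 0)"
    proof (rule metric_tendsto_imp_tendsto)
      show "\<forall>\<^sub>F h in at 0. dist ((s (clamp01 (1 + h)) - s 1) / h) 0 \<le> dist ((s (1 + h) - s 1) / h) 0"
        unfolding eventually_at
        by (intro exI[of _ 1]) (auto simp: clamp01_def min_def max_def dist_real_def)
    qed
    then show ?thesis using 5 z by (simp add: DERIV_def)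
  qed
qed

text \<open>The degree 7 smoothstep is the polynomial step with three continuous derivatives, as needed for a
  third-order Taylor expansion.\<close>

definition sstep :: "real \<Rightarrow> real" where
  "sstep u = (\<lambda>c. 35*c^4 - 84*c^5 + 70*c^6 - 20*c^7) (clamp01 u)"
text \<open>On [0,1] this is the density of the Beta(4,4) distribution, so \<open>sstep\<close> is
  its distribution function. The double zeros left in the second derivative and the simple zeros
  left in the third make every junction at 0 and 1 admissible for
  \<open>DERIV_clamp01_comp\<close>.\<close>

definition sstep1 :: "real \<Rightarrow> real" where
  "sstep1 u = (\<lambda>c. 140*c^3*(1-c)^3) (clamp01 u)"
definition sstep2 :: "real \<Rightarrow> real" where
  "sstep2 u = (\<lambda>c. 420*c^2*(1-c)^2*(1-2*c)) (clamp01 u)"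
definition sstep3 :: "real \<Rightarrow> real" where
  "sstep3 u = (\<lambda>c. 840*c*(1-c)*(1-5*c+5*c^2)) (clamp01 u)"

lemma DERIV_sstep: "(sstep has_real_derivative sstep1 u) (at u)"
  unfolding sstep_def[abs_def] sstep1_def
  by (rule DERIV_clamp01_comp) (auto intro!: derivative_eq_intros simp: algebra_simps power_numeral_reduce)

lemma DERIV_sstep1: "(sstep1 has_real_derivative sstep2 u) (at u)"
  unfolding sstep1_def[abs_def] sstep2_def
  by (rule DERIV_clamp01_comp) (auto intro!: derivative_eq_intros simp: algebra_simps power_numeral_reduce)

lemma DERIV_sstep2: "(sstep2 has_real_derivative sstep3 u) (at u)"
  unfolding sstep2_def[abs_def] sstep3_def
  by (rule DERIV_clamp01_comp) (auto intro!: derivative_eq_intros simp: algebra_simps power_numeral_reduce)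

lemma sstep_eq [simp]: "u \<le> 0 \<Longrightarrow> sstep u = 0" "1 \<le> u \<Longrightarrow> sstep u = 1"
  by (auto simp: sstep_def)

lemma sstep_bounds: "0 \<le> sstep u" "sstep u \<le> 1"
proof -
  have *: "0 \<le> 35*c^4 - 84*c^5 + 70*c^6 - 20*c^7" if "0 \<le> c" "c \<le> 1" for c :: real
  proof -
    \<comment> \<open>The cofactor of \<open>c^4\<close> is the expansion of \<open>c^(-4)\<close>
      in powers of \<open>1 - c\<close>, cut off after the cubic term, so its coefficients are
      positive. The upper bound below is the same identity at \<open>1 - c\<close>, by symmetry of
      the step.\<close>
    have "35*c^4 - 84*c^5 + 70*c^6 - 20*c^7 = c^4 * (1 + 4*(1-c) + 10*(1-c)^2 + 20*(1-c)^3)"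
      by (simp add: algebra_simps power_numeral_reduce)
    also have "\<dots> \<ge> 0" using that by (intro mult_nonneg_nonneg add_nonneg_nonneg) auto
    finally show ?thesis .
  qed
  have **: "35*c^4 - 84*c^5 + 70*c^6 - 20*c^7 \<le> 1" if "0 \<le> c" "c \<le> 1" for c :: real
  proof -
    have "1 - (35*c^4 - 84*c^5 + 70*c^6 - 20*c^7) = (1-c)^4 * (1 + 4*c + 10*c^2 + 20*c^3)"
      by (simp add: algebra_simps power_numeral_reduce)
    also have "\<dots> \<ge> 0" using that by (intro mult_nonneg_nonneg add_nonneg_nonneg) auto
    finally show ?thesis by simp
  qed
  show "0 \<le> sstep u" "sstep u \<le> 1"
    unfolding sstep_def using *[of "clamp01 u"] **[of "clamp01 u"] clamp01_bounds[of u] by auto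
qed

lemma sstep_deriv_bounds: "\<bar>sstep1 u\<bar> \<le> 140" "\<bar>sstep2 u\<bar> \<le> 420" "\<bar>sstep3 u\<bar> \<le> 840"
proof -
  define c where "c = clamp01 u"
  have c: "0 \<le> c" "c \<le> 1" using clamp01_bounds by (auto simp: c_def)
  have p: "\<bar>c\<bar> \<le> 1" "\<bar>1 - c\<bar> \<le> 1" "\<bar>1 - 2 * c\<bar> \<le> 1" using c by auto
  \<comment> \<open>On the unit interval this quadratic takes values in [-1/4, 1]. All factors being
    at most 1 in absolute value, only the leading coefficients 140, 420 and 840 survive.\<close>
  have q: "\<bar>1 - 5*c + 5*c^2\<bar> \<le> 1"
  proof -
    have "5*c^2 \<le> 5*c" using c by (simp add: power2_eq_square mult_left_le)
    moreover have "0 \<le> 5*(c - 1/2)^2" by simp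
    then have "0 \<le> 5*c^2 - 5*c + 5/4" by (simp add: power2_eq_square algebra_simps)
    ultimately show ?thesis by linarith
  qed
  have m: "\<bar>a * b\<bar> \<le> 1" if "\<bar>a\<bar> \<le> 1" "\<bar>b\<bar> \<le> 1" for a b :: real
    using mult_mono[OF that] by (simp add: abs_mult)
  have pw: "\<bar>a ^ k\<bar> \<le> 1" if "\<bar>a\<bar> \<le> 1" for a :: real and k
    using that by (simp add: power_abs power_le_one)
  have "\<bar>c^3*(1-c)^3\<bar> \<le> 1" "\<bar>c^2*(1-c)^2*(1-2*c)\<bar> \<le> 1" "\<bar>c*(1-c)*(1-5*c+5*c^2)\<bar> \<le> 1"
    by (intro m pw p q)+
  then show "\<bar>sstep1 u\<bar> \<le> 140" "\<bar>sstep2 u\<bar> \<le> 420" "\<bar>sstep3 u\<bar> \<le> 840"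
    unfolding sstep1_def sstep2_def sstep3_def c_def[symmetric] by (simp_all add: abs_mult mult.assoc)
qed

section \<open>Log-sum-exp as a smooth maximum, with its derivatives along lines\<close>

definition mx :: "'i set \<Rightarrow> ('i \<Rightarrow> real) \<Rightarrow> real" where
  "mx I x = Max (x ` I)"

definition lse :: "real \<Rightarrow> 'i set \<Rightarrow> ('i \<Rightarrow> real) \<Rightarrow> real" where
  "lse b I x = ln (\<Sum>i\<in>I. exp (b * x i)) / b"

definition softmax :: "real \<Rightarrow> 'i set \<Rightarrow> ('i \<Rightarrow> real) \<Rightarrow> 'i \<Rightarrow> real" where
  "softmax b I x i = exp (b * x i) / (\<Sum>j\<in>I. exp (b * x j))"

lemma mx_le_iff: "finite I \<Longrightarrow> I \<noteq> {} \<Longrightarrow> mx I x \<le> t \<longleftrightarrow> (\<forall>i\<in>I. x i \<le> t)"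
  by (auto simp: mx_def)

lemma mx_ge: "finite I \<Longrightarrow> i \<in> I \<Longrightarrow> x i \<le> mx I x"
  by (auto simp: mx_def)

lemma mx_in:
  assumes "finite I" "I \<noteq> {}" shows "\<exists>i\<in>I. mx I x = x i"
proof -
  have "Max (x ` I) \<in> x ` I" using assms by (intro Max_in) auto
  then show ?thesis by (auto simp only: mx_def image_iff)
qed

lemma sum_exp_pos: "finite I \<Longrightarrow> I \<noteq> {} \<Longrightarrow> 0 < (\<Sum>i\<in>I. exp (f i :: real))"
  by (simp add: sum_pos)

lemma lse_ge_mx:
  assumes "finite I" "I \<noteq> {}" "0 < b" shows "mx I x \<le> lse b I x"
proof -
  obtain i where i: "i \<in> I" "mx I x = x i" using mx_in assms by blast
  have "exp (b * x i) \<le> (\<Sum>i\<in>I. exp (b * x i))" by (rule member_le_sum) (use i assms in auto)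
  then have "b * x i \<le> ln (\<Sum>i\<in>I. exp (b * x i))"
    using sum_exp_pos[of I "\<lambda>i. b * x i"] assms by (simp add: ln_ge_iff)
  then show ?thesis using i assms by (simp add: lse_def field_simps)
qed

lemma lse_le_mx:
  assumes "finite I" "I \<noteq> {}" "0 < b" shows "lse b I x \<le> mx I x + ln (card I) / b"
proof -
  have "(\<Sum>i\<in>I. exp (b * x i)) \<le> (\<Sum>i\<in>I. exp (b * mx I x))"
    using assms by (intro sum_mono) (auto intro!: mult_left_mono mx_ge)
  also have "\<dots> = card I * exp (b * mx I x)" by simp
  finally have "ln (\<Sum>i\<in>I. exp (b * x i)) \<le> ln (card I * exp (b * mx I x))"
    using sum_exp_pos[of I "\<lambda>i. b * x i"] assms by (intro ln_mono) auto
  also have "\<dots> = ln (card I) + b * mx I x" using assms by (simp add: ln_mult card_gt_0_iff)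
  finally show ?thesis using assms by (simp add: lse_def field_simps)
qed

lemma softmax_nonneg: "0 \<le> softmax b I x i"
  by (simp add: softmax_def sum_nonneg)

lemma softmax_sum: "finite I \<Longrightarrow> I \<noteq> {} \<Longrightarrow> (\<Sum>i\<in>I. softmax b I x i) = 1"
  using sum_exp_pos[of I "\<lambda>i. b * x i"] by (simp add: softmax_def sum_divide_distrib[symmetric])

lemma softmax_le_1: "finite I \<Longrightarrow> i \<in> I \<Longrightarrow> softmax b I x i \<le> 1"
  using softmax_sum[of I b x] member_le_sum[of i I "softmax b I x"] softmax_nonneg[of b I x] by fastforce

text \<open>Moments of the direction \<open>y\<close> under the Gibbs weights at \<open>x\<close>.
  Along the line \<open>x + s y\<close> all derivatives of \<open>lse\<close> are polynomials in
  them (the cumulants), and since the weights sum to 1 they are bounded without any dimension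
  factor.\<close>

definition smom :: "real \<Rightarrow> 'i set \<Rightarrow> ('i \<Rightarrow> real) \<Rightarrow> ('i \<Rightarrow> real) \<Rightarrow> nat \<Rightarrow> real" where
  "smom b I x y r = (\<Sum>i\<in>I. softmax b I x i * y i ^ r)"

lemma smom_bound:
  assumes "finite I" "I \<noteq> {}" "\<And>i. i \<in> I \<Longrightarrow> \<bar>y i\<bar> \<le> d"
  shows "\<bar>smom b I x y r\<bar> \<le> d ^ r"
proof -
  have "\<bar>smom b I x y r\<bar> \<le> (\<Sum>i\<in>I. \<bar>softmax b I x i * y i ^ r\<bar>)"
    unfolding smom_def by (rule sum_abs)
  also have "\<dots> \<le> (\<Sum>i\<in>I. softmax b I x i * d ^ r)"
    using assms softmax_nonneg[of b I x]
    by (intro sum_mono) (auto simp: abs_mult power_abs intro!: mult_left_mono power_mono)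
  also have "\<dots> = d ^ r" using assms by (simp add: sum_distrib_right[symmetric] softmax_sum)
  finally show ?thesis .
qed

text \<open>Differentiating a Gibbs average gives \<open>b\<close> times a covariance, here of
  \<open>y^r\<close> with \<open>y\<close>. So the moments are closed under differentiation, and
  higher derivatives of \<open>lse\<close> need no separate computation.\<close>

lemma DERIV_smom:
  assumes "finite I" "I \<noteq> {}"
  shows "((\<lambda>s. smom b I (\<lambda>i. x i + s * y i) y r) has_real_derivative
    b * (smom b I (\<lambda>i. x i + s * y i) y (Suc r) - smom b I (\<lambda>i. x i + s * y i) y r * smom b I (\<lambda>i. x i + s * y i) y 1)) (at s)"
proof -
  define Z where "Z r s = (\<Sum>i\<in>I. exp (b * (x i + s * y i)) * y i ^ r)" for r s
  have m: "smom b I (\<lambda>i. x i + s * y i) y r = Z r s / Z 0 s" for r s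
    by (simp add: smom_def softmax_def Z_def sum_divide_distrib)
  have pos: "Z 0 s > 0" for s using sum_exp_pos[OF assms] by (simp add: Z_def)
  have D: "(Z r has_real_derivative b * Z (Suc r) s) (at s)" for r s
    unfolding Z_def[abs_def] sum_distrib_left
    by (rule DERIV_sum) (auto intro!: derivative_eq_intros)
  show ?thesis unfolding m
    by (rule derivative_eq_intros D)+ (use pos[of s] in \<open>auto simp: field_simps\<close>)
qed

lemma DERIV_lse:
  assumes "finite I" "I \<noteq> {}" "b \<noteq> 0"
  shows "((\<lambda>s. lse b I (\<lambda>i. x i + s * y i)) has_real_derivative smom b I (\<lambda>i. x i + s * y i) y 1) (at s)"
proof -
  define Z where "Z s = (\<Sum>i\<in>I. exp (b * (x i + s * y i)))" for s
  have pos: "Z s > 0" for s using sum_exp_pos[OF assms(1,2)] by (simp add: Z_def)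
  have D: "(Z has_real_derivative b * (\<Sum>i\<in>I. exp (b * (x i + s * y i)) * y i)) (at s)"
    unfolding Z_def[abs_def] sum_distrib_left
    by (rule DERIV_sum) (auto intro!: derivative_eq_intros)
  have "((\<lambda>s. ln (Z s) / b) has_real_derivative (b * (\<Sum>i\<in>I. exp (b * (x i + s * y i)) * y i) / Z s) / b) (at s)"
    by (rule DERIV_cdivide) (rule DERIV_cong[OF DERIV_chain2[OF DERIV_ln[OF pos] D]], simp add: field_simps)
  moreover have "(b * (\<Sum>i\<in>I. exp (b * (x i + s * y i)) * y i) / Z s) / b = smom b I (\<lambda>i. x i + s * y i) y 1"
  proof -
    have "smom b I (\<lambda>i. x i + s * y i) y 1 = (\<Sum>i\<in>I. exp (b * (x i + s * y i)) * y i) / Z s"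
      by (simp add: smom_def softmax_def Z_def sum_divide_distrib)
    then show ?thesis using assms(3) by simp
  qed
  ultimately show ?thesis unfolding lse_def Z_def by simp
qed

text \<open>Along the segment the second derivative is \<open>b\<close> times a softmax variance,
  bounded crudely by \<open>2 * b * d^2\<close>. The linear term pairs the increment with softmax
  weights at the old point, exactly the term that orthogonality removes in the maximal
  inequality.\<close>

lemma lse_second_order:
  assumes I: "finite I" "I \<noteq> {}" and b: "0 < b" and y: "\<And>i. i \<in> I \<Longrightarrow> \<bar>y i\<bar> \<le> d"
  shows "lse b I (\<lambda>i. x i + y i) \<le> lse b I x + (\<Sum>i\<in>I. softmax b I x i * y i) + b * d\<^sup>2"
proof -
  let ?m = "\<lambda>r s. smom b I (\<lambda>i. x i + s * y i) y r"
  define D where "D m = (case m of 0 \<Rightarrow> (\<lambda>s. lse b I (\<lambda>i. x i + s * y i))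
     | Suc 0 \<Rightarrow> ?m 1 | Suc (Suc k) \<Rightarrow> (\<lambda>s. b * (?m 2 s - ?m 1 s * ?m 1 s)))" for m
  have "\<exists>t. 0 < t \<and> t \<le> 1 \<and> D 0 1 = (\<Sum>m<2. D m 0 / fact m * 1 ^ m) + D 2 t / fact 2 * 1 ^ 2"
  proof (rule Maclaurin2)
    show "\<forall>m t. m < 2 \<and> 0 \<le> t \<and> t \<le> (1::real) \<longrightarrow> (D m has_real_derivative D (Suc m) t) (at t)"
    proof (intro allI impI)
      fix m :: nat and t :: real assume "m < 2 \<and> 0 \<le> t \<and> t \<le> 1"
      then consider "m = 0" | "m = 1" by linarith
      then show "(D m has_real_derivative D (Suc m) t) (at t)"
      proof cases
        case 1 then show ?thesis using DERIV_lse[OF I, where b=b and x=x and y=y] b by (simp add: D_def)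
      next
        case 2
        have "(D 1 has_real_derivative D 2 t) (at t)"
          using DERIV_smom[OF I, where b=b and x=x and y=y and r=1] by (simp add: D_def numeral_2_eq_2)
        then show ?thesis using 2 by (simp add: numeral_2_eq_2)
      qed
    qed
  qed auto
  then obtain t where t: "D 0 1 = D 0 0 + D 1 0 + D 2 t / 2"
    by (auto simp: numeral_2_eq_2)
  have b1: "\<bar>?m 1 t\<bar> \<le> d" "\<bar>?m 2 t\<bar> \<le> d\<^sup>2" using smom_bound[OF I y, where r=1] smom_bound[OF I y, where r=2] by auto
  have "- (?m 1 t * ?m 1 t) \<le> 0" by simp
  then have "?m 2 t - ?m 1 t * ?m 1 t \<le> 2 * d\<^sup>2" using b1(2) zero_le_power2[of d] by linarith
  then have "D 2 t \<le> b * (2 * d\<^sup>2)" unfolding D_def using b by (simp add: numeral_2_eq_2 mult_left_mono)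
  with t show ?thesis by (simp add: D_def smom_def)
qed

text \<open>Only the total mass of the quadratic coefficients and the constant of the cubic remainder
  enter the Lindeberg argument; both depend on the dimension only logarithmically below.\<close>

definition taylor3 :: "'i set \<Rightarrow> real \<Rightarrow> real \<Rightarrow> (('i \<Rightarrow> real) \<Rightarrow> real) \<Rightarrow> bool" where
  "taylor3 I M2 M3 \<phi> \<longleftrightarrow> (\<forall>x. \<exists>g H. (\<Sum>i\<in>I. \<Sum>j\<in>I. \<bar>H i j\<bar>) \<le> M2 \<and>
     (\<forall>y d. (\<forall>i\<in>I. \<bar>y i\<bar> \<le> d) \<longrightarrow>
       \<bar>\<phi> (\<lambda>i. x i + y i) - \<phi> x - (\<Sum>i\<in>I. g i * y i) - (\<Sum>i\<in>I. \<Sum>j\<in>I. H i j * (y i * y j)) / 2\<bar> \<le> M3 * d ^ 3))"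

text \<open>Expand \<open>h\<close> of \<open>lse\<close> to third order along the segment from
  \<open>x\<close> to \<open>x + y\<close>. Every derivative is a polynomial in Gibbs moments of
  \<open>y\<close>, hence controlled by powers of \<open>d\<close> and \<open>b\<close>
  alone.\<close>

lemma taylor3_comp_lse:
  fixes h h1 h2 h3 :: "real \<Rightarrow> real"
  assumes I: "finite I" "I \<noteq> {}" and b: "0 < b"
    and D: "\<And>v. (h has_real_derivative h1 v) (at v)" "\<And>v. (h1 has_real_derivative h2 v) (at v)"
      "\<And>v. (h2 has_real_derivative h3 v) (at v)"
    and a: "\<And>v. \<bar>h1 v\<bar> \<le> a1" "\<And>v. \<bar>h2 v\<bar> \<le> a2" "\<And>v. \<bar>h3 v\<bar> \<le> a3"
  shows "taylor3 I (a2 + 2 * b * a1) (a3 + 6 * b * a2 + 6 * b\<^sup>2 * a1) (\<lambda>x. h (lse b I x))"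
  unfolding taylor3_def
proof (rule allI)
  fix x :: "'a \<Rightarrow> real"
  define p where "p = softmax b I x"
  define F0 where "F0 = lse b I x"
  define g where "g i = h1 F0 * p i" for i
  \<comment> \<open>The Hessian of the composition: \<open>h2\<close> times the rank-one matrix of
    the softmax gradient \<open>p\<close>, plus \<open>h1\<close> times the Hessian
    \<open>b * (diag p - p p^T)\<close> of \<open>lse\<close>. Both pieces have bounded entry sums
    because \<open>p\<close> is a probability vector.\<close>
  define H where "H i j = (h2 F0 - b * h1 F0) * (p i * p j) + (if i = j then b * h1 F0 * p i else 0)" for i j
  have p0: "0 \<le> p i" for i by (simp add: p_def softmax_nonneg)
  have p1: "(\<Sum>i\<in>I. p i) = 1" using softmax_sum[OF I] by (simp add: p_def)
  have a0: "0 \<le> a1" "0 \<le> a2" "0 \<le> a3" using a[of 0] by linarith+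
  have H: "(\<Sum>i\<in>I. \<Sum>j\<in>I. \<bar>H i j\<bar>) \<le> a2 + 2 * b * a1"
  proof -
    have "(\<Sum>i\<in>I. \<Sum>j\<in>I. \<bar>H i j\<bar>) \<le> (\<Sum>i\<in>I. \<Sum>j\<in>I. (a2 + b * a1) * (p i * p j) + (if i = j then b * a1 * p i else 0))"
    proof (intro sum_mono)
      fix i j assume "i \<in> I" "j \<in> I"
      have "\<bar>(h2 F0 - b * h1 F0) * (p i * p j)\<bar> \<le> (a2 + b * a1) * (p i * p j)"
      proof -
        have "\<bar>h2 F0 - b * h1 F0\<bar> \<le> \<bar>h2 F0\<bar> + b * \<bar>h1 F0\<bar>" using b abs_triangle_ineq4[of "h2 F0" "b * h1 F0"] by (simp add: abs_mult)
        also have "\<dots> \<le> a2 + b * a1" using a[of F0] b by (intro add_mono mult_left_mono) auto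
        finally show ?thesis using p0[of i] p0[of j] by (simp add: abs_mult mult_right_mono)
      qed
      moreover have "\<bar>if i = j then b * h1 F0 * p i else 0\<bar> \<le> (if i = j then b * a1 * p i else 0)"
        using a(1)[of F0] b p0[of i] by (auto simp: abs_mult intro!: mult_right_mono mult_left_mono)
      ultimately show "\<bar>H i j\<bar> \<le> (a2 + b * a1) * (p i * p j) + (if i = j then b * a1 * p i else 0)"
        unfolding H_def by linarith
    qed
    also have "\<dots> = (\<Sum>i\<in>I. \<Sum>j\<in>I. (a2 + b * a1) * (p i * p j)) + (\<Sum>i\<in>I. b * a1 * p i)"
      using I by (simp add: sum.distrib sum.delta)
    also have "\<dots> = (a2 + b * a1) * ((\<Sum>i\<in>I. p i) * (\<Sum>i\<in>I. p i)) + b * a1 * (\<Sum>i\<in>I. p i)"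
      unfolding sum_product by (simp only: sum_distrib_left)
    also have "\<dots> = a2 + 2 * b * a1" by (simp add: p1)
    finally show ?thesis .
  qed
  have T: "\<bar>h (lse b I (\<lambda>i. x i + y i)) - h (lse b I x) - (\<Sum>i\<in>I. g i * y i) - (\<Sum>i\<in>I. \<Sum>j\<in>I. H i j * (y i * y j)) / 2\<bar>
      \<le> (a3 + 6 * b * a2 + 6 * b\<^sup>2 * a1) * d ^ 3" if y: "\<forall>i\<in>I. \<bar>y i\<bar> \<le> d" for y d
  proof -
    have y': "\<And>i. i \<in> I \<Longrightarrow> \<bar>y i\<bar> \<le> d" using y by auto
    have d0: "0 \<le> d" using I y' by (metis abs_ge_zero equals0I order_trans)
    define F where "F s = lse b I (\<lambda>i. x i + s * y i)" for s
    define m where "m r s = smom b I (\<lambda>i. x i + s * y i) y r" for r s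
    have dF: "(F has_real_derivative m 1 s) (at s)" for s
      unfolding F_def[abs_def] m_def using DERIV_lse[OF I] b by simp
    have dm: "(m r has_real_derivative b * (m (Suc r) s - m r s * m 1 s)) (at s)" for r s
      unfolding m_def[abs_def] using DERIV_smom[OF I] by simp
    have dh: "((\<lambda>s. h (F s)) has_real_derivative h1 (F s) * m 1 s) (at s)"
      "((\<lambda>s. h1 (F s)) has_real_derivative h2 (F s) * m 1 s) (at s)"
      "((\<lambda>s. h2 (F s)) has_real_derivative h3 (F s) * m 1 s) (at s)" for s
      by (rule DERIV_chain2[OF D(1) dF] DERIV_chain2[OF D(2) dF] DERIV_chain2[OF D(3) dF])+
    \<comment> \<open>The derivatives along the line by Faa di Bruno: \<open>m 2 - m 1 * m 1\<close>
      is the Gibbs variance of \<open>y\<close>, and \<open>m 3 - 3 m 2 m 1 + 2 (m 1)^3\<close> its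
      third cumulant.\<close>
    define G where "G k = (case k of 0 \<Rightarrow> (\<lambda>s. h (F s)) | Suc 0 \<Rightarrow> (\<lambda>s. h1 (F s) * m 1 s)
      | Suc (Suc 0) \<Rightarrow> (\<lambda>s. h2 (F s) * (m 1 s * m 1 s) + h1 (F s) * (b * (m 2 s - m 1 s * m 1 s)))
      | Suc (Suc (Suc k)) \<Rightarrow> (\<lambda>s. h3 (F s) * m 1 s ^ 3 + 3 * (h2 (F s) * m 1 s * (b * (m 2 s - m 1 s * m 1 s)))
           + h1 (F s) * (b\<^sup>2 * (m 3 s - 3 * (m 2 s * m 1 s) + 2 * m 1 s ^ 3))))" for k
    have "\<exists>t. 0 < t \<and> t \<le> 1 \<and> G 0 1 = (\<Sum>k<3. G k 0 / fact k * 1 ^ k) + G 3 t / fact 3 * 1 ^ 3"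
    proof (rule Maclaurin2)
      show "\<forall>k t. k < 3 \<and> 0 \<le> t \<and> t \<le> (1::real) \<longrightarrow> (G k has_real_derivative G (Suc k) t) (at t)"
      proof (intro allI impI)
        fix k :: nat and t :: real assume "k < 3 \<and> 0 \<le> t \<and> t \<le> 1"
        then consider "k = 0" | "k = 1" | "k = 2" by linarith
        then show "(G k has_real_derivative G (Suc k) t) (at t)"
        proof cases
          case 1 then show ?thesis using dh by (simp add: G_def)
        next
          case 2
          have "((\<lambda>s. h1 (F s) * m 1 s) has_real_derivative h2 (F t) * (m 1 t * m 1 t) + h1 (F t) * (b * (m 2 t - m 1 t * m 1 t))) (at t)"
            by (rule DERIV_cong[OF DERIV_mult[OF dh(2) dm[of 1]]]) (simp add: numeral_2_eq_2 algebra_simps)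
          then show ?thesis using 2 by (simp add: G_def)
        next
          case 3
          have "((\<lambda>s. h2 (F s) * (m 1 s * m 1 s) + h1 (F s) * (b * (m 2 s - m 1 s * m 1 s))) has_real_derivative
            h3 (F t) * m 1 t ^ 3 + 3 * (h2 (F t) * m 1 t * (b * (m 2 t - m 1 t * m 1 t)))
           + h1 (F t) * (b\<^sup>2 * (m 3 t - 3 * (m 2 t * m 1 t) + 2 * m 1 t ^ 3))) (at t)"
            by (rule DERIV_cong[OF DERIV_add[OF DERIV_mult[OF dh(3) DERIV_mult[OF dm[of 1] dm[of 1]]]
                 DERIV_mult[OF dh(2) DERIV_cmult[OF DERIV_diff[OF dm[of 2] DERIV_mult[OF dm[of 1] dm[of 1]]]]]]])
              (simp add: numeral_2_eq_2 numeral_3_eq_3 algebra_simps)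
          then show ?thesis using 3 by (simp add: G_def numeral_2_eq_2)
        qed
      qed
    qed auto
    then obtain t where t: "G 0 1 = G 0 0 + G 1 0 + G 2 0 / 2 + G 3 t / 6"
      by (auto simp: eval_nat_numeral)
    have F00: "F 0 = F0" by (simp add: F_def F0_def)
    have m0: "m r 0 = (\<Sum>i\<in>I. p i * y i ^ r)" for r by (simp add: m_def smom_def p_def)
    have g1: "G 1 0 = (\<Sum>i\<in>I. g i * y i)"
      by (simp add: G_def F00 m0 g_def sum_distrib_left mult.assoc)
    have g2: "G 2 0 = (\<Sum>i\<in>I. \<Sum>j\<in>I. H i j * (y i * y j))"
    proof -
      have "(\<Sum>i\<in>I. \<Sum>j\<in>I. H i j * (y i * y j)) = (\<Sum>i\<in>I. \<Sum>j\<in>I. (h2 F0 - b * h1 F0) * ((p i * y i) * (p j * y j)) + (if i = j then b * h1 F0 * (p i * y i ^ 2) else 0))"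
        by (intro sum.cong refl) (auto simp: H_def algebra_simps power2_eq_square)
      also have "\<dots> = (h2 F0 - b * h1 F0) * ((\<Sum>i\<in>I. p i * y i) * (\<Sum>j\<in>I. p j * y j)) + b * h1 F0 * (\<Sum>i\<in>I. p i * y i ^ 2)"
      proof -
        have "(\<Sum>i\<in>I. p i * y i) * (\<Sum>j\<in>I. p j * y j) = (\<Sum>i\<in>I. \<Sum>j\<in>I. p i * y i * (p j * y j))"
          by (rule sum_product)
        moreover have "(\<Sum>i\<in>I. \<Sum>j\<in>I. c * (p i * y i * (p j * y j))) = c * (\<Sum>i\<in>I. \<Sum>j\<in>I. p i * y i * (p j * y j))" for c
          by (simp only: sum_distrib_left)
        moreover have "(\<Sum>i\<in>I. \<Sum>j\<in>I. if i = j then e i else 0) = (\<Sum>i\<in>I. e i)" for e :: "'a \<Rightarrow> real"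
          using I by simp
        moreover have "(\<Sum>i\<in>I. c * (p i * y i ^ 2)) = c * (\<Sum>i\<in>I. p i * y i ^ 2)" for c
          by (simp only: sum_distrib_left)
        ultimately show ?thesis by (simp only: sum.distrib)
      qed
      also have "\<dots> = G 2 0" by (simp add: G_def numeral_2_eq_2 F00 m0 algebra_simps)
      finally show ?thesis by simp
    qed
    have mb: "\<bar>m 1 t\<bar> \<le> d" "\<bar>m 2 t\<bar> \<le> d^2" "\<bar>m 3 t\<bar> \<le> d^3"
      using smom_bound[OF I y', where r=1] smom_bound[OF I y', where r=2] smom_bound[OF I y', where r=3] by (auto simp: m_def)
    have mm: "\<bar>m 1 t * m 1 t\<bar> \<le> d^2" "\<bar>m 1 t ^ 3\<bar> \<le> d^3" "\<bar>m 2 t * m 1 t\<bar> \<le> d^3"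
      using mult_mono[OF mb(1) mb(1)] power_mono[OF mb(1), of 3] mult_mono[OF mb(2) mb(1)] d0
      by (auto simp: abs_mult power_abs power2_eq_square power3_eq_cube)
    have e1: "\<bar>m 2 t - m 1 t * m 1 t\<bar> \<le> 2 * d^2" using mb mm by linarith
    have e2: "\<bar>m 3 t - 3 * (m 2 t * m 1 t) + 2 * m 1 t ^ 3\<bar> \<le> 6 * d^3" using mb mm by linarith
    have t1: "\<bar>h3 (F t) * m 1 t ^ 3\<bar> \<le> a3 * d^3"
      unfolding abs_mult using a mm a0 by (intro mult_mono) auto
    have t2: "\<bar>h2 (F t) * m 1 t * (b * (m 2 t - m 1 t * m 1 t))\<bar> \<le> (a2 * d) * (b * (2 * d^2))"
      unfolding abs_mult using a mb e1 a0 b d0 by (intro mult_mono) auto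
    have t3: "\<bar>h1 (F t) * (b\<^sup>2 * (m 3 t - 3 * (m 2 t * m 1 t) + 2 * m 1 t ^ 3))\<bar> \<le> a1 * (b\<^sup>2 * (6 * d^3))"
      unfolding abs_mult using a e2 a0 by (intro mult_mono) auto
    have "\<bar>G 3 t\<bar> \<le> a3 * d^3 + 3 * ((a2 * d) * (b * (2 * d^2))) + a1 * (b\<^sup>2 * (6 * d^3))"
    proof -
      have "G 3 t = h3 (F t) * m 1 t ^ 3 + 3 * (h2 (F t) * m 1 t * (b * (m 2 t - m 1 t * m 1 t)))
           + h1 (F t) * (b\<^sup>2 * (m 3 t - 3 * (m 2 t * m 1 t) + 2 * m 1 t ^ 3))"
        by (simp add: G_def numeral_3_eq_3)
      then show ?thesis using t1 t2 t3 by linarith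
    qed
    also have "\<dots> = (a3 + 6 * b * a2 + 6 * b\<^sup>2 * a1) * d ^ 3"
      by (simp add: algebra_simps power2_eq_square power3_eq_cube)
    finally have G3: "\<bar>G 3 t\<bar> \<le> (a3 + 6 * b * a2 + 6 * b\<^sup>2 * a1) * d ^ 3" .
    have "h (lse b I (\<lambda>i. x i + y i)) = G 0 1" "h (lse b I x) = G 0 0" by (simp_all add: G_def F_def)
    then show ?thesis using t g1 g2 G3 by simp
  qed
  show "\<exists>g H. (\<Sum>i\<in>I. \<Sum>j\<in>I. \<bar>H i j\<bar>) \<le> a2 + 2 * b * a1 \<and>
     (\<forall>y d. (\<forall>i\<in>I. \<bar>y i\<bar> \<le> d) \<longrightarrow>
       \<bar>h (lse b I (\<lambda>i. x i + y i)) - h (lse b I x) - (\<Sum>i\<in>I. g i * y i) - (\<Sum>i\<in>I. \<Sum>j\<in>I. H i j * (y i * y j)) / 2\<bar>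
         \<le> (a3 + 6 * b * a2 + 6 * b\<^sup>2 * a1) * d ^ 3)"
    using H T by blast
qed

text \<open>At inverse temperature \<open>lam / del\<close> the log-sum-exp overshoots the maximum
  by at most \<open>del\<close> once \<open>lam\<close> is at least the log of the dimension. The
  shift by 1 puts the ramp between \<open>t + del\<close> and \<open>t + 2 * del\<close>, so that
  the value is exactly 1 when the maximum is at most \<open>t\<close> and exactly 0 when it is at
  least \<open>t + 2 * del\<close>.\<close>

definition mx_cutoff :: "real \<Rightarrow> real \<Rightarrow> 'i set \<Rightarrow> real \<Rightarrow> ('i \<Rightarrow> real) \<Rightarrow> real" where
  "mx_cutoff lam del I t x = 1 - sstep ((lse (lam / del) I x - t) / del - 1)"

text \<open>The outer function has derivative bounds \<open>140 / del\<close>,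
  \<open>420 / del^2\<close>, \<open>840 / del^3\<close>. With \<open>b = lam / del\<close> and
  \<open>lam \<ge> 1\<close> lower powers of \<open>lam\<close> are absorbed: 420 + 280 = 700 and
  840 + 2520 + 840 = 4200.\<close>

lemma taylor3_mx_cutoff:
  assumes I: "finite I" "I \<noteq> {}" and lam: "1 \<le> lam" and del: "0 < del"
  shows "taylor3 I (700 * lam / del\<^sup>2) (4200 * lam\<^sup>2 / del ^ 3) (mx_cutoff lam del I t)"
proof -
  define b where "b = lam / del"
  have b: "0 < b" using lam del by (simp add: b_def)
  have del0: "del \<noteq> 0" using del by simp
  let ?a = "\<lambda>v. (v - t) / del - 1"
  have d: "(?a has_real_derivative 1 / del) (at v)" for v
    by (auto intro!: derivative_eq_intros simp: del0)
  have 1: "((\<lambda>v. 1 - sstep (?a v)) has_real_derivative - sstep1 (?a v) / del) (at v)" for v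
    by (rule DERIV_cong[OF DERIV_diff[OF DERIV_const DERIV_chain2[OF DERIV_sstep d]]]) simp
  have 2: "((\<lambda>v. - sstep1 (?a v) / del) has_real_derivative - sstep2 (?a v) / del\<^sup>2) (at v)" for v
    by (rule DERIV_cong[OF DERIV_cdivide[OF DERIV_minus[OF DERIV_chain2[OF DERIV_sstep1 d]]]]) (simp add: power2_eq_square)
  have 3: "((\<lambda>v. - sstep2 (?a v) / del\<^sup>2) has_real_derivative - sstep3 (?a v) / del^3) (at v)" for v
    by (rule DERIV_cong[OF DERIV_cdivide[OF DERIV_minus[OF DERIV_chain2[OF DERIV_sstep2 d]]]]) (simp add: power3_eq_cube power2_eq_square)
  have "taylor3 I (420 / del\<^sup>2 + 2 * b * (140 / del)) (840 / del^3 + 6 * b * (420 / del\<^sup>2) + 6 * b\<^sup>2 * (140 / del))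
     (\<lambda>x. 1 - sstep (?a (lse b I x)))"
    by (rule taylor3_comp_lse[OF I b 1 2 3])
      (use sstep_deriv_bounds del in \<open>auto simp: abs_mult divide_right_mono\<close>)
  moreover have "420 / del\<^sup>2 + 2 * b * (140 / del) \<le> 700 * lam / del\<^sup>2"
    using lam del by (simp add: b_def divide_simps power2_eq_square)
  moreover have "840 / del^3 + 6 * b * (420 / del\<^sup>2) + 6 * b\<^sup>2 * (140 / del) \<le> 4200 * lam\<^sup>2 / del^3"
  proof -
    have "840 / del^3 + 6 * b * (420 / del\<^sup>2) + 6 * b\<^sup>2 * (140 / del) = (840 + 2520 * lam + 840 * lam\<^sup>2) / del^3"
      using del by (simp add: b_def field_simps power2_eq_square power3_eq_cube)
    also have "\<dots> \<le> 4200 * lam\<^sup>2 / del^3"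
    proof (rule divide_right_mono)
      have "lam \<le> lam\<^sup>2" "1 \<le> lam\<^sup>2" using lam by (auto simp: power2_eq_square mult_le_cancel_left1 intro: mult_mono[of 1 lam 1 lam, simplified])
      then show "840 + 2520 * lam + 840 * lam\<^sup>2 \<le> 4200 * lam\<^sup>2" by linarith
    qed (use del in simp)
    finally show ?thesis .
  qed
  moreover have "taylor3 I M2 M3 \<phi>" if tt: "taylor3 I A B \<phi>" and "A \<le> M2" "B \<le> M3" for A B M2 M3 and \<phi> :: "('a \<Rightarrow> real) \<Rightarrow> real"
    unfolding taylor3_def
  proof
    fix x
    obtain g H where gH: "(\<Sum>i\<in>I. \<Sum>j\<in>I. \<bar>H i j\<bar>) \<le> A"
      "\<forall>y d. (\<forall>i\<in>I. \<bar>y i\<bar> \<le> d) \<longrightarrow>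
       \<bar>\<phi> (\<lambda>i. x i + y i) - \<phi> x - (\<Sum>i\<in>I. g i * y i) - (\<Sum>i\<in>I. \<Sum>j\<in>I. H i j * (y i * y j)) / 2\<bar> \<le> B * d ^ 3"
      using tt unfolding taylor3_def by blast
    have "B * d ^ 3 \<le> M3 * d ^ 3" if "\<forall>i\<in>I. \<bar>y i\<bar> \<le> d" for y :: "'a \<Rightarrow> real" and d
    proof -
      have "0 \<le> d" using I that by (metis abs_ge_zero equals0I order_trans)
      then show ?thesis using \<open>B \<le> M3\<close> by (simp add: mult_right_mono)
    qed
    with gH \<open>A \<le> M2\<close> show "\<exists>g H. (\<Sum>i\<in>I. \<Sum>j\<in>I. \<bar>H i j\<bar>) \<le> M2 \<and>
     (\<forall>y d. (\<forall>i\<in>I. \<bar>y i\<bar> \<le> d) \<longrightarrow>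
       \<bar>\<phi> (\<lambda>i. x i + y i) - \<phi> x - (\<Sum>i\<in>I. g i * y i) - (\<Sum>i\<in>I. \<Sum>j\<in>I. H i j * (y i * y j)) / 2\<bar> \<le> M3 * d ^ 3)"
      by (intro exI[of _ g] exI[of _ H]) (meson order_trans)
  qed
  ultimately show ?thesis unfolding mx_cutoff_def[abs_def] b_def by blast
qed

lemma mx_cutoff_bounds: "0 \<le> mx_cutoff lam del I t x" "mx_cutoff lam del I t x \<le> 1"
  using sstep_bounds by (auto simp: mx_cutoff_def)

lemma mx_cutoff_eq_1:
  assumes I: "finite I" "I \<noteq> {}" and lam: "1 \<le> lam" "ln (card I) \<le> lam" and del: "0 < del" and m: "mx I x \<le> t"
  shows "mx_cutoff lam del I t x = 1"
proof -
  have "lse (lam / del) I x \<le> mx I x + ln (card I) / (lam / del)"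
    using lse_le_mx[OF I, of "lam/del" x] lam del by auto
  also have "ln (card I) / (lam / del) \<le> del"
    using lam del by (simp add: field_simps mult_left_mono)
  finally have "(lse (lam / del) I x - t) / del \<le> 1" using m del by (simp add: field_simps)
  then show ?thesis by (simp add: mx_cutoff_def)
qed

lemma mx_cutoff_eq_0:
  assumes I: "finite I" "I \<noteq> {}" and lam: "1 \<le> lam" and del: "0 < del" and m: "t + 2 * del \<le> mx I x"
  shows "mx_cutoff lam del I t x = 0"
proof -
  have "mx I x \<le> lse (lam / del) I x" using lse_ge_mx[OF I, of "lam/del" x] lam del by auto
  then have "1 \<le> (lse (lam / del) I x - t) / del - 1" using m del by (simp add: field_simps)
  then show ?thesis by (simp add: mx_cutoff_def)
qed

section \<open>The Lindeberg method\<close>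

text \<open>Invariance under \<open>restrict\<close> lets \<phi> be evaluated at arbitrary
  functions, such as partial sums given by lambda terms, while measurability is only required on the
  extensional functions of the product space.\<close>

definition test_fun :: "'i set \<Rightarrow> (('i \<Rightarrow> real) \<Rightarrow> real) \<Rightarrow> bool" where
  "test_fun I \<phi> \<longleftrightarrow> \<phi> \<in> borel_measurable (PiM I (\<lambda>_. borel)) \<and> (\<forall>x. \<phi> (restrict x I) = \<phi> x) \<and> (\<forall>x. \<bar>\<phi> x\<bar> \<le> 1)"

lemma test_fun_measurable:
  assumes "test_fun I \<phi>" "\<And>i. i \<in> I \<Longrightarrow> (\<lambda>m. X m i) \<in> borel_measurable M"
  shows "(\<lambda>m. \<phi> (X m)) \<in> borel_measurable M"
proof -
  have "(\<lambda>m. restrict (X m) I) \<in> measurable M (PiM I (\<lambda>_. borel))"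
    using assms(2) by (intro measurable_restrict) auto
  then have "(\<lambda>m. \<phi> (restrict (X m) I)) \<in> borel_measurable M"
    by (rule measurable_compose) (use assms(1) in \<open>simp add: test_fun_def\<close>)
  then show ?thesis using assms(1) by (simp add: test_fun_def)
qed

lemma test_fun_bound: "test_fun I \<phi> \<Longrightarrow> \<bar>\<phi> x\<bar> \<le> 1"
  by (simp add: test_fun_def)

lemma test_fun_integrable:
  assumes "test_fun I \<phi>" "\<And>i. i \<in> I \<Longrightarrow> (\<lambda>m. X m i) \<in> borel_measurable M" "finite_measure M"
  shows "integrable M (\<lambda>m. \<phi> (X m))"
  by (rule finite_measure.integrable_const_bound[OF assms(3), of _ 1])
    (use test_fun_measurable[OF assms(1,2)] test_fun_bound[OF assms(1)] in auto)

lemma test_fun_mx_cutoff: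
  assumes "finite I" "I \<noteq> {}"
  shows "test_fun I (\<lambda>x. mx_cutoff lam del I t (\<lambda>i. x i - c i))"
  unfolding test_fun_def
proof (intro conjI allI)
  have s: "sstep \<in> borel_measurable borel"
    by (rule borel_measurable_continuous_onI)
      (meson DERIV_sstep DERIV_isCont continuous_at_imp_continuous_on)
  show "(\<lambda>x. mx_cutoff lam del I t (\<lambda>i. x i - c i)) \<in> borel_measurable (PiM I (\<lambda>_. borel))"
    unfolding mx_cutoff_def lse_def
    by (intro borel_measurable_diff borel_measurable_const measurable_compose[OF _ s]) (measurable)
next
  fix x :: "'a \<Rightarrow> real"
  show "mx_cutoff lam del I t (\<lambda>i. restrict x I i - c i) = mx_cutoff lam del I t (\<lambda>i. x i - c i)"
    by (simp add: mx_cutoff_def lse_def cong: sum.cong)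
  show "\<bar>mx_cutoff lam del I t (\<lambda>i. x i - c i)\<bar> \<le> 1"
    using mx_cutoff_bounds[of lam del I t "\<lambda>i. x i - c i"] by simp
qed

lemma taylor3_shift:
  assumes "taylor3 I M2 M3 \<phi>" shows "taylor3 I M2 M3 (\<lambda>x. \<phi> (\<lambda>i. x i - c i))"
  unfolding taylor3_def
proof
  fix x
  have "\<exists>g H. (\<Sum>i\<in>I. \<Sum>j\<in>I. \<bar>H i j\<bar>) \<le> M2 \<and>
     (\<forall>y d. (\<forall>i\<in>I. \<bar>y i\<bar> \<le> d) \<longrightarrow>
       \<bar>\<phi> (\<lambda>i. (x i - c i) + y i) - \<phi> (\<lambda>i. x i - c i) - (\<Sum>i\<in>I. g i * y i) - (\<Sum>i\<in>I. \<Sum>j\<in>I. H i j * (y i * y j)) / 2\<bar> \<le> M3 * d ^ 3)"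
    using assms unfolding taylor3_def by (rule spec)
  then show "\<exists>g H. (\<Sum>i\<in>I. \<Sum>j\<in>I. \<bar>H i j\<bar>) \<le> M2 \<and>
     (\<forall>y d. (\<forall>i\<in>I. \<bar>y i\<bar> \<le> d) \<longrightarrow>
       \<bar>\<phi> (\<lambda>i. x i + y i - c i) - \<phi> (\<lambda>i. x i - c i) - (\<Sum>i\<in>I. g i * y i) - (\<Sum>i\<in>I. \<Sum>j\<in>I. H i j * (y i * y j)) / 2\<bar> \<le> M3 * d ^ 3)"
    by (simp add: algebra_simps)
qed

text \<open>One envelope \<open>D\<close> dominates all coordinates. Error bounds see the vector
  only through moments of \<open>D\<close>, which is how the size of \<open>I\<close> stays out of
  the third-order terms.\<close>

definition rvec :: "'i set \<Rightarrow> 'a measure \<Rightarrow> ('a \<Rightarrow> 'i \<Rightarrow> real) \<Rightarrow> ('a \<Rightarrow> real) \<Rightarrow> bool" where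
  "rvec I M X D \<longleftrightarrow> prob_space M \<and> (\<forall>i\<in>I. (\<lambda>m. X m i) \<in> borel_measurable M) \<and> D \<in> borel_measurable M \<and>
     (\<forall>m\<in>space M. 0 \<le> D m \<and> (\<forall>i\<in>I. \<bar>X m i\<bar> \<le> D m)) \<and> integrable M (\<lambda>m. D m ^ 3) \<and>
     (\<forall>i\<in>I. (\<integral>m. X m i \<partial>M) = 0)"

lemma rvec_integrable:
  assumes "rvec I M X D" "i \<in> I" "j \<in> I"
  shows "integrable M (\<lambda>m. X m i)" "integrable M (\<lambda>m. X m i * X m j)"
proof -
  have [measurable]: "(\<lambda>m. X m i) \<in> borel_measurable M" "(\<lambda>m. X m j) \<in> borel_measurable M"
    using assms by (auto simp: rvec_def)
  interpret prob_space M using assms by (simp add: rvec_def)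
  have I: "integrable M (\<lambda>m. 1 + D m ^ 3)" using assms by (auto simp: rvec_def)
  have p1: "d \<le> 1 + d ^ 3" "d\<^sup>2 \<le> 1 + d ^ 3" if "0 \<le> d" for d :: real
  proof -
    have "d \<le> 1 + d ^ 3 \<and> d\<^sup>2 \<le> 1 + d ^ 3"
    proof (cases "d \<le> 1")
      case True
      moreover have "0 \<le> d ^ 3" using that by simp
      ultimately show ?thesis using that power_le_one[of d 2] by linarith
    next
      case False
      then have "d ^ 1 \<le> d ^ 3" "d ^ 2 \<le> d ^ 3" by (intro power_increasing; simp)+
      then show ?thesis by simp
    qed
    then show "d \<le> 1 + d ^ 3" "d\<^sup>2 \<le> 1 + d ^ 3" by auto
  qed
  show "integrable M (\<lambda>m. X m i)"
  proof (rule Bochner_Integration.integrable_bound[OF I])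
    show "AE m in M. norm (X m i) \<le> norm (1 + D m ^ 3)"
    proof (rule AE_I2)
      fix m assume "m \<in> space M"
      then have "0 \<le> D m" "\<bar>X m i\<bar> \<le> D m" using assms by (auto simp: rvec_def)
      with p1[of "D m"] show "norm (X m i) \<le> norm (1 + D m ^ 3)" by simp
    qed
  qed measurable
  show "integrable M (\<lambda>m. X m i * X m j)"
  proof (rule Bochner_Integration.integrable_bound[OF I])
    show "AE m in M. norm (X m i * X m j) \<le> norm (1 + D m ^ 3)"
    proof (rule AE_I2)
      fix m assume "m \<in> space M"
      then have d: "0 \<le> D m" "\<bar>X m i\<bar> \<le> D m" "\<bar>X m j\<bar> \<le> D m" using assms by (auto simp: rvec_def)
      have "\<bar>X m i * X m j\<bar> \<le> (D m)\<^sup>2"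
        using mult_mono[OF d(2,3)] d by (simp add: abs_mult power2_eq_square)
      with p1[of "D m"] d show "norm (X m i * X m j) \<le> norm (1 + D m ^ 3)" by simp
    qed
  qed measurable
qed

lemma rvec_scale:
  assumes "rvec I M X D" shows "rvec I M (\<lambda>m i. c * X m i) (\<lambda>m. \<bar>c\<bar> * D m)"
  using assms by (auto simp: rvec_def abs_mult power_mult_distrib intro!: mult_left_mono)

text \<open>Both expectations are compared with the second-order expansion of \<phi> at
  \<open>s\<close>. Linear terms vanish by centring, quadratic terms differ by the covariance gap
  weighted with the total mass of \<open>H\<close>, and the envelopes absorb the cubic
  remainders.\<close>

lemma lindeberg_one_step:
  assumes I: "finite I" and X: "rvec I M X DX" and Y: "rvec I N Y DY"
    and phi: "test_fun I \<phi>" "taylor3 I M2 M3 \<phi>" and M3: "0 \<le> M3" and \<Delta>: "0 \<le> \<Delta>"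
    and cov: "\<And>i j. i \<in> I \<Longrightarrow> j \<in> I \<Longrightarrow> \<bar>(\<integral>m. X m i * X m j \<partial>M) - (\<integral>m. Y m i * Y m j \<partial>N)\<bar> \<le> \<Delta>"
  shows "\<bar>(\<integral>m. \<phi> (\<lambda>i. s i + X m i) \<partial>M) - (\<integral>m. \<phi> (\<lambda>i. s i + Y m i) \<partial>N)\<bar>
    \<le> M2 * \<Delta> / 2 + M3 * ((\<integral>m. DX m ^ 3 \<partial>M) + (\<integral>m. DY m ^ 3 \<partial>N))"
proof -
  obtain g H where H: "(\<Sum>i\<in>I. \<Sum>j\<in>I. \<bar>H i j\<bar>) \<le> M2"
    and T: "\<forall>y d. (\<forall>i\<in>I. \<bar>y i\<bar> \<le> d) \<longrightarrow>
       \<bar>\<phi> (\<lambda>i. s i + y i) - \<phi> s - (\<Sum>i\<in>I. g i * y i) - (\<Sum>i\<in>I. \<Sum>j\<in>I. H i j * (y i * y j)) / 2\<bar> \<le> M3 * d ^ 3"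
    using phi(2) unfolding taylor3_def by blast
  have key: "\<bar>(\<integral>m. \<phi> (\<lambda>i. s i + Z m i) \<partial>Q) - (\<phi> s + (\<Sum>i\<in>I. \<Sum>j\<in>I. H i j * (\<integral>m. Z m i * Z m j \<partial>Q)) / 2)\<bar>
      \<le> M3 * (\<integral>m. DZ m ^ 3 \<partial>Q)" if Z: "rvec I Q Z DZ" for Q :: "'q measure" and Z DZ
  proof -
    interpret prob_space Q using Z by (simp add: rvec_def)
    note int = rvec_integrable[OF Z]
    have m: "\<And>i. i \<in> I \<Longrightarrow> (\<lambda>m. s i + Z m i) \<in> borel_measurable Q" using Z by (auto simp: rvec_def)
    have iphi: "integrable Q (\<lambda>m. \<phi> (\<lambda>i. s i + Z m i))"
      by (rule test_fun_integrable[OF phi(1) m]) (auto intro: finite_measure_axioms)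
    define R where "R m = \<phi> (\<lambda>i. s i + Z m i) - \<phi> s - (\<Sum>i\<in>I. g i * Z m i) - (\<Sum>i\<in>I. \<Sum>j\<in>I. H i j * (Z m i * Z m j)) / 2" for m
    have i1: "integrable Q (\<lambda>m. \<Sum>i\<in>I. g i * Z m i)" using int by auto
    have i2: "integrable Q (\<lambda>m. (\<Sum>i\<in>I. \<Sum>j\<in>I. H i j * (Z m i * Z m j)) / 2)" using int by auto
    have iR: "integrable Q R" unfolding R_def[abs_def]
      by (intro Bochner_Integration.integrable_diff iphi i1 i2) auto
    have "(\<integral>m. R m \<partial>Q) = (\<integral>m. \<phi> (\<lambda>i. s i + Z m i) \<partial>Q) - \<phi> s - (\<integral>m. (\<Sum>i\<in>I. g i * Z m i) \<partial>Q) - (\<integral>m. (\<Sum>i\<in>I. \<Sum>j\<in>I. H i j * (Z m i * Z m j)) / 2 \<partial>Q)"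
      unfolding R_def[abs_def] using iphi i1 i2 by (simp add: prob_space)
    also have "(\<integral>m. (\<Sum>i\<in>I. g i * Z m i) \<partial>Q) = 0"
      using int Z by (simp add: Bochner_Integration.integral_sum rvec_def)
    also have "(\<integral>m. (\<Sum>i\<in>I. \<Sum>j\<in>I. H i j * (Z m i * Z m j)) / 2 \<partial>Q) = (\<Sum>i\<in>I. \<Sum>j\<in>I. H i j * (\<integral>m. Z m i * Z m j \<partial>Q)) / 2"
      using int by (simp add: Bochner_Integration.integral_sum)
    finally have e: "(\<integral>m. \<phi> (\<lambda>i. s i + Z m i) \<partial>Q) - (\<phi> s + (\<Sum>i\<in>I. \<Sum>j\<in>I. H i j * (\<integral>m. Z m i * Z m j \<partial>Q)) / 2) = (\<integral>m. R m \<partial>Q)"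
      by simp
    have "\<bar>\<integral>m. R m \<partial>Q\<bar> \<le> (\<integral>m. \<bar>R m\<bar> \<partial>Q)" by (rule integral_abs_bound)
    also have "\<dots> \<le> (\<integral>m. M3 * DZ m ^ 3 \<partial>Q)"
    proof (rule integral_mono)
      show "integrable Q (\<lambda>m. \<bar>R m\<bar>)" using iR by auto
      show "integrable Q (\<lambda>m. M3 * DZ m ^ 3)" using Z by (auto simp: rvec_def)
      fix m assume "m \<in> space Q"
      then show "\<bar>R m\<bar> \<le> M3 * DZ m ^ 3" unfolding R_def using T Z by (simp add: rvec_def)
    qed
    also have "\<dots> = M3 * (\<integral>m. DZ m ^ 3 \<partial>Q)" by simp
    finally show ?thesis using e by simp
  qed
  have "\<bar>(\<Sum>i\<in>I. \<Sum>j\<in>I. H i j * (\<integral>m. X m i * X m j \<partial>M)) - (\<Sum>i\<in>I. \<Sum>j\<in>I. H i j * (\<integral>m. Y m i * Y m j \<partial>N))\<bar>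
     = \<bar>\<Sum>i\<in>I. \<Sum>j\<in>I. H i j * ((\<integral>m. X m i * X m j \<partial>M) - (\<integral>m. Y m i * Y m j \<partial>N))\<bar>"
    by (simp add: sum_subtractf right_diff_distrib)
  also have "\<dots> \<le> (\<Sum>i\<in>I. \<Sum>j\<in>I. \<bar>H i j * ((\<integral>m. X m i * X m j \<partial>M) - (\<integral>m. Y m i * Y m j \<partial>N))\<bar>)"
    by (rule order_trans[OF sum_abs sum_mono[OF sum_abs]])
  also have "\<dots> \<le> (\<Sum>i\<in>I. \<Sum>j\<in>I. \<bar>H i j\<bar> * \<Delta>)"
    by (intro sum_mono) (auto simp: abs_mult intro!: mult_left_mono cov)
  also have "\<dots> \<le> M2 * \<Delta>"
    using H \<Delta> by (simp add: sum_distrib_right[symmetric] mult_right_mono)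
  finally show ?thesis using key[OF X] key[OF Y] by (simp add: algebra_simps abs_le_iff)
qed

section \<open>Exchanging independent summands one at a time\<close>

lemma integral_PiM_Suc:
  fixes F :: "(nat \<Rightarrow> 'a) \<Rightarrow> real"
  assumes M: "prob_space M" and F: "integrable (PiM {..<Suc n} (\<lambda>_. M)) F"
  shows "(\<integral>\<omega>. F \<omega> \<partial>PiM {..<Suc n} (\<lambda>_. M)) = (\<integral>x. (\<integral>y. F (x(n := y)) \<partial>M) \<partial>PiM {..<n} (\<lambda>_. M))"
proof -
  interpret prob_space M by fact
  interpret product_sigma_finite "\<lambda>_. M" by standard
  show ?thesis using product_integral_insert[of "{..<n}" n F] F by (simp add: lessThan_Suc)
qed

lemma prob_space_PiM_const: "prob_space M \<Longrightarrow> prob_space (PiM I (\<lambda>_. M))"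
  by (rule prob_space_PiM)

lemma sum_PiM_measurable:
  assumes "(\<lambda>m. X m i) \<in> borel_measurable M"
  shows "(\<lambda>\<omega>. \<Sum>k<n. X (\<omega> k) i :: real) \<in> borel_measurable (PiM {..<n} (\<lambda>_. M))"
proof (rule borel_measurable_sum)
  fix k assume "k \<in> {..<n}"
  then have "(\<lambda>\<omega>. \<omega> k) \<in> measurable (PiM {..<n} (\<lambda>_. M)) M" by (rule measurable_component_singleton)
  then show "(\<lambda>\<omega>. X (\<omega> k) i) \<in> borel_measurable (PiM {..<n} (\<lambda>_. M))"
    by (rule measurable_compose) fact
qed

lemma test_fun_Fubini:
  assumes phi: "test_fun I \<phi>" and M: "prob_space M" and N: "prob_space N"
    and X: "\<forall>i\<in>I. (\<lambda>m. X m i) \<in> borel_measurable M"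
    and Y: "\<forall>i\<in>I. (\<lambda>m. Y m i) \<in> borel_measurable N"
  shows "(\<integral>x. (\<integral>y. \<phi> (\<lambda>i. s i + X x i + Y y i) \<partial>N) \<partial>M) = (\<integral>y. (\<integral>x. \<phi> (\<lambda>i. s i + X x i + Y y i) \<partial>M) \<partial>N)"
    and "integrable (M \<Otimes>\<^sub>M N) (\<lambda>(x, y). \<phi> (\<lambda>i. s i + X x i + Y y i))"
    and "integrable M (\<lambda>x. \<integral>y. \<phi> (\<lambda>i. s i + X x i + Y y i) \<partial>N)"
    and "integrable N (\<lambda>y. \<integral>x. \<phi> (\<lambda>i. s i + X x i + Y y i) \<partial>M)"
proof -
  interpret M: prob_space M by fact
  interpret N: prob_space N by fact
  interpret P: pair_prob_space M N by standard
  have "(\<lambda>p. s i + X (fst p) i + Y (snd p) i) \<in> borel_measurable (M \<Otimes>\<^sub>M N)" if "i \<in> I" for i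
    using measurable_compose[OF measurable_fst X[rule_format, OF that]] measurable_compose[OF measurable_snd Y[rule_format, OF that]] by measurable
  then show i: "integrable (M \<Otimes>\<^sub>M N) (\<lambda>(x, y). \<phi> (\<lambda>i. s i + X x i + Y y i))"
    using test_fun_integrable[OF phi, of "\<lambda>p i. s i + X (fst p) i + Y (snd p) i" "M \<Otimes>\<^sub>M N"]
    by (simp add: split_beta' P.finite_measure_axioms)
  show "(\<integral>x. (\<integral>y. \<phi> (\<lambda>i. s i + X x i + Y y i) \<partial>N) \<partial>M) = (\<integral>y. (\<integral>x. \<phi> (\<lambda>i. s i + X x i + Y y i) \<partial>M) \<partial>N)"
    using P.Fubini_integral[OF i] by simp
  show "integrable M (\<lambda>x. \<integral>y. \<phi> (\<lambda>i. s i + X x i + Y y i) \<partial>N)" using P.integrable_fst'[OF i] by simp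
  show "integrable N (\<lambda>y. \<integral>x. \<phi> (\<lambda>i. s i + X x i + Y y i) \<partial>M)" using P.integrable_snd[OF i] by simp
qed

lemma integral_sum_PiM_Suc:
  assumes phi: "test_fun I \<phi>" and M: "prob_space M"
    and X: "\<And>i. i \<in> I \<Longrightarrow> (\<lambda>m. X m i) \<in> borel_measurable M"
  shows "(\<integral>\<omega>. \<phi> (\<lambda>i. s i + (\<Sum>k<Suc n. X (\<omega> k) i)) \<partial>PiM {..<Suc n} (\<lambda>_. M))
    = (\<integral>x. (\<integral>y. \<phi> (\<lambda>i. s i + (\<Sum>k<n. X (x k) i) + X y i) \<partial>M) \<partial>PiM {..<n} (\<lambda>_. M))"
proof -
  have "integrable (PiM {..<Suc n} (\<lambda>_. M)) (\<lambda>\<omega>. \<phi> (\<lambda>i. s i + (\<Sum>k<Suc n. X (\<omega> k) i)))"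
    by (rule test_fun_integrable[OF phi])
      (rule borel_measurable_add borel_measurable_const sum_PiM_measurable[OF X]
         prob_space.finite_measure[OF prob_space_PiM_const[OF M]] | assumption)+
  moreover have "(\<Sum>k<n. X (if k = n then y else x k) i) = (\<Sum>k<n. X (x k) i)" for x y i
    by (intro sum.cong) auto
  ultimately show ?thesis using integral_PiM_Suc[OF M] by (simp add: add.assoc)
qed

text \<open>Induction through a hybrid: the last summand is exchanged while the first
  \<open>n\<close> are frozen, and the first \<open>n\<close> by induction while the last is frozen.
  Both freezings use Fubini, and this is why the one-step bound must hold for every shift
  \<open>s\<close>.\<close>

lemma lindeberg_n_step:
  assumes phi: "test_fun I \<phi>" and M: "prob_space M" and N: "prob_space N"
    and X: "\<And>i. i \<in> I \<Longrightarrow> (\<lambda>m. X m i) \<in> borel_measurable M"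
    and Y: "\<And>i. i \<in> I \<Longrightarrow> (\<lambda>m. Y m i) \<in> borel_measurable N"
    and step: "\<And>s. \<bar>(\<integral>m. \<phi> (\<lambda>i. s i + X m i) \<partial>M) - (\<integral>m. \<phi> (\<lambda>i. s i + Y m i) \<partial>N)\<bar> \<le> \<eta>"
  shows "\<bar>(\<integral>\<omega>. \<phi> (\<lambda>i. s i + (\<Sum>k<n. X (\<omega> k) i)) \<partial>PiM {..<n} (\<lambda>_. M))
     - (\<integral>\<omega>. \<phi> (\<lambda>i. s i + (\<Sum>k<n. Y (\<omega> k) i)) \<partial>PiM {..<n} (\<lambda>_. N))\<bar> \<le> real n * \<eta>"
proof (induction n arbitrary: s)
  case 0
  interpret A: prob_space "PiM {..<0::nat} (\<lambda>_. M)" by (rule prob_space_PiM_const[OF M])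
  interpret B: prob_space "PiM {..<0::nat} (\<lambda>_. N)" by (rule prob_space_PiM_const[OF N])
  show ?case using A.prob_space B.prob_space by simp
next
  case (Suc n)
  interpret M: prob_space M by fact
  interpret N: prob_space N by fact
  let ?PM = "PiM {..<n} (\<lambda>_. M)" and ?PN = "PiM {..<n} (\<lambda>_. N)"
  interpret PM: prob_space ?PM by (rule prob_space_PiM_const[OF M])
  interpret PN: prob_space ?PN by (rule prob_space_PiM_const[OF N])
  define SX where "SX x i = (\<Sum>k<n. X (x k) i)" for x i
  define SY where "SY x i = (\<Sum>k<n. Y (x k) i)" for x i
  have SX: "\<forall>i\<in>I. (\<lambda>x. SX x i) \<in> borel_measurable ?PM"
    unfolding SX_def by (intro ballI sum_PiM_measurable X)
  have SY: "\<forall>i\<in>I. (\<lambda>x. SY x i) \<in> borel_measurable ?PN"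
    unfolding SY_def by (intro ballI sum_PiM_measurable Y)
  have XB: "\<forall>i\<in>I. (\<lambda>m. X m i) \<in> borel_measurable M" and YB: "\<forall>i\<in>I. (\<lambda>m. Y m i) \<in> borel_measurable N"
    using X Y by auto
  note f1 = test_fun_Fubini[OF phi PM.prob_space_axioms M SX XB, where s=s]
  note f2 = test_fun_Fubini[OF phi PM.prob_space_axioms N SX YB, where s=s]
  note f3 = test_fun_Fubini[OF phi PN.prob_space_axioms N SY YB, where s=s]
  have "\<bar>(\<integral>x. (\<integral>y. \<phi> (\<lambda>i. s i + SX x i + X y i) \<partial>M) \<partial>?PM) - (\<integral>x. (\<integral>y. \<phi> (\<lambda>i. s i + SX x i + Y y i) \<partial>N) \<partial>?PM)\<bar>
    = \<bar>\<integral>x. (\<integral>y. \<phi> (\<lambda>i. s i + SX x i + X y i) \<partial>M) - (\<integral>y. \<phi> (\<lambda>i. s i + SX x i + Y y i) \<partial>N) \<partial>?PM\<bar>"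
    using f1(3) f2(3) by simp
  also have "\<dots> \<le> \<eta>"
  proof -
    have "AE x in ?PM. \<bar>(\<integral>y. \<phi> (\<lambda>i. s i + SX x i + X y i) \<partial>M) - (\<integral>y. \<phi> (\<lambda>i. s i + SX x i + Y y i) \<partial>N)\<bar> \<le> \<eta>"
    proof (rule AE_I2)
      fix x
      show "\<bar>(\<integral>y. \<phi> (\<lambda>i. s i + SX x i + X y i) \<partial>M) - (\<integral>y. \<phi> (\<lambda>i. s i + SX x i + Y y i) \<partial>N)\<bar> \<le> \<eta>"
        using step[of "\<lambda>i. s i + SX x i"] by simp
    qed
    then show ?thesis
      using f1(3) f2(3) by (intro order_trans[OF integral_abs_bound] PM.integral_le_const) auto
  qed
  finally have 1: "\<bar>(\<integral>x. (\<integral>y. \<phi> (\<lambda>i. s i + SX x i + X y i) \<partial>M) \<partial>?PM) - (\<integral>x. (\<integral>y. \<phi> (\<lambda>i. s i + SX x i + Y y i) \<partial>N) \<partial>?PM)\<bar> \<le> \<eta>" .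
  have "\<bar>(\<integral>y. (\<integral>x. \<phi> (\<lambda>i. s i + SX x i + Y y i) \<partial>?PM) \<partial>N) - (\<integral>y. (\<integral>x. \<phi> (\<lambda>i. s i + SY x i + Y y i) \<partial>?PN) \<partial>N)\<bar>
    = \<bar>\<integral>y. (\<integral>x. \<phi> (\<lambda>i. s i + SX x i + Y y i) \<partial>?PM) - (\<integral>x. \<phi> (\<lambda>i. s i + SY x i + Y y i) \<partial>?PN) \<partial>N\<bar>"
    using f2(4) f3(4) by simp
  also have "\<dots> \<le> real n * \<eta>"
  proof -
    have "AE y in N. \<bar>(\<integral>x. \<phi> (\<lambda>i. s i + SX x i + Y y i) \<partial>?PM) - (\<integral>x. \<phi> (\<lambda>i. s i + SY x i + Y y i) \<partial>?PN)\<bar> \<le> real n * \<eta>"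
    proof (rule AE_I2)
      fix y
      show "\<bar>(\<integral>x. \<phi> (\<lambda>i. s i + SX x i + Y y i) \<partial>?PM) - (\<integral>x. \<phi> (\<lambda>i. s i + SY x i + Y y i) \<partial>?PN)\<bar> \<le> real n * \<eta>"
        using Suc.IH[of "\<lambda>i. s i + Y y i"] by (simp add: SX_def SY_def add.assoc add.commute add.left_commute)
    qed
    then show ?thesis
      using f2(4) f3(4) by (intro order_trans[OF integral_abs_bound] N.integral_le_const) auto
  qed
  finally have 2: "\<bar>(\<integral>y. (\<integral>x. \<phi> (\<lambda>i. s i + SX x i + Y y i) \<partial>?PM) \<partial>N) - (\<integral>y. (\<integral>x. \<phi> (\<lambda>i. s i + SY x i + Y y i) \<partial>?PN) \<partial>N)\<bar> \<le> real n * \<eta>" .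
  have "(\<integral>\<omega>. \<phi> (\<lambda>i. s i + (\<Sum>k<Suc n. X (\<omega> k) i)) \<partial>PiM {..<Suc n} (\<lambda>_. M))
      = (\<integral>x. (\<integral>y. \<phi> (\<lambda>i. s i + SX x i + X y i) \<partial>M) \<partial>?PM)"
    unfolding SX_def by (rule integral_sum_PiM_Suc[OF phi M X])
  moreover have "(\<integral>\<omega>. \<phi> (\<lambda>i. s i + (\<Sum>k<Suc n. Y (\<omega> k) i)) \<partial>PiM {..<Suc n} (\<lambda>_. N))
      = (\<integral>x. (\<integral>y. \<phi> (\<lambda>i. s i + SY x i + Y y i) \<partial>N) \<partial>?PN)"
    unfolding SY_def by (rule integral_sum_PiM_Suc[OF phi N Y])
  moreover have "real (Suc n) * \<eta> = real n * \<eta> + \<eta>" by (simp add: algebra_simps)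
  ultimately show ?case
    using 1 2 f2(1) f3(1) by linarith
qed

text \<open>Zipping two independent product samples gives a product of pairs. It suffices to check
  rectangles, where both sides factor by Fubini. The lemma serves twice: to rotate Gaussian vectors,
  and to attach multipliers to data.\<close>

lemma distr_pair_PiM:
  assumes I: "finite I" and M: "prob_space M" and N: "prob_space N" and f: "f \<in> measurable (M \<Otimes>\<^sub>M N) R"
  shows "distr (PiM I (\<lambda>_. M) \<Otimes>\<^sub>M PiM I (\<lambda>_. N)) (PiM I (\<lambda>_. R)) (\<lambda>p. \<lambda>i\<in>I. f (fst p i, snd p i))
    = PiM I (\<lambda>_. distr (M \<Otimes>\<^sub>M N) R f)"
proof -
  interpret M: prob_space M by fact
  interpret N: prob_space N by fact
  interpret MN: pair_prob_space M N by standard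
  interpret PM: product_sigma_finite "\<lambda>_. M" by standard
  interpret PN: product_sigma_finite "\<lambda>_. N" by standard
  interpret QM: prob_space "PiM I (\<lambda>_. M)" by (rule prob_space_PiM_const[OF M])
  interpret QN: prob_space "PiM I (\<lambda>_. N)" by (rule prob_space_PiM_const[OF N])
  interpret Q: pair_prob_space "PiM I (\<lambda>_. M)" "PiM I (\<lambda>_. N)" by standard
  interpret D: prob_space "distr (M \<Otimes>\<^sub>M N) R f" by (rule MN.prob_space_distr[OF f])
  interpret PD: product_sigma_finite "\<lambda>_. distr (M \<Otimes>\<^sub>M N) R f" by standard
  have fi: "(\<lambda>p. f (fst p i, snd p i)) \<in> measurable (PiM I (\<lambda>_. M) \<Otimes>\<^sub>M PiM I (\<lambda>_. N)) R" if "i \<in> I" for i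
  proof (rule measurable_compose[OF _ f], rule measurable_Pair)
    show "(\<lambda>p. fst p i) \<in> measurable (PiM I (\<lambda>_. M) \<Otimes>\<^sub>M PiM I (\<lambda>_. N)) M"
      by (rule measurable_compose[OF measurable_fst measurable_component_singleton[OF that]])
    show "(\<lambda>p. snd p i) \<in> measurable (PiM I (\<lambda>_. M) \<Otimes>\<^sub>M PiM I (\<lambda>_. N)) N"
      by (rule measurable_compose[OF measurable_snd measurable_component_singleton[OF that]])
  qed
  have g: "(\<lambda>p. \<lambda>i\<in>I. f (fst p i, snd p i)) \<in> measurable (PiM I (\<lambda>_. M) \<Otimes>\<^sub>M PiM I (\<lambda>_. N)) (PiM I (\<lambda>_. R))"
    by (rule measurable_restrict) (rule fi)
  show ?thesis
  proof (rule PD.PiM_eqI[OF I])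
    show "sets (distr (PiM I (\<lambda>_. M) \<Otimes>\<^sub>M PiM I (\<lambda>_. N)) (PiM I (\<lambda>_. R)) (\<lambda>p. \<lambda>i\<in>I. f (fst p i, snd p i))) = sets (PiM I (\<lambda>_. distr (M \<Otimes>\<^sub>M N) R f))"
      by (simp cong: sets_PiM_cong)
    fix A assume "\<And>i. i \<in> I \<Longrightarrow> A i \<in> sets (distr (M \<Otimes>\<^sub>M N) R f)"
    then have A: "\<And>i. i \<in> I \<Longrightarrow> A i \<in> sets R" by simp
    have ind: "(\<lambda>p. indicator (A i) (f p) :: ennreal) \<in> borel_measurable (M \<Otimes>\<^sub>M N)" if "i \<in> I" for i
      by (rule measurable_compose[OF f]) (use A[OF that] in simp)
    have indy: "(\<lambda>x. indicator (A i) (f (x, y)) :: ennreal) \<in> borel_measurable M" if "i \<in> I" "y \<in> space N" for i y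
      using measurable_Pair2'[of y N M] ind[OF that(1)] that(2)
      by (auto intro: measurable_compose[of _ M "M \<Otimes>\<^sub>M N" "\<lambda>p. indicator (A i) (f p)", OF measurable_Pair2'])
    have indx: "(\<lambda>y. \<integral>\<^sup>+x. indicator (A i) (f (x, y)) \<partial>M) \<in> borel_measurable N" if "i \<in> I" for i
      using ind[OF that] by (intro M.borel_measurable_nn_integral) (simp add: measurable_split_conv measurable_pair_swap_iff[of _ N] split_beta')
    have "emeasure (distr (PiM I (\<lambda>_. M) \<Otimes>\<^sub>M PiM I (\<lambda>_. N)) (PiM I (\<lambda>_. R)) (\<lambda>p. \<lambda>i\<in>I. f (fst p i, snd p i))) (Pi\<^sub>E I A)
      = (\<integral>\<^sup>+z. indicator (Pi\<^sub>E I A) z \<partial>distr (PiM I (\<lambda>_. M) \<Otimes>\<^sub>M PiM I (\<lambda>_. N)) (PiM I (\<lambda>_. R)) (\<lambda>p. \<lambda>i\<in>I. f (fst p i, snd p i)))"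
      using A I by (subst nn_integral_indicator) (auto intro!: sets_PiM_I_finite)
    also have "\<dots> = (\<integral>\<^sup>+p. indicator (Pi\<^sub>E I A) (\<lambda>i\<in>I. f (fst p i, snd p i)) \<partial>(PiM I (\<lambda>_. M) \<Otimes>\<^sub>M PiM I (\<lambda>_. N)))"
      using A I by (intro nn_integral_distr g) (auto intro!: borel_measurable_indicator sets_PiM_I_finite)
    also have "\<dots> = (\<integral>\<^sup>+p. (\<Prod>i\<in>I. indicator (A i) (f (fst p i, snd p i))) \<partial>(PiM I (\<lambda>_. M) \<Otimes>\<^sub>M PiM I (\<lambda>_. N)))"
    proof (rule nn_integral_cong)
      fix p
      show "indicator (Pi\<^sub>E I A) (\<lambda>i\<in>I. f (fst p i, snd p i)) = (\<Prod>i\<in>I. indicator (A i) (f (fst p i, snd p i)) :: ennreal)"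
        using I by (auto simp: indicator_def PiE_iff prod_zero_iff)
    qed
    also have "\<dots> = (\<integral>\<^sup>+y. \<integral>\<^sup>+x. (\<Prod>i\<in>I. indicator (A i) (f (x i, y i))) \<partial>PiM I (\<lambda>_. M) \<partial>PiM I (\<lambda>_. N))"
    proof (subst Q.nn_integral_snd[symmetric])
      show "(\<lambda>p. (\<Prod>i\<in>I. indicator (A i) (f (fst p i, snd p i))) :: ennreal) \<in> borel_measurable (PiM I (\<lambda>_. M) \<Otimes>\<^sub>M PiM I (\<lambda>_. N))"
        by (intro borel_measurable_prod_ennreal measurable_compose[OF fi]) (use A in auto)
    qed simp
    also have "\<dots> = (\<integral>\<^sup>+y. (\<Prod>i\<in>I. (\<lambda>y. \<integral>\<^sup>+x. indicator (A i) (f (x, y)) \<partial>M) (y i)) \<partial>PiM I (\<lambda>_. N))"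
    proof (rule nn_integral_cong)
      fix y assume y: "y \<in> space (PiM I (\<lambda>_. N))"
      show "(\<integral>\<^sup>+x. (\<Prod>i\<in>I. indicator (A i) (f (x i, y i))) \<partial>PiM I (\<lambda>_. M)) = (\<Prod>i\<in>I. (\<lambda>y. \<integral>\<^sup>+x. indicator (A i) (f (x, y)) \<partial>M) (y i))"
        using PM.product_nn_integral_prod[OF I, of "\<lambda>i x. indicator (A i) (f (x, y i))"] indy y
        by (simp add: space_PiM PiE_iff)
    qed
    also have "\<dots> = (\<Prod>i\<in>I. \<integral>\<^sup>+y. \<integral>\<^sup>+x. indicator (A i) (f (x, y)) \<partial>M \<partial>N)"
      by (rule PN.product_nn_integral_prod[OF I indx])
    also have "\<dots> = (\<Prod>i\<in>I. emeasure (distr (M \<Otimes>\<^sub>M N) R f) (A i))"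
    proof (rule prod.cong[OF refl])
      fix i assume i: "i \<in> I"
      have "(\<integral>\<^sup>+y. \<integral>\<^sup>+x. indicator (A i) (f (x, y)) \<partial>M \<partial>N) = (\<integral>\<^sup>+p. indicator (A i) (f p) \<partial>(M \<Otimes>\<^sub>M N))"
        using MN.nn_integral_snd[OF ind[OF i]] by simp
      also have "\<dots> = (\<integral>\<^sup>+z. indicator (A i) z \<partial>distr (M \<Otimes>\<^sub>M N) R f)"
        using A[OF i] by (intro nn_integral_distr[symmetric] f) auto
      also have "\<dots> = emeasure (distr (M \<Otimes>\<^sub>M N) R f) (A i)"
        using A[OF i] by simp
      finally show "(\<integral>\<^sup>+y. \<integral>\<^sup>+x. indicator (A i) (f (x, y)) \<partial>M \<partial>N) = emeasure (distr (M \<Otimes>\<^sub>M N) R f) (A i)" .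
    qed
    finally show "emeasure (distr (PiM I (\<lambda>_. M) \<Otimes>\<^sub>M PiM I (\<lambda>_. N)) (PiM I (\<lambda>_. R)) (\<lambda>p. \<lambda>i\<in>I. f (fst p i, snd p i))) (Pi\<^sub>E I A)
      = (\<Prod>i\<in>I. emeasure (distr (M \<Otimes>\<^sub>M N) R f) (A i))" .
  qed
qed

section \<open>Gaussian vectors\<close>

definition gstd :: "nat set \<Rightarrow> (nat \<Rightarrow> real) measure" where
  "gstd J = PiM J (\<lambda>_. std_normal_distribution)"

text \<open>Centred Gaussian vectors are represented as images of standard ones under a matrix
  \<open>L\<close> with columns indexed by \<open>J\<close>. The number of columns is left free, so
  one covariance may have several factors of different widths.\<close>

definition lin :: "('i \<Rightarrow> nat \<Rightarrow> real) \<Rightarrow> nat set \<Rightarrow> (nat \<Rightarrow> real) \<Rightarrow> 'i \<Rightarrow> real" where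
  "lin L J \<xi> i = (\<Sum>m\<in>J. L i m * \<xi> m)"

lemma prob_space_std_normal: "prob_space std_normal_distribution"
  by (rule prob_space_normal_density) simp

lemma prob_space_gstd: "prob_space (gstd J)"
  unfolding gstd_def by (rule prob_space_PiM_const[OF prob_space_std_normal])

lemma sets_gstd: "sets (gstd J) = sets (PiM J (\<lambda>_. borel))"
  unfolding gstd_def by (rule sets_PiM_cong) auto

lemma component_gstd [measurable]: "m \<in> J \<Longrightarrow> (\<lambda>\<xi>. \<xi> m) \<in> borel_measurable (gstd J)"
  unfolding gstd_def using measurable_component_singleton[of m J "\<lambda>_. std_normal_distribution"] by simp

lemma lin_measurable [measurable]: "(\<lambda>\<xi>. lin L J \<xi> i) \<in> borel_measurable (gstd J)"
  unfolding lin_def by (intro borel_measurable_sum borel_measurable_times borel_measurable_const component_gstd)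

text \<open>The characteristic function of the combination is the product of two Gaussian
  exponentials, whose exponents recombine because \<open>a\<close> and \<open>b\<close> are a cosine
  and a sine.\<close>

lemma std_normal_rotation:
  assumes ab: "a\<^sup>2 + b\<^sup>2 = 1"
  shows "distr (std_normal_distribution \<Otimes>\<^sub>M std_normal_distribution) borel (\<lambda>p. a * fst p + b * snd p) = std_normal_distribution"
proof (rule Levy_uniqueness)
  interpret N: prob_space std_normal_distribution by (rule prob_space_std_normal)
  interpret P: pair_prob_space std_normal_distribution std_normal_distribution by standard
  have m: "(\<lambda>p. a * fst p + b * snd p) \<in> borel_measurable (std_normal_distribution \<Otimes>\<^sub>M std_normal_distribution)"
    by measurable
  show "real_distribution (distr (std_normal_distribution \<Otimes>\<^sub>M std_normal_distribution) borel (\<lambda>p. a * fst p + b * snd p))"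
    using P.prob_space_distr[OF m] by (simp add: real_distribution_def real_distribution_axioms_def)
  show "real_distribution std_normal_distribution" by (rule real_dist_normal_dist)
  show "char (distr (std_normal_distribution \<Otimes>\<^sub>M std_normal_distribution) borel (\<lambda>p. a * fst p + b * snd p)) = char std_normal_distribution"
  proof
    fix t :: real
    let ?N = "std_normal_distribution"
    have i: "integrable (?N \<Otimes>\<^sub>M ?N) (\<lambda>p. iexp ((t * a) * fst p) * iexp ((t * b) * snd p))"
      by (rule P.integrable_const_bound[of _ 1]) (auto simp: norm_mult)
    have "char (distr (?N \<Otimes>\<^sub>M ?N) borel (\<lambda>p. a * fst p + b * snd p)) t = (\<integral>p. iexp (t * (a * fst p + b * snd p)) \<partial>(?N \<Otimes>\<^sub>M ?N))"
      unfolding char_def by (rule integral_distr[OF m]) measurable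
    also have "\<dots> = (\<integral>p. iexp ((t * a) * fst p) * iexp ((t * b) * snd p) \<partial>(?N \<Otimes>\<^sub>M ?N))"
      by (simp add: exp_add[symmetric] algebra_simps)
    also have "\<dots> = (\<integral>x. \<integral>y. iexp ((t * a) * x) * iexp ((t * b) * y) \<partial>?N \<partial>?N)"
      using P.integral_fst'[OF i] by simp
    also have "\<dots> = char ?N (t * a) * char ?N (t * b)"
      unfolding char_def by simp
    also have "\<dots> = exp (- ((t * a)\<^sup>2) / 2) * exp (- ((t * b)\<^sup>2) / 2)"
      by (simp add: char_std_normal_distribution)
    also have "\<dots> = exp (- (t\<^sup>2) / 2 * (a\<^sup>2 + b\<^sup>2))"
      by (simp add: exp_add[symmetric] field_simps power_mult_distrib)
    also have "\<dots> = char ?N t" using ab by (simp add: char_std_normal_distribution)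
    finally show "char (distr (?N \<Otimes>\<^sub>M ?N) borel (\<lambda>p. a * fst p + b * snd p)) t = char ?N t" .
  qed
qed

lemma gstd_rotation:
  assumes "finite J" "a\<^sup>2 + b\<^sup>2 = 1"
  shows "distr (gstd J \<Otimes>\<^sub>M gstd J) (PiM J (\<lambda>_. borel)) (\<lambda>p. \<lambda>m\<in>J. a * fst p m + b * snd p m) = gstd J"
  using distr_pair_PiM[OF assms(1) prob_space_std_normal prob_space_std_normal, of "\<lambda>p. a * fst p + b * snd p" borel]
  by (simp add: std_normal_rotation[OF assms(2)] gstd_def)

text \<open>Stability of the Gaussian law. By induction the first \<open>n\<close> copies collapse
  to \<open>sqrt n\<close> times one copy; this copy and the new one merge by the rotation with
  coefficients \<open>sqrt n / sqrt (n + 1)\<close> and \<open>1 / sqrt (n + 1)\<close>.\<close>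

lemma gauss_sum:
  fixes n :: nat
  assumes phi: "test_fun I \<phi>" and J: "finite J"
  shows "(\<integral>\<Omega>. \<phi> (\<lambda>i. s i + (\<Sum>k<n. c * lin L J (\<Omega> k) i)) \<partial>PiM {..<n} (\<lambda>_. gstd J))
    = (\<integral>\<xi>. \<phi> (\<lambda>i. s i + c * sqrt (real n) * lin L J \<xi> i) \<partial>gstd J)"
proof (induction n arbitrary: s)
  case 0
  interpret A: prob_space "PiM {..<0::nat} (\<lambda>_. gstd J)" by (rule prob_space_PiM_const[OF prob_space_gstd])
  interpret B: prob_space "gstd J" by (rule prob_space_gstd)
  show ?case using A.prob_space B.prob_space by simp
next
  case (Suc n)
  let ?G = "gstd J"
  let ?P = "PiM {..<n} (\<lambda>_. gstd J)"
  interpret G: prob_space ?G by (rule prob_space_gstd)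
  interpret P: prob_space ?P by (rule prob_space_PiM_const[OF prob_space_gstd])
  interpret GG: pair_prob_space ?G ?G by standard
  define S where "S x i = (\<Sum>k<n. c * lin L J (x k) i)" for x i
  have m: "(\<lambda>\<xi>. k * lin L J \<xi> i) \<in> borel_measurable ?G" for i k by measurable
  have Sm: "\<forall>i\<in>I. (\<lambda>x. S x i) \<in> borel_measurable ?P"
    unfolding S_def by (intro ballI sum_PiM_measurable m)
  have mB: "\<forall>i\<in>I. (\<lambda>\<xi>. c * lin L J \<xi> i) \<in> borel_measurable ?G"
    and mB': "\<forall>i\<in>I. (\<lambda>\<xi>. c * sqrt (real n) * lin L J \<xi> i) \<in> borel_measurable ?G" using m by auto
  have "(\<integral>\<Omega>. \<phi> (\<lambda>i. s i + (\<Sum>k<Suc n. c * lin L J (\<Omega> k) i)) \<partial>PiM {..<Suc n} (\<lambda>_. gstd J))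
     = (\<integral>x. (\<integral>y. \<phi> (\<lambda>i. s i + S x i + c * lin L J y i) \<partial>?G) \<partial>?P)"
    unfolding S_def by (rule integral_sum_PiM_Suc[OF phi prob_space_gstd m])
  also have "\<dots> = (\<integral>y. (\<integral>x. \<phi> (\<lambda>i. s i + S x i + c * lin L J y i) \<partial>?P) \<partial>?G)"
    by (rule test_fun_Fubini(1)[OF phi P.prob_space_axioms G.prob_space_axioms Sm mB])
  also have "\<dots> = (\<integral>y. (\<integral>x. \<phi> (\<lambda>i. (s i + c * lin L J y i) + S x i) \<partial>?P) \<partial>?G)"
    by (simp add: add.assoc add.commute add.left_commute)
  also have "\<dots> = (\<integral>y. (\<integral>x. \<phi> (\<lambda>i. s i + c * lin L J y i + c * sqrt (real n) * lin L J x i) \<partial>?G) \<partial>?G)"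
    unfolding S_def by (subst Suc.IH) simp
  also have "\<dots> = (\<integral>p. \<phi> (\<lambda>i. s i + c * lin L J (fst p) i + c * sqrt (real n) * lin L J (snd p) i) \<partial>(?G \<Otimes>\<^sub>M ?G))"
    using GG.integral_fst'[OF test_fun_Fubini(2)[OF phi G.prob_space_axioms G.prob_space_axioms mB mB']]
    by (simp add: split_beta')
  also have "\<dots> = (\<integral>p. \<phi> (\<lambda>i. s i + c * sqrt (Suc n) * lin L J (\<lambda>m\<in>J. (1 / sqrt (Suc n)) * fst p m + (sqrt n / sqrt (Suc n)) * snd p m) i) \<partial>(?G \<Otimes>\<^sub>M ?G))"
  proof -
    have "c * sqrt (Suc n) * lin L J (\<lambda>m\<in>J. (1 / sqrt (Suc n)) * fst p m + (sqrt n / sqrt (Suc n)) * snd p m) i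
        = c * lin L J (fst p) i + c * sqrt (real n) * lin L J (snd p) i" for p i
    proof -
      have "lin L J (\<lambda>m\<in>J. (1 / sqrt (Suc n)) * fst p m + (sqrt n / sqrt (Suc n)) * snd p m) i
         = (lin L J (fst p) i + sqrt n * lin L J (snd p) i) / sqrt (Suc n)"
        unfolding lin_def sum_distrib_left sum.distrib[symmetric] sum_divide_distrib
        by (intro sum.cong refl) (simp add: field_simps)
      then show ?thesis by (simp add: field_simps del: of_nat_Suc)
    qed
    then show ?thesis by (simp add: add.assoc)
  qed
  also have "\<dots> = (\<integral>\<xi>. \<phi> (\<lambda>i. s i + c * sqrt (Suc n) * lin L J \<xi> i) \<partial>?G)"
  proof -
    have e: "(1 / sqrt (Suc n))\<^sup>2 + (sqrt n / sqrt (Suc n))\<^sup>2 = 1"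
      by (simp add: power_divide add_divide_distrib[symmetric])
    have g: "(\<lambda>p. \<lambda>m\<in>J. (1 / sqrt (Suc n)) * fst p m + (sqrt n / sqrt (Suc n)) * snd p m) \<in> measurable (?G \<Otimes>\<^sub>M ?G) (PiM J (\<lambda>_. borel))"
      by (intro measurable_restrict borel_measurable_add borel_measurable_times borel_measurable_const
        measurable_compose[OF measurable_fst component_gstd] measurable_compose[OF measurable_snd component_gstd])
    have h: "(\<lambda>\<xi>. \<phi> (\<lambda>i. s i + c * sqrt (Suc n) * lin L J \<xi> i)) \<in> borel_measurable (PiM J (\<lambda>_. borel))"
    proof -
      have "(\<lambda>\<xi>. \<phi> (\<lambda>i. s i + c * sqrt (Suc n) * lin L J \<xi> i)) \<in> borel_measurable ?G"
        by (rule test_fun_measurable[OF phi]) measurable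
      then show ?thesis using measurable_cong_sets[OF sets_gstd refl] by blast
    qed
    show ?thesis
      by (subst (2) gstd_rotation[OF J e, symmetric], subst integral_distr[OF g h]) simp
  qed
  finally show ?case .
qed

section \<open>Moments and covariances of Gaussian linear forms\<close>

lemma std_normal_moments:
  "(\<integral>x. x \<partial>std_normal_distribution) = 0" "(\<integral>x. x\<^sup>2 \<partial>std_normal_distribution) = 1"
  "integrable std_normal_distribution (\<lambda>x. x ^ k)" "integrable std_normal_distribution (\<lambda>x. \<bar>x\<bar> ^ k)"
  "(\<integral>x. \<bar>x\<bar> ^ 3 \<partial>std_normal_distribution) \<le> 2"
proof -
  show i: "integrable std_normal_distribution (\<lambda>x. x ^ k)" for k by (rule integrable_std_normal_distribution_moment)
  show a: "integrable std_normal_distribution (\<lambda>x. \<bar>x\<bar> ^ k)" for k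
    using integrable_abs[OF i[of k]] by (simp add: power_abs)
  show "(\<integral>x. x \<partial>std_normal_distribution) = 0" using integral_std_normal_distribution_moment_odd[of 1] by simp
  show s: "(\<integral>x. x\<^sup>2 \<partial>std_normal_distribution) = 1" using std_normal_distribution_even_moments(1)[of 1] by simp
  have f: "(\<integral>x. x^4 \<partial>std_normal_distribution) = 3" using std_normal_distribution_even_moments(1)[of 2] by (simp add: fact_numeral)
  have "(\<integral>x. \<bar>x\<bar> ^ 3 \<partial>std_normal_distribution) \<le> (\<integral>x. (x\<^sup>2 + x^4) / 2 \<partial>std_normal_distribution)"
  proof (rule integral_mono[OF a])
    show "integrable std_normal_distribution (\<lambda>x. (x\<^sup>2 + x^4) / 2)" using i by auto
    fix x :: real
    \<comment> \<open>The third absolute moment is interpolated between the second and the fourth,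
      which are 1 and 3, so it is at most 2.\<close>
    have "0 \<le> \<bar>x\<bar>^2 * (1 - \<bar>x\<bar>)^2" by simp
    then have "2 * \<bar>x\<bar>^3 \<le> \<bar>x\<bar>^2 + \<bar>x\<bar>^4" by (simp add: algebra_simps power_numeral_reduce)
    then show "\<bar>x\<bar>^3 \<le> (x\<^sup>2 + x^4) / 2" by simp
  qed
  also have "\<dots> = 2" using i s f by simp
  finally show "(\<integral>x. \<bar>x\<bar> ^ 3 \<partial>std_normal_distribution) \<le> 2" .
qed

lemma integral_gstd_component:
  assumes "m \<in> J" "f \<in> borel_measurable borel"
  shows "(\<integral>\<xi>. f (\<xi> m) \<partial>gstd J) = (\<integral>x. f x \<partial>std_normal_distribution :: real)"
    and "integrable std_normal_distribution f \<Longrightarrow> integrable (gstd J) (\<lambda>\<xi>. f (\<xi> m))"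
proof -
  have d: "distr (gstd J) std_normal_distribution (\<lambda>\<xi>. \<xi> m) = std_normal_distribution"
    unfolding gstd_def by (rule distr_PiM_component[OF prob_space_std_normal assms(1)])
  have c: "(\<lambda>\<xi>. \<xi> m) \<in> measurable (gstd J) std_normal_distribution" using component_gstd[OF assms(1)] by simp
  have f: "f \<in> borel_measurable std_normal_distribution" using assms(2) by simp
  show "(\<integral>\<xi>. f (\<xi> m) \<partial>gstd J) = (\<integral>x. f x \<partial>std_normal_distribution)"
    using integral_distr[OF c f] d by simp
  show "integrable std_normal_distribution f \<Longrightarrow> integrable (gstd J) (\<lambda>\<xi>. f (\<xi> m))"
    using integrable_distr_eq[OF c f] d by simp
qed

lemma integral_gstd_mult:
  assumes J: "finite J" "m \<in> J" "m' \<in> J"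
  shows "(\<integral>\<xi>. \<xi> m * \<xi> m' \<partial>gstd J) = (if m = m' then 1 else 0)" "integrable (gstd J) (\<lambda>\<xi>. \<xi> m * \<xi> m')"
proof -
  interpret N: prob_space std_normal_distribution by (rule prob_space_std_normal)
  interpret P: product_sigma_finite "\<lambda>_. std_normal_distribution" by standard
  have "(\<integral>\<xi>. \<xi> m * \<xi> m' \<partial>gstd J) = (if m = m' then 1 else 0) \<and> integrable (gstd J) (\<lambda>\<xi>. \<xi> m * \<xi> m')"
  proof (cases "m = m'")
    case True
    then show ?thesis
      using integral_gstd_component[OF J(2), of "\<lambda>x. x\<^sup>2"] std_normal_moments(2) std_normal_moments(3)[of 2]
      by (simp add: power2_eq_square)
  next
    case False
    define f where "f k = (\<lambda>x::real. if k = m \<or> k = m' then x else 1)" for k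
    have fi: "integrable std_normal_distribution (f k)" for k
      using std_normal_moments(3)[of 1] by (cases "k = m \<or> k = m'") (auto simp: f_def)
    have e: "(\<Prod>k\<in>J. f k (\<xi> k)) = \<xi> m * \<xi> m'" for \<xi>
    proof -
      have "(\<Prod>k\<in>J. f k (\<xi> k)) = (\<Prod>k\<in>{m,m'}. f k (\<xi> k))"
        by (rule prod.mono_neutral_right) (use J in \<open>auto simp: f_def\<close>)
      then show ?thesis using False by (simp add: f_def)
    qed
    have "(\<integral>\<xi>. (\<Prod>k\<in>J. f k (\<xi> k)) \<partial>gstd J) = (\<Prod>k\<in>J. \<integral>x. f k x \<partial>std_normal_distribution)"
      unfolding gstd_def by (rule P.product_integral_prod[OF J(1) fi])
    also have "\<dots> = 0" using J std_normal_moments(1) by (auto simp: prod_zero_iff f_def intro!: bexI[of _ m])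
    finally have 1: "(\<integral>\<xi>. (\<Prod>k\<in>J. f k (\<xi> k)) \<partial>gstd J) = 0" .
    have "integrable (gstd J) (\<lambda>\<xi>. \<Prod>k\<in>J. f k (\<xi> k))"
      unfolding gstd_def by (rule P.product_integrable_prod[OF J(1)]) (rule fi)
    with 1 False show ?thesis unfolding e by simp
  qed
  then show "(\<integral>\<xi>. \<xi> m * \<xi> m' \<partial>gstd J) = (if m = m' then 1 else 0)" "integrable (gstd J) (\<lambda>\<xi>. \<xi> m * \<xi> m')" by auto
qed

lemma lin_cov:
  assumes J: "finite J"
  shows "(\<integral>\<xi>. lin L J \<xi> i * lin L J \<xi> j \<partial>gstd J) = (\<Sum>m\<in>J. L i m * L j m)"
proof -
  have "(\<integral>\<xi>. lin L J \<xi> i * lin L J \<xi> j \<partial>gstd J) = (\<integral>\<xi>. (\<Sum>m\<in>J. \<Sum>m'\<in>J. (L i m * L j m') * (\<xi> m * \<xi> m')) \<partial>gstd J)"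
    by (simp add: lin_def sum_product algebra_simps)
  also have "\<dots> = (\<Sum>m\<in>J. \<Sum>m'\<in>J. (L i m * L j m') * (\<integral>\<xi>. \<xi> m * \<xi> m' \<partial>gstd J))"
    using integral_gstd_mult(2)[OF J] by (simp add: Bochner_Integration.integral_sum)
  also have "\<dots> = (\<Sum>m\<in>J. \<Sum>m'\<in>J. if m' = m then L i m * L j m' else 0)"
    using integral_gstd_mult(1)[OF J] by (intro sum.cong refl) auto
  also have "\<dots> = (\<Sum>m\<in>J. L i m * L j m)" using J by simp
  finally show ?thesis .
qed

text \<open>The cubic norm of \<xi> serves as envelope because its cube is a finite sum of
  integrable terms. Its size does depend on the dimension, but in the Gaussian comparison it enters
  only a term that tends to 0.\<close>

lemma lin_rvec:
  assumes I: "finite I" and J: "finite J"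
  shows "\<exists>D. rvec I (gstd J) (lin L J) D"
proof -
  define c where "c = (\<Sum>i\<in>I. \<Sum>m\<in>J. \<bar>L i m\<bar>)"
  define D where "D \<xi> = c * root 3 (\<Sum>m\<in>J. \<bar>\<xi> m\<bar> ^ 3)" for \<xi> :: "nat \<Rightarrow> real"
  have c0: "0 \<le> c" by (simp add: c_def sum_nonneg)
  have D0: "0 \<le> D \<xi>" for \<xi> using c0 by (simp add: D_def sum_nonneg)
  have b: "\<bar>lin L J \<xi> i\<bar> \<le> D \<xi>" if i: "i \<in> I" for \<xi> i
  proof -
    define r where "r = root 3 (\<Sum>m\<in>J. \<bar>\<xi> m\<bar> ^ 3)"
    have r: "\<bar>\<xi> m\<bar> \<le> r" if "m \<in> J" for m
    proof -
      have "\<bar>\<xi> m\<bar> ^ 3 \<le> (\<Sum>m\<in>J. \<bar>\<xi> m\<bar> ^ 3)" by (rule member_le_sum) (use that J in auto)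
      then have "root 3 (\<bar>\<xi> m\<bar> ^ 3) \<le> r" unfolding r_def by (simp add: real_root_le_mono)
      then show ?thesis by (simp add: real_root_power_cancel)
    qed
    have r0: "0 \<le> r" by (simp add: r_def sum_nonneg)
    have "\<bar>lin L J \<xi> i\<bar> \<le> (\<Sum>m\<in>J. \<bar>L i m * \<xi> m\<bar>)" unfolding lin_def by (rule sum_abs)
    also have "\<dots> \<le> (\<Sum>m\<in>J. \<bar>L i m\<bar> * r)" by (intro sum_mono) (auto simp: abs_mult intro!: mult_left_mono r)
    also have "\<dots> = (\<Sum>m\<in>J. \<bar>L i m\<bar>) * r" by (simp add: sum_distrib_right)
    also have "\<dots> \<le> c * r"
      unfolding c_def by (intro mult_right_mono r0 member_le_sum[of i I "\<lambda>i. \<Sum>m\<in>J. \<bar>L i m\<bar>"]) (use i I in \<open>auto simp: sum_nonneg\<close>)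
    finally show ?thesis by (simp add: D_def r_def)
  qed
  have Dm: "D \<in> borel_measurable (gstd J)" unfolding D_def[abs_def] by measurable
  have D3: "D \<xi> ^ 3 = c ^ 3 * (\<Sum>m\<in>J. \<bar>\<xi> m\<bar> ^ 3)" for \<xi>
    by (simp add: D_def power_mult_distrib real_root_pow_pos2 sum_nonneg)
  have Di: "integrable (gstd J) (\<lambda>\<xi>. D \<xi> ^ 3)"
    unfolding D3
    by (intro Bochner_Integration.integrable_mult_right Bochner_Integration.integrable_sum
       integral_gstd_component(2)[where f="\<lambda>x. \<bar>x\<bar> ^ 3"] std_normal_moments) auto
  have mean: "(\<integral>\<xi>. lin L J \<xi> i \<partial>gstd J) = 0" for i
  proof -
    have x: "integrable std_normal_distribution (\<lambda>x. x)" using std_normal_moments(3)[of 1] by simp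
    have "integrable (gstd J) (\<lambda>\<xi>. L i m * \<xi> m)" if "m \<in> J" for m
      by (intro integrable_mult_right integral_gstd_component(2)[where f="\<lambda>x. x", OF that _ x]) simp
    then have "(\<integral>\<xi>. lin L J \<xi> i \<partial>gstd J) = (\<Sum>m\<in>J. \<integral>\<xi>. L i m * \<xi> m \<partial>gstd J)"
      unfolding lin_def by (rule Bochner_Integration.integral_sum)
    also have "\<dots> = (\<Sum>m\<in>J. L i m * (\<integral>x. x \<partial>std_normal_distribution))"
      by (intro sum.cong refl) (simp add: integral_gstd_component(1)[where f="\<lambda>x. x"])
    finally show ?thesis by (simp add: std_normal_moments(1))
  qed
  have "rvec I (gstd J) (lin L J) D"
    unfolding rvec_def using prob_space_gstd Dm Di D0 b mean by auto
  then show ?thesis by blast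
qed

text \<open>A Gaussian vector is a sum of \<open>N\<close> independent copies of itself scaled by
  \<open>1 / sqrt N\<close>. Exchanging the copies by the Lindeberg step accumulates the covariance
  gap to exactly \<open>M2 * \<Delta> / 2\<close>, while the cubic errors total order
  \<open>1 / sqrt N\<close> and disappear as \<open>N\<close> grows. No interpolation and no
  Gaussian integration by parts are involved.\<close>

lemma gauss_comparison:
  assumes I: "finite I" and J: "finite J" "finite J'" and phi: "test_fun I \<phi>" "taylor3 I M2 M3 \<phi>"
    and M3: "0 \<le> M3" and \<Delta>: "0 \<le> \<Delta>"
    and cov: "\<And>i j. i \<in> I \<Longrightarrow> j \<in> I \<Longrightarrow> \<bar>(\<Sum>m\<in>J. L i m * L j m) - (\<Sum>m\<in>J'. L' i m * L' j m)\<bar> \<le> \<Delta>"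
  shows "\<bar>(\<integral>\<xi>. \<phi> (lin L J \<xi>) \<partial>gstd J) - (\<integral>\<xi>. \<phi> (lin L' J' \<xi>) \<partial>gstd J')\<bar> \<le> M2 * \<Delta> / 2"
proof -
  obtain D where D: "rvec I (gstd J) (lin L J) D" using lin_rvec[OF I J(1)] by blast
  obtain D' where D': "rvec I (gstd J') (lin L' J') D'" using lin_rvec[OF I J(2)] by blast
  define E where "E = (\<integral>m. D m ^ 3 \<partial>gstd J) + (\<integral>m. D' m ^ 3 \<partial>gstd J')"
  have bound: "\<bar>(\<integral>\<xi>. \<phi> (lin L J \<xi>) \<partial>gstd J) - (\<integral>\<xi>. \<phi> (lin L' J' \<xi>) \<partial>gstd J')\<bar> \<le> M2 * \<Delta> / 2 + M3 * E / sqrt (Suc n)" for n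
  proof -
    define N where "N = Suc n"
    define c where "c = 1 / sqrt N"
    have N0: "0 < real N" by (simp add: N_def)
    have c0: "0 < c" using N0 by (simp add: c_def)
    have cc: "c * c = 1 / N" using N0 by (simp add: c_def)
    have cN: "c * sqrt N = 1" using N0 by (simp add: c_def)
    have step: "\<bar>(\<integral>m. \<phi> (\<lambda>i. s i + c * lin L J m i) \<partial>gstd J) - (\<integral>m. \<phi> (\<lambda>i. s i + c * lin L' J' m i) \<partial>gstd J')\<bar>
       \<le> M2 * (\<Delta> / N) / 2 + M3 * ((\<integral>m. (\<bar>c\<bar> * D m) ^ 3 \<partial>gstd J) + (\<integral>m. (\<bar>c\<bar> * D' m) ^ 3 \<partial>gstd J'))" for s
    proof (rule lindeberg_one_step[OF I rvec_scale[OF D] rvec_scale[OF D'] phi M3])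
      show "0 \<le> \<Delta> / N" using \<Delta> by simp
      fix i j assume ij: "i \<in> I" "j \<in> I"
      have e: "(\<integral>m. c * lin K G m i * (c * lin K G m j) \<partial>gstd G) = (c * c) * (\<Sum>m\<in>G. K i m * K j m)" if "finite G" for K :: "'a \<Rightarrow> nat \<Rightarrow> real" and G
      proof -
        have "(\<integral>m. c * lin K G m i * (c * lin K G m j) \<partial>gstd G) = (\<integral>m. (c * c) * (lin K G m i * lin K G m j) \<partial>gstd G)"
          by (simp add: ac_simps)
        then show ?thesis using lin_cov[OF that, of K i j] by simp
      qed
      have "\<bar>(c * c) * ((\<Sum>m\<in>J. L i m * L j m) - (\<Sum>m\<in>J'. L' i m * L' j m))\<bar> \<le> (1 / N) * \<Delta>"
        unfolding cc using cov[OF ij] N0 by (simp add: abs_mult divide_right_mono)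
      then show "\<bar>(\<integral>m. c * lin L J m i * (c * lin L J m j) \<partial>gstd J) - (\<integral>m. c * lin L' J' m i * (c * lin L' J' m j) \<partial>gstd J')\<bar> \<le> \<Delta> / N"
        unfolding e[OF J(1)] e[OF J(2)] by (simp add: right_diff_distrib)
    qed
    have m: "(\<lambda>\<xi>. c * lin K G \<xi> i) \<in> borel_measurable (gstd G)" for i G and K :: "'a \<Rightarrow> nat \<Rightarrow> real" by measurable
    have "\<bar>(\<integral>\<xi>. \<phi> (lin L J \<xi>) \<partial>gstd J) - (\<integral>\<xi>. \<phi> (lin L' J' \<xi>) \<partial>gstd J')\<bar>
       \<le> real N * (M2 * (\<Delta> / N) / 2 + M3 * ((\<integral>m. (\<bar>c\<bar> * D m) ^ 3 \<partial>gstd J) + (\<integral>m. (\<bar>c\<bar> * D' m) ^ 3 \<partial>gstd J')))"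
      using lindeberg_n_step[OF phi(1) prob_space_gstd prob_space_gstd m m step, where s="\<lambda>_. 0" and n=N]
      unfolding gauss_sum[OF phi(1) J(1)] gauss_sum[OF phi(1) J(2)] cN by (simp add: cN)
    also have "(\<integral>m. (\<bar>c\<bar> * D m) ^ 3 \<partial>gstd J) + (\<integral>m. (\<bar>c\<bar> * D' m) ^ 3 \<partial>gstd J') = c ^ 3 * E"
      using c0 by (simp add: power_mult_distrib E_def distrib_left)
    also have "real N * (M2 * (\<Delta> / N) / 2 + M3 * (c ^ 3 * E)) = M2 * \<Delta> / 2 + M3 * E * (real N * (c * c)) * c"
      using N0 by (simp add: distrib_left power3_eq_cube)
    also have "\<dots> = M2 * \<Delta> / 2 + M3 * E / sqrt (Suc n)"
      using N0 by (simp add: cc) (simp add: c_def N_def)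
    finally show ?thesis .
  qed
  have "(\<lambda>n. M2 * \<Delta> / 2 + M3 * E / sqrt (Suc n)) \<longlonglongrightarrow> M2 * \<Delta> / 2 + 0"
    by (intro tendsto_add tendsto_const real_tendsto_divide_at_top[OF tendsto_const]
       filterlim_compose[OF sqrt_at_top] filterlim_compose[OF filterlim_real_sequentially filterlim_Suc])
  then have "(\<lambda>n. M2 * \<Delta> / 2 + M3 * E / sqrt (Suc n)) \<longlonglongrightarrow> M2 * \<Delta> / 2" by simp
  then show ?thesis by (rule LIMSEQ_le_const) (use bound in blast)
qed

text \<open>The thresholds may differ between coordinates. Constant thresholds would do for maxima,
  but general orthants are what determines a law.\<close>

lemma cutoff_sandwich:
  assumes I: "finite I" "I \<noteq> {}" and lam: "1 \<le> lam" "ln (card I) \<le> lam" and del: "0 < del"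
    and M: "prob_space M" and X: "\<And>i. i \<in> I \<Longrightarrow> (\<lambda>m. X m i) \<in> borel_measurable M"
  shows "measure M {m\<in>space M. \<forall>i\<in>I. X m i \<le> c i} \<le> (\<integral>m. mx_cutoff lam del I 0 (\<lambda>i. X m i - c i) \<partial>M)"
    and "(\<integral>m. mx_cutoff lam del I 0 (\<lambda>i. X m i - c i) \<partial>M) \<le> measure M {m\<in>space M. \<forall>i\<in>I. X m i \<le> c i + 2 * del}"
proof -
  interpret prob_space M by fact
  let ?f = "\<lambda>m. mx_cutoff lam del I 0 (\<lambda>i. X m i - c i)"
  have i: "integrable M ?f"
    by (rule test_fun_integrable[OF test_fun_mx_cutoff[OF I] X finite_measure_axioms])
  have s: "{m\<in>space M. \<forall>i\<in>I. X m i \<le> d i} \<in> sets M" for d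
    using X I by measurable
  have e: "measure M {m\<in>space M. \<forall>i\<in>I. X m i \<le> d i} = (\<integral>m. indicator {m\<in>space M. \<forall>i\<in>I. X m i \<le> d i} m \<partial>M)" for d
    using s by simp
  show "measure M {m\<in>space M. \<forall>i\<in>I. X m i \<le> c i} \<le> integral\<^sup>L M ?f" unfolding e
  proof (rule integral_mono[OF _ i])
    show "integrable M (indicat_real {m\<in>space M. \<forall>i\<in>I. X m i \<le> c i})" using s by (simp add: emeasure_eq_measure)
    fix m assume "m \<in> space M"
    show "indicator {m\<in>space M. \<forall>i\<in>I. X m i \<le> c i} m \<le> ?f m"
    proof (cases "\<forall>i\<in>I. X m i \<le> c i")
      case True
      then have "mx I (\<lambda>i. X m i - c i) \<le> 0" using I by (simp add: mx_le_iff)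
      then show ?thesis using mx_cutoff_eq_1[OF I lam del] by (simp add: indicator_def)
    next
      case False
      then show ?thesis using mx_cutoff_bounds(1) by (auto simp: indicator_def)
    qed
  qed
  show "integral\<^sup>L M ?f \<le> measure M {m\<in>space M. \<forall>i\<in>I. X m i \<le> c i + 2 * del}" unfolding e
  proof (rule integral_mono[OF i])
    show "integrable M (indicat_real {m\<in>space M. \<forall>i\<in>I. X m i \<le> c i + 2 * del})" using s[of "\<lambda>i. c i + 2 * del"] by (simp add: emeasure_eq_measure)
    fix m assume m: "m \<in> space M"
    show "?f m \<le> indicator {m\<in>space M. \<forall>i\<in>I. X m i \<le> c i + 2 * del} m"
    proof (cases "\<forall>i\<in>I. X m i \<le> c i + 2 * del")
      case True
      then show ?thesis using mx_cutoff_bounds(2) m by (auto simp: indicator_def)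
    next
      case False
      then obtain i where "i \<in> I" "c i + 2 * del < X m i" by force
      then have "0 + 2 * del \<le> mx I (\<lambda>i. X m i - c i)" using mx_ge[OF I(1), of i "\<lambda>i. X m i - c i"] by auto
      then show ?thesis using mx_cutoff_eq_0[OF I lam(1) del] by (simp add: indicator_def)
    qed
  qed
qed

lemma gauss_cdf_compare:
  assumes I: "finite I" "I \<noteq> {}" and J: "finite J" "finite J'" and lam: "1 \<le> lam" "ln (card I) \<le> lam" and del: "0 < del"
    and \<Delta>: "0 \<le> \<Delta>"
    and cov: "\<And>i j. i \<in> I \<Longrightarrow> j \<in> I \<Longrightarrow> \<bar>(\<Sum>m\<in>J. L i m * L j m) - (\<Sum>m\<in>J'. L' i m * L' j m)\<bar> \<le> \<Delta>"
  shows "measure (gstd J) {\<xi>\<in>space (gstd J). \<forall>i\<in>I. lin L J \<xi> i \<le> c i}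
    \<le> measure (gstd J') {\<xi>\<in>space (gstd J'). \<forall>i\<in>I. lin L' J' \<xi> i \<le> c i + 2 * del} + 350 * lam / del\<^sup>2 * \<Delta>"
proof -
  have "\<bar>(\<integral>\<xi>. mx_cutoff lam del I 0 (\<lambda>i. lin L J \<xi> i - c i) \<partial>gstd J) - (\<integral>\<xi>. mx_cutoff lam del I 0 (\<lambda>i. lin L' J' \<xi> i - c i) \<partial>gstd J')\<bar>
     \<le> (700 * lam / del\<^sup>2) * \<Delta> / 2"
    by (rule gauss_comparison[OF I(1) J test_fun_mx_cutoff[OF I] taylor3_shift[OF taylor3_mx_cutoff[OF I lam(1) del]] _ \<Delta> cov])
      (use del in auto)
  also have "(700 * lam / del\<^sup>2) * \<Delta> / 2 = 350 * lam / del\<^sup>2 * \<Delta>" by simp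
  finally have "(\<integral>\<xi>. mx_cutoff lam del I 0 (\<lambda>i. lin L J \<xi> i - c i) \<partial>gstd J)
     \<le> (\<integral>\<xi>. mx_cutoff lam del I 0 (\<lambda>i. lin L' J' \<xi> i - c i) \<partial>gstd J') + 350 * lam / del\<^sup>2 * \<Delta>"
    unfolding abs_le_iff by (simp only: diff_le_eq add.commute)
  then show ?thesis
    using cutoff_sandwich(1)[OF I lam del prob_space_gstd[of J], where X="lin L J" and c=c, OF lin_measurable]
      cutoff_sandwich(2)[OF I lam del prob_space_gstd[of J'], where X="lin L' J'" and c=c, OF lin_measurable]
    by (meson add_right_mono order_trans)
qed

text \<open>The lower orthants form an intersection-stable generator of the product sigma-algebra,
  exhausted by cubes with integer bounds.\<close>

lemma PiM_atMost_eqI: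
  fixes P Q :: "('i \<Rightarrow> real) measure"
  assumes I: "finite I" and P: "prob_space P" "sets P = sets (PiM I (\<lambda>_. borel))"
    and Q: "sets Q = sets (PiM I (\<lambda>_. borel))"
    and eq: "\<And>c. emeasure P (Pi\<^sub>E I (\<lambda>i. {..c i})) = emeasure Q (Pi\<^sub>E I (\<lambda>i. {..c i}))"
  shows "P = Q"
proof -
  define E where "E = {{f\<in>(\<Pi>\<^sub>E i\<in>I. UNIV). \<forall>i\<in>j. f i \<in> A i} | (A :: 'i \<Rightarrow> real set) j. j \<in> {I} \<and> A \<in> Pi j (\<lambda>_. range atMost)}"
  have E: "E = {Pi\<^sub>E I (\<lambda>i. {..c i}) | c. True}"
  proof (intro equalityI subsetI)
    fix X assume "X \<in> E"
    then obtain A where A: "X = {f\<in>(\<Pi>\<^sub>E i\<in>I. UNIV). \<forall>i\<in>I. f i \<in> A i}" "\<forall>i\<in>I. A i \<in> range atMost"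
      unfolding E_def by auto
    then obtain c where "\<forall>i\<in>I. A i = {..c i}" by (metis image_iff)
    then have "X = Pi\<^sub>E I (\<lambda>i. {..c i})" using A by (auto simp: PiE_iff extensional_def)
    then show "X \<in> {Pi\<^sub>E I (\<lambda>i. {..c i}) | c. True}" by blast
  next
    fix X assume "X \<in> {Pi\<^sub>E I (\<lambda>i. {..c i :: real}) | c. True}"
    then obtain c where "X = Pi\<^sub>E I (\<lambda>i. {..c i})" by blast
    then show "X \<in> E" unfolding E_def by (intro CollectI exI[of _ "\<lambda>i. {..c i}"] exI[of _ I]) (auto simp: PiE_iff extensional_def)
  qed
  have b: "sets (PiM I (\<lambda>_. borel :: real measure)) = sigma_sets (\<Pi>\<^sub>E i\<in>I. UNIV) E"
  proof -
    have "sets (PiM I (\<lambda>_. sigma UNIV (range (\<lambda>a::real. {..a})))) = sets (sigma (\<Pi>\<^sub>E i\<in>I. UNIV) E)"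
      unfolding E_def
    proof (rule sets_PiM_sigma)
      show "\<exists>S\<subseteq>range (\<lambda>a::real. {..a}). countable S \<and> UNIV = \<Union>S"
      proof (intro exI conjI)
        show "(UNIV :: real set) = \<Union>(range (\<lambda>n::nat. {..real n}))"
          by (auto intro: real_arch_simple)
      qed auto
    qed (use I in auto)
    also have "\<dots> = sigma_sets (\<Pi>\<^sub>E i\<in>I. UNIV) E"
      by (rule sets_measure_of) (auto simp: E_def)
    finally show ?thesis by (simp add: borel_eq_atMost[where 'a=real])
  qed
  interpret P: prob_space P by fact
  show ?thesis
  proof (rule measure_eqI_generator_eq[where A="\<lambda>n::nat. Pi\<^sub>E I (\<lambda>_. {..real n})" and E=E and \<Omega>="\<Pi>\<^sub>E i\<in>I. UNIV"])
    show "Int_stable E"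
    proof (rule Int_stableI)
      fix a b assume "a \<in> E" "b \<in> E"
      then obtain c d where "a = Pi\<^sub>E I (\<lambda>i. {..c i})" "b = Pi\<^sub>E I (\<lambda>i. {..d i})" unfolding E by blast
      then have "a \<inter> b = Pi\<^sub>E I (\<lambda>i. {..min (c i) (d i)})" by (auto simp: PiE_iff)
      then show "a \<inter> b \<in> E" unfolding E by (intro CollectI exI[of _ "\<lambda>i. min (c i) (d i)"]) auto
    qed
    show "E \<subseteq> Pow (\<Pi>\<^sub>E i\<in>I. UNIV)" by (auto simp: E_def)
    show "emeasure P X = emeasure Q X" if "X \<in> E" for X using that eq unfolding E by auto
    show "sets P = sigma_sets (\<Pi>\<^sub>E i\<in>I. UNIV) E" "sets Q = sigma_sets (\<Pi>\<^sub>E i\<in>I. UNIV) E" using b P Q by auto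
    show "range (\<lambda>n::nat. Pi\<^sub>E I (\<lambda>_. {..real n})) \<subseteq> E" unfolding E by auto
    show "(\<Union>n::nat. Pi\<^sub>E I (\<lambda>_. {..real n})) = (\<Pi>\<^sub>E i\<in>I. UNIV)"
    proof (intro equalityI subsetI)
      fix x assume x: "x \<in> (\<Pi>\<^sub>E i\<in>I. (UNIV :: real set))"
      obtain n :: nat where n: "(\<Sum>i\<in>I. \<bar>x i\<bar>) \<le> real n" using real_arch_simple by blast
      have "x i \<le> real n" if "i \<in> I" for i
        using member_le_sum[of i I "\<lambda>i. \<bar>x i\<bar>"] that I n by auto
      then show "x \<in> (\<Union>n::nat. Pi\<^sub>E I (\<lambda>_. {..real n}))" using x by (auto simp: PiE_iff)
    qed (auto simp: PiE_iff)
    show "emeasure P (Pi\<^sub>E I (\<lambda>_. {..real n})) \<noteq> \<infinity>" for n :: nat by (simp add: P.emeasure_eq_measure)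
  qed
qed

text \<open>The comparison with gap 0 holds for every smoothing width; letting the width decrease to
  0 bounds one orthant probability by the other, and by symmetry they agree. Uniqueness of the
  Gaussian law with given covariance thus follows from the Lindeberg argument, for factors of any
  widths.\<close>

lemma gauss_law_eq:
  assumes I: "finite I" "I \<noteq> {}" and J: "finite J" "finite J'"
    and cov: "\<And>i j. i \<in> I \<Longrightarrow> j \<in> I \<Longrightarrow> (\<Sum>m\<in>J. L i m * L j m) = (\<Sum>m\<in>J'. L' i m * L' j m)"
  shows "distr (gstd J) (PiM I (\<lambda>_. borel)) (\<lambda>\<xi>. restrict (lin L J \<xi>) I)
       = distr (gstd J') (PiM I (\<lambda>_. borel)) (\<lambda>\<xi>. restrict (lin L' J' \<xi>) I)"
proof -
  have m: "(\<lambda>\<xi>. restrict (lin K G \<xi>) I) \<in> measurable (gstd G) (PiM I (\<lambda>_. borel))" for K :: "'a \<Rightarrow> nat \<Rightarrow> real" and G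
    by (intro measurable_restrict lin_measurable)
  define lam where "lam = max 1 (ln (card I))"
  have lam: "1 \<le> lam" "ln (card I) \<le> lam" by (auto simp: lam_def)
  have le: "measure (gstd G) {\<xi>\<in>space (gstd G). \<forall>i\<in>I. lin K G \<xi> i \<le> c i} \<le> measure (gstd G') {\<xi>\<in>space (gstd G'). \<forall>i\<in>I. lin K' G' \<xi> i \<le> c i}"
    if G: "finite G" "finite G'" and cv: "\<And>i j. i \<in> I \<Longrightarrow> j \<in> I \<Longrightarrow> (\<Sum>m\<in>G. K i m * K j m) = (\<Sum>m\<in>G'. K' i m * K' j m)"
    for K K' :: "'a \<Rightarrow> nat \<Rightarrow> real" and G G' c
  proof -
    interpret G': prob_space "gstd G'" by (rule prob_space_gstd)
    let ?A = "\<lambda>n::nat. {\<xi>\<in>space (gstd G'). \<forall>i\<in>I. lin K' G' \<xi> i \<le> c i + 2 * (1 / real (Suc n))}"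
    have meas: "?A n \<in> sets (gstd G')" for n using I by measurable
    have "(\<lambda>n. measure (gstd G') (?A n)) \<longlonglongrightarrow> measure (gstd G') (\<Inter>n. ?A n)"
    proof (rule G'.finite_Lim_measure_decseq)
      show "range ?A \<subseteq> sets (gstd G')" using meas by auto
      show "decseq ?A"
      proof (rule decseq_SucI, rule subsetI)
        fix n x assume "x \<in> ?A (Suc n)"
        moreover have "1 / real (Suc (Suc n)) \<le> 1 / real (Suc n)" by (simp add: field_simps)
        ultimately show "x \<in> ?A n" by force
      qed
    qed
    moreover have "measure (gstd G) {\<xi>\<in>space (gstd G). \<forall>i\<in>I. lin K G \<xi> i \<le> c i} \<le> measure (gstd G') (?A n)" for n
      using gauss_cdf_compare[OF I G lam, of "1 / real (Suc n)" 0 K K' c] cv by simp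
    ultimately have "measure (gstd G) {\<xi>\<in>space (gstd G). \<forall>i\<in>I. lin K G \<xi> i \<le> c i} \<le> measure (gstd G') (\<Inter>n. ?A n)"
      by (intro LIMSEQ_le_const) auto
    also have "(\<Inter>n. ?A n) = {\<xi>\<in>space (gstd G'). \<forall>i\<in>I. lin K' G' \<xi> i \<le> c i}"
    proof (intro equalityI subsetI)
      fix \<xi> assume x: "\<xi> \<in> (\<Inter>n. ?A n)"
      have "lin K' G' \<xi> i \<le> c i" if i: "i \<in> I" for i
      proof (rule LIMSEQ_le_const)
        have "(\<lambda>n. c i + 2 * (1 / real (Suc n))) \<longlonglongrightarrow> c i + 2 * 0"
          by (intro tendsto_intros) (use LIMSEQ_inverse_real_of_nat in \<open>simp add: inverse_eq_divide\<close>)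
        then show "(\<lambda>n. c i + 2 * (1 / real (Suc n))) \<longlonglongrightarrow> c i" by simp
        show "\<exists>N. \<forall>n\<ge>N. lin K' G' \<xi> i \<le> c i + 2 * (1 / real (Suc n))" using x i by auto
      qed
      then show "\<xi> \<in> {\<xi>\<in>space (gstd G'). \<forall>i\<in>I. lin K' G' \<xi> i \<le> c i}" using x by auto
    qed (auto intro: order_trans)
    finally show ?thesis .
  qed
  interpret G: prob_space "gstd J" by (rule prob_space_gstd)
  interpret G': prob_space "gstd J'" by (rule prob_space_gstd)
  have em: "emeasure (distr (gstd G) (PiM I (\<lambda>_. borel)) (\<lambda>\<xi>. restrict (lin K G \<xi>) I)) (Pi\<^sub>E I (\<lambda>i. {..c i}))
      = emeasure (gstd G) {\<xi>\<in>space (gstd G). \<forall>i\<in>I. lin K G \<xi> i \<le> c i}" for K :: "'a \<Rightarrow> nat \<Rightarrow> real" and G c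
  proof -
    have "(\<lambda>\<xi>. restrict (lin K G \<xi>) I) -` (Pi\<^sub>E I (\<lambda>i. {..c i})) \<inter> space (gstd G) = {\<xi>\<in>space (gstd G). \<forall>i\<in>I. lin K G \<xi> i \<le> c i}"
      by (auto simp: PiE_iff)
    then show ?thesis using I by (subst emeasure_distr[OF m]) (auto intro!: sets_PiM_I_finite)
  qed
  show ?thesis
  proof (rule PiM_atMost_eqI[OF I(1)])
    show "prob_space (distr (gstd J) (PiM I (\<lambda>_. borel)) (\<lambda>\<xi>. restrict (lin L J \<xi>) I))"
      by (rule G.prob_space_distr[OF m])
    fix c
    have "measure (gstd J) {\<xi>\<in>space (gstd J). \<forall>i\<in>I. lin L J \<xi> i \<le> c i} = measure (gstd J') {\<xi>\<in>space (gstd J'). \<forall>i\<in>I. lin L' J' \<xi> i \<le> c i}"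
    proof (rule antisym)
      show "measure (gstd J) {\<xi>\<in>space (gstd J). \<forall>i\<in>I. lin L J \<xi> i \<le> c i} \<le> measure (gstd J') {\<xi>\<in>space (gstd J'). \<forall>i\<in>I. lin L' J' \<xi> i \<le> c i}"
        by (rule le[OF J]) (rule cov)
      show "measure (gstd J') {\<xi>\<in>space (gstd J'). \<forall>i\<in>I. lin L' J' \<xi> i \<le> c i} \<le> measure (gstd J) {\<xi>\<in>space (gstd J). \<forall>i\<in>I. lin L J \<xi> i \<le> c i}"
        by (rule le[OF J(2,1)]) (rule cov[symmetric])
    qed
    then show "emeasure (distr (gstd J) (PiM I (\<lambda>_. borel)) (\<lambda>\<xi>. restrict (lin L J \<xi>) I)) (Pi\<^sub>E I (\<lambda>i. {..c i}))
      = emeasure (distr (gstd J') (PiM I (\<lambda>_. borel)) (\<lambda>\<xi>. restrict (lin L' J' \<xi>) I)) (Pi\<^sub>E I (\<lambda>i. {..c i}))"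
      unfolding em by (simp add: G.emeasure_eq_measure G'.emeasure_eq_measure)
  qed auto
qed

text \<open>Cholesky factorization by induction: the pivot \<open>a\<close> is eliminated and the
  Schur complement \<open>S'\<close> is again positive semidefinite. A zero pivot causes no division
  trouble, since then the whole column vanishes and quotients by 0 are 0.\<close>

lemma psd_factorization:
  fixes S :: "'i \<Rightarrow> 'i \<Rightarrow> real"
  assumes "finite I" and "\<And>i j. S i j = S j i"
    and "\<And>c. 0 \<le> (\<Sum>i\<in>I. \<Sum>j\<in>I. c i * c j * S i j)"
  shows "\<exists>L :: 'i \<Rightarrow> 'i \<Rightarrow> real. \<forall>i\<in>I. \<forall>j\<in>I. (\<Sum>m\<in>I. L i m * L j m) = S i j"
  using assms
proof (induction I arbitrary: S rule: finite_induct)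
  case empty
  then show ?case by simp
next
  case (insert a I)
  note sym = insert.prems(1) and psd = insert.prems(2)
  have ex: "(\<Sum>i\<in>insert a I. \<Sum>j\<in>insert a I. c i * c j * S i j)
     = c a * c a * S a a + 2 * (c a * (\<Sum>i\<in>I. c i * S i a)) + (\<Sum>i\<in>I. \<Sum>j\<in>I. c i * c j * S i j)" for c
  proof -
    have "(\<Sum>i\<in>insert a I. \<Sum>j\<in>insert a I. c i * c j * S i j)
      = c a * c a * S a a + (\<Sum>j\<in>I. c a * c j * S a j) + (\<Sum>i\<in>I. c i * c a * S i a + (\<Sum>j\<in>I. c i * c j * S i j))"
      using insert.hyps by simp
    also have "(\<Sum>j\<in>I. c a * c j * S a j) = c a * (\<Sum>i\<in>I. c i * S i a)"
      using sym by (simp add: sum_distrib_left mult.assoc)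
    also have "(\<Sum>i\<in>I. c i * c a * S i a + (\<Sum>j\<in>I. c i * c j * S i j)) = c a * (\<Sum>i\<in>I. c i * S i a) + (\<Sum>i\<in>I. \<Sum>j\<in>I. c i * c j * S i j)"
      by (simp add: sum.distrib sum_distrib_left algebra_simps)
    finally show ?thesis by simp
  qed
  have single: "(\<Sum>i\<in>I. \<Sum>j\<in>I. (if i = k then 1 else 0) * (if j = k then 1 else 0) * S i j) = S k k" if "k \<in> I" for k
  proof -
    have "(\<Sum>i\<in>I. \<Sum>j\<in>I. (if i = k then 1 else 0) * (if j = k then 1 else 0) * S i j) = (\<Sum>i\<in>I. if i = k then S i k else 0)"
      using insert.hyps(1) that by (intro sum.cong refl) (simp add: if_distrib[of "\<lambda>x. x * _"] cong: if_cong)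
    then show ?thesis using insert.hyps(1) that by simp
  qed
  have aa: "0 \<le> S a a"
    using psd[of "\<lambda>i. if i = a then 1 else 0"] insert.hyps unfolding ex by (auto simp: sum.neutral cong: if_cong)
  have zero: "S k a = 0" if "S a a = 0" "k \<in> I" for k
  proof -
    have "0 \<le> 2 * t * S k a + S k k" for t
    proof -
      define c where "c i = (if i = a then t else if i = k then 1 else (0::real))" for i
      have "(\<Sum>i\<in>I. c i * S i a) = (\<Sum>i\<in>I. if i = k then S k a else 0)"
        using insert.hyps by (intro sum.cong refl) (auto simp: c_def)
      then have 1: "(\<Sum>i\<in>I. c i * S i a) = S k a" using insert.hyps that by simp
      have "(\<Sum>i\<in>I. \<Sum>j\<in>I. c i * c j * S i j) = (\<Sum>i\<in>I. \<Sum>j\<in>I. (if i = k then 1 else 0) * (if j = k then 1 else 0) * S i j)"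
        using insert.hyps by (intro sum.cong refl) (auto simp: c_def)
      then have 2: "(\<Sum>i\<in>I. \<Sum>j\<in>I. c i * c j * S i j) = S k k" using single[OF that(2)] by simp
      show ?thesis using psd[of c] that(1) unfolding ex 1 2 by (simp add: c_def)
    qed
    \<comment> \<open>The quadratic form is affine in \<open>t\<close> when the pivot is 0; this
      \<open>t\<close> would make it equal to -1.\<close>
    from this[of "- (S k k + 1) / (2 * S k a)"] show "S k a = 0" by (cases "S k a = 0") (auto simp: field_simps)
  qed
  define S' where "S' i j = S i j - S i a * S j a / S a a" for i j
  have "\<exists>L. \<forall>i\<in>I. \<forall>j\<in>I. (\<Sum>m\<in>I. L i m * L j m) = S' i j"
  proof (rule insert.IH)
    show "S' i j = S' j i" for i j using sym by (simp add: S'_def)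
    fix c :: "'i \<Rightarrow> real"
    define q where "q = (\<Sum>i\<in>I. c i * S i a)"
    \<comment> \<open>The value at \<open>a\<close> that minimises the quadratic form with the other
      coordinates fixed; the minimum is the form of the Schur complement.\<close>
    define c' where "c' = c(a := - q / S a a)"
    have e1: "(\<Sum>i\<in>I. c' i * S i a) = q" unfolding q_def
      using insert.hyps by (intro sum.cong refl) (auto simp: c'_def)
    have e2: "(\<Sum>i\<in>I. \<Sum>j\<in>I. c' i * c' j * S i j) = (\<Sum>i\<in>I. \<Sum>j\<in>I. c i * c j * S i j)"
      using insert.hyps by (intro sum.cong refl) (auto simp: c'_def)
    have "(\<Sum>i\<in>I. \<Sum>j\<in>I. c i * c j * S' i j) = (\<Sum>i\<in>I. \<Sum>j\<in>I. c i * c j * S i j - (c i * S i a) * (c j * S j a) / S a a)"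
      by (intro sum.cong refl) (simp add: S'_def algebra_simps)
    also have "\<dots> = (\<Sum>i\<in>I. \<Sum>j\<in>I. c i * c j * S i j) - q * q / S a a"
      by (simp add: sum_subtractf q_def sum_product sum_divide_distrib)
    also have "\<dots> = c' a * c' a * S a a + 2 * (c' a * (\<Sum>i\<in>I. c' i * S i a)) + (\<Sum>i\<in>I. \<Sum>j\<in>I. c' i * c' j * S i j)"
      unfolding e1 e2 by (cases "S a a = 0") (auto simp: c'_def field_simps)
    also have "\<dots> \<ge> 0" using psd[of c'] unfolding ex .
    finally show "0 \<le> (\<Sum>i\<in>I. \<Sum>j\<in>I. c i * c j * S' i j)" .
  qed
  then obtain L where L: "\<And>i j. i \<in> I \<Longrightarrow> j \<in> I \<Longrightarrow> (\<Sum>m\<in>I. L i m * L j m) = S' i j" by blast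
  define K where "K i m = (if m = a then S i a / sqrt (S a a) else if i = a then 0 else L i m)" for i m
  have "(\<Sum>m\<in>insert a I. K i m * K j m) = S i j" if ij: "i \<in> insert a I" "j \<in> insert a I" for i j
  proof -
    have h: "K i a * K j a = S i a * S j a / S a a" using aa by (simp add: K_def real_sqrt_mult_self)
    have s: "(\<Sum>m\<in>I. K i m * K j m) = (if i = a \<or> j = a then 0 else S' i j)"
    proof (cases "i = a \<or> j = a")
      case True
      then show ?thesis using insert.hyps by (auto simp: K_def intro!: sum.neutral)
    next
      case False
      then have "(\<Sum>m\<in>I. K i m * K j m) = (\<Sum>m\<in>I. L i m * L j m)"
        using insert.hyps by (intro sum.cong refl) (auto simp: K_def)
      then show ?thesis using False ij L by simp
    qed
    have "(\<Sum>m\<in>insert a I. K i m * K j m) = S i a * S j a / S a a + (if i = a \<or> j = a then 0 else S' i j)"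
      using insert.hyps h s by simp
    also have "\<dots> = S i j"
    proof (cases "S a a = 0")
      case True
      then show ?thesis using zero[OF True] ij sym[of a i] sym[of a j] by (auto simp: S'_def)
    next
      case False
      then show ?thesis using sym[of a j] by (auto simp: S'_def)
    qed
    finally show ?thesis .
  qed
  then show ?case by blast
qed

section \<open>A maximal inequality from the log-sum-exp potential\<close>

lemma mx_measurable:
  assumes "finite I" "I \<noteq> {}" "\<And>i. i \<in> I \<Longrightarrow> (\<lambda>m. X m i) \<in> borel_measurable M"
  shows "(\<lambda>m. mx I (X m)) \<in> borel_measurable M"
  unfolding mx_def using assms(1,3) by (rule borel_measurable_Max)

lemma mx_abs_le: "finite I \<Longrightarrow> I \<noteq> {} \<Longrightarrow> \<bar>mx I x\<bar> \<le> (\<Sum>i\<in>I. \<bar>x i\<bar>)"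
  using mx_in[of I x] member_le_sum[of _ I "\<lambda>i. \<bar>x i\<bar>"] by fastforce

lemma softmax_measurable:
  assumes "\<And>i. i \<in> I \<Longrightarrow> (\<lambda>m. X m i) \<in> borel_measurable M" "i \<in> I"
  shows "(\<lambda>m. softmax b I (X m) i) \<in> borel_measurable M"
  unfolding softmax_def using assms
  by (intro borel_measurable_divide measurable_compose[OF _ borel_measurable_exp] borel_measurable_sum borel_measurable_times borel_measurable_const) auto

lemma lse_measurable:
  assumes "\<And>i. i \<in> I \<Longrightarrow> (\<lambda>m. X m i) \<in> borel_measurable M"
  shows "(\<lambda>m. lse b I (X m)) \<in> borel_measurable M"
  unfolding lse_def using assms
  by (intro borel_measurable_divide borel_measurable_ln measurable_compose[OF _ borel_measurable_exp] borel_measurable_sum borel_measurable_times borel_measurable_const) auto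

text \<open>Orthogonality of each increment to the softmax weights of the past replaces independence,
  so that the lemma also applies conditionally on part of the data.\<close>

lemma maximal_inequality:
  fixes Y :: "nat \<Rightarrow> 'a \<Rightarrow> 'i \<Rightarrow> real"
  assumes M: "prob_space M" and I: "finite I" "I \<noteq> {}" and b: "0 < b"
    and Ym: "\<And>k i. k < n \<Longrightarrow> i \<in> I \<Longrightarrow> (\<lambda>m. Y k m i) \<in> borel_measurable M"
    and Dm: "\<And>k. k < n \<Longrightarrow> D k \<in> borel_measurable M"
    and Di: "\<And>k. k < n \<Longrightarrow> integrable M (\<lambda>m. (D k m)\<^sup>2)"
    and YD: "\<And>k m i. k < n \<Longrightarrow> m \<in> space M \<Longrightarrow> i \<in> I \<Longrightarrow> \<bar>Y k m i\<bar> \<le> D k m"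
    and orth: "\<And>k i. k < n \<Longrightarrow> i \<in> I \<Longrightarrow> (\<integral>m. Y k m i * softmax b I (\<lambda>i. \<Sum>l<k. Y l m i) i \<partial>M) = 0"
  shows "integrable M (\<lambda>m. mx I (\<lambda>i. \<Sum>l<n. Y l m i))"
    and "(\<integral>m. mx I (\<lambda>i. \<Sum>l<n. Y l m i) \<partial>M) \<le> ln (card I) / b + b * (\<Sum>k<n. \<integral>m. (D k m)\<^sup>2 \<partial>M)"
proof -
  interpret prob_space M by fact
  define S where "S k m i = (\<Sum>l<k. Y l m i)" for k m i
  have Yi: "integrable M (\<lambda>m. Y k m i)" if "k < n" "i \<in> I" for k i
  proof (rule Bochner_Integration.integrable_bound[of M "\<lambda>m. 1 + (D k m)\<^sup>2"])
    show "AE m in M. norm (Y k m i) \<le> norm (1 + (D k m)\<^sup>2)"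
    proof (rule AE_I2)
      fix m assume "m \<in> space M"
      then have "\<bar>Y k m i\<bar> \<le> D k m" using YD that by auto
      also have "D k m \<le> 1 + (D k m)\<^sup>2"
      proof -
        have "0 \<le> (D k m - 1/2)\<^sup>2" by simp
        then show ?thesis by (simp add: power2_eq_square algebra_simps)
      qed
      finally show "norm (Y k m i) \<le> norm (1 + (D k m)\<^sup>2)" by simp
    qed
  qed (use Di Ym that in auto)
  have Sm: "(\<lambda>m. S k m i) \<in> borel_measurable M" if "k \<le> n" "i \<in> I" for k i
    unfolding S_def using Ym that by (intro borel_measurable_sum) auto
  have Si: "integrable M (\<lambda>m. S k m i)" if "k \<le> n" "i \<in> I" for k i
    unfolding S_def using Yi that by (intro Bochner_Integration.integrable_sum) auto
  have Sa: "integrable M (\<lambda>m. \<Sum>i\<in>I. \<bar>S k m i\<bar>)" if "k \<le> n" for k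
    using Si[OF that] by (intro Bochner_Integration.integrable_sum integrable_abs) auto
  have mi: "integrable M (\<lambda>m. mx I (S k m))" if "k \<le> n" for k
    by (rule Bochner_Integration.integrable_bound[OF Sa[OF that] mx_measurable[OF I Sm[OF that]]])
      (use mx_abs_le[OF I] in \<open>auto simp: sum_nonneg\<close>)
  then show "integrable M (\<lambda>m. mx I (\<lambda>i. \<Sum>l<n. Y l m i))" using mi[of n] by (simp add: S_def[abs_def])
  have li: "integrable M (\<lambda>m. lse b I (S k m))" if "k \<le> n" for k
  proof (rule Bochner_Integration.integrable_bound[of M "\<lambda>m. (\<Sum>i\<in>I. \<bar>S k m i\<bar>) + ln (card I) / b"])
    show "integrable M (\<lambda>m. (\<Sum>i\<in>I. \<bar>S k m i\<bar>) + ln (card I) / b)" using Sa[OF that] by auto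
    show "(\<lambda>m. lse b I (S k m)) \<in> borel_measurable M" by (rule lse_measurable[OF Sm[OF that]])
    have c: "0 \<le> ln (card I) / b" using b I by (simp add: ln_ge_zero Suc_leI card_gt_0_iff)
    show "AE m in M. norm (lse b I (S k m)) \<le> norm ((\<Sum>i\<in>I. \<bar>S k m i\<bar>) + ln (card I) / b)"
    proof (rule AE_I2)
      fix m
      show "norm (lse b I (S k m)) \<le> norm ((\<Sum>i\<in>I. \<bar>S k m i\<bar>) + ln (card I) / b)"
        using lse_ge_mx[OF I b, of "S k m"] lse_le_mx[OF I b, of "S k m"] mx_abs_le[OF I, of "S k m"] c
          sum_nonneg[of I "\<lambda>i. \<bar>S k m i\<bar>"]
        by (simp add: abs_le_iff)
    qed
  qed
  \<comment> \<open>The expected log-sum-exp is a potential: it starts at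
    \<open>ln (card I) / b\<close>, and each increment adds at most \<open>b\<close> times the
    second moment of its envelope because the linear term integrates to 0 by
    \<open>orth\<close>.\<close>
  have "k \<le> n \<Longrightarrow> (\<integral>m. lse b I (S k m) \<partial>M) \<le> ln (card I) / b + b * (\<Sum>l<k. \<integral>m. (D l m)\<^sup>2 \<partial>M)" for k
  proof (induction k)
    case 0
    show ?case by (simp add: S_def lse_def prob_space)
  next
    case (Suc k)
    then have k: "k < n" "k \<le> n" by auto
    have yi: "integrable M (\<lambda>m. Y k m i * softmax b I (S k m) i)" if "i \<in> I" for i
    proof (rule Bochner_Integration.integrable_bound[OF Yi[OF k(1) that]])
      show "(\<lambda>m. Y k m i * softmax b I (S k m) i) \<in> borel_measurable M"
        using Ym[OF k(1) that] softmax_measurable[OF Sm[OF k(2)] that] by measurable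
      show "AE m in M. norm (Y k m i * softmax b I (S k m) i) \<le> norm (Y k m i)"
      proof (rule AE_I2)
        fix m
        show "norm (Y k m i * softmax b I (S k m) i) \<le> norm (Y k m i)"
          using softmax_le_1[OF I(1) that, of b "S k m"] softmax_nonneg[of b I "S k m" i]
          by (simp add: abs_mult mult_left_le)
      qed
    qed
    have "(\<integral>m. lse b I (S (Suc k) m) \<partial>M) \<le> (\<integral>m. lse b I (S k m) + (\<Sum>i\<in>I. Y k m i * softmax b I (S k m) i) + b * (D k m)\<^sup>2 \<partial>M)"
    proof (rule integral_mono)
      show "integrable M (\<lambda>m. lse b I (S (Suc k) m))" by (rule li) (use Suc in auto)
      show "integrable M (\<lambda>m. lse b I (S k m) + (\<Sum>i\<in>I. Y k m i * softmax b I (S k m) i) + b * (D k m)\<^sup>2)"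
        using li[OF k(2)] yi Di[OF k(1)] by auto
      fix m assume m: "m \<in> space M"
      have "S (Suc k) m = (\<lambda>i. S k m i + Y k m i)" by (simp add: S_def fun_eq_iff)
      then show "lse b I (S (Suc k) m) \<le> lse b I (S k m) + (\<Sum>i\<in>I. Y k m i * softmax b I (S k m) i) + b * (D k m)\<^sup>2"
        using lse_second_order[OF I b, of "Y k m" "D k m" "S k m"] YD[OF k(1) m] by (simp add: mult.commute)
    qed
    also have "\<dots> = (\<integral>m. lse b I (S k m) \<partial>M) + (\<Sum>i\<in>I. \<integral>m. Y k m i * softmax b I (S k m) i \<partial>M) + b * (\<integral>m. (D k m)\<^sup>2 \<partial>M)"
      using li[OF k(2)] yi Di[OF k(1)] by (simp add: Bochner_Integration.integral_sum)
    also have "(\<Sum>i\<in>I. \<integral>m. Y k m i * softmax b I (S k m) i \<partial>M) = 0"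
      using orth[OF k(1)] by (simp add: S_def[abs_def])
    finally show ?case using Suc.IH[OF k(2)] by (simp add: algebra_simps)
  qed
  from this[of n] have "(\<integral>m. lse b I (S n m) \<partial>M) \<le> ln (card I) / b + b * (\<Sum>k<n. \<integral>m. (D k m)\<^sup>2 \<partial>M)" by simp
  moreover have "(\<integral>m. mx I (S n m) \<partial>M) \<le> (\<integral>m. lse b I (S n m) \<partial>M)"
    by (rule integral_mono[OF mi li]) (use lse_ge_mx[OF I b] in auto)
  ultimately show "(\<integral>m. mx I (\<lambda>i. \<Sum>l<n. Y l m i) \<partial>M) \<le> ln (card I) / b + b * (\<Sum>k<n. \<integral>m. (D k m)\<^sup>2 \<partial>M)"
    by (simp add: S_def[abs_def])
qed

section \<open>Anticoncentration of Gaussian maxima\<close>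

text \<open>Ties are broken by the rank \<open>r\<close>, so that these sets are disjoint for injective \<open>r\<close>.\<close>

definition argmax_set :: "('i \<Rightarrow> nat) \<Rightarrow> 'i set \<Rightarrow> 'i \<Rightarrow> real set \<Rightarrow> ('i \<Rightarrow> real) set" where
  "argmax_set r I j B = {x. x j \<in> B \<and> (\<forall>k\<in>I. x k \<le> x j \<and> (r k < r j \<longrightarrow> x k < x j))}"

lemma argmax_set_sets:
  assumes I: "finite I" and j: "j \<in> I" and B: "B \<in> sets borel"
    and X: "\<forall>i\<in>I. (\<lambda>m. X m i) \<in> borel_measurable M"
  shows "{m\<in>space M. X m \<in> argmax_set r I j B} \<in> sets M"
proof -
  have c: "(\<lambda>m. X m k) \<in> borel_measurable M" if "k \<in> I" for k using X that by auto
  have B: "{m\<in>space M. X m j \<in> B} \<in> sets M"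
    using measurable_sets[OF c[OF j] B] by (simp add: vimage_def Int_def conj_commute)
  have lt: "{m\<in>space M. r k < r j \<longrightarrow> X m k < X m j} \<in> sets M" if "k \<in> I" for k
    using borel_measurable_less[OF c[OF that] c[OF j]] by (cases "r k < r j") auto
  show ?thesis unfolding argmax_set_def mem_Collect_eq
    by (intro sets.sets_Collect_conj B sets.sets_Collect_finite_All lt borel_measurable_le c I j)
qed

text \<open>Conditioning on the value \<open>y\<close> of coordinate \<open>j\<close>: the residuals of the other coordinates are
  independent of it, and the condition that \<open>j\<close> is the argmax becomes weaker as \<open>y\<close> grows because
  all correlations are at most 1.\<close>

lemma gauss_argmax_density:
  assumes I: "finite I" and J: "finite J" and j: "j \<in> I"
    and unit: "\<forall>i\<in>I. (\<Sum>m\<in>J. L i m * L i m) = 1"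
  shows "\<exists>A :: real \<Rightarrow> real. mono A \<and> (\<forall>y. 0 \<le> A y \<and> A y \<le> 1) \<and>
    (\<forall>B\<in>sets borel. emeasure (gstd J) {\<xi>\<in>space (gstd J). lin L J \<xi> \<in> argmax_set r I j B}
       = (\<integral>\<^sup>+y. ennreal (A y) * indicator B y \<partial>std_normal_distribution))"
proof -
  have I0: "I \<noteq> {}" using j by auto
  define \<rho> where "\<rho> k = (\<Sum>m\<in>J. L k m * L j m)" for k
  have \<rho>j: "\<rho> j = 1" using unit[rule_format, OF j] by (simp add: \<rho>_def)
  have \<rho>1: "\<rho> k \<le> 1" if "k \<in> I" for k
  proof -
    have "0 \<le> (\<Sum>m\<in>J. (L k m - L j m)\<^sup>2)" by (simp add: sum_nonneg)
    also have "\<dots> = (\<Sum>m\<in>J. L k m * L k m) + (\<Sum>m\<in>J. L j m * L j m) - 2 * \<rho> k"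
      by (simp add: \<rho>_def sum.distrib sum_subtractf sum_distrib_left power2_eq_square algebra_simps)
    finally show ?thesis using unit j that by simp
  qed
  obtain j0 :: nat where j0: "j0 \<notin> J" using J ex_new_if_finite[of J] by auto
  define V where "V k m = L k m - \<rho> k * L j m" for k m
  define L' where "L' k m = (if m = j0 then \<rho> k else V k m)" for k m
  let ?J = "insert j0 J"
  have cov: "(\<Sum>m\<in>J. L i m * L k m) = (\<Sum>m\<in>?J. L' i m * L' k m)" if "i \<in> I" "k \<in> I" for i k
  proof -
    have "(\<Sum>m\<in>?J. L' i m * L' k m) = \<rho> i * \<rho> k + (\<Sum>m\<in>J. V i m * V k m)"
      using J j0 by (auto simp: L'_def intro!: sum.cong)
    also have "(\<Sum>m\<in>J. V i m * V k m) = (\<Sum>m\<in>J. L i m * L k m - \<rho> k * (L i m * L j m) - \<rho> i * (L k m * L j m) + \<rho> i * \<rho> k * (L j m * L j m))"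
      by (intro sum.cong refl) (simp add: V_def algebra_simps)
    also have "\<dots> = (\<Sum>m\<in>J. L i m * L k m) - \<rho> k * \<rho> i - \<rho> i * \<rho> k + \<rho> i * \<rho> k * (\<Sum>m\<in>J. L j m * L j m)"
      by (simp only: sum.distrib sum_subtractf sum_distrib_left[symmetric] \<rho>_def)
    finally show ?thesis using unit[rule_format, OF j] by simp
  qed
  \<comment> \<open>The conditional probability that \<open>j\<close> is the argmax given its value
    \<open>y\<close>: coordinate \<open>k\<close> equals \<open>\<rho> k * y\<close> plus its
    residual, so it stays below \<open>y\<close> iff the residual is at most
    \<open>(1 - \<rho> k) * y\<close>.\<close>
  define A where "A y = measure (gstd J) {\<xi>\<in>space (gstd J). \<forall>k\<in>I. lin V J \<xi> k \<le> (1 - \<rho> k) * y \<and> (r k < r j \<longrightarrow> lin V J \<xi> k < (1 - \<rho> k) * y)}" for y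
  interpret G: prob_space "gstd J" by (rule prob_space_gstd)
  interpret N: prob_space std_normal_distribution by (rule prob_space_std_normal)
  interpret PS: product_sigma_finite "\<lambda>_. std_normal_distribution" by standard
  have As: "{\<xi>\<in>space (gstd J). \<forall>k\<in>I. lin V J \<xi> k \<le> (1 - \<rho> k) * y \<and> (r k < r j \<longrightarrow> lin V J \<xi> k < (1 - \<rho> k) * y)} \<in> sets (gstd J)" for y
    using I by measurable
  have mono: "mono A"
  proof (rule monoI)
    fix y z :: real assume yz: "y \<le> z"
    have "(1 - \<rho> k) * y \<le> (1 - \<rho> k) * z" if "k \<in> I" for k
      using \<rho>1[OF that] yz by (intro mult_left_mono) auto
    then show "A y \<le> A z" unfolding A_def
      by (intro G.finite_measure_mono As) (auto intro: order_trans less_le_trans)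
  qed
  have em: "emeasure (gstd J) {\<xi>\<in>space (gstd J). lin L J \<xi> \<in> argmax_set r I j B} = (\<integral>\<^sup>+y. ennreal (A y) * indicator B y \<partial>std_normal_distribution)"
    if B: "B \<in> sets borel" for B
  proof -
    define E where "E = {x\<in>space (PiM I (\<lambda>_. borel :: real measure)). x \<in> argmax_set r I j B}"
    have E: "E \<in> sets (PiM I (\<lambda>_. borel))" unfolding E_def
      by (rule argmax_set_sets[OF I j B]) (auto intro: measurable_component_singleton)
    have e1: "emeasure (distr (gstd G) (PiM I (\<lambda>_. borel)) (\<lambda>\<xi>. restrict (lin K G \<xi>) I)) E
       = emeasure (gstd G) {\<xi>\<in>space (gstd G). lin K G \<xi> \<in> argmax_set r I j B}" for K :: "'a \<Rightarrow> nat \<Rightarrow> real" and G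
    proof -
      have "(\<lambda>\<xi>. restrict (lin K G \<xi>) I) -` E \<inter> space (gstd G) = {\<xi>\<in>space (gstd G). lin K G \<xi> \<in> argmax_set r I j B}"
        using j by (auto simp: E_def argmax_set_def space_PiM)
      then show ?thesis using E by (subst emeasure_distr) (auto intro!: measurable_restrict)
    qed
    let ?D = "{\<xi>\<in>space (gstd ?J). lin L' ?J \<xi> \<in> argmax_set r I j B}"
    have Ds: "?D \<in> sets (gstd ?J)"
      by (rule argmax_set_sets[OF I j B]) (auto intro: lin_measurable)
    have "emeasure (gstd J) {\<xi>\<in>space (gstd J). lin L J \<xi> \<in> argmax_set r I j B} = emeasure (gstd ?J) ?D"
    proof -
      have "distr (gstd J) (PiM I (\<lambda>_. borel)) (\<lambda>\<xi>. restrict (lin L J \<xi>) I)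
         = distr (gstd ?J) (PiM I (\<lambda>_. borel)) (\<lambda>\<xi>. restrict (lin L' ?J \<xi>) I)"
        by (rule gauss_law_eq[OF I I0 J]) (use J cov in auto)
      then show ?thesis using e1[of J L] e1[of ?J L'] by simp
    qed
    also have "\<dots> = (\<integral>\<^sup>+\<xi>. indicator ?D \<xi> \<partial>gstd ?J)" using Ds by simp
    also have "\<dots> = (\<integral>\<^sup>+y. \<integral>\<^sup>+x. indicator ?D (x(j0 := y)) \<partial>gstd J \<partial>std_normal_distribution)"
      unfolding gstd_def
      by (rule PS.product_nn_integral_insert_rev[OF J j0]) (use Ds in \<open>simp add: gstd_def\<close>)
    also have "\<dots> = (\<integral>\<^sup>+y. ennreal (A y) * indicator B y \<partial>std_normal_distribution)"
    proof (rule nn_integral_cong)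
      fix y :: real
      let ?C = "{\<xi>\<in>space (gstd J). \<forall>k\<in>I. lin V J \<xi> k \<le> (1 - \<rho> k) * y \<and> (r k < r j \<longrightarrow> lin V J \<xi> k < (1 - \<rho> k) * y)}"
      have "(\<integral>\<^sup>+x. indicator ?D (x(j0 := y)) \<partial>gstd J) = (\<integral>\<^sup>+x. indicator ?C x * indicator B y \<partial>gstd J)"
      proof (rule nn_integral_cong)
        fix x assume x: "x \<in> space (gstd J)"
        have l: "lin L' ?J (x(j0 := y)) k = \<rho> k * y + lin V J x k" for k
        proof -
          have "lin L' ?J (x(j0 := y)) k = \<rho> k * y + (\<Sum>m\<in>J. L' k m * (x(j0 := y)) m)"
            using J j0 by (simp add: lin_def L'_def)
          also have "(\<Sum>m\<in>J. L' k m * (x(j0 := y)) m) = lin V J x k"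
            unfolding lin_def using j0 by (intro sum.cong refl) (auto simp: L'_def)
          finally show ?thesis .
        qed
        have "lin V J x j = 0" unfolding lin_def by (rule sum.neutral) (simp add: V_def \<rho>j)
        then have lj: "lin L' ?J (x(j0 := y)) j = y" by (simp add: l \<rho>j)
        have sp: "x(j0 := y) \<in> space (gstd ?J)" using x by (auto simp: gstd_def space_PiM PiE_iff extensional_def)
        have "x(j0 := y) \<in> ?D \<longleftrightarrow> x \<in> ?C \<and> y \<in> B"
          using sp x unfolding argmax_set_def mem_Collect_eq lj by (auto simp: l algebra_simps)
        then show "indicator ?D (x(j0 := y)) = (indicator ?C x * indicator B y :: ennreal)"
          by (auto simp: indicator_def)
      qed
      also have "\<dots> = (\<integral>\<^sup>+x. indicator ?C x \<partial>gstd J) * indicator B y"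
        using As by (intro nn_integral_multc) auto
      also have "(\<integral>\<^sup>+x. indicator ?C x \<partial>gstd J) = ennreal (A y)"
        using As by (simp add: A_def G.emeasure_eq_measure)
      finally show "(\<integral>\<^sup>+x. indicator ?D (x(j0 := y)) \<partial>gstd J) = ennreal (A y) * indicator B y" .
    qed
    finally show ?thesis .
  qed
  show ?thesis using mono em by (intro exI[of _ A]) (auto simp: A_def)
qed

text \<open>The argmax events partition the space, so the conditional probabilities for single
  coordinates add up. Monotonicity survives the sum, and it is the one property of \<open>A\<close>,
  beyond its size, that the anticoncentration bound exploits.\<close>

lemma gauss_max_density:
  assumes I: "finite I" "I \<noteq> {}" and J: "finite J"
    and unit: "\<forall>i\<in>I. (\<Sum>m\<in>J. L i m * L i m) = 1"
  shows "\<exists>A :: real \<Rightarrow> real. mono A \<and> (\<forall>y. 0 \<le> A y \<and> A y \<le> card I) \<and>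
    (\<forall>B\<in>sets borel. emeasure (gstd J) {\<xi>\<in>space (gstd J). mx I (lin L J \<xi>) \<in> B}
       = (\<integral>\<^sup>+y. ennreal (A y * std_normal_density y) * indicator B y \<partial>lborel))"
proof -
  obtain r :: "'a \<Rightarrow> nat" where r: "inj_on r I" using finite_imp_inj_to_nat_seg[OF I(1)] by blast
  have "\<forall>j\<in>I. \<exists>A :: real \<Rightarrow> real. mono A \<and> (\<forall>y. 0 \<le> A y \<and> A y \<le> 1) \<and>
    (\<forall>B\<in>sets borel. emeasure (gstd J) {\<xi>\<in>space (gstd J). lin L J \<xi> \<in> argmax_set r I j B}
       = (\<integral>\<^sup>+y. ennreal (A y) * indicator B y \<partial>std_normal_distribution))"
    using gauss_argmax_density[OF I(1) J _ unit] by blast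
  then obtain A :: "'a \<Rightarrow> real \<Rightarrow> real" where A: "\<And>j. j \<in> I \<Longrightarrow> mono (A j)" "\<And>j y. j \<in> I \<Longrightarrow> 0 \<le> A j y \<and> A j y \<le> 1"
    "\<And>j B. j \<in> I \<Longrightarrow> B \<in> sets borel \<Longrightarrow> emeasure (gstd J) {\<xi>\<in>space (gstd J). lin L J \<xi> \<in> argmax_set r I j B}
       = (\<integral>\<^sup>+y. ennreal (A j y) * indicator B y \<partial>std_normal_distribution)"
    unfolding bchoice_iff by blast
  define T where "T y = (\<Sum>j\<in>I. A j y)" for y
  have T0: "0 \<le> T y" for y unfolding T_def using A(2) by (intro sum_nonneg) auto
  have T1: "T y \<le> card I" for y
    unfolding T_def using sum_mono[of I "\<lambda>j. A j y" "\<lambda>_. 1"] A(2) by auto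
  have Tm: "mono T" unfolding T_def using A(1) by (intro monoI sum_mono) (auto dest: monoD)
  have Am: "A j \<in> borel_measurable borel" if "j \<in> I" for j using A(1)[OF that] by (rule borel_measurable_mono)
  have [measurable]: "T \<in> borel_measurable borel" using Tm by (rule borel_measurable_mono)
  have "emeasure (gstd J) {\<xi>\<in>space (gstd J). mx I (lin L J \<xi>) \<in> B}
       = (\<integral>\<^sup>+y. ennreal (T y * std_normal_density y) * indicator B y \<partial>lborel)" if B: "B \<in> sets borel" for B
  proof -
    let ?E = "\<lambda>j. {\<xi>\<in>space (gstd J). lin L J \<xi> \<in> argmax_set r I j B}"
    have Es: "?E j \<in> sets (gstd J)" if "j \<in> I" for j
      by (rule argmax_set_sets[OF I(1) that B]) (auto intro: lin_measurable)
    have "{\<xi>\<in>space (gstd J). mx I (lin L J \<xi>) \<in> B} = (\<Union>j\<in>I. ?E j)"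
    proof (intro equalityI subsetI)
      fix \<xi> assume x: "\<xi> \<in> {\<xi>\<in>space (gstd J). mx I (lin L J \<xi>) \<in> B}"
      let ?x = "lin L J \<xi>"
      let ?S = "{k\<in>I. ?x k = mx I ?x}"
      have "?S \<noteq> {}" using mx_in[OF I, of ?x] by auto
      then obtain j where j: "j \<in> ?S" "\<And>k. k \<in> ?S \<Longrightarrow> r j \<le> r k"
        using ex_has_least_nat[of "\<lambda>k. k \<in> ?S" _ r] by blast
      have "?x k < ?x j" if "k \<in> I" "r k < r j" for k
        using j(2)[of k] that mx_ge[OF I(1) that(1), of ?x] j(1) by fastforce
      then have "\<xi> \<in> ?E j" using x j(1) mx_ge[OF I(1), of _ ?x] by (auto simp: argmax_set_def)
      then show "\<xi> \<in> (\<Union>j\<in>I. ?E j)" using j(1) by blast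
    next
      fix \<xi> assume "\<xi> \<in> (\<Union>j\<in>I. ?E j)"
      then obtain j where j: "j \<in> I" "\<xi> \<in> ?E j" by blast
      have "mx I (lin L J \<xi>) \<le> lin L J \<xi> j" using j I by (simp add: mx_le_iff argmax_set_def)
      then have "mx I (lin L J \<xi>) = lin L J \<xi> j" using mx_ge[OF I(1) j(1), of "lin L J \<xi>"] by simp
      then show "\<xi> \<in> {\<xi>\<in>space (gstd J). mx I (lin L J \<xi>) \<in> B}" using j by (simp add: argmax_set_def)
    qed
    moreover have "disjoint_family_on ?E I"
      unfolding disjoint_family_on_def
    proof (intro ballI impI)
      fix j k assume jk: "j \<in> I" "k \<in> I" "j \<noteq> k"
      then have "r j < r k \<or> r k < r j" using r by (meson inj_onD linorder_neqE_nat)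
      then show "?E j \<inter> ?E k = {}" using jk by (fastforce simp: argmax_set_def)
    qed
    ultimately have "emeasure (gstd J) {\<xi>\<in>space (gstd J). mx I (lin L J \<xi>) \<in> B} = (\<Sum>j\<in>I. emeasure (gstd J) (?E j))"
      using Es I(1) by (simp add: sum_emeasure[symmetric] image_subset_iff)
    also have "\<dots> = (\<Sum>j\<in>I. \<integral>\<^sup>+y. ennreal (A j y) * indicator B y \<partial>std_normal_distribution)"
      by (intro sum.cong refl A(3) B)
    also have "\<dots> = (\<integral>\<^sup>+y. (\<Sum>j\<in>I. ennreal (A j y) * indicator B y) \<partial>std_normal_distribution)"
      using Am B by (subst nn_integral_sum) auto
    also have "\<dots> = (\<integral>\<^sup>+y. ennreal (T y) * indicator B y \<partial>std_normal_distribution)"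
      using A(2) by (intro nn_integral_cong) (simp add: T_def sum_distrib_right[symmetric] sum_ennreal)
    also have "\<dots> = (\<integral>\<^sup>+y. ennreal (std_normal_density y) * (ennreal (T y) * indicator B y) \<partial>lborel)"
      using B by (intro nn_integral_density) auto
    also have "\<dots> = (\<integral>\<^sup>+y. ennreal (T y * std_normal_density y) * indicator B y \<partial>lborel)"
      using T0 by (intro nn_integral_cong) (simp add: ennreal_mult' ac_simps)
    finally show ?thesis .
  qed
  then show ?thesis using Tm T0 T1 by blast
qed

lemma exp_three_halves_le: "exp (3/2 :: real) \<le> 9"
proof -
  have "exp (3/2 :: real) \<le> exp (1 + 1)" by simp
  also have "\<dots> = exp 1 * exp 1" by (rule exp_add)
  also have "\<dots> \<le> 3 * 3" using exp_le by (intro mult_mono) auto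
  finally show ?thesis by simp
qed

text \<open>It suffices to bound the density \<open>A y * std_normal_density y\<close> of the
  maximum. For \<open>y \<ge> 0\<close> total mass 1 does it: on an interval of length
  \<open>1 / (1 + y)\<close> to the right of \<open>y\<close> the normal density loses at most the
  factor \<open>exp (-3/2)\<close> while \<open>A\<close> does not decrease, so the density at
  \<open>y\<close> is at most \<open>9 * (1 + y)\<close>. This is applied up to
  \<open>sqrt (2 * ln (card I))\<close>, beyond which the normal tail beats the trivial bound on
  \<open>A\<close>.\<close>

lemma gauss_anticoncentration:
  assumes I: "finite I" "I \<noteq> {}" and J: "finite J"
    and unit: "\<forall>i\<in>I. (\<Sum>m\<in>J. L i m * L i m) = 1" and ab: "a \<le> b"
  shows "measure (gstd J) {\<xi>\<in>space (gstd J). mx I (lin L J \<xi>) \<le> b} - measure (gstd J) {\<xi>\<in>space (gstd J). mx I (lin L J \<xi>) \<le> a}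
    \<le> 9 * (1 + sqrt (2 * ln (card I))) * (b - a)"
proof -
  interpret G: prob_space "gstd J" by (rule prob_space_gstd)
  obtain A :: "real \<Rightarrow> real" where A: "mono A" "\<And>y. 0 \<le> A y" "\<And>y. A y \<le> card I"
    and em: "\<And>B. B \<in> sets borel \<Longrightarrow> emeasure (gstd J) {\<xi>\<in>space (gstd J). mx I (lin L J \<xi>) \<in> B}
       = (\<integral>\<^sup>+y. ennreal (A y * std_normal_density y) * indicator B y \<partial>lborel)"
    using gauss_max_density[OF I J unit] by blast
  define p where "p = real (card I)"
  define C where "C = 9 * (1 + sqrt (2 * ln p))"
  have p1: "1 \<le> p" using I by (simp add: p_def Suc_leI card_gt_0_iff)
  have lp: "0 \<le> ln p" using p1 by simp
  have C9: "9 \<le> C" using lp by (simp add: C_def)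
  have nonneg_bound: "A y * std_normal_density y \<le> 9 * (1 + y)" if y: "0 \<le> y" for y
  proof -
    \<comment> \<open>With this length both \<open>y * s\<close> and \<open>s * s\<close> are at
      most 1, so the square grows by at most 3 over the interval, which gives the exponent
      3/2.\<close>
    define s where "s = 1 / (1 + y)"
    have s: "0 < s" "s \<le> 1" "s * (1 + y) = 1" using y by (auto simp: s_def)
    have sy: "y * s \<le> 1" using s y by (simp add: s_def divide_simps)
    have ss: "s * s \<le> 1" using s by (simp add: mult_le_one)
    define c where "c = A y * (std_normal_density y * exp (- (3/2)))"
    have c0: "0 \<le> c" using A(2)[of y] by (simp add: c_def)
    have "ennreal (c * s) = (\<integral>\<^sup>+z. ennreal c * indicator {y<..y+s} z \<partial>lborel)"
      using s c0 by (simp add: nn_integral_cmult ennreal_mult')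
    also have "\<dots> \<le> (\<integral>\<^sup>+z. ennreal (A z * std_normal_density z) * indicator {y<..} z \<partial>lborel)"
    proof (rule nn_integral_mono)
      fix z :: real
      show "ennreal c * indicator {y<..y+s} z \<le> ennreal (A z * std_normal_density z) * indicator {y<..} z"
      proof (cases "z \<in> {y<..y+s}")
        case True
        have "z\<^sup>2 \<le> (y + s)\<^sup>2" using True y by (intro power_mono) auto
        also have "\<dots> = y\<^sup>2 + 2 * (y * s) + s * s" by (simp add: power2_eq_square algebra_simps)
        also have "\<dots> \<le> y\<^sup>2 + 3" using sy ss by simp
        finally have "- y\<^sup>2 / 2 + - (3/2) \<le> - z\<^sup>2 / 2" by simp
        then have "exp (- y\<^sup>2 / 2) * exp (- (3/2)) \<le> exp (- z\<^sup>2 / 2)" by (simp only: exp_add[symmetric] exp_le_cancel_iff)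
        then have "std_normal_density y * exp (- (3/2)) \<le> std_normal_density z"
          by (simp add: std_normal_density_def divide_right_mono)
        moreover have "A y \<le> A z" using monoD[OF A(1), of y z] True by simp
        ultimately have "c \<le> A z * std_normal_density z" unfolding c_def using A(2) by (intro mult_mono) auto
        then show ?thesis using True by (simp add: ennreal_leI)
      qed simp
    qed
    also have "\<dots> = emeasure (gstd J) {\<xi>\<in>space (gstd J). mx I (lin L J \<xi>) \<in> {y<..}}"
      by (rule em[symmetric]) simp
    also have "\<dots> \<le> 1" using G.measure_le_1 by (simp add: G.emeasure_eq_measure)
    finally have "c * s \<le> 1" by (simp add: ennreal_le_1)
    then have "c * s * (1 + y) \<le> 1 * (1 + y)" using y by (intro mult_right_mono) auto
    then have "c \<le> 1 + y" using s by (simp add: mult.assoc)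
    then have "A y * std_normal_density y * exp (- (3/2)) * exp (3/2) \<le> (1 + y) * exp (3/2)"
      unfolding c_def by (intro mult_right_mono) (auto simp: mult.assoc)
    then have "A y * std_normal_density y \<le> (1 + y) * exp (3/2)"
      by (simp add: mult.assoc exp_add[symmetric])
    also have "\<dots> \<le> (1 + y) * 9" using y exp_three_halves_le by (intro mult_left_mono) auto
    finally show ?thesis by simp
  qed
  have dens: "std_normal_density y \<le> exp (- y\<^sup>2 / 2)" for y
  proof -
    have "1 \<le> sqrt (2 * pi)" using pi_ge_two by simp
    then show ?thesis by (simp add: std_normal_density_def divide_le_eq mult_le_cancel_left1)
  qed
  have bound: "A y * std_normal_density y \<le> C" for y
  proof -
    \<comment> \<open>To the left of 0 both factors are dominated by their values at 0; in the
      middle range the mass argument applies; to the right the normal density is at most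
      \<open>1 / p\<close> while \<open>A\<close> is at most \<open>p\<close>.\<close>
    consider "y \<le> 0" | "0 \<le> y" "y \<le> sqrt (2 * ln p)" | "sqrt (2 * ln p) < y" "0 \<le> y" by linarith
    then show ?thesis
    proof cases
      case 1
      have "std_normal_density y \<le> std_normal_density 0" by (simp add: std_normal_density_def divide_right_mono)
      then have "A y * std_normal_density y \<le> A 0 * std_normal_density 0"
        using A(2) monoD[OF A(1) 1] by (intro mult_mono) auto
      also have "\<dots> \<le> 9" using nonneg_bound[of 0] by simp
      finally show ?thesis using C9 by simp
    next
      case 2
      then show ?thesis using nonneg_bound[of y] by (simp add: C_def)
    next
      case 3
      have "2 * ln p = (sqrt (2 * ln p))\<^sup>2" using lp by simp
      also have "\<dots> \<le> y\<^sup>2" using 3 lp by (intro power_mono) auto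
      finally have "exp (- y\<^sup>2 / 2) \<le> exp (- ln p)" by simp
      also have "\<dots> = 1 / p" using p1 by (simp add: exp_minus inverse_eq_divide)
      finally have "std_normal_density y \<le> 1 / p" using dens[of y] by simp
      then have "A y * std_normal_density y \<le> p * (1 / p)"
        using A(2,3) p1 by (intro mult_mono) (auto simp: p_def)
      then show ?thesis using p1 C9 by simp
    qed
  qed
  have meas: "{\<xi>\<in>space (gstd J). mx I (lin L J \<xi>) \<in> B} \<in> sets (gstd J)" if "B \<in> sets borel" for B
    using mx_measurable[OF I, of "lin L J" "gstd J"] that by measurable
  have "emeasure (gstd J) {\<xi>\<in>space (gstd J). mx I (lin L J \<xi>) \<in> {a<..b}} = (\<integral>\<^sup>+y. ennreal (A y * std_normal_density y) * indicator {a<..b} y \<partial>lborel)"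
    by (rule em) simp
  also have "\<dots> \<le> (\<integral>\<^sup>+y. ennreal C * indicator {a<..b} y \<partial>lborel)"
    using bound by (intro nn_integral_mono mult_right_mono ennreal_leI) auto
  also have "\<dots> = ennreal (C * (b - a))" using ab C9 by (simp add: nn_integral_cmult ennreal_mult')
  finally have "measure (gstd J) {\<xi>\<in>space (gstd J). mx I (lin L J \<xi>) \<in> {a<..b}} \<le> C * (b - a)"
    using ab C9 by (simp add: G.emeasure_eq_measure ennreal_le_iff)
  moreover have "measure (gstd J) {\<xi>\<in>space (gstd J). mx I (lin L J \<xi>) \<in> {a<..b}}
    = measure (gstd J) {\<xi>\<in>space (gstd J). mx I (lin L J \<xi>) \<le> b} - measure (gstd J) {\<xi>\<in>space (gstd J). mx I (lin L J \<xi>) \<le> a}"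
  proof -
    have "{\<xi>\<in>space (gstd J). mx I (lin L J \<xi>) \<in> {a<..b}} = {\<xi>\<in>space (gstd J). mx I (lin L J \<xi>) \<in> {..b}} - {\<xi>\<in>space (gstd J). mx I (lin L J \<xi>) \<in> {..a}}"
      by auto
    then show ?thesis
      using G.finite_measure_Diff[OF meas[of "{..b}"] meas[of "{..a}"]] ab by (auto simp: subset_eq)
  qed
  ultimately show ?thesis by (simp add: C_def p_def)
qed

section \<open>Sums of independent vectors\<close>

definition mxa :: "'i set \<Rightarrow> ('i \<Rightarrow> real) \<Rightarrow> real" where
  "mxa I x = Max ((\<lambda>i. \<bar>x i\<bar>) ` I)"

text \<open>Doubling the index set turns a maximum of absolute values into an ordinary maximum. The
  price is the doubled cardinality, that is, \<open>ln 2\<close> in the logarithm.\<close>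

definition signed :: "('i \<Rightarrow> real) \<Rightarrow> 'i \<times> bool \<Rightarrow> real" where
  "signed x p = (if snd p then x (fst p) else - x (fst p))"

lemma mxa_le_iff: "finite I \<Longrightarrow> I \<noteq> {} \<Longrightarrow> mxa I x \<le> t \<longleftrightarrow> (\<forall>i\<in>I. \<bar>x i\<bar> \<le> t)"
  by (auto simp: mxa_def)

lemma mxa_ge: "finite I \<Longrightarrow> i \<in> I \<Longrightarrow> \<bar>x i\<bar> \<le> mxa I x"
  by (auto simp: mxa_def)

lemma mxa_nonneg: "finite I \<Longrightarrow> I \<noteq> {} \<Longrightarrow> 0 \<le> mxa I x"
  using mxa_ge[of I _ x] by (meson abs_ge_zero equals0I order_trans)

lemma mx_signed:
  assumes "finite I" "I \<noteq> {}" shows "mx (I \<times> UNIV) (signed x) = mxa I x"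
proof (rule order_antisym)
  show "mx (I \<times> UNIV) (signed x) \<le> mxa I x"
    using assms mxa_ge[OF assms(1), of _ x] by (subst mx_le_iff) (auto simp: signed_def abs_le_iff)
  have "\<bar>x i\<bar> \<le> mx (I \<times> UNIV) (signed x)" if "i \<in> I" for i
    using mx_ge[of "I \<times> (UNIV :: bool set)" "(i, True)" "signed x"] mx_ge[of "I \<times> (UNIV :: bool set)" "(i, False)" "signed x"] assms that
    by (simp add: signed_def abs_le_iff)
  then show "mxa I x \<le> mx (I \<times> UNIV) (signed x)" using assms by (simp add: mxa_le_iff)
qed

lemma mxa_measurable:
  assumes "finite I" "I \<noteq> {}" "\<And>i. i \<in> I \<Longrightarrow> (\<lambda>m. X m i) \<in> borel_measurable M"
  shows "(\<lambda>m. mxa I (X m)) \<in> borel_measurable M"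
  unfolding mxa_def using assms(1,3) by (intro borel_measurable_Max borel_measurable_abs)

lemma card_signed: "card (I \<times> (UNIV :: bool set)) = 2 * card I"
  by (simp add: card_cartesian_product)

lemma PiM_coordinate:
  assumes M: "prob_space M" and k: "k < n" and g: "g \<in> borel_measurable M"
  shows "(\<integral>\<omega>. g (\<omega> k) \<partial>PiM {..<n} (\<lambda>_. M)) = (\<integral>m. g m \<partial>M :: real)"
    and "integrable M g \<Longrightarrow> integrable (PiM {..<n} (\<lambda>_. M)) (\<lambda>\<omega>. g (\<omega> k))"
    and "(\<lambda>\<omega>. g (\<omega> k)) \<in> borel_measurable (PiM {..<n} (\<lambda>_. M))"
proof -
  have k': "k \<in> {..<n}" using k by simp
  have d: "distr (PiM {..<n} (\<lambda>_. M)) M (\<lambda>\<omega>. \<omega> k) = M"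
    by (rule distr_PiM_component[OF M k'])
  have c: "(\<lambda>\<omega>. \<omega> k) \<in> measurable (PiM {..<n} (\<lambda>_. M)) M" by (rule measurable_component_singleton[OF k'])
  show "(\<integral>\<omega>. g (\<omega> k) \<partial>PiM {..<n} (\<lambda>_. M)) = (\<integral>m. g m \<partial>M)"
    using integral_distr[OF c g] d by simp
  show "integrable M g \<Longrightarrow> integrable (PiM {..<n} (\<lambda>_. M)) (\<lambda>\<omega>. g (\<omega> k))"
    using integrable_distr_eq[OF c g] d by simp
  show "(\<lambda>\<omega>. g (\<omega> k)) \<in> borel_measurable (PiM {..<n} (\<lambda>_. M))" by (rule measurable_compose[OF c g])
qed

lemma PiM_integral_coordinate:
  fixes F :: "(nat \<Rightarrow> 'a) \<Rightarrow> real"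
  assumes M: "prob_space M" and k: "k < n" and F: "integrable (PiM {..<n} (\<lambda>_. M)) F"
  shows "(\<integral>\<omega>. F \<omega> \<partial>PiM {..<n} (\<lambda>_. M)) = (\<integral>x. (\<integral>y. F (x(k := y)) \<partial>M) \<partial>PiM ({..<n} - {k}) (\<lambda>_. M))"
proof -
  interpret prob_space M by fact
  interpret product_sigma_finite "\<lambda>_. M" by standard
  have "insert k ({..<n} - {k}) = {..<n}" using k by auto
  then show ?thesis using product_integral_insert[of "{..<n} - {k}" k F] F by simp
qed

text \<open>Independence enters only as orthogonality: when coordinate \<open>k\<close> is
  integrated out, the softmax weight depends on earlier coordinates alone and the centred summand
  contributes 0.\<close>

lemma iid_maximal_inequality:
  fixes n :: nat
  assumes M: "prob_space M" and I: "finite I" "I \<noteq> {}" and b: "0 < b"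
    and Zm: "\<forall>i\<in>I. (\<lambda>m. Z m i) \<in> borel_measurable M"
    and Em: "E \<in> borel_measurable M" and Ei: "integrable M (\<lambda>m. (E m)\<^sup>2)"
    and ZE: "\<forall>m\<in>space M. \<forall>i\<in>I. \<bar>Z m i\<bar> \<le> E m"
    and mean: "\<forall>i\<in>I. (\<integral>m. Z m i \<partial>M) = 0"
  shows "integrable (PiM {..<n} (\<lambda>_. M)) (\<lambda>\<omega>. mxa I (\<lambda>i. \<Sum>l<n. Z (\<omega> l) i))"
    and "(\<integral>\<omega>. mxa I (\<lambda>i. \<Sum>l<n. Z (\<omega> l) i) \<partial>PiM {..<n} (\<lambda>_. M)) \<le> ln (2 * card I) / b + b * (n * (\<integral>m. (E m)\<^sup>2 \<partial>M))"
proof -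
  let ?P = "PiM {..<n} (\<lambda>_. M)" and ?I = "I \<times> (UNIV :: bool set)"
  interpret M: prob_space M by fact
  interpret P: prob_space ?P by (rule prob_space_PiM_const[OF M])
  define Y where "Y k \<omega> = signed (Z (\<omega> k))" for k and \<omega> :: "nat \<Rightarrow> 'a"
  have fI: "finite ?I" "?I \<noteq> {}" using I by auto
  have sm: "(\<lambda>m. signed (Z m) p) \<in> borel_measurable M" if "p \<in> ?I" for p
    using Zm that by (cases "snd p") (auto simp: signed_def)
  have Ym: "(\<lambda>\<omega>. Y k \<omega> p) \<in> borel_measurable ?P" if "k < n" "p \<in> ?I" for k p
    unfolding Y_def using PiM_coordinate(3)[OF M that(1) sm[OF that(2)]] .
  have D: "(\<lambda>\<omega>. E (\<omega> k)) \<in> borel_measurable ?P" if "k < n" for k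
    using PiM_coordinate(3)[OF M that Em] .
  have E2m: "(\<lambda>m. (E m)\<^sup>2) \<in> borel_measurable M" using Em by measurable
  have D2: "integrable ?P (\<lambda>\<omega>. (E (\<omega> k))\<^sup>2)" if "k < n" for k
    using PiM_coordinate(2)[OF M that E2m Ei] .
  have YD: "\<bar>Y k \<omega> p\<bar> \<le> E (\<omega> k)" if "k < n" "\<omega> \<in> space ?P" "p \<in> ?I" for k \<omega> p
  proof -
    have "\<omega> k \<in> space M" using that by (auto simp: space_PiM)
    then show ?thesis using ZE that by (auto simp: Y_def signed_def)
  qed
  have E1: "e \<le> 1 + e\<^sup>2" for e :: real
  proof -
    have "0 \<le> (e - 1/2)\<^sup>2" by simp
    then show ?thesis by (simp add: power2_eq_square algebra_simps)
  qed
  have sZ: "integrable M (\<lambda>m. signed (Z m) p)" "(\<integral>m. signed (Z m) p \<partial>M) = 0" if p: "p \<in> ?I" for p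
  proof -
    have "\<bar>signed (Z m) p\<bar> \<le> 1 + (E m)\<^sup>2" if "m \<in> space M" for m
      using ZE that p E1[of "E m"] by (force simp: signed_def)
    then show "integrable M (\<lambda>m. signed (Z m) p)"
      using Ei by (intro Bochner_Integration.integrable_bound[OF _ sm[OF p], of "\<lambda>m. 1 + (E m)\<^sup>2"]) auto
    show "(\<integral>m. signed (Z m) p \<partial>M) = 0" using mean p by (cases "snd p") (auto simp: signed_def)
  qed
  have orth: "(\<integral>\<omega>. Y k \<omega> p * softmax b ?I (\<lambda>p. \<Sum>l<k. Y l \<omega> p) p \<partial>?P) = 0" if k: "k < n" and p: "p \<in> ?I" for k p
  proof -
    let ?F = "\<lambda>\<omega>. Y k \<omega> p * softmax b ?I (\<lambda>p. \<Sum>l<k. Y l \<omega> p) p"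
    have "integrable ?P ?F"
    proof (rule Bochner_Integration.integrable_bound[OF PiM_coordinate(2)[OF M k sm[OF p] sZ(1)[OF p]]])
      show "?F \<in> borel_measurable ?P"
        using k by (intro borel_measurable_times Ym p softmax_measurable borel_measurable_sum) auto
      have "\<bar>?F \<omega>\<bar> \<le> \<bar>Y k \<omega> p\<bar>" for \<omega>
        using softmax_le_1[OF fI(1) p, of b "\<lambda>p. \<Sum>l<k. Y l \<omega> p"] softmax_nonneg[of b ?I "\<lambda>p. \<Sum>l<k. Y l \<omega> p" p]
        by (simp add: abs_mult mult_left_le)
      then show "AE \<omega> in ?P. norm (?F \<omega>) \<le> norm (signed (Z (\<omega> k)) p)" by (simp add: Y_def)
    qed
    then have "(\<integral>\<omega>. ?F \<omega> \<partial>?P) = (\<integral>x. (\<integral>y. ?F (x(k := y)) \<partial>M) \<partial>PiM ({..<n} - {k}) (\<lambda>_. M))"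
      by (rule PiM_integral_coordinate[OF M k])
    also have "\<dots> = (\<integral>x. (\<integral>y. signed (Z y) p * softmax b ?I (\<lambda>p. \<Sum>l<k. Y l x p) p \<partial>M) \<partial>PiM ({..<n} - {k}) (\<lambda>_. M))"
    proof -
      have "(\<Sum>l<k. Y l (x(k := y)) p) = (\<Sum>l<k. Y l x p)" for x y p
        by (intro sum.cong) (auto simp: Y_def)
      then show ?thesis by (simp add: Y_def)
    qed
    also have "\<dots> = 0" using sZ[OF p] by simp
    finally show ?thesis .
  qed
  have e: "(\<lambda>\<omega>. mx ?I (\<lambda>p. \<Sum>l<n. Y l \<omega> p)) = (\<lambda>\<omega>. mxa I (\<lambda>i. \<Sum>l<n. Z (\<omega> l) i))"
  proof
    fix \<omega>
    have "(\<lambda>p. \<Sum>l<n. Y l \<omega> p) = signed (\<lambda>i. \<Sum>l<n. Z (\<omega> l) i)"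
      by (auto simp: fun_eq_iff Y_def signed_def sum_negf)
    then show "mx ?I (\<lambda>p. \<Sum>l<n. Y l \<omega> p) = mxa I (\<lambda>i. \<Sum>l<n. Z (\<omega> l) i)" using mx_signed[OF I] by simp
  qed
  note mi = maximal_inequality[where M="?P" and I="?I" and b=b and n=n and Y=Y and D="\<lambda>k \<omega>. E (\<omega> k)", OF P.prob_space_axioms fI b Ym D D2 YD orth]
  show "integrable ?P (\<lambda>\<omega>. mxa I (\<lambda>i. \<Sum>l<n. Z (\<omega> l) i))"
    using mi(1) unfolding e by simp
  have "(\<Sum>k<n. \<integral>\<omega>. (E (\<omega> k))\<^sup>2 \<partial>?P) = n * (\<integral>m. (E m)\<^sup>2 \<partial>M)"
  proof -
    have "(\<Sum>k<n. \<integral>\<omega>. (E (\<omega> k))\<^sup>2 \<partial>?P) = (\<Sum>k<n. \<integral>m. (E m)\<^sup>2 \<partial>M)"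
      by (intro sum.cong refl PiM_coordinate(1)[OF M _ E2m]) auto
    then show ?thesis by simp
  qed
  then show "(\<integral>\<omega>. mxa I (\<lambda>i. \<Sum>l<n. Z (\<omega> l) i) \<partial>?P) \<le> ln (2 * card I) / b + b * (n * (\<integral>m. (E m)\<^sup>2 \<partial>M))"
    using mi(2) unfolding e card_signed by simp
qed

text \<open>The maximal inequality is applied to the centred products indexed by pairs, with
  envelope \<open>(D m)^2\<close> plus its mean. The constant is 7 = 3 + 4: the log of the doubled
  number of pairs is at most \<open>3 * lam\<close>, and the squared envelope has mean at most
  \<open>4 * m4\<close>.\<close>

lemma covariance_concentration:
  fixes n :: nat
  assumes X: "rvec I M X D" and I: "finite I" "I \<noteq> {}" and D4: "integrable M (\<lambda>m. D m ^ 4)"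
    and m4: "(\<integral>m. D m ^ 4 \<partial>M) \<le> m4" "0 < m4" and lam: "1 \<le> lam" "ln (card I) \<le> lam" and n: "0 < n"
  shows "integrable (PiM {..<n} (\<lambda>_. M)) (\<lambda>\<omega>. mxa (I \<times> I) (\<lambda>(i, j). (\<Sum>l<n. X (\<omega> l) i * X (\<omega> l) j) / n - (\<integral>m. X m i * X m j \<partial>M)))"
    and "(\<integral>\<omega>. mxa (I \<times> I) (\<lambda>(i, j). (\<Sum>l<n. X (\<omega> l) i * X (\<omega> l) j) / n - (\<integral>m. X m i * X m j \<partial>M)) \<partial>PiM {..<n} (\<lambda>_. M)) \<le> 7 * sqrt (lam * m4 / n)"
proof -
  let ?P = "PiM {..<n} (\<lambda>_. M)"
  interpret M: prob_space M using X by (simp add: rvec_def)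
  define Z where "Z m = (\<lambda>(i, j). X m i * X m j - (\<integral>m. X m i * X m j \<partial>M))" for m
  define d2 where "d2 = (\<integral>m. (D m)\<^sup>2 \<partial>M)"
  define E where "E m = (D m)\<^sup>2 + d2" for m
  have [measurable]: "D \<in> borel_measurable M" using X by (simp add: rvec_def)
  have D2i: "integrable M (\<lambda>m. (D m)\<^sup>2)"
  proof (rule Bochner_Integration.integrable_bound[of M "\<lambda>m. 1 + D m ^ 4"])
    have "d\<^sup>2 \<le> 1 + d ^ 4" for d :: real
    proof -
      have "0 \<le> (d\<^sup>2 - 1/2)\<^sup>2" by simp
      then show ?thesis by (simp add: power2_eq_square power4_eq_xxxx algebra_simps)
    qed
    then show "AE m in M. norm ((D m)\<^sup>2) \<le> norm (1 + D m ^ 4)" by simp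
  qed (use D4 in auto)
  have d2: "0 \<le> d2" by (simp add: d2_def)
  have d24: "d2\<^sup>2 \<le> (\<integral>m. D m ^ 4 \<partial>M)"
  proof -
    have "0 \<le> (\<integral>m. ((D m)\<^sup>2 - d2)\<^sup>2 \<partial>M)" by simp
    also have "(\<integral>m. ((D m)\<^sup>2 - d2)\<^sup>2 \<partial>M) = (\<integral>m. D m ^ 4 - 2 * d2 * (D m)\<^sup>2 + d2\<^sup>2 \<partial>M)"
      by (intro Bochner_Integration.integral_cong refl) (simp add: power2_eq_square power4_eq_xxxx algebra_simps)
    also have "\<dots> = (\<integral>m. D m ^ 4 \<partial>M) - 2 * d2 * d2 + d2\<^sup>2"
      using D4 D2i by (simp add: M.prob_space d2_def)
    finally show ?thesis by (simp add: power2_eq_square)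
  qed
  have Ei: "integrable M (\<lambda>m. (E m)\<^sup>2)" and E4: "(\<integral>m. (E m)\<^sup>2 \<partial>M) \<le> 4 * m4"
  proof -
    have e: "(E m)\<^sup>2 = D m ^ 4 + 2 * d2 * (D m)\<^sup>2 + d2\<^sup>2" for m
      by (simp add: E_def power2_eq_square power4_eq_xxxx algebra_simps)
    show "integrable M (\<lambda>m. (E m)\<^sup>2)" unfolding e using D4 D2i by auto
    have "(\<integral>m. (E m)\<^sup>2 \<partial>M) = (\<integral>m. D m ^ 4 \<partial>M) + 2 * d2 * d2 + d2\<^sup>2"
      unfolding e using D4 D2i by (simp add: M.prob_space d2_def)
    then show "(\<integral>m. (E m)\<^sup>2 \<partial>M) \<le> 4 * m4" using d24 m4 by (simp add: power2_eq_square)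
  qed
  have Xm: "\<And>i. i \<in> I \<Longrightarrow> (\<lambda>m. X m i) \<in> borel_measurable M" using X by (auto simp: rvec_def)
  have Zm: "\<forall>p\<in>I \<times> I. (\<lambda>m. Z m p) \<in> borel_measurable M"
    using Xm by (auto simp: Z_def)
  have XX: "\<bar>X m i * X m j\<bar> \<le> (D m)\<^sup>2" if "m \<in> space M" "i \<in> I" "j \<in> I" for m i j
    using mult_mono[of "\<bar>X m i\<bar>" "D m" "\<bar>X m j\<bar>" "D m"] X that by (auto simp: rvec_def abs_mult power2_eq_square)
  have ZE: "\<forall>m\<in>space M. \<forall>p\<in>I \<times> I. \<bar>Z m p\<bar> \<le> E m"
  proof safe
    fix m i j assume m: "m \<in> space M" "i \<in> I" "j \<in> I"
    have "\<bar>\<integral>m. X m i * X m j \<partial>M\<bar> \<le> d2" unfolding d2_def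
      using rvec_integrable(2)[OF X m(2,3)] D2i XX m
      by (intro order_trans[OF integral_abs_bound] integral_mono) auto
    then show "\<bar>Z m (i, j)\<bar> \<le> E m" using XX[OF m] by (simp add: Z_def E_def)
  qed
  have mean: "\<forall>p\<in>I \<times> I. (\<integral>m. Z m p \<partial>M) = 0"
    using rvec_integrable(2)[OF X] by (auto simp: Z_def M.prob_space)
  have II: "finite (I \<times> I)" "I \<times> I \<noteq> {}" using I by auto
  \<comment> \<open>Balances the two terms of the maximal inequality: \<open>lam / b\<close> and
    \<open>b * (n * m4)\<close> coincide.\<close>
  define b where "b = sqrt (lam / (n * m4))"
  have b0: "0 < b" using lam n m4 by (simp add: b_def)
  note mi = iid_maximal_inequality[OF M.prob_space_axioms II b0 Zm _ Ei ZE mean, of n]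
  have Em: "E \<in> borel_measurable M" unfolding E_def by measurable
  have e: "mxa (I \<times> I) (\<lambda>(i, j). (\<Sum>l<n. X (\<omega> l) i * X (\<omega> l) j) / n - (\<integral>m. X m i * X m j \<partial>M))
       = mxa (I \<times> I) (\<lambda>p. \<Sum>l<n. Z (\<omega> l) p) / n" for \<omega>
  proof -
    have s: "(case p of (i, j) \<Rightarrow> (\<Sum>l<n. X (\<omega> l) i * X (\<omega> l) j) / n - (\<integral>m. X m i * X m j \<partial>M)) = (\<Sum>l<n. Z (\<omega> l) p) / n" for p
      using n by (cases p) (simp add: Z_def sum_subtractf field_simps)
    show ?thesis unfolding s
    proof (rule order_antisym)
      show "mxa (I \<times> I) (\<lambda>p. (\<Sum>l<n. Z (\<omega> l) p) / n) \<le> mxa (I \<times> I) (\<lambda>p. \<Sum>l<n. Z (\<omega> l) p) / n"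
      proof (subst mxa_le_iff[OF II], rule ballI)
        fix p assume "p \<in> I \<times> I"
        from mxa_ge[OF II(1) this, of "\<lambda>p. \<Sum>l<n. Z (\<omega> l) p"] show "\<bar>(\<Sum>l<n. Z (\<omega> l) p) / n\<bar> \<le> mxa (I \<times> I) (\<lambda>p. \<Sum>l<n. Z (\<omega> l) p) / n"
          using n by (simp add: divide_right_mono)
      qed
      have "\<bar>\<Sum>l<n. Z (\<omega> l) p\<bar> \<le> n * mxa (I \<times> I) (\<lambda>p. (\<Sum>l<n. Z (\<omega> l) p) / n)" if "p \<in> I \<times> I" for p
        using mxa_ge[OF II(1) that, of "\<lambda>p. (\<Sum>l<n. Z (\<omega> l) p) / n"] n by (simp add: field_simps)
      then have "mxa (I \<times> I) (\<lambda>p. \<Sum>l<n. Z (\<omega> l) p) \<le> n * mxa (I \<times> I) (\<lambda>p. (\<Sum>l<n. Z (\<omega> l) p) / n)"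
        by (subst mxa_le_iff[OF II]) auto
      then show "mxa (I \<times> I) (\<lambda>p. \<Sum>l<n. Z (\<omega> l) p) / n \<le> mxa (I \<times> I) (\<lambda>p. (\<Sum>l<n. Z (\<omega> l) p) / n)"
        using n by (simp add: field_simps)
    qed
  qed
  show "integrable ?P (\<lambda>\<omega>. mxa (I \<times> I) (\<lambda>(i, j). (\<Sum>l<n. X (\<omega> l) i * X (\<omega> l) j) / n - (\<integral>m. X m i * X m j \<partial>M)))"
    unfolding e using mi(1)[OF Em] by simp
  have "(\<integral>\<omega>. mxa (I \<times> I) (\<lambda>(i, j). (\<Sum>l<n. X (\<omega> l) i * X (\<omega> l) j) / n - (\<integral>m. X m i * X m j \<partial>M)) \<partial>?P)
     = (\<integral>\<omega>. mxa (I \<times> I) (\<lambda>p. \<Sum>l<n. Z (\<omega> l) p) \<partial>?P) / n"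
    unfolding e by simp
  also have "\<dots> \<le> (ln (2 * card (I \<times> I)) / b + b * (n * (\<integral>m. (E m)\<^sup>2 \<partial>M))) / n"
    using mi(2)[OF Em] n by (intro divide_right_mono) auto
  also have "\<dots> \<le> (3 * lam / b + b * (n * (4 * m4))) / n"
  proof -
    have "ln (2 * card (I \<times> I)) = ln 2 + 2 * ln (card I)"
      using I by (simp add: card_cartesian_product ln_mult card_gt_0_iff)
    also have "\<dots> \<le> 3 * lam" using lam ln_2_less_1 by simp
    finally show ?thesis using b0 n E4 by (intro divide_right_mono add_mono mult_left_mono) auto
  qed
  also have "\<dots> = 7 * sqrt (lam * m4 / n)"
  proof -
    have q: "b * (n * m4) = sqrt (lam * m4 / n) * n"
    proof (rule power2_eq_imp_eq)
      show "(b * (n * m4))\<^sup>2 = (sqrt (lam * m4 / n) * n)\<^sup>2"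
        using lam n m4 by (simp add: b_def power_mult_distrib field_simps power2_eq_square)
    qed (use b0 m4 lam in auto)
    have "lam / b = sqrt (lam * m4 / n) * n"
    proof -
      have "lam = b * b * (n * m4)" using lam n m4 by (simp add: b_def)
      then have "lam / b = b * (n * m4)" using b0 by (simp add: field_simps)
      then show ?thesis using q by simp
    qed
    then have "3 * lam / b + b * (n * (4 * m4)) = 7 * (sqrt (lam * m4 / n) * n)"
    proof -
      have "3 * lam / b + b * (n * (4 * m4)) = 3 * (lam / b) + 4 * (b * (n * m4))" by simp
      then show ?thesis using q \<open>lam / b = sqrt (lam * m4 / n) * n\<close> by (simp only:)
    qed
    then show ?thesis using n by simp
  qed
  finally show "(\<integral>\<omega>. mxa (I \<times> I) (\<lambda>(i, j). (\<Sum>l<n. X (\<omega> l) i * X (\<omega> l) j) / n - (\<integral>m. X m i * X m j \<partial>M)) \<partial>?P) \<le> 7 * sqrt (lam * m4 / n)" .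
qed

section \<open>Gaussian multipliers and the approximation of oracle sums\<close>

lemma integral_pair_mult:
  fixes f :: "'a \<Rightarrow> real" and g :: "'b \<Rightarrow> real"
  assumes M: "prob_space M" and N: "prob_space N" and f: "integrable M f" and g: "integrable N g"
  shows "integrable (M \<Otimes>\<^sub>M N) (\<lambda>p. f (fst p) * g (snd p))"
    and "(\<integral>p. f (fst p) * g (snd p) \<partial>(M \<Otimes>\<^sub>M N)) = (\<integral>x. f x \<partial>M) * (\<integral>y. g y \<partial>N)"
proof -
  interpret M: prob_space M by fact
  interpret N: prob_space N by fact
  interpret P: pair_prob_space M N by standard
  have [measurable]: "f \<in> borel_measurable M" "g \<in> borel_measurable N" using f g by auto
  show i: "integrable (M \<Otimes>\<^sub>M N) (\<lambda>p. f (fst p) * g (snd p))"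
  proof (rule P.Fubini_integrable)
    show "integrable M (\<lambda>x. \<integral>y. norm (f (fst (x, y)) * g (snd (x, y))) \<partial>N)"
      using f g by (simp add: abs_mult)
    show "AE x in M. integrable N (\<lambda>y. f (fst (x, y)) * g (snd (x, y)))" using g by simp
  qed measurable
  show "(\<integral>p. f (fst p) * g (snd p) \<partial>(M \<Otimes>\<^sub>M N)) = (\<integral>x. f x \<partial>M) * (\<integral>y. g y \<partial>N)"
    using P.integral_fst'[OF i] by simp
qed

text \<open>A Gaussian multiplier matches the first two moments and keeps an envelope without a
  dimension factor; given the data, the multiplier sum is exactly Gaussian.\<close>

lemma multiplier_rvec:
  assumes X: "rvec I M X D"
  shows "rvec I (M \<Otimes>\<^sub>M std_normal_distribution) (\<lambda>p i. snd p * X (fst p) i) (\<lambda>p. \<bar>snd p\<bar> * D (fst p))"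
    and "\<And>i j. i \<in> I \<Longrightarrow> j \<in> I \<Longrightarrow> (\<integral>p. (snd p * X (fst p) i) * (snd p * X (fst p) j) \<partial>(M \<Otimes>\<^sub>M std_normal_distribution)) = (\<integral>m. X m i * X m j \<partial>M)"
    and "(\<integral>p. (\<bar>snd p\<bar> * D (fst p)) ^ 3 \<partial>(M \<Otimes>\<^sub>M std_normal_distribution)) \<le> 2 * (\<integral>m. D m ^ 3 \<partial>M)"
proof -
  let ?N = "std_normal_distribution"
  interpret M: prob_space M using X by (simp add: rvec_def)
  interpret N: prob_space ?N by (rule prob_space_std_normal)
  interpret P: pair_prob_space M ?N by standard
  note ip = integral_pair_mult[OF M.prob_space_axioms N.prob_space_axioms]
  have [measurable]: "D \<in> borel_measurable M" using X by (simp add: rvec_def)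
  have Xm: "\<And>i. i \<in> I \<Longrightarrow> (\<lambda>m. X m i) \<in> borel_measurable M" using X by (auto simp: rvec_def)
  have D3: "integrable M (\<lambda>m. D m ^ 3)" using X by (simp add: rvec_def)
  have e3: "(\<bar>snd p\<bar> * D (fst p)) ^ 3 = D (fst p) ^ 3 * \<bar>snd p\<bar> ^ 3" for p :: "'b \<times> real"
    by (simp add: power_mult_distrib)
  have D30: "0 \<le> (\<integral>m. D m ^ 3 \<partial>M)" using X by (intro integral_nonneg_AE) (auto simp: rvec_def)
  show "rvec I (M \<Otimes>\<^sub>M ?N) (\<lambda>p i. snd p * X (fst p) i) (\<lambda>p. \<bar>snd p\<bar> * D (fst p))"
    unfolding rvec_def
  proof (intro conjI ballI)
    show "prob_space (M \<Otimes>\<^sub>M ?N)" by (rule P.prob_space_axioms)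
    show "integrable (M \<Otimes>\<^sub>M ?N) (\<lambda>p. (\<bar>snd p\<bar> * D (fst p)) ^ 3)"
      unfolding e3 by (rule ip(1)[OF D3 std_normal_moments(4)])
    show "(\<lambda>p. \<bar>snd p\<bar> * D (fst p)) \<in> borel_measurable (M \<Otimes>\<^sub>M ?N)" by measurable
  next
    fix i assume i: "i \<in> I"
    note [measurable] = Xm[OF i]
    show "(\<lambda>p. snd p * X (fst p) i) \<in> borel_measurable (M \<Otimes>\<^sub>M ?N)" by measurable
    have x: "integrable ?N (\<lambda>x. x)" using std_normal_moments(3)[of 1] by simp
    show "(\<integral>p. snd p * X (fst p) i \<partial>(M \<Otimes>\<^sub>M ?N)) = 0"
      using ip(2)[OF rvec_integrable(1)[OF X i i] x] by (simp add: std_normal_moments(1) mult.commute)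
  next
    fix p assume p: "p \<in> space (M \<Otimes>\<^sub>M ?N)"
    then have p1: "fst p \<in> space M" by (auto simp: space_pair_measure)
    then show "0 \<le> \<bar>snd p\<bar> * D (fst p)" using X by (auto simp: rvec_def)
    fix i assume "i \<in> I"
    then show "\<bar>snd p * X (fst p) i\<bar> \<le> \<bar>snd p\<bar> * D (fst p)"
      using X p1 by (auto simp: rvec_def abs_mult intro!: mult_left_mono)
  qed
  show "(\<integral>p. (snd p * X (fst p) i) * (snd p * X (fst p) j) \<partial>(M \<Otimes>\<^sub>M ?N)) = (\<integral>m. X m i * X m j \<partial>M)" if "i \<in> I" "j \<in> I" for i j
  proof -
    have "(\<lambda>p. (snd p * X (fst p) i) * (snd p * X (fst p) j)) = (\<lambda>p. (X (fst p) i * X (fst p) j) * (snd p)\<^sup>2)"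
      by (auto simp: power2_eq_square)
    then show ?thesis
      using ip(2)[OF rvec_integrable(2)[OF X that] std_normal_moments(3)[of 2]] by (simp add: std_normal_moments(2))
  qed
  show "(\<integral>p. (\<bar>snd p\<bar> * D (fst p)) ^ 3 \<partial>(M \<Otimes>\<^sub>M ?N)) \<le> 2 * (\<integral>m. D m ^ 3 \<partial>M)"
    unfolding e3 ip(2)[OF D3 std_normal_moments(4)]
    using mult_left_mono[OF std_normal_moments(5) D30] by (simp add: mult.commute)
qed

text \<open>Unzip the sample of pairs and integrate the multipliers with the data fixed: the sum is
  then a linear image of a standard Gaussian vector. Its matrix has entries
  \<open>c * X (x l) i\<close>, so for \<open>c = 1 / sqrt n\<close> its covariance is the empirical
  second-moment matrix.\<close>

lemma multiplier_sum_gaussian: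
  fixes n :: nat
  assumes phi: "test_fun I \<phi>" and M: "prob_space M" and Xm: "\<forall>i\<in>I. (\<lambda>m. X m i) \<in> borel_measurable M"
  shows "(\<integral>\<omega>. \<phi> (\<lambda>i. \<Sum>l<n. c * (snd (\<omega> l) * X (fst (\<omega> l)) i)) \<partial>PiM {..<n} (\<lambda>_. M \<Otimes>\<^sub>M std_normal_distribution))
     = (\<integral>x. (\<integral>\<xi>. \<phi> (lin (\<lambda>i l. c * X (x l) i) {..<n} \<xi>) \<partial>gstd {..<n}) \<partial>PiM {..<n} (\<lambda>_. M))"
    and "integrable (PiM {..<n} (\<lambda>_. M)) (\<lambda>x. \<integral>\<xi>. \<phi> (lin (\<lambda>i l. c * X (x l) i) {..<n} \<xi>) \<partial>gstd {..<n})"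
proof -
  let ?N = "std_normal_distribution" and ?J = "{..<n}"
  interpret M: prob_space M by fact
  interpret N: prob_space ?N by (rule prob_space_std_normal)
  interpret MN: pair_prob_space M ?N by standard
  interpret PM: prob_space "PiM ?J (\<lambda>_. M)" by (rule prob_space_PiM_const[OF M])
  interpret PN: prob_space "PiM ?J (\<lambda>_. ?N)" by (rule prob_space_PiM_const[OF prob_space_std_normal])
  interpret P: pair_prob_space "PiM ?J (\<lambda>_. M)" "PiM ?J (\<lambda>_. ?N)" by standard
  interpret Q: prob_space "PiM ?J (\<lambda>_. M \<Otimes>\<^sub>M ?N)" by (rule prob_space_PiM_const[OF MN.prob_space_axioms])
  let ?g = "\<lambda>p. \<lambda>i\<in>?J. (fst p i, snd p i)"
  let ?F = "\<lambda>\<omega>. \<phi> (\<lambda>i. \<Sum>l<n. c * (snd (\<omega> l) * X (fst (\<omega> l)) i))"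
  have d: "distr (PiM ?J (\<lambda>_. M) \<Otimes>\<^sub>M PiM ?J (\<lambda>_. ?N)) (PiM ?J (\<lambda>_. M \<Otimes>\<^sub>M ?N)) ?g = PiM ?J (\<lambda>_. M \<Otimes>\<^sub>M ?N)"
    using distr_pair_PiM[OF _ M prob_space_std_normal measurable_ident, of ?J] by (simp add: id_def)
  have g: "?g \<in> measurable (PiM ?J (\<lambda>_. M) \<Otimes>\<^sub>M PiM ?J (\<lambda>_. ?N)) (PiM ?J (\<lambda>_. M \<Otimes>\<^sub>M ?N))"
  proof (rule measurable_restrict, rule measurable_Pair)
    fix i assume i: "i \<in> ?J"
    show "(\<lambda>p. fst p i) \<in> measurable (PiM ?J (\<lambda>_. M) \<Otimes>\<^sub>M PiM ?J (\<lambda>_. ?N)) M"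
      by (rule measurable_compose[OF measurable_fst measurable_component_singleton[OF i]])
    show "(\<lambda>p. snd p i) \<in> measurable (PiM ?J (\<lambda>_. M) \<Otimes>\<^sub>M PiM ?J (\<lambda>_. ?N)) ?N"
      by (rule measurable_compose[OF measurable_snd measurable_component_singleton[OF i]])
  qed
  have sm: "(\<lambda>p. c * (snd p * X (fst p) i)) \<in> borel_measurable (M \<Otimes>\<^sub>M ?N)" if "i \<in> I" for i
  proof -
    have [measurable]: "(\<lambda>m. X m i) \<in> borel_measurable M" using Xm that by simp
    show ?thesis by measurable
  qed
  have F: "?F \<in> borel_measurable (PiM ?J (\<lambda>_. M \<Otimes>\<^sub>M ?N))"
  proof (rule test_fun_measurable[OF phi])
    fix i assume "i \<in> I"
    from sum_PiM_measurable[where X="\<lambda>p i. c * (snd p * X (fst p) i)" and i=i, OF sm[OF this]]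
    show "(\<lambda>\<omega>. \<Sum>l<n. c * (snd (\<omega> l) * X (fst (\<omega> l)) i)) \<in> borel_measurable (PiM ?J (\<lambda>_. M \<Otimes>\<^sub>M ?N))" .
  qed
  have e: "?F (?g p) = \<phi> (lin (\<lambda>i l. c * X (fst p l) i) ?J (snd p))" for p
  proof -
    have "(\<Sum>l<n. c * (snd (?g p l) * X (fst (?g p l)) i)) = lin (\<lambda>i l. c * X (fst p l) i) ?J (snd p) i" for i
      unfolding lin_def by (intro sum.cong) auto
    then show ?thesis by (simp only:)
  qed
  have i: "integrable (PiM ?J (\<lambda>_. M) \<Otimes>\<^sub>M PiM ?J (\<lambda>_. ?N)) (\<lambda>p. ?F (?g p))"
    using measurable_compose[OF g F] test_fun_bound[OF phi] by (intro P.integrable_const_bound[of _ 1]) auto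
  have "(\<integral>\<omega>. ?F \<omega> \<partial>PiM ?J (\<lambda>_. M \<Otimes>\<^sub>M ?N)) = (\<integral>p. ?F (?g p) \<partial>(PiM ?J (\<lambda>_. M) \<Otimes>\<^sub>M PiM ?J (\<lambda>_. ?N)))"
    using integral_distr[OF g F] d by simp
  also have "\<dots> = (\<integral>x. (\<integral>\<xi>. \<phi> (lin (\<lambda>i l. c * X (x l) i) ?J \<xi>) \<partial>gstd ?J) \<partial>PiM ?J (\<lambda>_. M))"
    using P.integral_fst'[OF i] unfolding e gstd_def by simp
  finally show "(\<integral>\<omega>. ?F \<omega> \<partial>PiM ?J (\<lambda>_. M \<Otimes>\<^sub>M ?N)) = (\<integral>x. (\<integral>\<xi>. \<phi> (lin (\<lambda>i l. c * X (x l) i) ?J \<xi>) \<partial>gstd ?J) \<partial>PiM ?J (\<lambda>_. M))" .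
  show "integrable (PiM ?J (\<lambda>_. M)) (\<lambda>x. \<integral>\<xi>. \<phi> (lin (\<lambda>i l. c * X (x l) i) ?J \<xi>) \<partial>gstd ?J)"
    using P.integrable_fst'[OF i] unfolding e gstd_def by simp
qed

text \<open>Passing to multiplied summands has no covariance error and a cubic error with moment
  \<open>3 * q\<close>, namely \<open>q\<close> for the data and \<open>2 * q\<close> for the
  multiplied data. Passing from the conditionally Gaussian sum to the target has only a covariance
  error, averaged over the data. Smoothing is undone at the end by anticoncentration.\<close>

lemma gaussian_approximation:
  fixes n :: nat
  assumes X: "rvec I M X D" and I: "finite I" "I \<noteq> {}" and n: "0 < n"
    and D4: "integrable M (\<lambda>m. D m ^ 4)" and m3: "(\<integral>m. D m ^ 3 \<partial>M) \<le> q" and m4: "(\<integral>m. D m ^ 4 \<partial>M) \<le> q\<^sup>2" and q: "0 < q"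
    and lam: "1 \<le> lam" "ln (card I) \<le> lam" and s: "0 < s" "s \<le> 1"
    and small: "q * (lam ^ 3 * sqrt lam) \<le> s ^ 4 * sqrt n"
    and unit: "\<forall>i\<in>I. (\<integral>m. X m i * X m i \<partial>M) = 1"
    and J: "finite J" and cov: "\<forall>i\<in>I. \<forall>j\<in>I. (\<Sum>m\<in>J. L i m * L j m) = (\<integral>m. X m i * X m j \<partial>M)"
  shows "\<bar>measure (PiM {..<n} (\<lambda>_. M)) {\<omega>\<in>space (PiM {..<n} (\<lambda>_. M)). mx I (\<lambda>i. (\<Sum>l<n. X (\<omega> l) i) / sqrt n) \<le> t}
     - measure (gstd J) {\<xi>\<in>space (gstd J). mx I (lin L J \<xi>) \<le> t}\<bar> \<le> 16000 * s"
proof -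
  let ?P = "PiM {..<n} (\<lambda>_. M)" and ?N = "std_normal_distribution"
  interpret M: prob_space M using X by (simp add: rvec_def)
  interpret P: prob_space ?P by (rule prob_space_PiM_const[OF M.prob_space_axioms])
  interpret N: prob_space ?N by (rule prob_space_std_normal)
  interpret MN: pair_prob_space M ?N by standard
  \<comment> \<open>The widest smoothing that anticoncentration tolerates: a window of
    \<open>2 * del\<close> carries Gaussian mass at most \<open>54 * s\<close>. With it,
    \<open>M2\<close> and \<open>M3\<close> have orders \<open>lam^2 / s^2\<close> and
    \<open>lam^(7/2) / s^3\<close>, which is what \<open>small\<close> is made for.\<close>
  define del where "del = s / sqrt lam"
  have del: "0 < del" using s lam by (simp add: del_def)
  define M2 where "M2 = 700 * lam / del\<^sup>2"
  define M3 where "M3 = 4200 * lam\<^sup>2 / del ^ 3"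
  have M0: "0 \<le> M2" "0 \<le> M3" using lam del by (auto simp: M2_def M3_def)
  define c where "c = 1 / sqrt n"
  have c0: "0 < c" using n by (simp add: c_def)
  define F where "F t = measure (gstd J) {\<xi>\<in>space (gstd J). mx I (lin L J \<xi>) \<le> t}" for t
  define S where "S \<omega> i = (\<Sum>l<n. X (\<omega> l) i) / sqrt n" for \<omega> i
  define Dl where "Dl \<omega> = mxa (I \<times> I) (\<lambda>(i, j). (\<Sum>l<n. X (\<omega> l) i * X (\<omega> l) j) / n - (\<integral>m. X m i * X m j \<partial>M))" for \<omega>
  have Xm: "\<forall>i\<in>I. (\<lambda>m. X m i) \<in> borel_measurable M" using X by (auto simp: rvec_def)
  have sl: "0 < sqrt lam" "1 \<le> sqrt lam" "(sqrt lam)\<^sup>2 = lam" using lam by auto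
  have sn: "0 < sqrt n" using n by simp
  note cc = covariance_concentration[OF X I D4 m4 _ lam n]
  have Dli: "integrable ?P Dl" and Dlb: "(\<integral>\<omega>. Dl \<omega> \<partial>?P) \<le> 7 * sqrt (lam * q\<^sup>2 / n)"
    using cc q by (simp_all add: Dl_def[abs_def])
  define \<eta> where "\<eta> = M3 * (3 * q / sqrt n) + M2 / 2 * (7 * sqrt (lam * q\<^sup>2 / n))"
  have main: "\<bar>(\<integral>\<omega>. mx_cutoff lam del I 0 (\<lambda>i. S \<omega> i - a) \<partial>?P) - (\<integral>\<xi>. mx_cutoff lam del I 0 (\<lambda>i. lin L J \<xi> i - a) \<partial>gstd J)\<bar> \<le> \<eta>" for a
  proof -
    define \<phi> where "\<phi> x = mx_cutoff lam del I 0 (\<lambda>i. x i - a)" for x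
    have tf: "test_fun I \<phi>" unfolding \<phi>_def[abs_def] by (rule test_fun_mx_cutoff[OF I])
    have t3: "taylor3 I M2 M3 \<phi>" unfolding \<phi>_def[abs_def] M2_def M3_def
      by (rule taylor3_shift[OF taylor3_mx_cutoff[OF I lam(1) del]])
    have step: "\<bar>(\<integral>m. \<phi> (\<lambda>i. r i + c * X m i) \<partial>M) - (\<integral>p. \<phi> (\<lambda>i. r i + c * (snd p * X (fst p) i)) \<partial>(M \<Otimes>\<^sub>M ?N))\<bar> \<le> M3 * (c ^ 3 * (3 * q))" for r
    proof -
      have "\<bar>(\<integral>m. \<phi> (\<lambda>i. r i + c * X m i) \<partial>M) - (\<integral>p. \<phi> (\<lambda>i. r i + c * (snd p * X (fst p) i)) \<partial>(M \<Otimes>\<^sub>M ?N))\<bar>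
        \<le> M2 * 0 / 2 + M3 * ((\<integral>m. (\<bar>c\<bar> * D m) ^ 3 \<partial>M) + (\<integral>p. (\<bar>c\<bar> * (\<bar>snd p\<bar> * D (fst p))) ^ 3 \<partial>(M \<Otimes>\<^sub>M ?N)))"
      proof (rule lindeberg_one_step[OF I(1) rvec_scale[OF X] rvec_scale[OF multiplier_rvec(1)[OF X]] tf t3 M0(2)])
        fix i j assume ij: "i \<in> I" "j \<in> I"
        have "(\<integral>m. c * X m i * (c * X m j) \<partial>M) = (\<integral>m. (c * c) * (X m i * X m j) \<partial>M)"
          by (simp add: ac_simps)
        moreover have "(\<integral>p. c * (snd p * X (fst p) i) * (c * (snd p * X (fst p) j)) \<partial>(M \<Otimes>\<^sub>M ?N)) = (\<integral>p. (c * c) * ((snd p * X (fst p) i) * (snd p * X (fst p) j)) \<partial>(M \<Otimes>\<^sub>M ?N))"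
          by (simp add: ac_simps)
        ultimately show "\<bar>(\<integral>m. c * X m i * (c * X m j) \<partial>M) - (\<integral>p. c * (snd p * X (fst p) i) * (c * (snd p * X (fst p) j)) \<partial>(M \<Otimes>\<^sub>M ?N))\<bar> \<le> 0"
          using multiplier_rvec(2)[OF X ij] by simp
      qed simp
      also have "(\<integral>m. (\<bar>c\<bar> * D m) ^ 3 \<partial>M) + (\<integral>p. (\<bar>c\<bar> * (\<bar>snd p\<bar> * D (fst p))) ^ 3 \<partial>(M \<Otimes>\<^sub>M ?N))
          = c ^ 3 * ((\<integral>m. D m ^ 3 \<partial>M) + (\<integral>p. (\<bar>snd p\<bar> * D (fst p)) ^ 3 \<partial>(M \<Otimes>\<^sub>M ?N)))"
        using c0 by (simp add: power_mult_distrib[of c] distrib_left)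
      finally have "\<bar>(\<integral>m. \<phi> (\<lambda>i. r i + c * X m i) \<partial>M) - (\<integral>p. \<phi> (\<lambda>i. r i + c * (snd p * X (fst p) i)) \<partial>(M \<Otimes>\<^sub>M ?N))\<bar>
        \<le> M3 * (c ^ 3 * ((\<integral>m. D m ^ 3 \<partial>M) + (\<integral>p. (\<bar>snd p\<bar> * D (fst p)) ^ 3 \<partial>(M \<Otimes>\<^sub>M ?N))))" by simp
      also have "\<dots> \<le> M3 * (c ^ 3 * (3 * q))"
        using multiplier_rvec(3)[OF X] m3 c0 M0 by (intro mult_left_mono) auto
      finally show ?thesis .
    qed
    have xm: "\<And>i. i \<in> I \<Longrightarrow> (\<lambda>m. c * X m i) \<in> borel_measurable M" using Xm by auto
    have ym: "(\<lambda>p. c * (snd p * X (fst p) i)) \<in> borel_measurable (M \<Otimes>\<^sub>M ?N)" if "i \<in> I" for i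
    proof -
      have [measurable]: "(\<lambda>m. X m i) \<in> borel_measurable M" using Xm that by simp
      show ?thesis by measurable
    qed
    have "\<bar>(\<integral>\<omega>. \<phi> (\<lambda>i. 0 + (\<Sum>k<n. c * X (\<omega> k) i)) \<partial>?P) - (\<integral>\<omega>. \<phi> (\<lambda>i. 0 + (\<Sum>k<n. c * (snd (\<omega> k) * X (fst (\<omega> k)) i))) \<partial>PiM {..<n} (\<lambda>_. M \<Otimes>\<^sub>M ?N))\<bar> \<le> real n * (M3 * (c ^ 3 * (3 * q)))"
      by (rule lindeberg_n_step[where s="\<lambda>_. 0", OF tf M.prob_space_axioms MN.prob_space_axioms]) (rule xm ym step, assumption?)+
    moreover have "(\<lambda>i. \<Sum>k<n. c * X (\<omega> k) i) = S \<omega>" for \<omega>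
      by (simp add: fun_eq_iff S_def c_def sum_divide_distrib)
    moreover have "real n * (M3 * (c ^ 3 * (3 * q))) = M3 * (3 * q / sqrt n)"
    proof -
      have "real n * (c * c) = 1" using n by (simp add: c_def)
      then have "real n * c ^ 3 = c" by (simp add: power3_eq_cube mult.assoc[symmetric])
      then have "real n * (M3 * (c ^ 3 * (3 * q))) = M3 * (c * (3 * q))" by (simp add: mult.left_commute mult.assoc[symmetric])
      then show ?thesis by (simp add: c_def)
    qed
    ultimately have l1: "\<bar>(\<integral>\<omega>. \<phi> (S \<omega>) \<partial>?P) - (\<integral>x. (\<integral>\<xi>. \<phi> (lin (\<lambda>i l. c * X (x l) i) {..<n} \<xi>) \<partial>gstd {..<n}) \<partial>?P)\<bar> \<le> M3 * (3 * q / sqrt n)"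
      using multiplier_sum_gaussian(1)[OF tf M.prob_space_axioms Xm, of n c] by simp
    have cmp: "\<bar>(\<integral>\<xi>. \<phi> (lin (\<lambda>i l. c * X (x l) i) {..<n} \<xi>) \<partial>gstd {..<n}) - (\<integral>\<xi>. \<phi> (lin L J \<xi>) \<partial>gstd J)\<bar> \<le> M2 * Dl x / 2" for x
    proof (rule gauss_comparison[OF I(1) _ J tf t3 M0(2)])
      show "0 \<le> Dl x" unfolding Dl_def using I by (intro mxa_nonneg) auto
      fix i j assume ij: "i \<in> I" "j \<in> I"
      have "(\<Sum>m<n. c * X (x m) i * (c * X (x m) j)) = (\<Sum>l<n. X (x l) i * X (x l) j) / n"
        by (simp add: c_def sum_divide_distrib)
      then show "\<bar>(\<Sum>m<n. c * X (x m) i * (c * X (x m) j)) - (\<Sum>m\<in>J. L i m * L j m)\<bar> \<le> Dl x"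
        unfolding Dl_def using mxa_ge[of "I \<times> I" "(i, j)" "\<lambda>(i, j). (\<Sum>l<n. X (x l) i * X (x l) j) / n - (\<integral>m. X m i * X m j \<partial>M)"] I ij cov by simp
    qed simp
    note ig = multiplier_sum_gaussian(2)[OF tf M.prob_space_axioms Xm, of n c]
    have "\<bar>(\<integral>x. (\<integral>\<xi>. \<phi> (lin (\<lambda>i l. c * X (x l) i) {..<n} \<xi>) \<partial>gstd {..<n}) \<partial>?P) - (\<integral>\<xi>. \<phi> (lin L J \<xi>) \<partial>gstd J)\<bar>
       = \<bar>\<integral>x. (\<integral>\<xi>. \<phi> (lin (\<lambda>i l. c * X (x l) i) {..<n} \<xi>) \<partial>gstd {..<n}) - (\<integral>\<xi>. \<phi> (lin L J \<xi>) \<partial>gstd J) \<partial>?P\<bar>"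
      using ig by (simp add: P.prob_space)
    also have "\<dots> \<le> (\<integral>x. M2 * Dl x / 2 \<partial>?P)"
      using ig cmp Dli by (intro order_trans[OF integral_abs_bound] integral_mono) auto
    also have "\<dots> = M2 / 2 * (\<integral>x. Dl x \<partial>?P)" by simp
    also have "\<dots> \<le> M2 / 2 * (7 * sqrt (lam * q\<^sup>2 / n))" using Dlb M0 by (intro mult_left_mono) auto
    finally show ?thesis using l1 unfolding \<eta>_def \<phi>_def by linarith
  qed
  have \<eta>: "\<eta> \<le> 12600 * s + 2450 * s\<^sup>2"
  proof -
    have d2: "del\<^sup>2 = s\<^sup>2 / lam" using sl by (simp add: del_def power_divide)
    have d3: "del ^ 3 = s ^ 3 / (lam * sqrt lam)" using sl lam by (simp add: del_def power_divide power3_eq_cube)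
    define w where "w = q * (lam ^ 3 * sqrt lam) / sqrt n"
    have w: "w \<le> s ^ 4" "0 \<le> w" using small sn q lam by (auto simp: w_def divide_le_eq)
    have "M3 * (3 * q / sqrt n) = 12600 * w / s ^ 3"
      unfolding M3_def d3 w_def by (simp add: power2_eq_square power3_eq_cube ac_simps)
    also have "\<dots> \<le> 12600 * s ^ 4 / s ^ 3" using w s by (intro divide_right_mono) auto
    also have "\<dots> = 12600 * s" using s by (simp add: power4_eq_xxxx power3_eq_cube)
    finally have 1: "M3 * (3 * q / sqrt n) \<le> 12600 * s" .
    have "M2 / 2 * (7 * sqrt (lam * q\<^sup>2 / n)) = 2450 * (q * (lam\<^sup>2 * sqrt lam) / sqrt n) / s\<^sup>2"
      unfolding M2_def d2 using q lam by (simp add: real_sqrt_mult real_sqrt_divide power2_eq_square ac_simps)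
    also have "\<dots> \<le> 2450 * w / s\<^sup>2"
    proof -
      have "lam\<^sup>2 \<le> lam ^ 3" using lam by (intro power_increasing) auto
      then have "q * (lam\<^sup>2 * sqrt lam) / sqrt n \<le> w" unfolding w_def using q sl sn
        by (intro divide_right_mono mult_left_mono mult_right_mono) auto
      then show ?thesis using s by (intro divide_right_mono mult_left_mono) auto
    qed
    also have "\<dots> \<le> 2450 * s ^ 4 / s\<^sup>2" using w s by (intro divide_right_mono) auto
    also have "\<dots> = 2450 * s\<^sup>2" using s by (simp add: power4_eq_xxxx power2_eq_square)
    finally show ?thesis using 1 unfolding \<eta>_def by linarith
  qed
  have anti: "F (b + 2 * del) - F b \<le> 54 * s" for b
  proof -
    have "\<forall>i\<in>I. (\<Sum>m\<in>J. L i m * L i m) = 1" using cov unit by auto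
    then have "F (b + 2 * del) - F b \<le> 9 * (1 + sqrt (2 * ln (card I))) * (b + 2 * del - b)"
      unfolding F_def using del by (intro gauss_anticoncentration[OF I J]) auto
    also have "\<dots> \<le> 9 * (sqrt lam + 2 * sqrt lam) * (2 * del)"
    proof -
      have "sqrt (2 * ln (card I)) \<le> sqrt (4 * lam)" using lam by (intro real_sqrt_le_mono) linarith
      also have "\<dots> = 2 * sqrt lam" by (simp add: real_sqrt_mult)
      finally have x: "sqrt (2 * ln (card I)) \<le> 2 * sqrt lam" .
      have "9 * (1 + x) \<le> 9 * (y + 2 * y)" if "x \<le> 2 * y" "1 \<le> y" for x y :: real using that by simp
      from this[OF x sl(2)] have "9 * (1 + sqrt (2 * ln (card I))) \<le> 9 * (sqrt lam + 2 * sqrt lam)" .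
      from mult_right_mono[OF this, of "2 * del"] show ?thesis using del by simp
    qed
    also have "\<dots> = 54 * s" using sl(1) by (simp add: del_def)
    finally show ?thesis .
  qed
  have Sm: "\<And>i. i \<in> I \<Longrightarrow> (\<lambda>\<omega>. S \<omega> i) \<in> borel_measurable ?P"
    unfolding S_def using sum_PiM_measurable Xm by (intro borel_measurable_divide) auto
  have F': "F b = measure (gstd J) {\<xi>\<in>space (gstd J). \<forall>i\<in>I. lin L J \<xi> i \<le> b}" for b
    unfolding F_def mx_le_iff[OF I] ..
  define p where "p b = measure ?P {\<omega>\<in>space ?P. \<forall>i\<in>I. S \<omega> i \<le> b}" for b
  have up: "p b \<le> F (b + 2 * del) + \<eta>" for b
    using cutoff_sandwich(1)[OF I lam del P.prob_space_axioms, where X=S and c="\<lambda>_. b", OF Sm]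
      cutoff_sandwich(2)[OF I lam del prob_space_gstd[of J], where X="lin L J" and c="\<lambda>_. b", OF lin_measurable]
      main[of b] unfolding p_def F' by linarith
  have lo: "F b \<le> p (b + 2 * del) + \<eta>" for b
    using cutoff_sandwich(2)[OF I lam del P.prob_space_axioms, where X=S and c="\<lambda>_. b", OF Sm]
      cutoff_sandwich(1)[OF I lam del prob_space_gstd[of J], where X="lin L J" and c="\<lambda>_. b", OF lin_measurable]
      main[of b] unfolding p_def F' by linarith
  have "s\<^sup>2 \<le> s" using s by (simp add: power2_eq_square mult_left_le)
  \<comment> \<open>The budget is 12600 for the cubic terms, 2450 for the covariances and 54 for
    anticoncentration.\<close>
  then have "\<bar>p t - F t\<bar> \<le> 16000 * s"
    using up[of t] lo[of "t - 2 * del"] anti[of t] anti[of "t - 2 * del"] \<eta> s by simp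
  then show ?thesis unfolding p_def F_def S_def mx_le_iff[OF I] .
qed

section \<open>Conditional independence and residuals\<close>

text \<open>The densities \<open>a\<close> and \<open>b\<close> produce the same image measure under
  \<open>Z\<close>, so equality on events of \<open>Z\<close> extends to all nonnegative functions
  of \<open>Z\<close>, with no integrability condition.\<close>

lemma nn_integral_comp_eqI:
  assumes Z: "Z \<in> measurable P N" and [measurable]: "a \<in> borel_measurable P" "b \<in> borel_measurable P"
    and eq: "\<And>C. C \<in> sets N \<Longrightarrow> (\<integral>\<^sup>+w. a w * indicator C (Z w) \<partial>P) = (\<integral>\<^sup>+w. b w * indicator C (Z w) \<partial>P)"
    and k: "k \<in> borel_measurable N"
  shows "(\<integral>\<^sup>+w. a w * k (Z w) \<partial>P) = (\<integral>\<^sup>+w. b w * k (Z w) \<partial>P :: ennreal)"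
proof -
  note Z[measurable] k[measurable]
  have e: "(\<integral>\<^sup>+w. c w * g (Z w) \<partial>P) = (\<integral>\<^sup>+z. g z \<partial>distr (density P c) N Z)"
    if [measurable]: "c \<in> borel_measurable P" "g \<in> borel_measurable N" for c and g :: "'b \<Rightarrow> ennreal"
    by (subst nn_integral_distr) (auto simp: nn_integral_density)
  have "distr (density P a) N Z = distr (density P b) N Z"
  proof (rule measure_eqI)
    fix C assume "C \<in> sets (distr (density P a) N Z)"
    then have C: "C \<in> sets N" by simp
    have m: "emeasure (distr (density P c) N Z) C = (\<integral>\<^sup>+w. c w * indicator C (Z w) \<partial>P)" if "c \<in> borel_measurable P" for c
      using e[OF that, of "indicator C"] C by simp
    show "emeasure (distr (density P a) N Z) C = emeasure (distr (density P b) N Z) C"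
      using eq[OF C] by (simp add: m)
  qed simp
  then show ?thesis by (simp add: e)
qed

text \<open>Rectangles generate the product sigma-algebra, but the weighted measure may be infinite;
  the sets \<open>Ci\<close> supply the exhaustion by finite pieces that uniqueness of measures
  requires.\<close>

lemma nn_integral_pair_eqI:
  fixes Y :: "'a \<Rightarrow> 'y::second_countable_topology" and Z :: "'a \<Rightarrow> 'z::second_countable_topology"
  assumes [measurable]: "Y \<in> borel_measurable P" "Z \<in> borel_measurable P" "a \<in> borel_measurable P" "b \<in> borel_measurable P"
    and eq: "\<And>B C. B \<in> sets borel \<Longrightarrow> C \<in> sets borel \<Longrightarrow>
      (\<integral>\<^sup>+w. a w * (indicator B (Y w) * indicator C (Z w)) \<partial>P) = (\<integral>\<^sup>+w. b w * (indicator B (Y w) * indicator C (Z w)) \<partial>P)"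
    and fin: "\<And>i::nat. Ci i \<in> sets borel" "(\<Union>i. Ci i) = UNIV" "\<And>i. (\<integral>\<^sup>+w. a w * indicator (Ci i) (Z w) \<partial>P) \<noteq> \<infinity>"
    and h: "h \<in> borel_measurable (borel \<Otimes>\<^sub>M borel)"
  shows "(\<integral>\<^sup>+w. a w * h (Y w, Z w) \<partial>P) = (\<integral>\<^sup>+w. b w * h (Y w, Z w) \<partial>P :: ennreal)"
proof -
  note h[measurable]
  let ?N = "borel \<Otimes>\<^sub>M borel :: ('y \<times> 'z) measure"
  let ?Q = "\<lambda>c. distr (density P c) ?N (\<lambda>w. (Y w, Z w))"
  have e: "(\<integral>\<^sup>+w. c w * g (Y w, Z w) \<partial>P) = (\<integral>\<^sup>+z. g z \<partial>?Q c)"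
    if [measurable]: "c \<in> borel_measurable P" "g \<in> borel_measurable ?N" for c and g :: "'y \<times> 'z \<Rightarrow> ennreal"
    by (subst nn_integral_distr) (auto simp: nn_integral_density)
  have m: "emeasure (?Q c) (B \<times> C) = (\<integral>\<^sup>+w. c w * (indicator B (Y w) * indicator C (Z w)) \<partial>P)"
    if "c \<in> borel_measurable P" "B \<in> sets borel" "C \<in> sets borel" for c B C
  proof -
    have BC: "B \<times> C \<in> sets ?N" using that by auto
    have "emeasure (?Q c) (B \<times> C) = (\<integral>\<^sup>+z. indicator (B \<times> C) z \<partial>?Q c)" using BC by simp
    also have "\<dots> = (\<integral>\<^sup>+w. c w * indicator (B \<times> C) (Y w, Z w) \<partial>P)"
      using e[OF that(1), of "indicator (B \<times> C)"] BC by simp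
    finally show ?thesis by (simp add: indicator_times)
  qed
  have "?Q a = ?Q b"
  proof (rule measure_eqI_generator_eq[where \<Omega>=UNIV and E="{B \<times> C | B C. B \<in> sets borel \<and> C \<in> sets borel}" and A="\<lambda>i. UNIV \<times> Ci i"])
    show "Int_stable {B \<times> C | B C. B \<in> sets (borel :: 'y measure) \<and> C \<in> sets (borel :: 'z measure)}"
      using Int_stable_pair_measure_generator[of "borel :: 'y measure" "borel :: 'z measure"] by simp
    show "sets (?Q a) = sigma_sets UNIV {B \<times> C | B C. B \<in> sets borel \<and> C \<in> sets borel}"
      "sets (?Q b) = sigma_sets UNIV {B \<times> C | B C. B \<in> sets borel \<and> C \<in> sets borel}"
      by (simp_all add: sets_pair_measure)
    show "emeasure (?Q a) X = emeasure (?Q b) X" if "X \<in> {B \<times> C | B C. B \<in> sets borel \<and> C \<in> sets borel}" for X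
      using that eq by (auto simp: m)
    show "range (\<lambda>i. UNIV \<times> Ci i) \<subseteq> {B \<times> C | B C. B \<in> sets borel \<and> C \<in> sets borel}"
    proof (rule image_subsetI)
      fix i :: nat
      show "UNIV \<times> Ci i \<in> {B \<times> C | B C. B \<in> sets borel \<and> C \<in> sets borel}"
        by (intro CollectI exI[of _ UNIV] exI[of _ "Ci i"]) (use fin(1) in auto)
    qed
    show "(\<Union>i. (UNIV :: 'y set) \<times> Ci i) = UNIV" using fin(2) by auto
    show "emeasure (?Q a) (UNIV \<times> Ci i) \<noteq> \<infinity>" for i
      using fin(1,3)[of i] by (simp add: m)
  qed auto
  then show ?thesis by (simp add: e)
qed

lemma obs_measurable:
  assumes "sets P = sets (borel :: ('z::euclidean_space) obs measure)"
  shows "obsX \<in> borel_measurable P" "obsY \<in> borel_measurable P" "obsZ \<in> borel_measurable P"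
proof -
  have "obsX \<in> borel_measurable (borel :: 'z obs measure)" "obsY \<in> borel_measurable (borel :: 'z obs measure)" "obsZ \<in> borel_measurable (borel :: 'z obs measure)"
    unfolding obsX_def[abs_def] obsY_def[abs_def] obsZ_def[abs_def]
    by (intro borel_measurable_continuous_onI continuous_intros)+
  then show "obsX \<in> borel_measurable P" "obsY \<in> borel_measurable P" "obsZ \<in> borel_measurable P"
    using measurable_cong_sets[OF assms refl] by blast+
qed

text \<open>Conditional independence is phrased for all versions of the conditional probabilities,
  so it yields something only once versions exist. They are Radon-Nikodym derivatives of image
  measures under \<open>obsZ\<close>. A single version is produced for the signed and for the
  nonnegative form, since the hypothesis speaks of the former and the computations below use the
  latter.\<close>

lemma cond_mean_exists:
  fixes P :: "('z::euclidean_space) obs measure"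
  assumes P: "prob_space P" "sets P = sets borel" and h[measurable]: "h \<in> borel_measurable P" and h01: "\<And>w. 0 \<le> h w" "\<And>w. h w \<le> 1"
  shows "\<exists>m. cond_mean P h m \<and> cond_mean_nn P h m"
proof -
  interpret prob_space P by fact
  note obs_measurable[OF P(2), measurable]
  let ?M = "distr P borel (obsZ :: 'z obs \<Rightarrow> 'z)"
  let ?N = "distr (density P (\<lambda>w. ennreal (h w))) borel (obsZ :: 'z obs \<Rightarrow> 'z)"
  interpret M: prob_space ?M by (rule prob_space_distr) measurable
  have N: "emeasure ?N C = (\<integral>\<^sup>+w. ennreal (indicator C (obsZ w) * h w) \<partial>P)" if C: "C \<in> sets borel" for C
  proof -
    have "emeasure ?N C = (\<integral>\<^sup>+z. indicator C z \<partial>?N)" using C by simp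
    also have "\<dots> = (\<integral>\<^sup>+w. ennreal (h w) * indicator C (obsZ w) \<partial>P)"
      using C by (subst nn_integral_distr) (auto simp: nn_integral_density)
    also have "\<dots> = (\<integral>\<^sup>+w. ennreal (indicator C (obsZ w) * h w) \<partial>P)"
      by (intro nn_integral_cong) (auto simp: indicator_def)
    finally show ?thesis .
  qed
  have ac: "absolutely_continuous ?M ?N"
    unfolding absolutely_continuous_def
  proof
    fix C assume "C \<in> null_sets ?M"
    then have C: "C \<in> sets borel" and z: "emeasure ?M C = 0" by auto
    have "emeasure ?N C \<le> (\<integral>\<^sup>+w. indicator C (obsZ w) \<partial>P)"
      unfolding N[OF C] using h01 by (intro nn_integral_mono) (auto simp: indicator_def ennreal_le_1)
    also have "\<dots> = emeasure ?M C"
      using C by (subst nn_integral_indicator[symmetric], simp, subst nn_integral_distr) auto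
    finally show "C \<in> null_sets ?N" using C z by auto
  qed
  define f where "f = RN_deriv ?M ?N"
  have [measurable]: "f \<in> borel_measurable borel" using borel_measurable_RN_deriv[of ?M ?N] by (simp add: f_def)
  have d: "density ?M f = ?N" unfolding f_def by (rule M.density_RN_deriv[OF ac]) simp
  have Nf: "emeasure ?N C = (\<integral>\<^sup>+w. f (obsZ w) * indicator C (obsZ w) \<partial>P)" if C: "C \<in> sets borel" for C
  proof -
    have "emeasure ?N C = (\<integral>\<^sup>+z. f z * indicator C z \<partial>?M)" using C by (subst d[symmetric]) (simp add: emeasure_density)
    also have "\<dots> = (\<integral>\<^sup>+w. f (obsZ w) * indicator C (obsZ w) \<partial>P)" using C by (subst nn_integral_distr) auto
    finally show ?thesis .
  qed
  have "(\<integral>\<^sup>+w. f (obsZ w) \<partial>P) = (\<integral>\<^sup>+w. ennreal (h w) \<partial>P)" using Nf[of UNIV] N[of UNIV] by simp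
  also have "\<dots> \<le> (\<integral>\<^sup>+w. 1 \<partial>P)" using h01 by (intro nn_integral_mono) (simp add: ennreal_le_1)
  also have "\<dots> = 1" by (simp add: emeasure_space_1)
  finally have fin: "(\<integral>\<^sup>+w. f (obsZ w) \<partial>P) \<noteq> \<infinity>" by (auto simp: top_unique)
  then have ae: "AE w in P. f (obsZ w) \<noteq> \<infinity>" by (intro nn_integral_PInf_AE) auto
  define m where "m z = enn2real (f z)" for z
  have mm[measurable]: "m \<in> borel_measurable borel" unfolding m_def[abs_def] by measurable
  have m0: "0 \<le> m z" for z by (simp add: m_def)
  have nn: "(\<integral>\<^sup>+w. ennreal (indicator C (obsZ w) * h w) \<partial>P) = (\<integral>\<^sup>+w. ennreal (indicator C (obsZ w) * m (obsZ w)) \<partial>P)"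
    if C: "C \<in> sets borel" for C
  proof -
    have "(\<integral>\<^sup>+w. ennreal (indicator C (obsZ w) * m (obsZ w)) \<partial>P) = (\<integral>\<^sup>+w. f (obsZ w) * indicator C (obsZ w) \<partial>P)"
      by (rule nn_integral_cong_AE) (use ae in \<open>auto simp: m_def indicator_def ennreal_enn2real_if\<close>)
    then show ?thesis using N[OF C] Nf[OF C] by simp
  qed
  have "cond_mean_nn P h m" unfolding cond_mean_nn_def using nn m0 by auto
  moreover have "cond_mean P h m" unfolding cond_mean_def
  proof (intro conjI ballI)
    show "integrable P h" by (rule integrable_const_bound[of _ 1]) (use h01 in auto)
    have "(\<integral>\<^sup>+w. ennreal (m (obsZ w)) \<partial>P) = (\<integral>\<^sup>+w. f (obsZ w) \<partial>P)"
      by (rule nn_integral_cong_AE) (use ae in \<open>auto simp: m_def ennreal_enn2real_if\<close>)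
    then show "integrable P (\<lambda>w. m (obsZ w))" using fin m0 by (intro integrableI_nonneg) (auto simp: top.not_eq_extremum)
    fix C :: "'z set" assume C: "C \<in> sets borel"
    show "(\<integral>w. indicator C (obsZ w) * h w \<partial>P) = (\<integral>w. indicator C (obsZ w) * m (obsZ w) \<partial>P)"
      using nn[OF C] h01 m0 C by (simp add: integral_eq_nn_integral)
  qed measurable
  ultimately show ?thesis by blast
qed

text \<open>The symmetric form of conditional independence, in which the two responses can be exchanged.\<close>

definition cond_indep :: "('z::euclidean_space) obs measure \<Rightarrow> ('z obs \<Rightarrow> real) \<Rightarrow> ('z obs \<Rightarrow> real) \<Rightarrow> bool" where
  "cond_indep P X Y \<longleftrightarrow>
     (\<forall>A\<in>sets (borel :: real measure). \<forall>B\<in>sets (borel :: real measure). \<forall>pA pB pAB.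
        cond_mean P (\<lambda>w. indicator A (X w)) pA \<and>
        cond_mean P (\<lambda>w. indicator B (Y w)) pB \<and>
        cond_mean P (\<lambda>w. indicator A (X w) * indicator B (Y w)) pAB \<longrightarrow>
        (AE w in P. pAB (obsZ w) = pA (obsZ w) * pB (obsZ w)))"

lemma cond_indep_commute: "cond_indep P X Y \<Longrightarrow> cond_indep P Y X"
  unfolding cond_indep_def by (fastforce simp: mult.commute)

text \<open>The conditional probability of \<open>Y\<close> in \<open>B\<close> given (X, Z) depends
  on Z alone. On rectangles this is the product formula for conditional probabilities read from
  right to left; the extension to \<phi> is by uniqueness of measures.\<close>

lemma cond_indep_nn_integral:
  fixes P :: "('z::euclidean_space) obs measure"
  assumes P: "prob_space P" "sets P = sets borel" and ci: "cond_indep P X Y"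
    and XY[measurable]: "X \<in> borel_measurable P" "Y \<in> borel_measurable P" and B: "B \<in> sets borel"
  shows "\<exists>p. p \<in> borel_measurable borel \<and>
    (\<forall>\<phi>\<in>borel_measurable (borel \<Otimes>\<^sub>M borel). (\<integral>\<^sup>+w. indicator B (Y w) * \<phi> (X w, obsZ w) \<partial>P) = (\<integral>\<^sup>+w. ennreal (p (obsZ w)) * \<phi> (X w, obsZ w) \<partial>P))"
proof -
  interpret prob_space P by fact
  note obs_measurable[OF P(2), measurable]
  note B[measurable]
  obtain pB where pB: "cond_mean P (\<lambda>w. indicator B (Y w)) pB" "cond_mean_nn P (\<lambda>w. indicator B (Y w)) pB"
    using cond_mean_exists[OF P, of "\<lambda>w. indicator B (Y w)"] by auto
  have [measurable]: "pB \<in> borel_measurable borel" using pB(2) by (simp add: cond_mean_nn_def)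
  have pB0: "0 \<le> pB z" for z using pB(2) by (simp add: cond_mean_nn_def)
  have rect: "(\<integral>\<^sup>+w. indicator B (Y w) * (indicator A (X w) * indicator C (obsZ w)) \<partial>P)
     = (\<integral>\<^sup>+w. ennreal (pB (obsZ w)) * (indicator A (X w) * indicator C (obsZ w)) \<partial>P)"
    if A[measurable]: "A \<in> sets borel" and C[measurable]: "C \<in> sets borel" for A C
  proof -
    obtain pA where pA: "cond_mean P (\<lambda>w. indicator A (X w)) pA" "cond_mean_nn P (\<lambda>w. indicator A (X w)) pA"
      using cond_mean_exists[OF P, of "\<lambda>w. indicator A (X w)"] by auto
    have "\<exists>m. cond_mean P (\<lambda>w. indicator A (X w) * indicator B (Y w)) m \<and> cond_mean_nn P (\<lambda>w. indicator A (X w) * indicator B (Y w)) m"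
    proof (rule cond_mean_exists[OF P])
      show "(\<lambda>w. indicator A (X w) * indicator B (Y w) :: real) \<in> borel_measurable P" by measurable
    qed (simp_all add: indicator_def)
    then obtain pAB where pAB: "cond_mean P (\<lambda>w. indicator A (X w) * indicator B (Y w)) pAB" "cond_mean_nn P (\<lambda>w. indicator A (X w) * indicator B (Y w)) pAB"
      by blast
    have [measurable]: "pA \<in> borel_measurable borel" using pA(2) by (simp add: cond_mean_nn_def)
    have pA0: "0 \<le> pA z" for z using pA(2) by (simp add: cond_mean_nn_def)
    have ae: "AE w in P. pAB (obsZ w) = pA (obsZ w) * pB (obsZ w)"
      using ci A B pA(1) pB(1) pAB(1) unfolding cond_indep_def by blast
    have "(\<integral>\<^sup>+w. indicator B (Y w) * (indicator A (X w) * indicator C (obsZ w)) \<partial>P) = (\<integral>\<^sup>+w. ennreal (indicator C (obsZ w) * (indicator A (X w) * indicator B (Y w))) \<partial>P)"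
      by (intro nn_integral_cong) (auto simp: indicator_def)
    also have "\<dots> = (\<integral>\<^sup>+w. ennreal (indicator C (obsZ w) * pAB (obsZ w)) \<partial>P)"
      using pAB(2) C unfolding cond_mean_nn_def by blast
    also have "\<dots> = (\<integral>\<^sup>+w. ennreal (pA (obsZ w)) * (indicator C (obsZ w) * ennreal (pB (obsZ w))) \<partial>P)"
      by (rule nn_integral_cong_AE) (use ae pA0 pB0 in \<open>auto simp: indicator_def ennreal_mult'\<close>)
    also have "\<dots> = (\<integral>\<^sup>+w. indicator A (X w) * (indicator C (obsZ w) * ennreal (pB (obsZ w))) \<partial>P)"
    proof (rule nn_integral_comp_eqI[where Z=obsZ and N=borel and k="\<lambda>z. indicator C z * ennreal (pB z)"])
      fix G :: "'z set" assume "G \<in> sets borel"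
      then have "(\<integral>\<^sup>+w. ennreal (indicator G (obsZ w) * indicator A (X w)) \<partial>P) = (\<integral>\<^sup>+w. ennreal (indicator G (obsZ w) * pA (obsZ w)) \<partial>P)"
        using pA(2) unfolding cond_mean_nn_def by blast
      moreover have "(\<integral>\<^sup>+w. ennreal (indicator G (obsZ w) * indicator A (X w)) \<partial>P) = (\<integral>\<^sup>+w. indicator A (X w) * indicator G (obsZ w) \<partial>P)"
        by (intro nn_integral_cong) (auto simp: indicator_def)
      moreover have "(\<integral>\<^sup>+w. ennreal (indicator G (obsZ w) * pA (obsZ w)) \<partial>P) = (\<integral>\<^sup>+w. ennreal (pA (obsZ w)) * indicator G (obsZ w) \<partial>P)"
        by (intro nn_integral_cong) (auto simp: indicator_def)
      ultimately show "(\<integral>\<^sup>+w. ennreal (pA (obsZ w)) * indicator G (obsZ w) \<partial>P) = (\<integral>\<^sup>+w. indicator A (X w) * indicator G (obsZ w) \<partial>P)" by simp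
    qed measurable
    also have "\<dots> = (\<integral>\<^sup>+w. ennreal (pB (obsZ w)) * (indicator A (X w) * indicator C (obsZ w)) \<partial>P)"
      by (intro nn_integral_cong) (auto simp: ac_simps)
    finally show ?thesis .
  qed
  have "\<forall>\<phi>\<in>borel_measurable (borel \<Otimes>\<^sub>M borel). (\<integral>\<^sup>+w. indicator B (Y w) * \<phi> (X w, obsZ w) \<partial>P) = (\<integral>\<^sup>+w. ennreal (pB (obsZ w)) * \<phi> (X w, obsZ w) \<partial>P)"
  proof
    fix \<phi> :: "real \<times> 'z \<Rightarrow> ennreal" assume \<phi>: "\<phi> \<in> borel_measurable (borel \<Otimes>\<^sub>M borel)"
    show "(\<integral>\<^sup>+w. indicator B (Y w) * \<phi> (X w, obsZ w) \<partial>P) = (\<integral>\<^sup>+w. ennreal (pB (obsZ w)) * \<phi> (X w, obsZ w) \<partial>P)"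
    proof (rule nn_integral_pair_eqI[where Ci="\<lambda>_. UNIV", OF _ _ _ _ rect _ _ _ \<phi>])
      fix i :: nat
      have "(\<integral>\<^sup>+w. indicator B (Y w) * indicator UNIV (obsZ w) \<partial>P) \<le> (\<integral>\<^sup>+w. 1 \<partial>P)"
        by (intro nn_integral_mono) (auto simp: indicator_def)
      then show "(\<integral>\<^sup>+w. indicator B (Y w) * indicator UNIV (obsZ w) \<partial>P) \<noteq> \<infinity>"
        by (auto simp: emeasure_space_1 top_unique)
    qed auto
  qed
  then show ?thesis by (intro exI[of _ pB]) auto
qed

text \<open>An equality of conditional means given Z lifts to conditioning on (Y, Z). On a rectangle
  the indicator of \<open>Y\<close> may be replaced by a function of Z, after which the assumed
  equality applies.\<close>

lemma cond_indep_transfer: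
  fixes P :: "('z::euclidean_space) obs measure" and a b :: "real \<times> 'z \<Rightarrow> ennreal"
  assumes P: "prob_space P" "sets P = sets borel" and ci: "cond_indep P X Y"
    and XY[measurable]: "X \<in> borel_measurable P" "Y \<in> borel_measurable P"
    and ab[measurable]: "a \<in> borel_measurable (borel \<Otimes>\<^sub>M borel)" "b \<in> borel_measurable (borel \<Otimes>\<^sub>M borel)"
    and eq: "\<And>C. C \<in> sets borel \<Longrightarrow> (\<integral>\<^sup>+w. a (X w, obsZ w) * indicator C (obsZ w) \<partial>P) = (\<integral>\<^sup>+w. b (X w, obsZ w) * indicator C (obsZ w) \<partial>P)"
    and fin: "\<And>i::nat. Ci i \<in> sets borel" "(\<Union>i. Ci i) = UNIV" "\<And>i. (\<integral>\<^sup>+w. a (X w, obsZ w) * indicator (Ci i) (obsZ w) \<partial>P) \<noteq> \<infinity>"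
    and h: "h \<in> borel_measurable (borel \<Otimes>\<^sub>M borel)"
  shows "(\<integral>\<^sup>+w. a (X w, obsZ w) * h (Y w, obsZ w) \<partial>P) = (\<integral>\<^sup>+w. b (X w, obsZ w) * h (Y w, obsZ w) \<partial>P)"
proof (rule nn_integral_pair_eqI[where Ci=Ci, OF _ _ _ _ _ fin h])
  note obs_measurable[OF P(2), measurable]
  show "Y \<in> borel_measurable P" "obsZ \<in> borel_measurable P"
    "(\<lambda>w. a (X w, obsZ w)) \<in> borel_measurable P" "(\<lambda>w. b (X w, obsZ w)) \<in> borel_measurable P" by measurable
  fix B :: "real set" and C :: "'z set" assume B: "B \<in> sets borel" and C[measurable]: "C \<in> sets borel"
  obtain p where p[measurable]: "p \<in> borel_measurable borel"
    and ph: "\<And>\<phi>. \<phi> \<in> borel_measurable (borel \<Otimes>\<^sub>M borel) \<Longrightarrow> (\<integral>\<^sup>+w. indicator B (Y w) * \<phi> (X w, obsZ w) \<partial>P) = (\<integral>\<^sup>+w. ennreal (p (obsZ w)) * \<phi> (X w, obsZ w) \<partial>P)"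
    using cond_indep_nn_integral[OF P ci XY B] by blast
  have tr: "(\<integral>\<^sup>+w. c (X w, obsZ w) * (indicator B (Y w) * indicator C (obsZ w)) \<partial>P) = (\<integral>\<^sup>+w. c (X w, obsZ w) * (ennreal (p (obsZ w)) * indicator C (obsZ w)) \<partial>P)"
    if [measurable]: "c \<in> borel_measurable (borel \<Otimes>\<^sub>M borel)" for c :: "real \<times> 'z \<Rightarrow> ennreal"
    using ph[of "\<lambda>q. c q * indicator C (snd q)"] by (simp add: ac_simps)
  show "(\<integral>\<^sup>+w. a (X w, obsZ w) * (indicator B (Y w) * indicator C (obsZ w)) \<partial>P) = (\<integral>\<^sup>+w. b (X w, obsZ w) * (indicator B (Y w) * indicator C (obsZ w)) \<partial>P)"
    unfolding tr[OF ab(1)] tr[OF ab(2)]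
  proof (rule nn_integral_comp_eqI[where Z=obsZ and N=borel and k="\<lambda>z. ennreal (p z) * indicator C z"])
    show "(\<integral>\<^sup>+w. a (X w, obsZ w) * indicator G (obsZ w) \<partial>P) = (\<integral>\<^sup>+w. b (X w, obsZ w) * indicator G (obsZ w) \<partial>P)"
      if "G \<in> sets borel" for G using that by (rule eq)
  qed measurable
qed

text \<open>The positive and negative parts of the residual have equal conditional means given Z,
  hence by transfer also given (Y, Z). Splitting \<open>h\<close> by sign as well keeps the whole
  computation within nonnegative integrals.\<close>

lemma residual_orthogonal:
  fixes P :: "('z::euclidean_space) obs measure" and h :: "real \<times> 'z \<Rightarrow> real"
  assumes P: "prob_space P" "sets P = sets borel" and ci: "cond_indep P X Y"
    and XY[measurable]: "X \<in> borel_measurable P" "Y \<in> borel_measurable P"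
    and f: "cond_mean P X f" and h[measurable]: "h \<in> borel_measurable (borel \<Otimes>\<^sub>M borel)"
  shows "(\<integral>w. (X w - f (obsZ w)) * h (Y w, obsZ w) \<partial>P) = 0"
proof (cases "integrable P (\<lambda>w. (X w - f (obsZ w)) * h (Y w, obsZ w))")
  case False
  \<comment> \<open>The integral of a non-integrable function is 0 by convention.\<close>
  then show ?thesis by (rule not_integrable_integral_eq)
next
  case True
  interpret prob_space P by fact
  note obs_measurable[OF P(2), measurable]
  have fm[measurable]: "f \<in> borel_measurable borel" and Xi: "integrable P X" and fi: "integrable P (\<lambda>w. f (obsZ w))"
    using f by (auto simp: cond_mean_def)
  let ?e = "\<lambda>w. X w - f (obsZ w)"
  have ei: "integrable P ?e" using Xi fi by auto
  define a where "a q = ennreal (fst q - f (snd q))" for q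
  define b where "b q = ennreal (- (fst q - f (snd q)))" for q
  have [measurable]: "a \<in> borel_measurable (borel \<Otimes>\<^sub>M borel)" "b \<in> borel_measurable (borel \<Otimes>\<^sub>M borel)"
    unfolding a_def[abs_def] b_def[abs_def] by measurable
  have tr: "(\<integral>\<^sup>+w. a (X w, obsZ w) * g (Y w, obsZ w) \<partial>P) = (\<integral>\<^sup>+w. b (X w, obsZ w) * g (Y w, obsZ w) \<partial>P)"
    if g: "g \<in> borel_measurable (borel \<Otimes>\<^sub>M borel)" for g
  proof (rule cond_indep_transfer[OF P ci XY _ _ _ _ _ _ g, where Ci="\<lambda>_. UNIV"])
    fix C :: "'z set" assume C[measurable]: "C \<in> sets borel"
    have eC: "integrable P (\<lambda>w. indicator C (obsZ w) * ?e w)"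
      by (rule Bochner_Integration.integrable_bound[OF ei]) (auto simp: indicator_def)
    have XC: "integrable P (\<lambda>w. indicator C (obsZ w) * X w)"
      by (rule Bochner_Integration.integrable_bound[OF Xi]) (auto simp: indicator_def)
    have fC: "integrable P (\<lambda>w. indicator C (obsZ w) * f (obsZ w))"
      by (rule Bochner_Integration.integrable_bound[OF fi]) (auto simp: indicator_def)
    have "(\<integral>w. indicator C (obsZ w) * X w \<partial>P) = (\<integral>w. indicator C (obsZ w) * f (obsZ w) \<partial>P)"
      using f C unfolding cond_mean_def by blast
    then have "(\<integral>w. indicator C (obsZ w) * ?e w \<partial>P) = 0"
      using XC fC by (simp add: right_diff_distrib)
    then have "enn2real (\<integral>\<^sup>+w. ennreal (indicator C (obsZ w) * ?e w) \<partial>P) = enn2real (\<integral>\<^sup>+w. ennreal (- (indicator C (obsZ w) * ?e w)) \<partial>P)"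
      using real_lebesgue_integral_def[OF eC] by simp
    moreover have "(\<integral>\<^sup>+w. ennreal (indicator C (obsZ w) * ?e w) \<partial>P) \<noteq> \<infinity>" "(\<integral>\<^sup>+w. ennreal (- (indicator C (obsZ w) * ?e w)) \<partial>P) \<noteq> \<infinity>"
      using eC by (auto simp: real_integrable_def)
    moreover have "r = t" if "enn2real r = enn2real t" "r \<noteq> \<infinity>" "t \<noteq> \<infinity>" for r t :: ennreal
      using that by (cases r; cases t) auto
    ultimately have "(\<integral>\<^sup>+w. ennreal (indicator C (obsZ w) * ?e w) \<partial>P) = (\<integral>\<^sup>+w. ennreal (- (indicator C (obsZ w) * ?e w)) \<partial>P)"
      by blast
    moreover have "(\<integral>\<^sup>+w. ennreal (indicator C (obsZ w) * ?e w) \<partial>P) = (\<integral>\<^sup>+w. a (X w, obsZ w) * indicator C (obsZ w) \<partial>P)"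
      by (intro nn_integral_cong) (auto simp: indicator_def a_def)
    moreover have "(\<integral>\<^sup>+w. ennreal (- (indicator C (obsZ w) * ?e w)) \<partial>P) = (\<integral>\<^sup>+w. b (X w, obsZ w) * indicator C (obsZ w) \<partial>P)"
      by (intro nn_integral_cong) (auto simp: indicator_def b_def)
    ultimately show "(\<integral>\<^sup>+w. a (X w, obsZ w) * indicator C (obsZ w) \<partial>P) = (\<integral>\<^sup>+w. b (X w, obsZ w) * indicator C (obsZ w) \<partial>P)" by simp
  next
    fix i :: nat
    show "(\<integral>\<^sup>+w. a (X w, obsZ w) * indicator UNIV (obsZ w) \<partial>P) \<noteq> \<infinity>"
      using ei by (auto simp: real_integrable_def a_def)
  qed auto
  let ?F = "\<lambda>w. ?e w * h (Y w, obsZ w)"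
  have hp: "(\<lambda>q. ennreal (h q)) \<in> borel_measurable (borel \<Otimes>\<^sub>M borel)" "(\<lambda>q. ennreal (- h q)) \<in> borel_measurable (borel \<Otimes>\<^sub>M borel)" by measurable
  have p1: "ennreal (x * y) = ennreal x * ennreal y + ennreal (- x) * ennreal (- y)" for x y :: real
  proof (cases "0 \<le> x")
    case True
    then show ?thesis by (simp add: ennreal_mult' ennreal_neg)
  next
    case False
    then show ?thesis using ennreal_mult'[of "- x" "- y"] by (simp add: ennreal_neg)
  qed
  have p2: "ennreal (- (x * y)) = ennreal (- x) * ennreal y + ennreal x * ennreal (- y)" for x y :: real
    using p1[of "- x" y] by simp
  have "(\<integral>\<^sup>+w. ennreal (?F w) \<partial>P) = (\<integral>\<^sup>+w. a (X w, obsZ w) * ennreal (h (Y w, obsZ w)) \<partial>P) + (\<integral>\<^sup>+w. b (X w, obsZ w) * ennreal (- h (Y w, obsZ w)) \<partial>P)"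
    unfolding p1 by (subst nn_integral_add) (auto simp: a_def b_def)
  also have "\<dots> = (\<integral>\<^sup>+w. b (X w, obsZ w) * ennreal (h (Y w, obsZ w)) \<partial>P) + (\<integral>\<^sup>+w. a (X w, obsZ w) * ennreal (- h (Y w, obsZ w)) \<partial>P)"
    using tr[OF hp(1)] tr[OF hp(2)] by simp
  also have "\<dots> = (\<integral>\<^sup>+w. ennreal (- ?F w) \<partial>P)"
    unfolding p2 by (subst nn_integral_add) (auto simp: a_def b_def)
  finally show ?thesis using real_lebesgue_integral_def[OF True] by simp
qed

text \<open>Under conditional independence \<open>u\<close> is also the conditional variance given
  (Y, Z). Neither side need be finite, so finiteness is obtained on the sets where \<open>u\<close>
  is at most an integer.\<close>

lemma residual_second_moment:
  fixes P :: "('z::euclidean_space) obs measure" and h :: "real \<times> 'z \<Rightarrow> ennreal"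
  assumes P: "prob_space P" "sets P = sets borel" and ci: "cond_indep P X Y"
    and XY[measurable]: "X \<in> borel_measurable P" "Y \<in> borel_measurable P"
    and f[measurable]: "f \<in> borel_measurable borel" and u: "cond_mean_nn P (\<lambda>w. (X w - f (obsZ w))\<^sup>2) u"
    and h: "h \<in> borel_measurable (borel \<Otimes>\<^sub>M borel)"
  shows "(\<integral>\<^sup>+w. ennreal ((X w - f (obsZ w))\<^sup>2) * h (Y w, obsZ w) \<partial>P) = (\<integral>\<^sup>+w. ennreal (u (obsZ w)) * h (Y w, obsZ w) \<partial>P)"
proof -
  interpret prob_space P by fact
  note obs_measurable[OF P(2), measurable]
  have um[measurable]: "u \<in> borel_measurable borel" and u0: "\<And>z. 0 \<le> u z" using u by (auto simp: cond_mean_nn_def)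
  have eq: "(\<integral>\<^sup>+w. ennreal ((X w - f (obsZ w))\<^sup>2) * indicator C (obsZ w) \<partial>P) = (\<integral>\<^sup>+w. ennreal (u (obsZ w)) * indicator C (obsZ w) \<partial>P)"
    if C: "C \<in> sets borel" for C
  proof -
    have "(\<integral>\<^sup>+w. ennreal (indicator C (obsZ w) * (X w - f (obsZ w))\<^sup>2) \<partial>P) = (\<integral>\<^sup>+w. ennreal (indicator C (obsZ w) * u (obsZ w)) \<partial>P)"
      using u C unfolding cond_mean_nn_def by blast
    moreover have "(\<integral>\<^sup>+w. ennreal (indicator C (obsZ w) * (X w - f (obsZ w))\<^sup>2) \<partial>P) = (\<integral>\<^sup>+w. ennreal ((X w - f (obsZ w))\<^sup>2) * indicator C (obsZ w) \<partial>P)"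
      "(\<integral>\<^sup>+w. ennreal (indicator C (obsZ w) * u (obsZ w)) \<partial>P) = (\<integral>\<^sup>+w. ennreal (u (obsZ w)) * indicator C (obsZ w) \<partial>P)"
      by (intro nn_integral_cong; auto simp: indicator_def)+
    ultimately show ?thesis by simp
  qed
  define a where "a q = ennreal ((fst q - f (snd q))\<^sup>2)" for q
  define b where "b q = ennreal (u (snd q))" for q :: "real \<times> 'z"
  have [measurable]: "a \<in> borel_measurable (borel \<Otimes>\<^sub>M borel)" "b \<in> borel_measurable (borel \<Otimes>\<^sub>M borel)"
    unfolding a_def[abs_def] b_def[abs_def] by measurable
  have "(\<integral>\<^sup>+w. a (X w, obsZ w) * h (Y w, obsZ w) \<partial>P) = (\<integral>\<^sup>+w. b (X w, obsZ w) * h (Y w, obsZ w) \<partial>P)"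
  proof (rule cond_indep_transfer[OF P ci XY _ _ _ _ _ _ h, where Ci="\<lambda>i. {z. u z \<le> real i}"])
    show "(\<integral>\<^sup>+w. a (X w, obsZ w) * indicator C (obsZ w) \<partial>P) = (\<integral>\<^sup>+w. b (X w, obsZ w) * indicator C (obsZ w) \<partial>P)"
      if "C \<in> sets borel" for C using eq[OF that] by (simp add: a_def b_def)
    show "(\<Union>i. {z. u z \<le> real i}) = UNIV" by (auto intro: real_arch_simple)
    fix i :: nat
    have "(\<integral>\<^sup>+w. ennreal (u (obsZ w)) * indicator {z. u z \<le> real i} (obsZ w) \<partial>P) \<le> (\<integral>\<^sup>+w. ennreal (real i) \<partial>P)"
      by (intro nn_integral_mono) (auto simp: indicator_def ennreal_leI)
    also have "\<dots> = ennreal (real i)" by (simp add: emeasure_space_1)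
    finally have "(\<integral>\<^sup>+w. ennreal (u (obsZ w)) * indicator {z. u z \<le> real i} (obsZ w) \<partial>P) \<noteq> \<infinity>"
      by (auto simp: top_unique)
    then show "(\<integral>\<^sup>+w. a (X w, obsZ w) * indicator {z. u z \<le> real i} (obsZ w) \<partial>P) \<noteq> \<infinity>"
      using eq[of "{z. u z \<le> real i}"] by (simp add: a_def)
  qed measurable
  then show ?thesis by (simp add: a_def b_def)
qed

text \<open>Abstracts from which response is being regressed: \<open>X\<close> is the response whose
  residual is averaged, \<open>Y\<close> the one on which the other regression error depends. The
  cross-term bounds are proved once and applied with both assignments.\<close>

definition residual_model :: "('z::euclidean_space) obs measure \<Rightarrow> ('z obs \<Rightarrow> real) \<Rightarrow> ('z obs \<Rightarrow> real)
    \<Rightarrow> ('z \<Rightarrow> real) \<Rightarrow> ('z \<Rightarrow> real) \<Rightarrow> (real \<times> 'z \<Rightarrow> 'z obs) \<Rightarrow> bool" where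
  "residual_model P X Y f u r \<longleftrightarrow> prob_space P \<and> sets P = sets borel \<and> cond_indep P X Y \<and>
     X \<in> borel_measurable P \<and> Y \<in> borel_measurable P \<and> cond_mean P X f \<and>
     cond_mean_nn P (\<lambda>w. (X w - f (obsZ w))\<^sup>2) u \<and> r \<in> measurable (borel \<Otimes>\<^sub>M borel) P \<and>
     (\<forall>y z. Y (r (y, z)) = y \<and> obsZ (r (y, z)) = z)"

text \<open>The map \<open>r\<close> is a section that fixes the first response, so invariance under \<open>r\<close> says that a
  statistic ignores the first response of observation \<open>k\<close>.\<close>

definition ignores_at :: "('z obs \<Rightarrow> real) \<Rightarrow> (real \<times> 'z \<Rightarrow> 'z obs) \<Rightarrow> nat \<Rightarrow> ((nat \<Rightarrow> 'z obs) \<Rightarrow> 'b) \<Rightarrow> bool" where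
  "ignores_at Y r k H \<longleftrightarrow> (\<forall>x w. H (x(k := w)) = H (x(k := r (Y w, obsZ w))))"

lemma ignores_atD: "ignores_at Y r k H \<Longrightarrow> H (x(k := w)) = H (x(k := r (Y w, obsZ w)))"
  unfolding ignores_at_def by blast

text \<open>With all observations but \<open>k\<close> fixed, \<open>H\<close> becomes a function of
  \<open>Y\<close> and \<open>obsZ\<close> of observation \<open>k\<close>; the section
  \<open>r\<close> exhibits it as such, measurably. The identity for one observation then applies
  under the integral over the others.\<close>

lemma sample_second_moment:
  fixes H :: "(nat \<Rightarrow> ('z::euclidean_space) obs) \<Rightarrow> ennreal"
  assumes R: "residual_model P X Y f u r" and k: "k < n" and H: "H \<in> borel_measurable (PiM {..<n} (\<lambda>_. P))"
    and inv: "ignores_at Y r k H"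
  shows "(\<integral>\<^sup>+\<omega>. ennreal ((X (\<omega> k) - f (obsZ (\<omega> k)))\<^sup>2) * H \<omega> \<partial>PiM {..<n} (\<lambda>_. P))
     = (\<integral>\<^sup>+\<omega>. ennreal (u (obsZ (\<omega> k))) * H \<omega> \<partial>PiM {..<n} (\<lambda>_. P))"
proof -
  interpret prob_space P using R by (simp add: residual_model_def)
  interpret S: product_sigma_finite "\<lambda>_. P" by standard
  have P: "prob_space P" "sets P = sets borel" and ci: "cond_indep P X Y" and XY: "X \<in> borel_measurable P" "Y \<in> borel_measurable P"
    and f: "f \<in> borel_measurable borel" and u: "cond_mean_nn P (\<lambda>w. (X w - f (obsZ w))\<^sup>2) u" and um: "u \<in> borel_measurable borel"
    and r: "r \<in> measurable (borel \<Otimes>\<^sub>M borel) P"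
    using R by (auto simp: residual_model_def cond_mean_def cond_mean_nn_def)
  note obs_measurable[OF P(2), measurable] XY[measurable] f[measurable] um[measurable]
  let ?I = "{..<n} - {k}"
  have ins: "insert k ?I = {..<n}" using k by auto
  have comp: "(\<lambda>\<omega>. \<omega> k) \<in> measurable (PiM {..<n} (\<lambda>_. P)) P" using k by (intro measurable_component_singleton) auto
  have m1: "(\<lambda>\<omega>. ennreal ((X (\<omega> k) - f (obsZ (\<omega> k)))\<^sup>2) * H \<omega>) \<in> borel_measurable (PiM {..<n} (\<lambda>_. P))"
    by (intro borel_measurable_times_ennreal H measurable_compose[OF comp]) measurable
  have m2: "(\<lambda>\<omega>. ennreal (u (obsZ (\<omega> k))) * H \<omega>) \<in> borel_measurable (PiM {..<n} (\<lambda>_. P))"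
    by (intro borel_measurable_times_ennreal H measurable_compose[OF comp]) measurable
  have "(\<integral>\<^sup>+\<omega>. ennreal ((X (\<omega> k) - f (obsZ (\<omega> k)))\<^sup>2) * H \<omega> \<partial>PiM {..<n} (\<lambda>_. P))
     = (\<integral>\<^sup>+x. (\<integral>\<^sup>+w. ennreal ((X w - f (obsZ w))\<^sup>2) * H (x(k := w)) \<partial>P) \<partial>PiM ?I (\<lambda>_. P))"
    using S.product_nn_integral_insert[of ?I k "\<lambda>\<omega>. ennreal ((X (\<omega> k) - f (obsZ (\<omega> k)))\<^sup>2) * H \<omega>", unfolded ins] m1 by simp
  also have "\<dots> = (\<integral>\<^sup>+x. (\<integral>\<^sup>+w. ennreal (u (obsZ w)) * H (x(k := w)) \<partial>P) \<partial>PiM ?I (\<lambda>_. P))"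
  proof (rule nn_integral_cong)
    fix x assume x: "x \<in> space (PiM ?I (\<lambda>_. P))"
    have upd: "(\<lambda>w. x(k := w)) \<in> measurable P (PiM {..<n} (\<lambda>_. P))"
      using measurable_component_update[OF x, of k, unfolded ins] by simp
    define h where "h q = H (x(k := r q))" for q
    have hm: "h \<in> borel_measurable (borel \<Otimes>\<^sub>M borel)"
      unfolding h_def[abs_def] by (rule measurable_compose[OF measurable_compose[OF r upd] H])
    have e: "H (x(k := w)) = h (Y w, obsZ w)" for w unfolding h_def by (rule ignores_atD[OF inv])
    show "(\<integral>\<^sup>+w. ennreal ((X w - f (obsZ w))\<^sup>2) * H (x(k := w)) \<partial>P) = (\<integral>\<^sup>+w. ennreal (u (obsZ w)) * H (x(k := w)) \<partial>P)"
      unfolding e by (rule residual_second_moment[OF P ci XY f u hm])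
  qed
  also have "\<dots> = (\<integral>\<^sup>+\<omega>. ennreal (u (obsZ (\<omega> k))) * H \<omega> \<partial>PiM {..<n} (\<lambda>_. P))"
    using S.product_nn_integral_insert[of ?I k "\<lambda>\<omega>. ennreal (u (obsZ (\<omega> k))) * H \<omega>", unfolded ins] m2 by simp
  finally show ?thesis .
qed

lemma sample_orthogonal:
  fixes H :: "(nat \<Rightarrow> ('z::euclidean_space) obs) \<Rightarrow> real"
  assumes R: "residual_model P X Y f u r" and k: "k < n" and H: "H \<in> borel_measurable (PiM {..<n} (\<lambda>_. P))"
    and inv: "ignores_at Y r k H"
  shows "(\<integral>\<omega>. (X (\<omega> k) - f (obsZ (\<omega> k))) * H \<omega> \<partial>PiM {..<n} (\<lambda>_. P)) = 0"
proof (cases "integrable (PiM {..<n} (\<lambda>_. P)) (\<lambda>\<omega>. (X (\<omega> k) - f (obsZ (\<omega> k))) * H \<omega>)")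
  case False
  then show ?thesis by (rule not_integrable_integral_eq)
next
  case True
  interpret prob_space P using R by (simp add: residual_model_def)
  have P: "prob_space P" "sets P = sets borel" and ci: "cond_indep P X Y" and XY: "X \<in> borel_measurable P" "Y \<in> borel_measurable P"
    and f: "cond_mean P X f" and r: "r \<in> measurable (borel \<Otimes>\<^sub>M borel) P"
    using R by (auto simp: residual_model_def)
  let ?I = "{..<n} - {k}"
  have ins: "insert k ?I = {..<n}" using k by auto
  have "(\<integral>\<omega>. (X (\<omega> k) - f (obsZ (\<omega> k))) * H \<omega> \<partial>PiM {..<n} (\<lambda>_. P))
     = (\<integral>x. (\<integral>w. (X w - f (obsZ w)) * H (x(k := w)) \<partial>P) \<partial>PiM ?I (\<lambda>_. P))"
    using PiM_integral_coordinate[OF P(1) k True] by simp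
  also have "\<dots> = (\<integral>x. 0 \<partial>PiM ?I (\<lambda>_. P))"
  proof (rule Bochner_Integration.integral_cong[OF refl])
    fix x assume x: "x \<in> space (PiM ?I (\<lambda>_. P))"
    have upd: "(\<lambda>w. x(k := w)) \<in> measurable P (PiM {..<n} (\<lambda>_. P))"
      using measurable_component_update[OF x, of k, unfolded ins] by simp
    define h where "h q = H (x(k := r q))" for q
    have hm: "h \<in> borel_measurable (borel \<Otimes>\<^sub>M borel)"
      unfolding h_def[abs_def] by (rule measurable_compose[OF measurable_compose[OF r upd] H])
    have e: "H (x(k := w)) = h (Y w, obsZ w)" for w unfolding h_def by (rule ignores_atD[OF inv])
    show "(\<integral>w. (X w - f (obsZ w)) * H (x(k := w)) \<partial>P) = 0"
      unfolding e by (rule residual_orthogonal[OF P ci XY f hm])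
  qed
  finally show ?thesis by simp
qed

text \<open>The factor \<open>b\<close> may depend on every observation, but never on the response
  \<open>X\<close>. Hence the residuals act like independent centred multipliers given the rest:
  squares integrate to \<open>u\<close> times \<open>b^2\<close>, and the weighted sums satisfy the
  hypotheses of the maximal inequality without any independence between \<open>b\<close> and the
  data. The bound on the weighted mean square of \<open>b\<close> is required at every \<omega>,
  since \<open>b\<close> is inside expectations.\<close>

lemma cross_terms_bound:
  fixes b :: "(nat \<Rightarrow> ('z::euclidean_space) obs) \<Rightarrow> nat \<Rightarrow> real" and n K :: nat
  assumes R: "residual_model P X Y f u r" and n: "0 < n" and K: "0 < K"
    and bm: "\<And>i. i < n \<Longrightarrow> (\<lambda>\<omega>. b \<omega> i) \<in> borel_measurable (PiM {..<n} (\<lambda>_. P))"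
    and inv: "\<And>i k. i < n \<Longrightarrow> k < n \<Longrightarrow> ignores_at Y r k (\<lambda>\<omega>. b \<omega> i)"
    and B: "\<And>\<omega>. (\<Sum>i<n. (b \<omega> i)\<^sup>2 * u (obsZ (\<omega> i))) / n \<le> \<tau>"
    and w: "\<And>k. w k \<in> borel_measurable borel" "\<And>k z. k \<in> {1..K} \<Longrightarrow> \<bar>w k z\<bar> \<le> C1" and \<beta>: "0 < \<beta>"
  shows "integrable (PiM {..<n} (\<lambda>_. P)) (\<lambda>\<omega>. (\<Sum>i<n. (X (\<omega> i) - f (obsZ (\<omega> i)))\<^sup>2 * (b \<omega> i)\<^sup>2) / n)"
    and "(\<integral>\<omega>. (\<Sum>i<n. (X (\<omega> i) - f (obsZ (\<omega> i)))\<^sup>2 * (b \<omega> i)\<^sup>2) / n \<partial>PiM {..<n} (\<lambda>_. P)) \<le> \<tau>"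
    and "integrable (PiM {..<n} (\<lambda>_. P)) (\<lambda>\<omega>. mxa {1..K} (\<lambda>k. (\<Sum>i<n. (X (\<omega> i) - f (obsZ (\<omega> i))) * b \<omega> i * w k (obsZ (\<omega> i))) / sqrt n))"
    and "(\<integral>\<omega>. mxa {1..K} (\<lambda>k. (\<Sum>i<n. (X (\<omega> i) - f (obsZ (\<omega> i))) * b \<omega> i * w k (obsZ (\<omega> i))) / sqrt n) \<partial>PiM {..<n} (\<lambda>_. P))
       \<le> ln (2 * K) / \<beta> + \<beta> * (C1\<^sup>2 * \<tau>)"
proof -
  let ?P = "PiM {..<n} (\<lambda>_. P)"
  interpret P: prob_space P using R by (simp add: residual_model_def)
  interpret S: prob_space ?P by (rule prob_space_PiM_const[OF P.prob_space_axioms])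
  have Ps: "sets P = sets borel" and X[measurable]: "X \<in> borel_measurable P" and Y[measurable]: "Y \<in> borel_measurable P"
    and f[measurable]: "f \<in> borel_measurable borel" and um[measurable]: "u \<in> borel_measurable borel" and u0: "\<And>z. 0 \<le> u z"
    and rYZ: "\<And>y z. Y (r (y, z)) = y" "\<And>y z. obsZ (r (y, z)) = z"
    using R by (auto simp: residual_model_def cond_mean_def cond_mean_nn_def)
  note obs_measurable[OF Ps, measurable] w(1)[measurable]
  define e where "e w = X w - f (obsZ w)" for w
  have em[measurable]: "e \<in> borel_measurable P" unfolding e_def[abs_def] by measurable
  have comp: "(\<lambda>\<omega>. g (\<omega> i)) \<in> borel_measurable ?P" if "g \<in> borel_measurable P" "i < n" for g :: "'z obs \<Rightarrow> real" and i
    by (rule PiM_coordinate(3)[OF P.prob_space_axioms that(2,1)])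
  have eim: "(\<lambda>\<omega>. e (\<omega> i)) \<in> borel_measurable ?P" if "i < n" for i by (rule comp[OF em that])
  have uim: "(\<lambda>\<omega>. u (obsZ (\<omega> i))) \<in> borel_measurable ?P" if "i < n" for i by (rule comp[OF _ that]) measurable
  have wim: "(\<lambda>\<omega>. w k (obsZ (\<omega> i))) \<in> borel_measurable ?P" if "i < n" for i k by (rule comp[OF _ that]) measurable
  have \<tau>0: "0 \<le> \<tau>"
    by (rule order_trans[OF _ B[of "\<lambda>_. undefined"]]) (intro divide_nonneg_nonneg sum_nonneg mult_nonneg_nonneg u0; simp)
  have sec: "(\<integral>\<^sup>+\<omega>. ennreal ((e (\<omega> i))\<^sup>2 * (b \<omega> i)\<^sup>2) \<partial>?P) = (\<integral>\<^sup>+\<omega>. ennreal (u (obsZ (\<omega> i)) * (b \<omega> i)\<^sup>2) \<partial>?P)" if i: "i < n" for i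
  proof -
    have "(\<lambda>\<omega>. ennreal ((b \<omega> i)\<^sup>2)) \<in> borel_measurable ?P" using bm[OF i] by measurable
    moreover have "ignores_at Y r i (\<lambda>\<omega>. ennreal ((b \<omega> i)\<^sup>2))"
      using inv[OF i i] by (simp add: ignores_at_def)
    ultimately show ?thesis
      using sample_second_moment[OF R i, of "\<lambda>\<omega>. ennreal ((b \<omega> i)\<^sup>2)"] u0 by (simp add: e_def ennreal_mult')
  qed
  let ?A = "\<lambda>\<omega>. (\<Sum>i<n. (e (\<omega> i))\<^sup>2 * (b \<omega> i)\<^sup>2) / n"
  have Am: "?A \<in> borel_measurable ?P" using eim bm by (intro borel_measurable_divide borel_measurable_sum borel_measurable_times borel_measurable_power) auto
  have nnA: "(\<integral>\<^sup>+\<omega>. ennreal (?A \<omega>) \<partial>?P) \<le> ennreal \<tau>"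
  proof -
    have sum: "(\<integral>\<^sup>+\<omega>. ennreal ((\<Sum>i<n. g \<omega> i) / n) \<partial>?P) = (\<Sum>i<n. \<integral>\<^sup>+\<omega>. ennreal (g \<omega> i) \<partial>?P) / n"
      if g: "\<And>i. i < n \<Longrightarrow> (\<lambda>\<omega>. g \<omega> i) \<in> borel_measurable ?P" and g0: "\<And>\<omega> i. 0 \<le> g \<omega> i" for g :: "_ \<Rightarrow> nat \<Rightarrow> real"
    proof -
      have "(\<integral>\<^sup>+\<omega>. ennreal ((\<Sum>i<n. g \<omega> i) / n) \<partial>?P) = (\<integral>\<^sup>+\<omega>. (\<Sum>i<n. ennreal (g \<omega> i)) / n \<partial>?P)"
        using n g0 by (intro nn_integral_cong) (simp add: divide_ennreal[symmetric] sum_nonneg sum_ennreal ennreal_of_nat_eq_real_of_nat)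
      also have "\<dots> = (\<integral>\<^sup>+\<omega>. (\<Sum>i<n. ennreal (g \<omega> i)) \<partial>?P) / n"
        using g by (intro nn_integral_divide) auto
      also have "(\<integral>\<^sup>+\<omega>. (\<Sum>i<n. ennreal (g \<omega> i)) \<partial>?P) = (\<Sum>i<n. \<integral>\<^sup>+\<omega>. ennreal (g \<omega> i) \<partial>?P)"
        using g by (intro nn_integral_sum) auto
      finally show ?thesis .
    qed
    have "(\<integral>\<^sup>+\<omega>. ennreal (?A \<omega>) \<partial>?P) = (\<Sum>i<n. \<integral>\<^sup>+\<omega>. ennreal ((e (\<omega> i))\<^sup>2 * (b \<omega> i)\<^sup>2) \<partial>?P) / n"
      using eim bm by (intro sum borel_measurable_times borel_measurable_power) auto
    also have "\<dots> = (\<Sum>i<n. \<integral>\<^sup>+\<omega>. ennreal (u (obsZ (\<omega> i)) * (b \<omega> i)\<^sup>2) \<partial>?P) / n"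
      using sec by simp
    also have "\<dots> = (\<integral>\<^sup>+\<omega>. ennreal ((\<Sum>i<n. u (obsZ (\<omega> i)) * (b \<omega> i)\<^sup>2) / n) \<partial>?P)"
      using uim bm u0 by (intro sum[symmetric] borel_measurable_times borel_measurable_power) auto
    also have "\<dots> \<le> (\<integral>\<^sup>+\<omega>. ennreal \<tau> \<partial>?P)"
      using B by (intro nn_integral_mono ennreal_leI) (simp add: mult.commute)
    also have "\<dots> = ennreal \<tau>" by (simp add: S.emeasure_space_1)
    finally show ?thesis .
  qed
  have A0: "0 \<le> ?A \<omega>" for \<omega> by (simp add: sum_nonneg)
  have iA: "integrable ?P ?A"
    using nnA Am A0 by (intro integrableI_nonneg) (auto simp: less_top[symmetric] top_unique)
  then show "integrable ?P (\<lambda>\<omega>. (\<Sum>i<n. (X (\<omega> i) - f (obsZ (\<omega> i)))\<^sup>2 * (b \<omega> i)\<^sup>2) / n)" by (simp add: e_def)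
  have eA: "(\<integral>\<omega>. ?A \<omega> \<partial>?P) \<le> \<tau>"
    using nnA nn_integral_eq_integral[OF iA] A0 \<tau>0 by (simp add: ennreal_le_iff)
  then show "(\<integral>\<omega>. (\<Sum>i<n. (X (\<omega> i) - f (obsZ (\<omega> i)))\<^sup>2 * (b \<omega> i)\<^sup>2) / n \<partial>?P) \<le> \<tau>" by (simp add: e_def)
  define Yv where "Yv i \<omega> = signed (\<lambda>k. e (\<omega> i) * b \<omega> i * w k (obsZ (\<omega> i)) / sqrt n)" for i \<omega>
  define D where "D i \<omega> = \<bar>e (\<omega> i)\<bar> * \<bar>b \<omega> i\<bar> * C1 / sqrt n" for i \<omega>
  let ?I = "{1..K} \<times> (UNIV :: bool set)"
  have I: "finite ?I" "?I \<noteq> {}" and IK: "finite {1..K}" "{1..K} \<noteq> {}" using K by auto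
  have Ym: "(\<lambda>\<omega>. Yv i \<omega> p) \<in> borel_measurable ?P" if "i < n" "p \<in> ?I" for i p
    using eim[OF that(1)] bm[OF that(1)] wim[OF that(1), of "fst p"] by (cases "snd p") (simp_all add: Yv_def signed_def)
  have Dm: "D i \<in> borel_measurable ?P" if "i < n" for i
    unfolding D_def[abs_def] using eim[OF that] bm[OF that] by measurable
  have D2: "(D i \<omega>)\<^sup>2 = (C1\<^sup>2 / n) * ((e (\<omega> i))\<^sup>2 * (b \<omega> i)\<^sup>2)" for i \<omega>
    by (simp add: D_def power_mult_distrib power_divide)
  have iei: "integrable ?P (\<lambda>\<omega>. (e (\<omega> i))\<^sup>2 * (b \<omega> i)\<^sup>2)" if "i < n" for i
  proof (rule Bochner_Integration.integrable_bound[of ?P "\<lambda>\<omega>. n * ?A \<omega>"])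
    show "integrable ?P (\<lambda>\<omega>. n * ?A \<omega>)" by (intro Bochner_Integration.integrable_mult_right iA)
    show "(\<lambda>\<omega>. (e (\<omega> i))\<^sup>2 * (b \<omega> i)\<^sup>2) \<in> borel_measurable ?P" using eim[OF that] bm[OF that] by measurable
    show "AE \<omega> in ?P. norm ((e (\<omega> i))\<^sup>2 * (b \<omega> i)\<^sup>2) \<le> norm (n * ?A \<omega>)"
    proof (rule AE_I2)
      fix \<omega>
      have "(e (\<omega> i))\<^sup>2 * (b \<omega> i)\<^sup>2 \<le> (\<Sum>i<n. (e (\<omega> i))\<^sup>2 * (b \<omega> i)\<^sup>2)"
        by (rule member_le_sum[of i "{..<n}" "\<lambda>i. (e (\<omega> i))\<^sup>2 * (b \<omega> i)\<^sup>2"]) (use that in auto)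
      then show "norm ((e (\<omega> i))\<^sup>2 * (b \<omega> i)\<^sup>2) \<le> norm (n * ?A \<omega>)" using n by simp
    qed
  qed
  have Di: "integrable ?P (\<lambda>\<omega>. (D i \<omega>)\<^sup>2)" if "i < n" for i
    unfolding D2 using iei[OF that] by simp
  have YD: "\<bar>Yv i \<omega> p\<bar> \<le> D i \<omega>" if "i < n" "\<omega> \<in> space ?P" "p \<in> ?I" for i \<omega> p
  proof -
    have "\<bar>w (fst p) (obsZ (\<omega> i))\<bar> \<le> C1" using w(2) that by auto
    then have "\<bar>e (\<omega> i)\<bar> * \<bar>b \<omega> i\<bar> * \<bar>w (fst p) (obsZ (\<omega> i))\<bar> / sqrt n \<le> D i \<omega>"
      unfolding D_def by (intro divide_right_mono mult_left_mono) auto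
    then show ?thesis by (auto simp: Yv_def signed_def abs_mult)
  qed
  have orth: "(\<integral>\<omega>. Yv i \<omega> p * softmax \<beta> ?I (\<lambda>p. \<Sum>l<i. Yv l \<omega> p) p \<partial>?P) = 0" if i: "i < n" and p: "p \<in> ?I" for i p
  proof -
    \<comment> \<open>Everything except the residual of observation \<open>i\<close>. It ignores
      response \<open>i\<close>: the softmax weight sums over \<open>l < i\<close> only, and each
      \<open>b \<omega> l\<close> ignores it as well.\<close>
    define H where "H \<omega> = signed (\<lambda>k. b \<omega> i * w k (obsZ (\<omega> i)) / sqrt n) p * softmax \<beta> ?I (\<lambda>p. \<Sum>l<i. Yv l \<omega> p) p" for \<omega>
    have Hm: "H \<in> borel_measurable ?P"
      unfolding H_def[abs_def]
    proof (rule borel_measurable_times)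
      show "(\<lambda>\<omega>. signed (\<lambda>k. b \<omega> i * w k (obsZ (\<omega> i)) / sqrt n) p) \<in> borel_measurable ?P"
        using bm[OF i] wim[OF i, of "fst p"] by (cases "snd p") (simp_all add: signed_def)
      show "(\<lambda>\<omega>. softmax \<beta> ?I (\<lambda>p. \<Sum>l<i. Yv l \<omega> p) p) \<in> borel_measurable ?P"
        using i by (intro softmax_measurable p borel_measurable_sum Ym) auto
    qed
    have Hinv: "ignores_at Y r i H"
      unfolding ignores_at_def
    proof (intro allI)
      fix x v
      have bi: "b (x(i := v)) l = b (x(i := r (Y v, obsZ v))) l" if "l < n" for l
        using ignores_atD[OF inv[OF that i]] .
      have "(\<Sum>l<i. Yv l (x(i := v)) p) = (\<Sum>l<i. Yv l (x(i := r (Y v, obsZ v))) p)" for p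
        using i bi by (intro sum.cong refl) (auto simp: Yv_def)
      then show "H (x(i := v)) = H (x(i := r (Y v, obsZ v)))"
        unfolding H_def using bi[OF i] by (simp add: rYZ)
    qed
    have "Yv i \<omega> p * softmax \<beta> ?I (\<lambda>p. \<Sum>l<i. Yv l \<omega> p) p = (X (\<omega> i) - f (obsZ (\<omega> i))) * H \<omega>" for \<omega>
      by (simp add: H_def Yv_def signed_def e_def)
    then show ?thesis using sample_orthogonal[OF R i Hm Hinv] by simp
  qed
  have ey: "(\<lambda>\<omega>. mx ?I (\<lambda>p. \<Sum>l<n. Yv l \<omega> p)) = (\<lambda>\<omega>. mxa {1..K} (\<lambda>k. (\<Sum>i<n. (X (\<omega> i) - f (obsZ (\<omega> i))) * b \<omega> i * w k (obsZ (\<omega> i))) / sqrt n))"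
  proof
    fix \<omega>
    have "(\<lambda>p. \<Sum>l<n. Yv l \<omega> p) = signed (\<lambda>k. (\<Sum>i<n. (X (\<omega> i) - f (obsZ (\<omega> i))) * b \<omega> i * w k (obsZ (\<omega> i))) / sqrt n)"
      by (auto simp: fun_eq_iff Yv_def signed_def sum_negf e_def sum_divide_distrib)
    then show "mx ?I (\<lambda>p. \<Sum>l<n. Yv l \<omega> p) = mxa {1..K} (\<lambda>k. (\<Sum>i<n. (X (\<omega> i) - f (obsZ (\<omega> i))) * b \<omega> i * w k (obsZ (\<omega> i))) / sqrt n)"
      using mx_signed[OF IK] by simp
  qed
  note mi = maximal_inequality[where M="?P" and I="?I" and b=\<beta> and n=n and Y=Yv and D=D, OF S.prob_space_axioms I \<beta> Ym Dm Di YD orth]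
  show "integrable ?P (\<lambda>\<omega>. mxa {1..K} (\<lambda>k. (\<Sum>i<n. (X (\<omega> i) - f (obsZ (\<omega> i))) * b \<omega> i * w k (obsZ (\<omega> i))) / sqrt n))"
    using mi(1) unfolding ey .
  have "(\<Sum>k<n. \<integral>\<omega>. (D k \<omega>)\<^sup>2 \<partial>?P) = C1\<^sup>2 * (\<integral>\<omega>. ?A \<omega> \<partial>?P)"
    using iei by (simp add: D2 Bochner_Integration.integral_sum sum_distrib_left sum_divide_distrib)
  also have "\<dots> \<le> C1\<^sup>2 * \<tau>" using eA by (intro mult_left_mono) auto
  finally have "\<beta> * (\<Sum>k<n. \<integral>\<omega>. (D k \<omega>)\<^sup>2 \<partial>?P) \<le> \<beta> * (C1\<^sup>2 * \<tau>)" using \<beta> by simp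
  then show "(\<integral>\<omega>. mxa {1..K} (\<lambda>k. (\<Sum>i<n. (X (\<omega> i) - f (obsZ (\<omega> i))) * b \<omega> i * w k (obsZ (\<omega> i))) / sqrt n) \<partial>?P)
       \<le> ln (2 * K) / \<beta> + \<beta> * (C1\<^sup>2 * \<tau>)"
    using mi(2) unfolding ey card_signed by simp
qed

section \<open>Perturbation of correlations\<close>

lemma average_cauchy_schwarz:
  fixes p q :: "nat \<Rightarrow> real"
  shows "(\<Sum>i<n. \<bar>p i\<bar> * \<bar>q i\<bar>) / n \<le> sqrt ((\<Sum>i<n. (p i)\<^sup>2) / n) * sqrt ((\<Sum>i<n. (q i)\<^sup>2) / n)"
proof -
  have "(\<Sum>i<n. \<bar>p i\<bar> * \<bar>q i\<bar>) / n \<le> (sqrt (\<Sum>i<n. (p i)\<^sup>2) * sqrt (\<Sum>i<n. (q i)\<^sup>2)) / n"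
    using L2_set_mult_ineq[of p q "{..<n}"] by (intro divide_right_mono) (auto simp: L2_set_def)
  then show ?thesis by (simp add: real_sqrt_divide)
qed

lemma sum_product_le:
  fixes p q :: "nat \<Rightarrow> real"
  assumes "\<And>i. 0 \<le> p i" "\<And>i. 0 \<le> q i"
  shows "(\<Sum>i<n. p i * q i) \<le> (\<Sum>i<n. p i) * (\<Sum>i<n. q i)"
proof -
  have "(\<Sum>i<n. p i * q i) \<le> (\<Sum>i<n. p i * (\<Sum>i<n. q i))"
    by (intro sum_mono mult_left_mono member_le_sum) (use assms in auto)
  then show ?thesis by (simp add: sum_distrib_right)
qed

lemma mean_perturbation:
  fixes e x a b v :: "nat \<Rightarrow> real"
  assumes v: "\<And>i. i < n \<Longrightarrow> \<bar>v i\<bar> \<le> C"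
  shows "\<bar>(\<Sum>i<n. (e i + a i) * (x i + b i) * v i) - (\<Sum>i<n. e i * x i * v i)\<bar>
    \<le> \<bar>\<Sum>i<n. e i * b i * v i\<bar> + \<bar>\<Sum>i<n. x i * a i * v i\<bar> + C * sqrt ((\<Sum>i<n. (a i)\<^sup>2) * (\<Sum>i<n. (b i)\<^sup>2))"
proof -
  have "(\<Sum>i<n. (e i + a i) * (x i + b i) * v i) - (\<Sum>i<n. e i * x i * v i)
    = (\<Sum>i<n. e i * b i * v i) + (\<Sum>i<n. x i * a i * v i) + (\<Sum>i<n. a i * b i * v i)"
    by (simp add: sum.distrib[symmetric] sum_subtractf[symmetric] algebra_simps)
  moreover have "\<bar>\<Sum>i<n. a i * b i * v i\<bar> \<le> C * sqrt ((\<Sum>i<n. (a i)\<^sup>2) * (\<Sum>i<n. (b i)\<^sup>2))"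
  proof (cases "n = 0")
    case False
    then have C: "0 \<le> C" using v[of 0] by auto
    have "\<bar>\<Sum>i<n. a i * b i * v i\<bar> \<le> (\<Sum>i<n. \<bar>a i * b i * v i\<bar>)" by (rule sum_abs)
    also have "\<dots> \<le> (\<Sum>i<n. C * (\<bar>a i\<bar> * \<bar>b i\<bar>))"
      using v by (intro sum_mono) (simp add: abs_mult mult.commute mult_right_mono)
    also have "\<dots> = C * (\<Sum>i<n. \<bar>a i\<bar> * \<bar>b i\<bar>)" by (simp add: sum_distrib_left)
    also have "\<dots> \<le> C * sqrt ((\<Sum>i<n. (a i)\<^sup>2) * (\<Sum>i<n. (b i)\<^sup>2))"
      using L2_set_mult_ineq[of a b "{..<n}"] C by (intro mult_left_mono) (auto simp: L2_set_def real_sqrt_mult)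
    finally show ?thesis .
  qed simp
  ultimately show ?thesis by linarith
qed

text \<open>Cauchy-Schwarz throughout, with \<open>3/2\<close> as a bound for \<open>sqrt 2\<close>.
  The only delicate summand is the one with \<open>a i * b i\<close>.\<close>

lemma cross_product_perturbation:
  fixes e x a b v w :: "nat \<Rightarrow> real" and n :: nat
  assumes n: "0 < n" and k: "1 \<le> \<kappa>" and t: "0 \<le> t" "t \<le> 1"
    and v: "\<And>i. i < n \<Longrightarrow> \<bar>v i\<bar> \<le> \<kappa>" and w: "\<And>i. i < n \<Longrightarrow> \<bar>w i\<bar> \<le> \<kappa>"
    and pv: "(\<Sum>i<n. (e i * x i * v i)\<^sup>2) / n \<le> 2"
    and eb: "(\<Sum>i<n. (e i)\<^sup>2 * (b i)\<^sup>2) / n \<le> t\<^sup>2" and xa: "(\<Sum>i<n. (x i)\<^sup>2 * (a i)\<^sup>2) / n \<le> t\<^sup>2"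
  shows "\<bar>\<Sum>i<n. (e i * x i * v i) * ((e i * b i + x i * a i + a i * b i) * w i)\<bar> / n \<le> 4 * \<kappa>\<^sup>2 * t"
proof -
  have ebi: "(\<Sum>i<n. (e i * b i)\<^sup>2) / n \<le> t\<^sup>2" and xai: "(\<Sum>i<n. (x i * a i)\<^sup>2) / n \<le> t\<^sup>2"
    using eb xa by (simp_all add: power_mult_distrib)
  have s1: "sqrt ((\<Sum>i<n. (e i * b i)\<^sup>2) / n) \<le> t" "sqrt ((\<Sum>i<n. (x i * a i)\<^sup>2) / n) \<le> t"
    using ebi xai t by (auto intro!: real_le_lsqrt)
  have s2: "sqrt ((\<Sum>i<n. (e i * x i * v i)\<^sup>2) / n) \<le> 3/2" 
  proof (rule real_le_lsqrt)
    have "(3/2 :: real)\<^sup>2 = 9/4" by (simp add: power2_eq_square)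
    then show "(\<Sum>i<n. (e i * x i * v i)\<^sup>2) / n \<le> (3/2)\<^sup>2" using pv by linarith
  qed simp
  have "\<bar>\<Sum>i<n. (e i * x i * v i) * ((e i * b i + x i * a i + a i * b i) * w i)\<bar>
    \<le> (\<Sum>i<n. \<bar>(e i * x i * v i) * ((e i * b i + x i * a i + a i * b i) * w i)\<bar>)" by (rule sum_abs)
  also have "\<dots> \<le> (\<Sum>i<n. \<kappa> * (\<bar>e i * x i * v i\<bar> * \<bar>e i * b i\<bar>) + \<kappa> * (\<bar>e i * x i * v i\<bar> * \<bar>x i * a i\<bar>) + \<kappa>\<^sup>2 * (\<bar>e i * b i\<bar> * \<bar>x i * a i\<bar>))"
  proof (rule sum_mono)
    fix i assume "i \<in> {..<n}"
    then have vw: "\<bar>v i\<bar> \<le> \<kappa>" "\<bar>w i\<bar> \<le> \<kappa>" using v w by auto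
    let ?p = "\<bar>e i * x i * v i\<bar>"
    have "\<bar>(e i * x i * v i) * ((e i * b i + x i * a i + a i * b i) * w i)\<bar>
       \<le> ?p * \<bar>e i * b i\<bar> * \<bar>w i\<bar> + ?p * \<bar>x i * a i\<bar> * \<bar>w i\<bar> + ?p * \<bar>a i * b i\<bar> * \<bar>w i\<bar>"
    proof -
      have "\<bar>(e i * x i * v i) * ((e i * b i + x i * a i + a i * b i) * w i)\<bar> = (?p * \<bar>w i\<bar>) * \<bar>e i * b i + x i * a i + a i * b i\<bar>"
        by (simp only: abs_mult) (simp add: ac_simps)
      also have "\<dots> \<le> (?p * \<bar>w i\<bar>) * (\<bar>e i * b i\<bar> + \<bar>x i * a i\<bar> + \<bar>a i * b i\<bar>)"
        by (intro mult_left_mono) auto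
      finally show ?thesis by (simp add: algebra_simps)
    qed
    moreover have "?p * \<bar>e i * b i\<bar> * \<bar>w i\<bar> \<le> ?p * \<bar>e i * b i\<bar> * \<kappa>" using vw by (intro mult_left_mono) auto
    moreover have "?p * \<bar>x i * a i\<bar> * \<bar>w i\<bar> \<le> ?p * \<bar>x i * a i\<bar> * \<kappa>" using vw by (intro mult_left_mono) auto
    \<comment> \<open>The factors are regrouped as \<open>e b\<close> times \<open>x a\<close>,
      whose mean squares are controlled; no fourth moment of residuals or of regression errors is
      called for.\<close>
    moreover have "?p * \<bar>a i * b i\<bar> * \<bar>w i\<bar> \<le> \<kappa>\<^sup>2 * (\<bar>e i * b i\<bar> * \<bar>x i * a i\<bar>)"
    proof -
      have "?p * \<bar>a i * b i\<bar> * \<bar>w i\<bar> = (\<bar>v i\<bar> * \<bar>w i\<bar>) * (\<bar>e i * b i\<bar> * \<bar>x i * a i\<bar>)"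
        by (simp add: abs_mult ac_simps)
      also have "\<dots> \<le> (\<kappa> * \<kappa>) * (\<bar>e i * b i\<bar> * \<bar>x i * a i\<bar>)"
        using vw k by (intro mult_right_mono mult_mono) auto
      finally show ?thesis by (simp add: power2_eq_square)
    qed
    ultimately show "\<bar>(e i * x i * v i) * ((e i * b i + x i * a i + a i * b i) * w i)\<bar>
      \<le> \<kappa> * (?p * \<bar>e i * b i\<bar>) + \<kappa> * (?p * \<bar>x i * a i\<bar>) + \<kappa>\<^sup>2 * (\<bar>e i * b i\<bar> * \<bar>x i * a i\<bar>)"
      by (simp add: ac_simps)
  qed
  finally have "\<bar>\<Sum>i<n. (e i * x i * v i) * ((e i * b i + x i * a i + a i * b i) * w i)\<bar> / n
    \<le> (\<Sum>i<n. \<kappa> * (\<bar>e i * x i * v i\<bar> * \<bar>e i * b i\<bar>) + \<kappa> * (\<bar>e i * x i * v i\<bar> * \<bar>x i * a i\<bar>) + \<kappa>\<^sup>2 * (\<bar>e i * b i\<bar> * \<bar>x i * a i\<bar>)) / n"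
    by (intro divide_right_mono) auto
  also have "\<dots> = \<kappa> * ((\<Sum>i<n. \<bar>e i * x i * v i\<bar> * \<bar>e i * b i\<bar>) / n) + \<kappa> * ((\<Sum>i<n. \<bar>e i * x i * v i\<bar> * \<bar>x i * a i\<bar>) / n)
     + \<kappa>\<^sup>2 * ((\<Sum>i<n. \<bar>e i * b i\<bar> * \<bar>x i * a i\<bar>) / n)"
    by (simp only: sum.distrib add_divide_distrib sum_distrib_left times_divide_eq_right)
  also have "\<dots> \<le> \<kappa> * (3/2 * t) + \<kappa> * (3/2 * t) + \<kappa>\<^sup>2 * (t * t)"
  proof (intro add_mono mult_left_mono)
    show "(\<Sum>i<n. \<bar>e i * x i * v i\<bar> * \<bar>e i * b i\<bar>) / n \<le> 3/2 * t"
      using s1 s2 t by (intro order_trans[OF average_cauchy_schwarz] mult_mono) (auto simp: sum_nonneg)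
    show "(\<Sum>i<n. \<bar>e i * x i * v i\<bar> * \<bar>x i * a i\<bar>) / n \<le> 3/2 * t"
      using s1 s2 t by (intro order_trans[OF average_cauchy_schwarz] mult_mono) (auto simp: sum_nonneg)
    show "(\<Sum>i<n. \<bar>e i * b i\<bar> * \<bar>x i * a i\<bar>) / n \<le> t * t"
      using s1 t by (intro order_trans[OF average_cauchy_schwarz] mult_mono) (auto simp: sum_nonneg)
  qed (use k in auto)
  also have "\<dots> \<le> 4 * \<kappa>\<^sup>2 * t"
  proof -
    have "\<kappa> * t \<le> \<kappa>\<^sup>2 * t" using k t by (intro mult_right_mono) (auto simp: power2_eq_square)
    moreover have "\<kappa>\<^sup>2 * (t * t) \<le> \<kappa>\<^sup>2 * t" using t by (intro mult_left_mono) (auto simp: mult_left_le)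
    ultimately show ?thesis by simp
  qed
  finally show ?thesis .
qed

text \<open>Each estimated product is the oracle product \<open>p\<close> plus the error
  \<open>U\<close>. The two mixed terms cost \<open>4 * \<kappa>^2 * t\<close> each and the
  quadratic one \<open>9 * \<kappa>^2 * t\<close>.\<close>

lemma square_perturbation:
  fixes e x a b v w :: "nat \<Rightarrow> real" and n :: nat
  assumes n: "0 < n" and k: "1 \<le> \<kappa>" and t: "0 \<le> t" "t \<le> 1"
    and v: "\<And>i. i < n \<Longrightarrow> \<bar>v i\<bar> \<le> \<kappa>" and w: "\<And>i. i < n \<Longrightarrow> \<bar>w i\<bar> \<le> \<kappa>"
    and pv: "(\<Sum>i<n. (e i * x i * v i)\<^sup>2) / n \<le> 2" and pw: "(\<Sum>i<n. (e i * x i * w i)\<^sup>2) / n \<le> 2"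
    and eb: "(\<Sum>i<n. (e i)\<^sup>2 * (b i)\<^sup>2) / n \<le> t\<^sup>2" and xa: "(\<Sum>i<n. (x i)\<^sup>2 * (a i)\<^sup>2) / n \<le> t\<^sup>2"
    and ab: "(\<Sum>i<n. (a i)\<^sup>2) * (\<Sum>i<n. (b i)\<^sup>2) / n \<le> t"
  shows "\<bar>(\<Sum>i<n. ((e i + a i) * (x i + b i) * v i) * ((e i + a i) * (x i + b i) * w i)) / n - (\<Sum>i<n. (e i * x i * v i) * (e i * x i * w i)) / n\<bar> \<le> 17 * \<kappa>\<^sup>2 * t"
proof -
  define U where "U i = e i * b i + x i * a i + a i * b i" for i
  define p where "p i = e i * x i" for i
  have "(\<Sum>i<n. ((e i + a i) * (x i + b i) * v i) * ((e i + a i) * (x i + b i) * w i)) - (\<Sum>i<n. (e i * x i * v i) * (e i * x i * w i))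
    = (\<Sum>i<n. (p i * v i) * (U i * w i)) + (\<Sum>i<n. (p i * w i) * (U i * v i)) + (\<Sum>i<n. (U i * v i) * (U i * w i))"
    unfolding sum.distrib[symmetric] sum_subtractf[symmetric]
    by (intro sum.cong refl) (simp add: U_def p_def algebra_simps)
  then have "\<bar>(\<Sum>i<n. ((e i + a i) * (x i + b i) * v i) * ((e i + a i) * (x i + b i) * w i)) / n - (\<Sum>i<n. (e i * x i * v i) * (e i * x i * w i)) / n\<bar>
    \<le> \<bar>\<Sum>i<n. (p i * v i) * (U i * w i)\<bar> / n + \<bar>\<Sum>i<n. (p i * w i) * (U i * v i)\<bar> / n + \<bar>\<Sum>i<n. (U i * v i) * (U i * w i)\<bar> / n"
    unfolding diff_divide_distrib[symmetric]
    using abs_triangle_ineq[of "(\<Sum>i<n. (p i * v i) * (U i * w i)) + (\<Sum>i<n. (p i * w i) * (U i * v i))" "\<Sum>i<n. (U i * v i) * (U i * w i)"]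
      abs_triangle_ineq[of "\<Sum>i<n. (p i * v i) * (U i * w i)" "\<Sum>i<n. (p i * w i) * (U i * v i)"]
    by (simp add: abs_divide add_divide_distrib[symmetric] divide_right_mono)
  moreover have "\<bar>\<Sum>i<n. (p i * v i) * (U i * w i)\<bar> / n \<le> 4 * \<kappa>\<^sup>2 * t"
    unfolding p_def U_def by (rule cross_product_perturbation[OF n k t v w pv eb xa])
  moreover have "\<bar>\<Sum>i<n. (p i * w i) * (U i * v i)\<bar> / n \<le> 4 * \<kappa>\<^sup>2 * t"
    unfolding p_def U_def by (rule cross_product_perturbation[OF n k t w v pw eb xa])
  moreover have "\<bar>\<Sum>i<n. (U i * v i) * (U i * w i)\<bar> / n \<le> 9 * \<kappa>\<^sup>2 * t"
  proof -
    have "\<bar>\<Sum>i<n. (U i * v i) * (U i * w i)\<bar> \<le> (\<Sum>i<n. \<bar>(U i * v i) * (U i * w i)\<bar>)" by (rule sum_abs)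
    also have "\<dots> \<le> (\<Sum>i<n. \<kappa>\<^sup>2 * (3 * ((e i)\<^sup>2 * (b i)\<^sup>2) + 3 * ((x i)\<^sup>2 * (a i)\<^sup>2) + 3 * ((a i)\<^sup>2 * (b i)\<^sup>2)))"
    proof (rule sum_mono)
      fix i assume "i \<in> {..<n}"
      then have vw: "\<bar>v i\<bar> \<le> \<kappa>" "\<bar>w i\<bar> \<le> \<kappa>" using v w by auto
      have "\<bar>(U i * v i) * (U i * w i)\<bar> = (\<bar>v i\<bar> * \<bar>w i\<bar>) * (U i)\<^sup>2"
        by (simp add: abs_mult power2_eq_square ac_simps)
      also have "\<dots> \<le> (\<kappa> * \<kappa>) * (U i)\<^sup>2" using vw k by (intro mult_right_mono mult_mono) auto
      also have "\<dots> \<le> (\<kappa> * \<kappa>) * (3 * ((e i)\<^sup>2 * (b i)\<^sup>2) + 3 * ((x i)\<^sup>2 * (a i)\<^sup>2) + 3 * ((a i)\<^sup>2 * (b i)\<^sup>2))"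
      proof (intro mult_left_mono)
        have "(y + z + r)\<^sup>2 \<le> 3 * y\<^sup>2 + 3 * z\<^sup>2 + 3 * r\<^sup>2" for y z r :: real
        proof -
          have "0 \<le> (y - z)\<^sup>2 + (y - r)\<^sup>2 + (z - r)\<^sup>2" by simp
          then show ?thesis by (simp add: power2_eq_square algebra_simps)
        qed
        from this[of "e i * b i" "x i * a i" "a i * b i"]
        show "(U i)\<^sup>2 \<le> 3 * ((e i)\<^sup>2 * (b i)\<^sup>2) + 3 * ((x i)\<^sup>2 * (a i)\<^sup>2) + 3 * ((a i)\<^sup>2 * (b i)\<^sup>2)"
          by (simp add: U_def power_mult_distrib)
      qed (use k in auto)
      finally show "\<bar>(U i * v i) * (U i * w i)\<bar> \<le> \<kappa>\<^sup>2 * (3 * ((e i)\<^sup>2 * (b i)\<^sup>2) + 3 * ((x i)\<^sup>2 * (a i)\<^sup>2) + 3 * ((a i)\<^sup>2 * (b i)\<^sup>2))"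
        by (simp add: power2_eq_square)
    qed
    finally have "\<bar>\<Sum>i<n. (U i * v i) * (U i * w i)\<bar> / n \<le> (\<Sum>i<n. \<kappa>\<^sup>2 * (3 * ((e i)\<^sup>2 * (b i)\<^sup>2) + 3 * ((x i)\<^sup>2 * (a i)\<^sup>2) + 3 * ((a i)\<^sup>2 * (b i)\<^sup>2))) / n"
      by (intro divide_right_mono) auto
    also have "\<dots> = \<kappa>\<^sup>2 * (3 * ((\<Sum>i<n. (e i)\<^sup>2 * (b i)\<^sup>2) / n) + 3 * ((\<Sum>i<n. (x i)\<^sup>2 * (a i)\<^sup>2) / n) + 3 * ((\<Sum>i<n. (a i)\<^sup>2 * (b i)\<^sup>2) / n))"
      by (simp only: sum_distrib_left[symmetric] sum.distrib) (simp add: add_divide_distrib distrib_left)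
    also have "\<dots> \<le> \<kappa>\<^sup>2 * (3 * t + 3 * t + 3 * t)"
    proof (intro mult_left_mono add_mono)
      have "t\<^sup>2 \<le> t" using t by (simp add: power2_eq_square mult_left_le)
      then show "(\<Sum>i<n. (e i)\<^sup>2 * (b i)\<^sup>2) / n \<le> t" "(\<Sum>i<n. (x i)\<^sup>2 * (a i)\<^sup>2) / n \<le> t" using eb xa by auto
      have "(\<Sum>i<n. (a i)\<^sup>2 * (b i)\<^sup>2) / n \<le> (\<Sum>i<n. (a i)\<^sup>2) * (\<Sum>i<n. (b i)\<^sup>2) / n"
        using sum_product_le[of "\<lambda>i. (a i)\<^sup>2" "\<lambda>i. (b i)\<^sup>2" n] by (intro divide_right_mono) auto
      then show "(\<Sum>i<n. (a i)\<^sup>2 * (b i)\<^sup>2) / n \<le> t" using ab by simp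
    qed (use k in auto)
    finally show ?thesis by simp
  qed
  ultimately show ?thesis by linarith
qed

lemma inverse_sqrt_perturbation:
  fixes g :: real
  assumes "\<bar>g - 1\<bar> \<le> r" "r \<le> 1/2"
  shows "\<bar>1 / sqrt g - 1\<bar> \<le> 2 * r" "1 / sqrt g \<le> 2" "0 < g"
proof -
  have g: "1/2 \<le> g" using assms by linarith
  then show "0 < g" by linarith
  have sg: "1/2 \<le> sqrt g" using g by (intro real_le_rsqrt) (auto simp: power2_eq_square)
  have "0 < sqrt g" using sg by linarith
  then show "1 / sqrt g \<le> 2" using sg by (simp add: divide_le_eq)
  have sg0: "sqrt g \<noteq> 0" "1 + sqrt g \<noteq> 0" using sg by linarith+
  have "1 / sqrt g - 1 = (1 - sqrt g) / sqrt g" using sg0 by (simp add: diff_divide_distrib)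
  also have "\<dots> = ((1 - sqrt g) * (1 + sqrt g)) / (sqrt g * (1 + sqrt g))" using sg0 by simp
  also have "(1 - sqrt g) * (1 + sqrt g) = 1 - g" using g by (simp add: algebra_simps)
  finally have "\<bar>1 / sqrt g - 1\<bar> = \<bar>1 - g\<bar> / (sqrt g * (1 + sqrt g))" using sg \<open>0 < g\<close> by (simp add: abs_divide abs_mult)
  also have "\<dots> \<le> r / (1/2)"
  proof (rule frac_le)
    have "1/2 * 1 \<le> sqrt g * (1 + sqrt g)" using sg \<open>0 < g\<close> by (intro mult_mono) auto
    then show "1/2 \<le> sqrt g * (1 + sqrt g)" by simp
  qed (use assms g in auto)
  finally show "\<bar>1 / sqrt g - 1\<bar> \<le> 2 * r" by simp
qed

text \<open>Normalisation by the perturbed variances changes the product of reciprocal roots by at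
  most \<open>6 * r\<close>; multiplied by a covariance of size at most 3/2 this costs
  \<open>9 * r\<close>, and the covariance itself moves by \<open>r\<close>.\<close>

lemma correlation_perturbation:
  fixes gkk gll gkl \<sigma> :: real
  assumes "\<bar>gkk - 1\<bar> \<le> r" "\<bar>gll - 1\<bar> \<le> r" "\<bar>gkl - \<sigma>\<bar> \<le> r" "r \<le> 1/2" "\<bar>\<sigma>\<bar> \<le> 1"
  shows "\<bar>gkl / (sqrt gkk * sqrt gll) - \<sigma>\<bar> \<le> 10 * r"
proof -
  define \<alpha> where "\<alpha> = 1 / sqrt gkk"
  define \<beta> where "\<beta> = 1 / sqrt gll"
  have a: "\<bar>\<alpha> - 1\<bar> \<le> 2 * r" and b: "\<bar>\<beta> - 1\<bar> \<le> 2 * r" "\<bar>\<beta>\<bar> \<le> 2"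
    using inverse_sqrt_perturbation[OF assms(1,4)] inverse_sqrt_perturbation[OF assms(2,4)] by (auto simp: \<alpha>_def \<beta>_def)
  have r: "0 \<le> r" using assms(1) by linarith
  have "\<alpha> * \<beta> - 1 = (\<alpha> - 1) * \<beta> + (\<beta> - 1)" by (simp add: algebra_simps)
  moreover have "\<bar>(\<alpha> - 1) * \<beta>\<bar> \<le> (2 * r) * 2" unfolding abs_mult using a b r by (intro mult_mono) auto
  ultimately have ab: "\<bar>\<alpha> * \<beta> - 1\<bar> \<le> 6 * r" using b by linarith
  have g: "\<bar>gkl\<bar> \<le> 3/2" using assms by linarith
  have "gkl / (sqrt gkk * sqrt gll) - \<sigma> = gkl * (\<alpha> * \<beta> - 1) + (gkl - \<sigma>)"
    by (simp add: \<alpha>_def \<beta>_def algebra_simps)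
  moreover have "\<bar>gkl * (\<alpha> * \<beta> - 1)\<bar> \<le> 3/2 * (6 * r)" unfolding abs_mult using g ab by (intro mult_mono) auto
  ultimately show ?thesis using assms(3) by linarith
qed

section \<open>Bootstrap quantiles\<close>

text \<open>Testing only levels strictly below \<open>S\<close> makes the equivalence exact for
  every law, atoms included. The vanishing below 0 and the limit 1 at infinity ensure that the
  infimum defining the quantile is over a nonempty set bounded below.\<close>

lemma quantile_characterization:
  assumes \<mu>: "real_distribution \<mu>" and neg: "\<And>t. t < 0 \<Longrightarrow> measure \<mu> {..t} = 0" and \<alpha>: "0 < \<alpha>" "\<alpha> < 1"
  shows "S \<le> quantile \<mu> \<alpha> \<longleftrightarrow> (\<forall>t<S. measure \<mu> {..t} < \<alpha>)"
proof -
  interpret real_distribution \<mu> by fact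
  let ?T = "{t. \<alpha> \<le> measure \<mu> {..t}}"
  have bb: "bdd_below ?T"
  proof (rule bdd_belowI)
    fix t assume "t \<in> ?T"
    then show "0 \<le> t" using neg[of t] \<alpha> by (cases "t < 0") auto
  qed
  have "eventually (\<lambda>t. \<alpha> < cdf \<mu> t) at_top"
    using cdf_lim_at_top_prob \<alpha> by (intro order_tendstoD) auto
  then obtain t0 where "\<alpha> < cdf \<mu> t0" by (auto simp: eventually_at_top_linorder)
  then have ne: "?T \<noteq> {}" by (auto simp: cdf_def intro: less_imp_le)
  show ?thesis
  proof
    assume S: "S \<le> quantile \<mu> \<alpha>"
    show "\<forall>t<S. measure \<mu> {..t} < \<alpha>"
    proof (intro allI impI, rule ccontr)
      fix t assume t: "t < S" "\<not> measure \<mu> {..t} < \<alpha>"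
      then have "quantile \<mu> \<alpha> \<le> t" unfolding quantile_def by (intro cInf_lower bb) auto
      then show False using S t by simp
    qed
  next
    assume L: "\<forall>t<S. measure \<mu> {..t} < \<alpha>"
    show "S \<le> quantile \<mu> \<alpha>" unfolding quantile_def
      by (rule cInf_greatest[OF ne]) (use L in \<open>force simp: not_less[symmetric]\<close>)
  qed
qed

text \<open>Markov's inequality for \<open>exp (z^2 / 4)\<close>: multiplying the standard normal
  density by it gives \<open>sqrt 2\<close> times the density of variance 2, so the mean is
  \<open>sqrt 2\<close>.\<close>

lemma std_normal_tail:
  assumes x: "0 \<le> x"
  shows "measure std_normal_distribution {z. x < \<bar>z\<bar>} \<le> 2 * exp (- x\<^sup>2 / 4)"
proof -
  let ?N = "std_normal_distribution"
  interpret N: prob_space ?N by (rule prob_space_std_normal)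
  have d: "std_normal_density z * exp (z\<^sup>2 / 4) = sqrt 2 * normal_density 0 (sqrt 2) z" for z :: real
  proof -
    have "std_normal_density z * exp (z\<^sup>2 / 4) = (1 / sqrt (2 * pi)) * exp (- z\<^sup>2 / 4)"
      unfolding std_normal_density_def by (simp add: exp_add[symmetric] mult.assoc field_simps)
    also have "\<dots> = sqrt 2 * normal_density 0 (sqrt 2) z"
    proof -
      have "sqrt (2 * pi * (sqrt 2)\<^sup>2) = sqrt (2 * pi) * sqrt 2" by (simp only: real_sqrt_mult[symmetric]) simp
      then show ?thesis unfolding normal_density_def by (simp del: real_sqrt_mult)
    qed
    finally show ?thesis .
  qed
  have "ennreal (exp (x\<^sup>2 / 4)) * emeasure ?N {z. x < \<bar>z\<bar>} = (\<integral>\<^sup>+z. ennreal (exp (x\<^sup>2 / 4)) * indicator {z. x < \<bar>z\<bar>} z \<partial>?N)"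
    by (subst nn_integral_cmult_indicator) auto
  also have "\<dots> \<le> (\<integral>\<^sup>+z. ennreal (exp (z\<^sup>2 / 4)) \<partial>?N)"
  proof (rule nn_integral_mono)
    fix z :: real
    have "x\<^sup>2 \<le> z\<^sup>2" if "x < \<bar>z\<bar>" using power_mono[of x "\<bar>z\<bar>" 2] that x by simp
    then show "ennreal (exp (x\<^sup>2 / 4)) * indicator {z. x < \<bar>z\<bar>} z \<le> ennreal (exp (z\<^sup>2 / 4))"
      by (auto simp: indicator_def intro!: ennreal_leI)
  qed
  also have "\<dots> = (\<integral>\<^sup>+z. ennreal (sqrt 2 * normal_density 0 (sqrt 2) z) \<partial>lborel)"
    by (subst nn_integral_density) (auto simp: ennreal_mult'[symmetric] d)
  also have "\<dots> = ennreal (\<integral>z. sqrt 2 * normal_density 0 (sqrt 2) z \<partial>lborel)"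
    by (rule nn_integral_eq_integral) auto
  also have "\<dots> = ennreal (sqrt 2)" by simp
  finally have "ennreal (exp (x\<^sup>2 / 4) * measure ?N {z. x < \<bar>z\<bar>}) \<le> ennreal (sqrt 2)"
    by (simp add: N.emeasure_eq_measure ennreal_mult')
  then have "exp (x\<^sup>2 / 4) * measure ?N {z. x < \<bar>z\<bar>} \<le> sqrt 2" by (simp add: ennreal_le_iff)
  also have "sqrt 2 \<le> (2::real)" by (rule real_le_lsqrt) auto
  finally show ?thesis by (simp add: exp_minus field_simps)
qed

lemma gauss_max_tail:
  assumes I: "finite I" "I \<noteq> {}" and J: "finite J" and unit: "\<forall>i\<in>I. (\<Sum>m\<in>J. L i m * L i m) = 1" and x: "0 \<le> x"
  shows "measure (gstd J) {\<xi>\<in>space (gstd J). x < mxa I (lin L J \<xi>)} \<le> card I * (2 * exp (- x\<^sup>2 / 4))"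
proof -
  interpret G: prob_space "gstd J" by (rule prob_space_gstd)
  have one: "measure (gstd J) {\<xi>\<in>space (gstd J). x < \<bar>lin L J \<xi> i\<bar>} \<le> 2 * exp (- x\<^sup>2 / 4)" if i: "i \<in> I" for i
  proof -
    \<comment> \<open>The one-column matrix with entry 1: a coordinate of unit variance has the law
      of a single standard normal variable, by uniqueness of the Gaussian law on a one-point index
      set.\<close>
    let ?L1 = "\<lambda>(_::'a) (_::nat). 1 :: real"
    let ?E = "{y\<in>space (PiM {i} (\<lambda>_. borel :: real measure)). x < \<bar>y i\<bar>}"
    have [measurable]: "(\<lambda>y. y i) \<in> borel_measurable (PiM {i} (\<lambda>_. borel :: real measure))" by (rule measurable_component_singleton) simp
    have E: "?E \<in> sets (PiM {i} (\<lambda>_. borel))" by measurable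
    have e: "emeasure (distr (gstd G) (PiM {i} (\<lambda>_. borel)) (\<lambda>\<xi>. restrict (lin K G \<xi>) {i})) ?E
       = emeasure (gstd G) {\<xi>\<in>space (gstd G). x < \<bar>lin K G \<xi> i\<bar>}" for K :: "'a \<Rightarrow> nat \<Rightarrow> real" and G
    proof -
      have "(\<lambda>\<xi>. restrict (lin K G \<xi>) {i}) -` ?E \<inter> space (gstd G) = {\<xi>\<in>space (gstd G). x < \<bar>lin K G \<xi> i\<bar>}"
        by (auto simp: space_PiM)
      then show ?thesis using E by (subst emeasure_distr) (auto intro!: measurable_restrict)
    qed
    have "distr (gstd J) (PiM {i} (\<lambda>_. borel)) (\<lambda>\<xi>. restrict (lin L J \<xi>) {i}) = distr (gstd {0}) (PiM {i} (\<lambda>_. borel)) (\<lambda>\<xi>. restrict (lin ?L1 {0} \<xi>) {i})"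
      by (rule gauss_law_eq) (use J unit i in auto)
    then have "emeasure (gstd J) {\<xi>\<in>space (gstd J). x < \<bar>lin L J \<xi> i\<bar>} = emeasure (gstd {0}) {\<xi>\<in>space (gstd {0}). x < \<bar>\<xi> 0\<bar>}"
      using e[of J L] e[of "{0}" ?L1] by (simp add: lin_def)
    also have "\<dots> = emeasure (distr (gstd {0}) std_normal_distribution (\<lambda>\<xi>. \<xi> 0)) {z. x < \<bar>z\<bar>}"
    proof -
      have "(\<lambda>\<xi>. \<xi> 0) \<in> measurable (gstd {0}) std_normal_distribution" using component_gstd[of 0 "{0}"] by simp
      then show ?thesis by (subst emeasure_distr) (auto intro!: arg_cong[where f="emeasure _"])
    qed
    also have "distr (gstd {0}) std_normal_distribution (\<lambda>\<xi>. \<xi> 0) = std_normal_distribution"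
      unfolding gstd_def by (rule distr_PiM_component[OF prob_space_std_normal]) simp
    finally have "measure (gstd J) {\<xi>\<in>space (gstd J). x < \<bar>lin L J \<xi> i\<bar>} = measure std_normal_distribution {z. x < \<bar>z\<bar>}"
      by (simp add: measure_def)
    then show ?thesis using std_normal_tail[OF x] by simp
  qed
  have "{\<xi>\<in>space (gstd J). x < mxa I (lin L J \<xi>)} = (\<Union>i\<in>I. {\<xi>\<in>space (gstd J). x < \<bar>lin L J \<xi> i\<bar>})"
    using mxa_le_iff[OF I] by (auto simp: not_le[symmetric])
  then have "measure (gstd J) {\<xi>\<in>space (gstd J). x < mxa I (lin L J \<xi>)} \<le> (\<Sum>i\<in>I. measure (gstd J) {\<xi>\<in>space (gstd J). x < \<bar>lin L J \<xi> i\<bar>})"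
    using I by (simp only:) (intro G.finite_measure_subadditive_finite, auto)
  also have "\<dots> \<le> (\<Sum>i\<in>I. 2 * exp (- x\<^sup>2 / 4))" by (intro sum_mono one)
  finally show ?thesis by simp
qed

text \<open>\<open>gauss_vec\<close> selects some square factor by choice. Such a factor exists
  because a Gram matrix is positive semidefinite, and the law does not depend on the selection, so
  the explicit factor \<open>V\<close> with \<open>n\<close> columns may be used instead.\<close>

lemma max_abs_law:
  fixes n K :: nat
  assumes K: "0 < K" and S: "\<And>k l. k \<in> {1..K} \<Longrightarrow> l \<in> {1..K} \<Longrightarrow> S k l = (\<Sum>i<n. V k i * V l i)"
  shows "max_abs_law K S = distr (gstd {..<n}) borel (\<lambda>\<xi>. mxa {1..K} (lin V {..<n} \<xi>))"
proof -
  let ?I = "{1..K}"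
  have I: "finite ?I" "?I \<noteq> {}" using K by auto
  define S' where "S' k l = (\<Sum>i<n. V k i * V l i)" for k l
  have psd: "0 \<le> (\<Sum>i\<in>?I. \<Sum>j\<in>?I. c i * c j * S' i j)" for c :: "nat \<Rightarrow> real"
  proof -
    have "(\<Sum>i\<in>?I. \<Sum>j\<in>?I. c i * c j * S' i j) = (\<Sum>i\<in>?I. \<Sum>j\<in>?I. \<Sum>m<n. (c i * V i m) * (c j * V j m))"
      by (simp add: S'_def sum_distrib_left ac_simps)
    also have "\<dots> = (\<Sum>i\<in>?I. \<Sum>m<n. \<Sum>j\<in>?I. (c i * V i m) * (c j * V j m))" by (subst (2) sum.swap) simp
    also have "\<dots> = (\<Sum>m<n. \<Sum>i\<in>?I. \<Sum>j\<in>?I. (c i * V i m) * (c j * V j m))" by (rule sum.swap)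
    also have "\<dots> = (\<Sum>m<n. (\<Sum>i\<in>?I. c i * V i m) * (\<Sum>i\<in>?I. c i * V i m))" by (simp add: sum_product)
    also have "\<dots> \<ge> 0" by (intro sum_nonneg) simp
    finally show ?thesis .
  qed
  have "\<exists>L :: nat \<Rightarrow> nat \<Rightarrow> real. \<forall>i\<in>?I. \<forall>j\<in>?I. (\<Sum>m\<in>?I. L i m * L j m) = S' i j"
    by (rule psd_factorization[OF I(1) _ psd]) (simp add: S'_def mult.commute)
  then have ex: "\<exists>L :: nat \<Rightarrow> nat \<Rightarrow> real. \<forall>i\<in>?I. \<forall>j\<in>?I. (\<Sum>m\<in>?I. L i m * L j m) = S i j"
    using S by (simp add: S'_def)
  define L where "L = (SOME L :: nat \<Rightarrow> nat \<Rightarrow> real. \<forall>i\<in>?I. \<forall>j\<in>?I. (\<Sum>m\<in>?I. L i m * L j m) = S i j)"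
  have L: "\<forall>i\<in>?I. \<forall>j\<in>?I. (\<Sum>m\<in>?I. L i m * L j m) = S i j" unfolding L_def by (rule someI_ex[OF ex])
  have "gauss_vec K S = distr (gstd ?I) (PiM ?I (\<lambda>_. borel)) (\<lambda>\<xi>. restrict (lin L ?I \<xi>) ?I)"
    unfolding gauss_vec_def Let_def L_def[symmetric] std_gauss_vec_def gstd_def lin_def ..
  also have "\<dots> = distr (gstd {..<n}) (PiM ?I (\<lambda>_. borel)) (\<lambda>\<xi>. restrict (lin V {..<n} \<xi>) ?I)"
    by (rule gauss_law_eq[OF I]) (use L S in auto)
  finally have g: "gauss_vec K S = distr (gstd {..<n}) (PiM ?I (\<lambda>_. borel)) (\<lambda>\<xi>. restrict (lin V {..<n} \<xi>) ?I)" .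
  have m1: "(\<lambda>\<xi>. restrict (lin V {..<n} \<xi>) ?I) \<in> measurable (gstd {..<n}) (PiM ?I (\<lambda>_. borel))"
    by (intro measurable_restrict lin_measurable)
  have m2: "(\<lambda>t. mxa ?I t) \<in> borel_measurable (PiM ?I (\<lambda>_. borel))"
    by (rule mxa_measurable[OF I]) (rule measurable_component_singleton)
  have r: "mxa ?I (restrict x ?I) = mxa ?I x" for x unfolding mxa_def by (rule arg_cong[where f=Max]) auto
  have "max_abs_law K S = distr (gauss_vec K S) borel (\<lambda>t. mxa ?I t)"
    by (simp add: max_abs_law_def mxa_def)
  also have "\<dots> = distr (gstd {..<n}) borel ((\<lambda>t. mxa ?I t) \<circ> (\<lambda>\<xi>. restrict (lin V {..<n} \<xi>) ?I))"
    unfolding g by (rule distr_distr[OF m2 m1])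
  finally show ?thesis unfolding comp_def r .
qed

lemma mxa_lin_measurable: "0 < (K :: nat) \<Longrightarrow> (\<lambda>\<xi>. mxa {1..K} (lin V J \<xi>)) \<in> borel_measurable (gstd J)"
  by (rule mxa_measurable) (auto intro: lin_measurable)

lemma max_abs_distribution:
  fixes K :: nat
  assumes K: "0 < K"
  shows "real_distribution (distr (gstd J) borel (\<lambda>\<xi>. mxa {1..K} (lin V J \<xi>)))"
    and "measure (distr (gstd J) borel (\<lambda>\<xi>. mxa {1..K} (lin V J \<xi>))) {..t} = measure (gstd J) {\<xi>\<in>space (gstd J). mxa {1..K} (lin V J \<xi>) \<le> t}"
    and "t < 0 \<Longrightarrow> measure (gstd J) {\<xi>\<in>space (gstd J). mxa {1..K} (lin V J \<xi>) \<le> t} = 0"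
proof -
  interpret prob_space "gstd J" by (rule prob_space_gstd)
  have m: "(\<lambda>\<xi>. mxa {1..K} (lin V J \<xi>)) \<in> borel_measurable (gstd J)" by (rule mxa_lin_measurable[OF K])
  show "real_distribution (distr (gstd J) borel (\<lambda>\<xi>. mxa {1..K} (lin V J \<xi>)))"
    using prob_space_distr[OF m] by (simp add: real_distribution_def real_distribution_axioms_def)
  show "measure (distr (gstd J) borel (\<lambda>\<xi>. mxa {1..K} (lin V J \<xi>))) {..t} = measure (gstd J) {\<xi>\<in>space (gstd J). mxa {1..K} (lin V J \<xi>) \<le> t}"
    by (subst measure_distr[OF m]) (auto intro!: arg_cong[where f="measure _"])
  assume t: "t < 0"
  have "{\<xi>\<in>space (gstd J). mxa {1..K} (lin V J \<xi>) \<le> t} = {}"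
    using mxa_nonneg[of "{1..K}"] K t by (auto simp: not_le intro: less_le_trans)
  then show "measure (gstd J) {\<xi>\<in>space (gstd J). mxa {1..K} (lin V J \<xi>) \<le> t} = 0" by (simp only: measure_empty)
qed

text \<open>The rows of an explicit \<open>n\<close>-column factor of \<open>Sigma_hat\<close>.
  Unlike the chosen factor in \<open>gauss_vec\<close> it is visibly a measurable function of the
  data.\<close>

definition standardized :: "'z regr \<Rightarrow> 'z regr \<Rightarrow> (nat \<Rightarrow> 'z \<Rightarrow> real) \<Rightarrow> nat \<Rightarrow> (nat \<Rightarrow> 'z obs) \<Rightarrow> nat \<Rightarrow> nat \<Rightarrow> real" where
  "standardized fh gh w n \<omega> k i = (Rk fh gh w n \<omega> k i - Rbar fh gh w n \<omega> k) / (sqrt n * sdR fh gh w n \<omega> k)"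

text \<open>Centring commutes with forming second moments. Vanishing standard deviations are covered
  too: both sides are then 0, because division by 0 gives 0.\<close>

lemma Sigma_hat_gram:
  assumes n: "0 < n"
  shows "Sigma_hat fh gh w n \<omega> k l = (\<Sum>i<n. standardized fh gh w n \<omega> k i * standardized fh gh w n \<omega> l i)"
proof -
  let ?R = "Rk fh gh w n \<omega>" and ?B = "Rbar fh gh w n \<omega>" and ?s = "sdR fh gh w n \<omega>"
  have b: "(\<Sum>i<n. ?R k i) = n * ?B k" for k using n by (simp add: Rbar_def)
  have q: "(\<Sum>i<n. ?R k i * ?R l i) = n * Rsq fh gh w n \<omega> k l" using n by (simp add: Rsq_def)
  have "(\<Sum>i<n. (?R k i - ?B k) * (?R l i - ?B l)) = (\<Sum>i<n. ?R k i * ?R l i) - ?B l * (\<Sum>i<n. ?R k i) - ?B k * (\<Sum>i<n. ?R l i) + n * (?B k * ?B l)"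
    by (simp add: sum.distrib sum_subtractf sum_distrib_left algebra_simps)
  also have "\<dots> = n * (Rsq fh gh w n \<omega> k l - ?B k * ?B l)" unfolding b q by (simp add: algebra_simps)
  finally have c: "(\<Sum>i<n. (?R k i - ?B k) * (?R l i - ?B l)) = n * (Rsq fh gh w n \<omega> k l - ?B k * ?B l)" .
  have "(\<Sum>i<n. standardized fh gh w n \<omega> k i * standardized fh gh w n \<omega> l i) = (\<Sum>i<n. (?R k i - ?B k) * (?R l i - ?B l)) / (n * (?s k * ?s l))"
  proof -
    have d: "(sqrt n * p) * (sqrt n * q) = n * (p * q)" for p q :: real
    proof -
      have "(sqrt n * p) * (sqrt n * q) = (sqrt n * sqrt n) * (p * q)" by (simp only: ac_simps)
      then show ?thesis by simp
    qed
    show ?thesis unfolding standardized_def times_divide_times_eq d sum_divide_distrib ..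
  qed
  also have "\<dots> = Sigma_hat fh gh w n \<omega> k l" unfolding c Sigma_hat_def using n by simp
  finally show ?thesis by simp
qed

lemma Ghat_characterization:
  assumes K: "0 < K" and n: "0 < n" and \<alpha>: "0 < \<alpha>" "\<alpha> < 1"
  shows "S \<le> Ghat fh gh w K n \<omega> \<alpha> \<longleftrightarrow>
    (\<forall>t<S. measure (gstd {..<n}) {\<xi>\<in>space (gstd {..<n}). mxa {1..K} (lin (standardized fh gh w n \<omega>) {..<n} \<xi>) \<le> t} < \<alpha>)"
proof -
  have m: "max_abs_law K (Sigma_hat fh gh w n \<omega>) = distr (gstd {..<n}) borel (\<lambda>\<xi>. mxa {1..K} (lin (standardized fh gh w n \<omega>) {..<n} \<xi>))"
    by (rule max_abs_law[OF K]) (rule Sigma_hat_gram[OF n])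
  have neg: "measure (distr (gstd {..<n}) borel (\<lambda>\<xi>. mxa {1..K} (lin (standardized fh gh w n \<omega>) {..<n} \<xi>))) {..t} = 0" if "t < 0" for t
    unfolding max_abs_distribution(2)[OF K] by (rule max_abs_distribution(3)[OF K that])
  show ?thesis
    using quantile_characterization[OF max_abs_distribution(1)[OF K] neg \<alpha>, of S]
    by (simp only: Ghat_def m max_abs_distribution(2)[OF K])
qed

lemma Sstat_mxa: "Sstat fh gh w K n \<omega> = mxa {1..K} (Tstat fh gh w n \<omega>)"
  by (simp add: Sstat_def mxa_def)

lemma statistics_measurable:
  fixes w :: "nat \<Rightarrow> ('z::euclidean_space) \<Rightarrow> real"
  assumes P: "prob_space P" "sets P = sets borel" and w: "\<And>k. w k \<in> borel_measurable borel"
    and fh: "\<And>i. i < n \<Longrightarrow> (\<lambda>\<omega>. fhat fh n \<omega> (obsZ (\<omega> i))) \<in> borel_measurable (PiM {..<n} (\<lambda>_. P))"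
    and gh: "\<And>i. i < n \<Longrightarrow> (\<lambda>\<omega>. ghat gh n \<omega> (obsZ (\<omega> i))) \<in> borel_measurable (PiM {..<n} (\<lambda>_. P))"
  shows "i < n \<Longrightarrow> (\<lambda>\<omega>. Rk fh gh w n \<omega> k i) \<in> borel_measurable (PiM {..<n} (\<lambda>_. P))"
    and "(\<lambda>\<omega>. Tstat fh gh w n \<omega> k) \<in> borel_measurable (PiM {..<n} (\<lambda>_. P))"
    and "i < n \<Longrightarrow> (\<lambda>\<omega>. standardized fh gh w n \<omega> k i) \<in> borel_measurable (PiM {..<n} (\<lambda>_. P))"
proof -
  note obs = obs_measurable[OF P(2)]
  have wz: "(\<lambda>x. w k (obsZ x)) \<in> borel_measurable P" for k by (rule measurable_compose[OF obs(3) w])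
  have R: "(\<lambda>\<omega>. Rk fh gh w n \<omega> k i) \<in> borel_measurable (PiM {..<n} (\<lambda>_. P))" if "i < n" for i k
    unfolding Rk_def
    by (intro borel_measurable_times borel_measurable_diff fh gh that PiM_coordinate(3)[OF P(1) that obs(1)]
      PiM_coordinate(3)[OF P(1) that obs(2)] PiM_coordinate(3)[OF P(1) that wz])
  then show "i < n \<Longrightarrow> (\<lambda>\<omega>. Rk fh gh w n \<omega> k i) \<in> borel_measurable (PiM {..<n} (\<lambda>_. P))" .
  have B: "(\<lambda>\<omega>. Rbar fh gh w n \<omega> k) \<in> borel_measurable (PiM {..<n} (\<lambda>_. P))" for k
    unfolding Rbar_def using R by (intro borel_measurable_times borel_measurable_const borel_measurable_sum) auto
  have Q: "(\<lambda>\<omega>. Rsq fh gh w n \<omega> k l) \<in> borel_measurable (PiM {..<n} (\<lambda>_. P))" for k l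
    unfolding Rsq_def using R by (intro borel_measurable_times borel_measurable_const borel_measurable_sum) auto
  have sd: "(\<lambda>\<omega>. sdR fh gh w n \<omega> k) \<in> borel_measurable (PiM {..<n} (\<lambda>_. P))" for k
    unfolding sdR_def using B Q by measurable
  show "(\<lambda>\<omega>. Tstat fh gh w n \<omega> k) \<in> borel_measurable (PiM {..<n} (\<lambda>_. P))"
    unfolding Tstat_def using B sd by measurable
  show "i < n \<Longrightarrow> (\<lambda>\<omega>. standardized fh gh w n \<omega> k i) \<in> borel_measurable (PiM {..<n} (\<lambda>_. P))"
    unfolding standardized_def using B sd R by measurable
qed

lemma gaussian_cdf_measurable:
  fixes K n :: nat
  assumes M: "prob_space M" and K: "0 < K" and V: "\<And>k i. i < n \<Longrightarrow> (\<lambda>\<omega>. V \<omega> k i) \<in> borel_measurable M"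
  shows "(\<lambda>\<omega>. measure (gstd {..<n}) {\<xi>\<in>space (gstd {..<n}). mxa {1..K} (lin (V \<omega>) {..<n} \<xi>) \<le> t}) \<in> borel_measurable M"
proof -
  interpret G: prob_space "gstd {..<n}" by (rule prob_space_gstd)
  let ?N = "M \<Otimes>\<^sub>M gstd {..<n}"
  have l: "(\<lambda>p. lin (V (fst p)) {..<n} (snd p) k) \<in> borel_measurable ?N" for k
    unfolding lin_def
    by (intro borel_measurable_sum borel_measurable_times measurable_compose[OF measurable_fst V] measurable_compose[OF measurable_snd component_gstd]) auto
  have "(\<lambda>p. mxa {1..K} (lin (V (fst p)) {..<n} (snd p))) \<in> borel_measurable ?N"
    by (rule mxa_measurable) (use K l in auto)
  then have Q: "{p\<in>space ?N. mxa {1..K} (lin (V (fst p)) {..<n} (snd p)) \<le> t} \<in> sets ?N" by measurable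
  have "(\<lambda>\<omega>. emeasure (gstd {..<n}) (Pair \<omega> -` {p\<in>space ?N. mxa {1..K} (lin (V (fst p)) {..<n} (snd p)) \<le> t})) \<in> borel_measurable M"
    by (rule G.measurable_emeasure_Pair[OF Q])
  then have "(\<lambda>\<omega>. enn2real (emeasure (gstd {..<n}) (Pair \<omega> -` {p\<in>space ?N. mxa {1..K} (lin (V (fst p)) {..<n} (snd p)) \<le> t}))) \<in> borel_measurable M"
    by measurable
  moreover have "enn2real (emeasure (gstd {..<n}) (Pair \<omega> -` {p\<in>space ?N. mxa {1..K} (lin (V (fst p)) {..<n} (snd p)) \<le> t}))
     = measure (gstd {..<n}) {\<xi>\<in>space (gstd {..<n}). mxa {1..K} (lin (V \<omega>) {..<n} \<xi>) \<le> t}" if "\<omega> \<in> space M" for \<omega>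
    unfolding measure_def using that by (intro arg_cong[where f="\<lambda>A. enn2real (emeasure _ A)"]) (auto simp: space_pair_measure)
  ultimately show ?thesis by (simp cong: measurable_cong)
qed

text \<open>The bootstrap quantile is an infimum over a law built by choice, so measurability of the
  event is not immediate. By the characterization it is a condition on the conditional distribution
  function below \<open>Sstat\<close>, and monotonicity reduces it to countably many rational
  levels.\<close>

lemma quantile_event_sets:
  fixes w :: "nat \<Rightarrow> ('z::euclidean_space) \<Rightarrow> real"
  assumes P: "prob_space P" "sets P = sets borel" and w: "\<And>k. w k \<in> borel_measurable borel"
    and fh: "\<And>i. i < n \<Longrightarrow> (\<lambda>\<omega>. fhat fh n \<omega> (obsZ (\<omega> i))) \<in> borel_measurable (PiM {..<n} (\<lambda>_. P))"
    and gh: "\<And>i. i < n \<Longrightarrow> (\<lambda>\<omega>. ghat gh n \<omega> (obsZ (\<omega> i))) \<in> borel_measurable (PiM {..<n} (\<lambda>_. P))"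
    and K: "0 < K" and n: "0 < n" and \<alpha>: "0 < \<alpha>" "\<alpha> < 1"
  shows "(\<lambda>\<omega>. Sstat fh gh w K n \<omega>) \<in> borel_measurable (PiM {..<n} (\<lambda>_. P))"
    and "{\<omega>\<in>space (PiM {..<n} (\<lambda>_. P)). Sstat fh gh w K n \<omega> \<le> Ghat fh gh w K n \<omega> \<alpha>} \<in> sets (PiM {..<n} (\<lambda>_. P))"
proof -
  let ?P = "PiM {..<n} (\<lambda>_. P)"
  let ?F = "\<lambda>\<omega> t. measure (gstd {..<n}) {\<xi>\<in>space (gstd {..<n}). mxa {1..K} (lin (standardized fh gh w n \<omega>) {..<n} \<xi>) \<le> t}"
  interpret G: prob_space "gstd {..<n}" by (rule prob_space_gstd)
  note sm = statistics_measurable[OF P w fh gh]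
  show Sm[measurable]: "(\<lambda>\<omega>. Sstat fh gh w K n \<omega>) \<in> borel_measurable ?P"
    unfolding Sstat_mxa by (rule mxa_measurable) (use K sm in auto)
  have Fm[measurable]: "(\<lambda>\<omega>. ?F \<omega> t) \<in> borel_measurable ?P" for t
    by (rule gaussian_cdf_measurable[OF prob_space_PiM_const[OF P(1)] K]) (rule sm)
  have Fmono: "?F \<omega> s \<le> ?F \<omega> t" if "s \<le> t" for \<omega> s t
    using mxa_lin_measurable[OF K, of "standardized fh gh w n \<omega>" "{..<n}"] that
    by (intro G.finite_measure_mono) auto
  have eqv: "Sstat fh gh w K n \<omega> \<le> Ghat fh gh w K n \<omega> \<alpha> \<longleftrightarrow> (\<forall>q::rat. of_rat q < Sstat fh gh w K n \<omega> \<longrightarrow> ?F \<omega> (of_rat q) < \<alpha>)" for \<omega>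
    unfolding Ghat_characterization[OF K n \<alpha>]
  proof
    assume L: "\<forall>q::rat. of_rat q < Sstat fh gh w K n \<omega> \<longrightarrow> ?F \<omega> (of_rat q) < \<alpha>"
    show "\<forall>t<Sstat fh gh w K n \<omega>. ?F \<omega> t < \<alpha>"
    proof (intro allI impI)
      fix t assume "t < Sstat fh gh w K n \<omega>"
      then obtain q where "t < of_rat q" "of_rat q < Sstat fh gh w K n \<omega>" using of_rat_dense by blast
      then show "?F \<omega> t < \<alpha>" using L Fmono[of t "of_rat q" \<omega>] by force
    qed
  qed auto
  show "{\<omega>\<in>space ?P. Sstat fh gh w K n \<omega> \<le> Ghat fh gh w K n \<omega> \<alpha>} \<in> sets ?P"
    unfolding eqv by measurable
qed

section \<open>Coverage in finite samples\<close>

lemma mxa_diff_le: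
  assumes "finite I" "I \<noteq> {}" "\<And>i. i \<in> I \<Longrightarrow> \<bar>x i - y i\<bar> \<le> d"
  shows "\<bar>mxa I x - mxa I y\<bar> \<le> d"
proof -
  have "mxa I x \<le> mxa I y + d" if h: "\<And>i. i \<in> I \<Longrightarrow> \<bar>x i - y i\<bar> \<le> d" for x y
  proof (subst mxa_le_iff[OF assms(1,2)], rule ballI)
    fix i assume i: "i \<in> I"
    show "\<bar>x i\<bar> \<le> mxa I y + d" using h[OF i] mxa_ge[OF assms(1) i, of y] by linarith
  qed
  from this[of x y] this[of y x] show ?thesis using assms(3) by (simp add: abs_minus_commute abs_le_iff)
qed

text \<open>Purely deterministic: it isolates what a sample must satisfy for the statistic and the
  estimated correlations to be near their oracle versions. The constant 340 is 10 times 34, where 34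
  = 17 + 1 + 16 collects the perturbation of products, the sampling error of the oracle covariance
  and the centring term; 74 is 6 + 68.\<close>

lemma good_event:
  fixes e x a b :: "nat \<Rightarrow> real" and w :: "nat \<Rightarrow> 'z \<Rightarrow> real" and n K :: nat
  assumes n: "0 < n" and K: "0 < K" and l: "1 \<le> l" and s: "0 < s" "100 * \<kappa>\<^sup>2 * s \<le> 1" and \<kappa>: "1 \<le> \<kappa>"
    and R: "\<And>k i. i < n \<Longrightarrow> Rk fh gh w n \<omega> k i = (e i + a i) * (x i + b i) * w k (z i)"
    and sg: "\<And>k. k \<in> {1..K} \<Longrightarrow> 0 < \<sigma> k" "\<And>k. k \<in> {1..K} \<Longrightarrow> 1 \<le> \<kappa> * \<sigma> k"
    and w: "\<And>k y. k \<in> {1..K} \<Longrightarrow> \<bar>w k y\<bar> \<le> \<kappa> * \<sigma> k"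
    and S1: "\<And>k. k \<in> {1..K} \<Longrightarrow> \<Sigma> k k = 1" "\<And>k j. k \<in> {1..K} \<Longrightarrow> j \<in> {1..K} \<Longrightarrow> \<bar>\<Sigma> k j\<bar> \<le> 1"
    and h1: "(\<Sum>i<n. (a i)\<^sup>2) * (\<Sum>i<n. (b i)\<^sup>2) / n \<le> s ^ 8 / l\<^sup>2"
    and h2: "(\<Sum>i<n. (e i)\<^sup>2 * (b i)\<^sup>2) / n \<le> s ^ 6 / l ^ 4"
    and h3: "(\<Sum>i<n. (x i)\<^sup>2 * (a i)\<^sup>2) / n \<le> s ^ 6 / l ^ 4"
    and h4: "\<And>k. k \<in> {1..K} \<Longrightarrow> \<bar>(\<Sum>i<n. e i * b i * w k (z i)) / sqrt n\<bar> \<le> s / sqrt l"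
    and h5: "\<And>k. k \<in> {1..K} \<Longrightarrow> \<bar>(\<Sum>i<n. x i * a i * w k (z i)) / sqrt n\<bar> \<le> s / sqrt l"
    and h6: "\<And>k j. k \<in> {1..K} \<Longrightarrow> j \<in> {1..K} \<Longrightarrow>
       \<bar>(\<Sum>i<n. (e i * x i * (w k (z i) / \<sigma> k)) * (e i * x i * (w j (z i) / \<sigma> j))) / n - \<Sigma> k j\<bar> \<le> s ^ 3 / l\<^sup>2"
    and h7: "\<And>k. k \<in> {1..K} \<Longrightarrow> \<bar>(\<Sum>i<n. e i * x i * (w k (z i) / \<sigma> k)) / sqrt n\<bar> \<le> sqrt l / s"
    and h8: "l ^ 3 \<le> s ^ 8 * n"
  shows "\<bar>Sstat fh gh w K n \<omega> - mxa {1..K} (\<lambda>k. (\<Sum>i<n. e i * x i * (w k (z i) / \<sigma> k)) / sqrt n)\<bar> \<le> 74 * \<kappa>\<^sup>2 * s / sqrt l"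
    and "\<And>k j. k \<in> {1..K} \<Longrightarrow> j \<in> {1..K} \<Longrightarrow> \<bar>Sigma_hat fh gh w n \<omega> k j - \<Sigma> k j\<bar> \<le> 340 * \<kappa>\<^sup>2 * (s ^ 3 / l\<^sup>2)"
proof -
  \<comment> \<open>The accuracy needed for covariances. The bounds on the squared cross terms are
    exactly its square.\<close>
  define t where "t = s ^ 3 / l\<^sup>2"
  define v where "v k i = w k (z i) / \<sigma> k" for k i
  \<comment> \<open>Empirical covariances normalised by the oracle deviations \<sigma>, so that the
    passage to estimated deviations is isolated in \<open>correlation_perturbation\<close>. Likewise
    \<open>M\<close> and \<open>T\<close> are the estimated and the oracle means in oracle
    units.\<close>
  define G where "G k j = (Rsq fh gh w n \<omega> k j - Rbar fh gh w n \<omega> k * Rbar fh gh w n \<omega> j) / (\<sigma> k * \<sigma> j)" for k j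
  define M where "M k = (\<Sum>i<n. (e i + a i) * (x i + b i) * v k i) / sqrt n" for k
  define T where "T k = (\<Sum>i<n. e i * x i * v k i) / sqrt n" for k
  have sn: "0 < sqrt n" "sqrt n * sqrt n = n" using n by auto
  have sl: "0 < sqrt l" "1 \<le> sqrt l" "sqrt l * sqrt l = l" "sqrt l \<le> l"
    using l by (auto intro: real_le_lsqrt simp: power2_eq_square mult_le_cancel_left1)
  have k2: "1 \<le> \<kappa>\<^sup>2" "\<kappa> \<le> \<kappa>\<^sup>2" using \<kappa> by (auto simp: power2_eq_square mult_le_cancel_left1 intro: mult_mono[of 1 \<kappa> 1 \<kappa>, simplified])
  have s1: "s \<le> 1"
  proof -
    have "1 * s \<le> (100 * \<kappa>\<^sup>2) * s" using k2 s by (intro mult_right_mono) auto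
    then show ?thesis using s(2) by (simp only: mult_1)
  qed
  have sp: "s ^ j \<le> s ^ i" if "i \<le> j" for i j using s(1) s1 that by (intro power_decreasing) auto
  have l2: "1 \<le> l\<^sup>2" using l by simp
  have t0: "0 \<le> t" using s l by (simp add: t_def)
  have ts: "t \<le> s"
  proof -
    have "t \<le> s ^ 3" unfolding t_def using l2 s by (simp add: divide_le_eq mult_le_cancel_left1)
    also have "\<dots> \<le> s" using sp[of 1 3] by simp
    finally show ?thesis .
  qed
  have t1: "t \<le> 1" using ts s1 by simp
  have tt: "s ^ 6 / l ^ 4 = t\<^sup>2" by (simp add: t_def power_divide power_mult[symmetric])
  have v\<kappa>: "\<bar>v k i\<bar> \<le> \<kappa>" if "k \<in> {1..K}" for k i
    using w[OF that, of "z i"] sg(1)[OF that] by (simp add: v_def abs_divide divide_le_eq)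
  have inv: "1 / \<sigma> k \<le> \<kappa>" if "k \<in> {1..K}" for k using sg[OF that] by (simp add: divide_le_eq)
  have rb: "Rbar fh gh w n \<omega> k / \<sigma> k = M k / sqrt n" for k
  proof -
    have "Rbar fh gh w n \<omega> k / \<sigma> k = (\<Sum>i<n. (e i + a i) * (x i + b i) * v k i) / n"
      unfolding Rbar_def v_def using R by (simp add: sum_divide_distrib mult.commute)
    then show ?thesis by (simp add: M_def sn(2))
  qed
  have MT: "\<bar>M k - T k\<bar> \<le> 3 * \<kappa> * (s / sqrt l)" if k: "k \<in> {1..K}" for k
  proof -
    have "\<bar>(\<Sum>i<n. (e i + a i) * (x i + b i) * v k i) - (\<Sum>i<n. e i * x i * v k i)\<bar>
      \<le> \<bar>\<Sum>i<n. e i * b i * v k i\<bar> + \<bar>\<Sum>i<n. x i * a i * v k i\<bar> + \<kappa> * sqrt ((\<Sum>i<n. (a i)\<^sup>2) * (\<Sum>i<n. (b i)\<^sup>2))"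
      by (rule mean_perturbation) (rule v\<kappa>[OF k])
    then have A1: "\<bar>(\<Sum>i<n. (e i + a i) * (x i + b i) * v k i) - (\<Sum>i<n. e i * x i * v k i)\<bar> / sqrt n
      \<le> (\<bar>\<Sum>i<n. e i * b i * v k i\<bar> + \<bar>\<Sum>i<n. x i * a i * v k i\<bar> + \<kappa> * sqrt ((\<Sum>i<n. (a i)\<^sup>2) * (\<Sum>i<n. (b i)\<^sup>2))) / sqrt n"
      using sn by (intro divide_right_mono) auto
    have A2: "\<bar>M k - T k\<bar> = \<bar>(\<Sum>i<n. (e i + a i) * (x i + b i) * v k i) - (\<Sum>i<n. e i * x i * v k i)\<bar> / sqrt n"
      using sn by (simp add: M_def T_def diff_divide_distrib[symmetric] abs_divide)
    have A3: "\<bar>\<Sum>i<n. y i * v k i\<bar> / sqrt n \<le> \<kappa> * (s / sqrt l)"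
      if h: "\<bar>(\<Sum>i<n. y i * w k (z i)) / sqrt n\<bar> \<le> s / sqrt l" for y
    proof -
      have "\<bar>\<Sum>i<n. y i * v k i\<bar> / sqrt n = (1 / \<sigma> k) * \<bar>(\<Sum>i<n. y i * w k (z i)) / sqrt n\<bar>"
        using sg(1)[OF k] sn by (simp add: v_def sum_divide_distrib[symmetric] abs_divide)
      also have "\<dots> \<le> \<kappa> * (s / sqrt l)" using h inv[OF k] sg(1)[OF k] \<kappa> by (intro mult_mono) auto
      finally show ?thesis .
    qed
    have A4: "\<kappa> * sqrt ((\<Sum>i<n. (a i)\<^sup>2) * (\<Sum>i<n. (b i)\<^sup>2)) / sqrt n \<le> \<kappa> * (s / sqrt l)"
    proof -
      have "sqrt ((\<Sum>i<n. (a i)\<^sup>2) * (\<Sum>i<n. (b i)\<^sup>2)) / sqrt n \<le> sqrt (s ^ 8 / l\<^sup>2)"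
        using h1 by (simp add: real_sqrt_divide[symmetric])
      also have "\<dots> = s ^ 4 / l"
        by (rule real_sqrt_unique) (use s l in \<open>auto simp: power_divide power_mult[symmetric]\<close>)
      also have "\<dots> \<le> s / sqrt l" using sp[of 1 4] s sl by (intro frac_le) auto
      finally show ?thesis using \<kappa> by (simp add: mult_left_mono times_divide_eq_right[symmetric] del: times_divide_eq_right)
    qed
    have "\<bar>M k - T k\<bar> \<le> \<kappa> * (s / sqrt l) + \<kappa> * (s / sqrt l) + \<kappa> * (s / sqrt l)"
      unfolding A2
      by (rule order_trans[OF A1[unfolded add_divide_distrib]]) (intro add_mono A3 A4 h4[OF k] h5[OF k])
    then show ?thesis by simp
  qed
  have Tb: "\<bar>T k\<bar> \<le> sqrt l / s" if "k \<in> {1..K}" for k using h7[OF that] by (simp add: T_def v_def)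
  have Mb: "\<bar>M k\<bar> \<le> 4 * \<kappa> * (sqrt l / s)" if k: "k \<in> {1..K}" for k
  proof -
    have "s \<le> sqrt l" "s \<le> 1 * sqrt l" using s1 sl(2) by linarith+
    then have "s / sqrt l \<le> sqrt l / s" using s(1) sl(1) by (intro frac_le) auto
    then have "3 * \<kappa> * (s / sqrt l) \<le> 3 * \<kappa> * (sqrt l / s)" using \<kappa> by (intro mult_left_mono) auto
    moreover have "1 * (sqrt l / s) \<le> \<kappa> * (sqrt l / s)" using \<kappa> s(1) sl(1) by (intro mult_right_mono) auto
    ultimately show ?thesis using MT[OF k] Tb[OF k] by linarith
  qed
  have GS: "\<bar>G k j - \<Sigma> k j\<bar> \<le> 34 * \<kappa>\<^sup>2 * t" if k: "k \<in> {1..K}" and j: "j \<in> {1..K}" for k j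
  proof -
    have p2: "(\<Sum>i<n. (e i * x i * v k i)\<^sup>2) / n \<le> 2" if "k \<in> {1..K}" for k
      using h6[OF that that] S1(1)[OF that] t1 by (simp add: v_def t_def power2_eq_square abs_le_iff)
    have "\<bar>(\<Sum>i<n. ((e i + a i) * (x i + b i) * v k i) * ((e i + a i) * (x i + b i) * v j i)) / n - (\<Sum>i<n. (e i * x i * v k i) * (e i * x i * v j i)) / n\<bar> \<le> 17 * \<kappa>\<^sup>2 * t"
    proof (rule square_perturbation[OF n \<kappa> t0 t1 v\<kappa>[OF k] v\<kappa>[OF j] p2[OF k] p2[OF j]])
      show "(\<Sum>i<n. (e i)\<^sup>2 * (b i)\<^sup>2) / n \<le> t\<^sup>2" "(\<Sum>i<n. (x i)\<^sup>2 * (a i)\<^sup>2) / n \<le> t\<^sup>2" using h2 h3 unfolding tt .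
      have "s ^ 8 / l\<^sup>2 \<le> t" unfolding t_def using sp[of 3 8] by (intro divide_right_mono) auto
      then show "(\<Sum>i<n. (a i)\<^sup>2) * (\<Sum>i<n. (b i)\<^sup>2) / n \<le> t" using h1 by simp
    qed
    moreover have "\<bar>(\<Sum>i<n. (e i * x i * v k i) * (e i * x i * v j i)) / n - \<Sigma> k j\<bar> \<le> t"
      using h6[OF k j] by (simp add: v_def t_def)
    moreover have "G k j = (\<Sum>i<n. ((e i + a i) * (x i + b i) * v k i) * ((e i + a i) * (x i + b i) * v j i)) / n - M k * M j / n"
    proof -
      have "Rsq fh gh w n \<omega> k j / (\<sigma> k * \<sigma> j) = (\<Sum>i<n. ((e i + a i) * (x i + b i) * v k i) * ((e i + a i) * (x i + b i) * v j i)) / n"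
        unfolding Rsq_def v_def using R by (simp add: sum_divide_distrib ac_simps)
      moreover have "Rbar fh gh w n \<omega> k * Rbar fh gh w n \<omega> j / (\<sigma> k * \<sigma> j) = M k * M j / n"
        using rb[of k] rb[of j] sn by (metis times_divide_times_eq)
      ultimately show ?thesis by (simp add: G_def diff_divide_distrib)
    qed
    moreover have "\<bar>M k * M j / n\<bar> \<le> 16 * \<kappa>\<^sup>2 * t"
    proof -
      have "\<bar>M k * M j\<bar> \<le> (4 * \<kappa> * (sqrt l / s)) * (4 * \<kappa> * (sqrt l / s))"
        unfolding abs_mult using Mb[OF k] Mb[OF j] \<kappa> sl s by (intro mult_mono) auto
      also have "\<dots> = 16 * \<kappa>\<^sup>2 * (l / s\<^sup>2)" using sl(3) by (simp add: power2_eq_square)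
      finally have "\<bar>M k * M j\<bar> / n \<le> 16 * \<kappa>\<^sup>2 * (l / s\<^sup>2) / n" by (rule divide_right_mono) simp
      then have "\<bar>M k * M j / n\<bar> \<le> 16 * \<kappa>\<^sup>2 * (l / s\<^sup>2) / n" by (simp only: abs_divide abs_of_nat)
      also have "\<dots> = 16 * \<kappa>\<^sup>2 * (l / (s\<^sup>2 * n))" by simp
      also have "\<dots> \<le> 16 * \<kappa>\<^sup>2 * t"
      proof (intro mult_left_mono)
        have "s ^ 8 * n \<le> s ^ 5 * n" using sp[of 5 8] by (intro mult_right_mono) auto
        then have "l ^ 3 \<le> s ^ 5 * n" using h8 by simp
        then have "l * l\<^sup>2 \<le> s ^ 3 * (s\<^sup>2 * n)" by (simp add: power_numeral_reduce ac_simps)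
        then show "l / (s\<^sup>2 * n) \<le> t" unfolding t_def using s l n by (simp add: divide_le_eq le_divide_eq mult.commute)
      qed simp
      finally show ?thesis .
    qed
    moreover have "t \<le> \<kappa>\<^sup>2 * t" using k2 t0 by (simp add: mult_le_cancel_right1)
    ultimately show ?thesis unfolding abs_le_iff by linarith
  qed
  define r where "r = 34 * \<kappa>\<^sup>2 * t"
  have r: "r \<le> 1/2"
  proof -
    have "r \<le> 34 * \<kappa>\<^sup>2 * s" unfolding r_def using ts by (intro mult_left_mono) auto
    then show ?thesis using s by simp
  qed
  have Gk: "\<bar>G k k - 1\<bar> \<le> r" if "k \<in> {1..K}" for k using GS[OF that that] S1(1)[OF that] by (simp add: r_def)
  have sd: "sdR fh gh w n \<omega> k = \<sigma> k * sqrt (G k k)" if k: "k \<in> {1..K}" for k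
  proof -
    have "Rsq fh gh w n \<omega> k k - (Rbar fh gh w n \<omega> k)\<^sup>2 = (\<sigma> k)\<^sup>2 * G k k"
      using sg(1)[OF k] by (simp add: G_def power2_eq_square)
    then show ?thesis using sg(1)[OF k] by (simp add: sdR_def real_sqrt_mult)
  qed
  have Ts: "Tstat fh gh w n \<omega> k = M k * (1 / sqrt (G k k))" if k: "k \<in> {1..K}" for k
  proof -
    have "sqrt n * Rbar fh gh w n \<omega> k = M k * \<sigma> k" using rb[of k] sg(1)[OF k] sn by (simp add: field_simps)
    then show ?thesis using sg(1)[OF k] by (simp add: Tstat_def sd[OF k])
  qed
  show "\<bar>Sigma_hat fh gh w n \<omega> k j - \<Sigma> k j\<bar> \<le> 340 * \<kappa>\<^sup>2 * (s ^ 3 / l\<^sup>2)" if k: "k \<in> {1..K}" and j: "j \<in> {1..K}" for k j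
  proof -
    have "Sigma_hat fh gh w n \<omega> k j = G k j / (sqrt (G k k) * sqrt (G j j))"
      using sg(1)[OF k] sg(1)[OF j] by (simp add: Sigma_hat_def sd[OF k] sd[OF j] G_def ac_simps)
    then show ?thesis
      using correlation_perturbation[OF Gk[OF k] Gk[OF j] _ r S1(2)[OF k j], of "G k j"] GS[OF k j] by (simp add: r_def t_def)
  qed
  show "\<bar>Sstat fh gh w K n \<omega> - mxa {1..K} (\<lambda>k. (\<Sum>i<n. e i * x i * (w k (z i) / \<sigma> k)) / sqrt n)\<bar> \<le> 74 * \<kappa>\<^sup>2 * s / sqrt l"
    unfolding Sstat_mxa
  proof (rule mxa_diff_le)
    fix k assume k: "k \<in> {1..K}"
    note iq = inverse_sqrt_perturbation[OF Gk[OF k] r]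
    have "m * q - t = (m - t) * q + t * (q - 1)" for m q t :: real by (simp add: algebra_simps)
    from this[of "M k" "1 / sqrt (G k k)" "T k"]
    have "M k * (1 / sqrt (G k k)) - T k = (M k - T k) * (1 / sqrt (G k k)) + T k * (1 / sqrt (G k k) - 1)" .
    moreover have "\<bar>(M k - T k) * (1 / sqrt (G k k))\<bar> \<le> (3 * \<kappa> * (s / sqrt l)) * 2"
      unfolding abs_mult using MT[OF k] iq by (intro mult_mono) auto
    moreover have "\<bar>T k * (1 / sqrt (G k k) - 1)\<bar> \<le> (sqrt l / s) * (2 * r)"
      unfolding abs_mult using Tb[OF k] iq s sl by (intro mult_mono) auto
    \<comment> \<open>Replacing the estimated deviation by the oracle one multiplies
      \<open>T\<close>, which may be as large as \<open>sqrt l / s\<close>, by a relative error of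
      order \<open>s^3 / l^2\<close>; the result is even of order
      \<open>s^2 / (l * sqrt l)\<close>.\<close>
    moreover have "(sqrt l / s) * (2 * r) \<le> 68 * \<kappa>\<^sup>2 * (s / sqrt l)"
    proof -
      have "(sqrt l / s) * (2 * r) = 68 * \<kappa>\<^sup>2 * ((sqrt l / s) * (s ^ 3 / l\<^sup>2))" by (simp add: r_def t_def)
      also have "(sqrt l / s) * (s ^ 3 / l\<^sup>2) = s\<^sup>2 / (l * sqrt l)"
      proof -
        have "y / (d * q) = (y * q) / (d * (q * q))" if "q \<noteq> 0" for y d q :: real using that by simp
        from this[of "sqrt l" "s\<^sup>2" l] sl(1) have "s\<^sup>2 / (l * sqrt l) = (s\<^sup>2 * sqrt l) / (l * (sqrt l * sqrt l))" by simp
        also have "\<dots> = (sqrt l / s) * (s ^ 3 / l\<^sup>2)"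
          unfolding sl(3) using s(1) by (simp add: power2_eq_square power3_eq_cube)
        finally show ?thesis by simp
      qed
      also have "68 * \<kappa>\<^sup>2 * (s\<^sup>2 / (l * sqrt l)) \<le> 68 * \<kappa>\<^sup>2 * (s / sqrt l)"
        using sp[of 1 2] l sl s by (intro mult_left_mono frac_le) (auto simp: mult_le_cancel_right1)
      finally show ?thesis .
    qed
    moreover have "6 * \<kappa> * (s / sqrt l) \<le> 6 * \<kappa>\<^sup>2 * (s / sqrt l)" using k2 s sl by (intro mult_right_mono) auto
    ultimately have "\<bar>M k * (1 / sqrt (G k k)) - T k\<bar> \<le> 74 * \<kappa>\<^sup>2 * (s / sqrt l)" by linarith
    then show "\<bar>Tstat fh gh w n \<omega> k - (\<Sum>i<n. e i * x i * (w k (z i) / \<sigma> k)) / sqrt n\<bar> \<le> 74 * \<kappa>\<^sup>2 * s / sqrt l"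
      unfolding Ts[OF k] by (simp add: T_def v_def)
  qed (use K in auto)
qed

lemma markov_gt:
  assumes M: "prob_space M" and X: "integrable M X" "\<And>m. m \<in> space M \<Longrightarrow> 0 \<le> X m" and E: "(\<integral>m. X m \<partial>M) \<le> c * d" and c: "0 < c"
  shows "measure M {m\<in>space M. c < X m} \<le> d"
proof -
  interpret prob_space M by fact
  have [measurable]: "X \<in> borel_measurable M" using X by auto
  have "measure M {m\<in>space M. c < X m} \<le> measure M {m\<in>space M. X m \<ge> c}"
    by (intro finite_measure_mono) auto
  also have "\<dots> \<le> (\<integral>m. X m \<partial>M) / c"
    using X c by (intro integral_Markov_inequality_measure[where A="space M"]) auto
  also have "\<dots> \<le> d" using E c by (simp add: divide_le_eq mult.commute)
  finally show ?thesis .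
qed

text \<open>The weighted mean square of \<open>b\<close> is small only with high probability,
  whereas the moment bounds need it everywhere. Hence \<open>b\<close> is truncated to the event
  where it is small. Since this event is itself determined by \<open>b\<close> and the covariates,
  truncation keeps the ignored response ignored. Markov's inequality then bounds the bad events
  inside it.\<close>

lemma cross_events:
  fixes b :: "(nat \<Rightarrow> ('z::euclidean_space) obs) \<Rightarrow> nat \<Rightarrow> real" and n K :: nat
  assumes R: "residual_model P X Y f u r" and n: "0 < n" and K: "0 < K" and l: "1 \<le> l" "ln (2 * K) \<le> 2 * l"
    and bm: "\<And>i. i < n \<Longrightarrow> (\<lambda>\<omega>. b \<omega> i) \<in> borel_measurable (PiM {..<n} (\<lambda>_. P))"
    and inv: "\<And>i k. i < n \<Longrightarrow> k < n \<Longrightarrow> ignores_at Y r k (\<lambda>\<omega>. b \<omega> i)"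
    and w: "\<And>k. w k \<in> borel_measurable borel" "\<And>k z. k \<in> {1..K} \<Longrightarrow> \<bar>w k z\<bar> \<le> C1" and s: "0 < s" "s \<le> 1"
  shows "{\<omega>\<in>space (PiM {..<n} (\<lambda>_. P)). (\<Sum>i<n. (b \<omega> i)\<^sup>2 * u (obsZ (\<omega> i))) / n \<le> s ^ 8 / l ^ 4 \<and>
       s ^ 6 / l ^ 4 < (\<Sum>i<n. (X (\<omega> i) - f (obsZ (\<omega> i)))\<^sup>2 * (b \<omega> i)\<^sup>2) / n} \<in> sets (PiM {..<n} (\<lambda>_. P))" (is "?E1 \<in> _")
    and "measure (PiM {..<n} (\<lambda>_. P)) {\<omega>\<in>space (PiM {..<n} (\<lambda>_. P)). (\<Sum>i<n. (b \<omega> i)\<^sup>2 * u (obsZ (\<omega> i))) / n \<le> s ^ 8 / l ^ 4 \<and>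
       s ^ 6 / l ^ 4 < (\<Sum>i<n. (X (\<omega> i) - f (obsZ (\<omega> i)))\<^sup>2 * (b \<omega> i)\<^sup>2) / n} \<le> s"
    and "{\<omega>\<in>space (PiM {..<n} (\<lambda>_. P)). (\<Sum>i<n. (b \<omega> i)\<^sup>2 * u (obsZ (\<omega> i))) / n \<le> s ^ 8 / l ^ 4 \<and>
       s / sqrt l < mxa {1..K} (\<lambda>k. (\<Sum>i<n. (X (\<omega> i) - f (obsZ (\<omega> i))) * b \<omega> i * w k (obsZ (\<omega> i))) / sqrt n)} \<in> sets (PiM {..<n} (\<lambda>_. P))" (is "?E2 \<in> _")
    and "measure (PiM {..<n} (\<lambda>_. P)) {\<omega>\<in>space (PiM {..<n} (\<lambda>_. P)). (\<Sum>i<n. (b \<omega> i)\<^sup>2 * u (obsZ (\<omega> i))) / n \<le> s ^ 8 / l ^ 4 \<and>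
       s / sqrt l < mxa {1..K} (\<lambda>k. (\<Sum>i<n. (X (\<omega> i) - f (obsZ (\<omega> i))) * b \<omega> i * w k (obsZ (\<omega> i))) / sqrt n)} \<le> (2 + C1\<^sup>2) * s"
proof -
  let ?P = "PiM {..<n} (\<lambda>_. P)"
  interpret P: prob_space P using R by (simp add: residual_model_def)
  interpret S: prob_space ?P by (rule prob_space_PiM_const[OF P.prob_space_axioms])
  have Ps: "sets P = sets borel" and X[measurable]: "X \<in> borel_measurable P"
    and f[measurable]: "f \<in> borel_measurable borel" and um[measurable]: "u \<in> borel_measurable borel" and u0: "\<And>z. 0 \<le> u z"
    and rYZ: "\<And>y z. Y (r (y, z)) = y" "\<And>y z. obsZ (r (y, z)) = z"
    using R by (auto simp: residual_model_def cond_mean_def cond_mean_nn_def)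
  note obs_measurable[OF Ps, measurable] w(1)[measurable]
  define B where "B \<omega> = (\<Sum>i<n. (b \<omega> i)\<^sup>2 * u (obsZ (\<omega> i))) / n" for \<omega>
  define \<tau> where "\<tau> = s ^ 8 / l ^ 4"
  have \<tau>0: "0 \<le> \<tau>" using s l by (simp add: \<tau>_def)
  \<comment> \<open>On the event in question the truncated factor coincides with \<open>b\<close>,
    so both bad sets can be rewritten with \<open>bt\<close>.\<close>
  define bt where "bt \<omega> i = (if B \<omega> \<le> \<tau> then b \<omega> i else 0)" for \<omega> i
  have uim: "(\<lambda>\<omega>. u (obsZ (\<omega> i))) \<in> borel_measurable ?P" if "i < n" for i
    by (rule PiM_coordinate(3)[OF P.prob_space_axioms that]) measurable
  have Bm[measurable]: "B \<in> borel_measurable ?P"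
    unfolding B_def[abs_def] using bm uim by (intro borel_measurable_divide borel_measurable_sum borel_measurable_times borel_measurable_power) auto
  have btm: "(\<lambda>\<omega>. bt \<omega> i) \<in> borel_measurable ?P" if "i < n" for i
    unfolding bt_def using bm[OF that] by measurable
  have binv: "b (x(k := v)) i = b (x(k := r (Y v, obsZ v))) i" if "i < n" "k < n" for x v i k
    using ignores_atD[OF inv[OF that]] .
  have btinv: "ignores_at Y r k (\<lambda>\<omega>. bt \<omega> i)" if "i < n" "k < n" for i k
    unfolding ignores_at_def
  proof (intro allI)
    fix x v
    have "B (x(k := v)) = B (x(k := r (Y v, obsZ v)))"
      unfolding B_def
    proof (rule arg_cong[where f="\<lambda>t. t / real n"], rule sum.cong[OF refl])
      fix j assume "j \<in> {..<n}"
      then have "b (x(k := v)) j = b (x(k := r (Y v, obsZ v))) j" using binv[OF _ that(2)] by blast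
      moreover have "obsZ ((x(k := v)) j) = obsZ ((x(k := r (Y v, obsZ v))) j)" by (simp add: rYZ)
      ultimately show "(b (x(k := v)) j)\<^sup>2 * u (obsZ ((x(k := v)) j)) = (b (x(k := r (Y v, obsZ v))) j)\<^sup>2 * u (obsZ ((x(k := r (Y v, obsZ v))) j))"
        by simp
    qed
    moreover have "b (x(k := v)) i = b (x(k := r (Y v, obsZ v))) i" using binv[OF that] by blast
    ultimately show "bt (x(k := v)) i = bt (x(k := r (Y v, obsZ v))) i"
      unfolding bt_def by (simp only:)
  qed
  have btB: "(\<Sum>i<n. (bt \<omega> i)\<^sup>2 * u (obsZ (\<omega> i))) / n \<le> \<tau>" for \<omega>
    using \<tau>0 by (cases "B \<omega> \<le> \<tau>") (simp_all add: bt_def B_def)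
  have sl: "0 < sqrt l" "sqrt l * sqrt l = l" using l by auto
  \<comment> \<open>Balances the maximal inequality: \<open>2 * l / \<beta>\<close> and
    \<open>\<beta> * \<tau>\<close> are both multiples of \<open>s^4 / (l * sqrt l)\<close>, which
    leaves a factor \<open>s\<close> after division by the threshold
    \<open>s / sqrt l\<close>.\<close>
  define \<beta> where "\<beta> = l\<^sup>2 * sqrt l / s ^ 4"
  have \<beta>: "0 < \<beta>" using l s by (simp add: \<beta>_def)
  note ct = cross_terms_bound[OF R n K btm btinv btB w \<beta>]
  let ?Q = "\<lambda>b \<omega>. (\<Sum>i<n. (X (\<omega> i) - f (obsZ (\<omega> i)))\<^sup>2 * (b \<omega> i)\<^sup>2) / n"
  let ?V = "\<lambda>b \<omega>. mxa {1..K} (\<lambda>k. (\<Sum>i<n. (X (\<omega> i) - f (obsZ (\<omega> i))) * b \<omega> i * w k (obsZ (\<omega> i))) / sqrt n)"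
  have e1: "?E1 = {\<omega>\<in>space ?P. B \<omega> \<le> \<tau> \<and> s ^ 6 / l ^ 4 < ?Q bt \<omega>}"
    by (auto simp: bt_def B_def \<tau>_def)
  have e2: "?E2 = {\<omega>\<in>space ?P. B \<omega> \<le> \<tau> \<and> s / sqrt l < ?V bt \<omega>}"
    by (auto simp: bt_def B_def \<tau>_def)
  have [measurable]: "?Q bt \<in> borel_measurable ?P" "?V bt \<in> borel_measurable ?P" using ct(1,3) by auto
  show "?E1 \<in> sets ?P" unfolding e1 by measurable
  show "?E2 \<in> sets ?P" unfolding e2 by measurable
  have "measure ?P ?E1 \<le> measure ?P {\<omega>\<in>space ?P. s ^ 6 / l ^ 4 < ?Q bt \<omega>}"
    unfolding e1 by (intro S.finite_measure_mono) auto
  also have "\<dots> \<le> s\<^sup>2"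
  proof (rule markov_gt[OF S.prob_space_axioms ct(1)])
    have "\<tau> = s ^ 6 / l ^ 4 * s\<^sup>2" by (simp add: \<tau>_def power_add[symmetric])
    then show "(\<integral>\<omega>. ?Q bt \<omega> \<partial>?P) \<le> s ^ 6 / l ^ 4 * s\<^sup>2" using ct(2) by simp
  qed (use s l in \<open>auto intro!: sum_nonneg divide_nonneg_nonneg\<close>)
  also have "s\<^sup>2 \<le> s" using s by (simp add: power2_eq_square mult_left_le)
  finally show "measure ?P ?E1 \<le> s" .
  have "measure ?P ?E2 \<le> measure ?P {\<omega>\<in>space ?P. s / sqrt l < ?V bt \<omega>}"
    unfolding e2
  proof (rule S.finite_measure_mono)
    show "{\<omega>\<in>space ?P. s / sqrt l < ?V bt \<omega>} \<in> sets ?P" by measurable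
  qed blast
  also have "\<dots> \<le> (2 + C1\<^sup>2) * s"
  proof (rule markov_gt[OF S.prob_space_axioms ct(3)])
    show "0 \<le> ?V bt \<omega>" for \<omega> using K by (intro mxa_nonneg) auto
    show "0 < s / sqrt l" using s sl by simp
    have "(\<integral>\<omega>. ?V bt \<omega> \<partial>?P) \<le> ln (2 * K) / \<beta> + \<beta> * (C1\<^sup>2 * \<tau>)" using ct(4) .
    also have "\<dots> \<le> 2 * l / \<beta> + \<beta> * (C1\<^sup>2 * \<tau>)" using l \<beta> by (intro add_mono divide_right_mono) auto
    also have "2 * l / \<beta> = 2 * (s ^ 4 / (l * sqrt l))"
      using l s sl(1) by (simp add: \<beta>_def power2_eq_square)
    also have "\<beta> * (C1\<^sup>2 * \<tau>) = C1\<^sup>2 * (s ^ 4 / (l * sqrt l))"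
    proof -
      have "\<beta> * \<tau> = s ^ 4 * sqrt l / l\<^sup>2"
        using l s unfolding \<beta>_def \<tau>_def by (simp add: field_simps power_numeral_reduce)
      also have "\<dots> = s ^ 4 * sqrt l / ((sqrt l * sqrt l) * l)" using sl(2) by (simp add: power2_eq_square)
      also have "\<dots> = s ^ 4 / (l * sqrt l)"
      proof -
        have "(y * q) / ((q * q) * d) = y / (d * q)" if "q \<noteq> 0" for y d q :: real using that by simp
        from this[of "sqrt l" "s ^ 4" l, OF less_imp_neq[OF sl(1), symmetric]] show ?thesis .
      qed
      finally have bt: "\<beta> * \<tau> = s ^ 4 / (l * sqrt l)" .
      have "\<beta> * (C1\<^sup>2 * \<tau>) = C1\<^sup>2 * (\<beta> * \<tau>)" by (simp only: mult.left_commute)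
      then show ?thesis unfolding bt .
    qed
    also have "2 * (s ^ 4 / (l * sqrt l)) + C1\<^sup>2 * (s ^ 4 / (l * sqrt l)) = (2 + C1\<^sup>2) * (s ^ 4 / (l * sqrt l))"
      by (simp only: distrib_right)
    also have "\<dots> \<le> (2 + C1\<^sup>2) * (s / sqrt l * s)"
    proof (intro mult_left_mono)
      have "s ^ 4 / (l * sqrt l) \<le> s\<^sup>2 / (1 * sqrt l)"
        using s l sl by (intro frac_le mult_right_mono power_decreasing) auto
      then show "s ^ 4 / (l * sqrt l) \<le> s / sqrt l * s" by (simp add: power2_eq_square)
    qed simp
    finally show "(\<integral>\<omega>. ?V bt \<omega> \<partial>?P) \<le> s / sqrt l * ((2 + C1\<^sup>2) * s)" by (simp add: ac_simps)
  qed
  finally show "measure ?P ?E2 \<le> (2 + C1\<^sup>2) * s" .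
qed

section \<open>Conditional independence in the model, and the responses ignored by each
  regression\<close>

lemma P0_model:
  assumes "P \<in> P0"
  shows "prob_space P" "sets P = sets borel" "cond_indep P obsX obsY"
  using assms by (auto simp: P0_def E0_def cond_indep_def cond_indep_XY_Z_def)

text \<open>The sections put 0 in place of the ignored response; any constant would serve, as only
  measurability and the retained coordinates matter.\<close>

lemma section_maps:
  fixes P :: "('z::euclidean_space) obs measure"
  assumes "sets P = sets borel"
  shows "(\<lambda>(y, z). (0, y, z)) \<in> measurable (borel \<Otimes>\<^sub>M borel) P" "(\<lambda>(x, z). (x, 0, z)) \<in> measurable (borel \<Otimes>\<^sub>M borel) P"
proof -
  have "(\<lambda>q. (0, fst q, snd q)) \<in> borel_measurable (borel :: (real \<times> 'z) measure)"
    "(\<lambda>q. (fst q, 0, snd q)) \<in> borel_measurable (borel :: (real \<times> 'z) measure)"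
    by (intro borel_measurable_continuous_onI continuous_intros)+
  then show "(\<lambda>(y, z). (0, y, z)) \<in> measurable (borel \<Otimes>\<^sub>M borel) P" "(\<lambda>(x, z). (x, 0, z)) \<in> measurable (borel \<Otimes>\<^sub>M borel) P"
    unfolding borel_prod split_beta' using measurable_cong_sets[OF refl assms] by blast+
qed

lemma residual_models:
  assumes P: "P \<in> P0"
    and f: "cond_mean P obsX f" and g: "cond_mean P obsY g"
    and u: "cond_mean_nn P (\<lambda>w. (obsX w - f (obsZ w))\<^sup>2) u" and v: "cond_mean_nn P (\<lambda>w. (obsY w - g (obsZ w))\<^sup>2) v"
  shows "residual_model P obsX obsY f u (\<lambda>(y, z). (0, y, z))" "residual_model P obsY obsX g v (\<lambda>(x, z). (x, 0, z))"
  using P0_model[OF P] obs_measurable[OF P0_model(2)[OF P]] section_maps[OF P0_model(2)[OF P]] f g u v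
  by (auto simp: residual_model_def obsX_def obsY_def obsZ_def intro: cond_indep_commute)

text \<open>A regression procedure receives only its own responses and the covariates. Altering the
  X-value of an observation, even one used in the fit, therefore leaves the error of
  \<open>ghat\<close> at every sample point unchanged.\<close>

lemma ignores_at_ghat: "ignores_at obsY (\<lambda>(y, z). (0, y, z)) k (\<lambda>\<omega>. g (obsZ (\<omega> i)) - ghat gh n \<omega> (obsZ (\<omega> i)))"
proof -
  define F where "F y z = g (z i) - gh n y z (z i)" for y z
  have e: "(\<lambda>\<omega>. g (obsZ (\<omega> i)) - ghat gh n \<omega> (obsZ (\<omega> i))) = (\<lambda>\<omega>. F (\<lambda>j. obsY (\<omega> j)) (\<lambda>j. obsZ (\<omega> j)))"
    by (simp add: F_def ghat_def)
  show ?thesis unfolding e ignores_at_def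
    by (intro allI arg_cong2[where f=F]) (auto simp: fun_eq_iff obsY_def obsZ_def)
qed

lemma ignores_at_fhat: "ignores_at obsX (\<lambda>(x, z). (x, 0, z)) k (\<lambda>\<omega>. f (obsZ (\<omega> i)) - fhat fh n \<omega> (obsZ (\<omega> i)))"
proof -
  define F where "F y z = f (z i) - fh n y z (z i)" for y z
  have e: "(\<lambda>\<omega>. f (obsZ (\<omega> i)) - fhat fh n \<omega> (obsZ (\<omega> i))) = (\<lambda>\<omega>. F (\<lambda>j. obsX (\<omega> j)) (\<lambda>j. obsZ (\<omega> j)))"
    by (simp add: F_def fhat_def)
  show ?thesis unfolding e ignores_at_def
    by (intro allI arg_cong2[where f=F]) (auto simp: fun_eq_iff obsX_def obsZ_def)
qed

section \<open>Gaussian bounds for maxima of absolute values\<close>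

lemma gaussian_cdf_lipschitz:
  fixes K :: nat
  assumes K: "3 \<le> K" and unit: "\<forall>k\<in>{1..K}. (\<Sum>m\<in>{1..K}. L k m * L k m) = 1" and ab: "a \<le> b"
  shows "measure (gstd {1..K}) {\<xi>\<in>space (gstd {1..K}). mxa {1..K} (lin L {1..K} \<xi>) \<le> b}
    - measure (gstd {1..K}) {\<xi>\<in>space (gstd {1..K}). mxa {1..K} (lin L {1..K} \<xi>) \<le> a} \<le> 27 * sqrt (2 * ln K) * (b - a)"
proof -
  let ?I = "{1..K} \<times> (UNIV :: bool set)"
  have IK: "finite {1..K}" "{1..K} \<noteq> {}" using K by auto
  have I: "finite ?I" "?I \<noteq> {}" using K by auto
  define L' where "L' p m = signed (\<lambda>k. L k m) p" for p m
  have e: "lin L' {1..K} \<xi> = signed (lin L {1..K} \<xi>)" for \<xi>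
    by (auto simp: fun_eq_iff lin_def L'_def signed_def sum_negf)
  have u: "\<forall>p\<in>?I. (\<Sum>m\<in>{1..K}. L' p m * L' p m) = 1"
  proof
    fix p assume p: "p \<in> ?I"
    have "(\<Sum>m\<in>{1..K}. L' p m * L' p m) = (\<Sum>m\<in>{1..K}. L (fst p) m * L (fst p) m)"
      by (cases "snd p") (simp_all add: L'_def signed_def)
    then show "(\<Sum>m\<in>{1..K}. L' p m * L' p m) = 1" using unit p by auto
  qed
  have l1: "1 \<le> ln (real K)"
  proof -
    have "exp 1 \<le> real K" using exp_le K by linarith
    then show ?thesis using K by (subst ln_ge_iff) auto
  qed
  have lc: "ln (real (card ?I)) \<le> 2 * ln K"
  proof -
    have "ln (real (card ?I)) = ln 2 + ln K" unfolding card_signed using K by (simp add: ln_mult)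
    then show ?thesis using l1 ln_2_less_1 by linarith
  qed
  \<comment> \<open>With \<open>y = sqrt (2 * ln K)\<close>, which is at least 1 because
    \<open>K \<ge> 3\<close> gives \<open>ln K \<ge> 1\<close>. Doubling the index set for the signs
    at most doubles the logarithm.\<close>
  have "9 * (1 + x) \<le> 27 * y" if "x \<le> 2 * y" "1 \<le> y" for x y :: real
  proof -
    have "9 * (1 + x) = 9 + 9 * x" by simp
    then show ?thesis using that by linarith
  qed
  moreover have "sqrt (2 * ln (real (card ?I))) \<le> 2 * sqrt (2 * ln K)"
  proof -
    have "sqrt (2 * ln (real (card ?I))) \<le> sqrt (4 * (2 * ln K))" using lc l1 by (intro real_sqrt_le_mono) linarith
    also have "\<dots> = 2 * sqrt (2 * ln K)" by (subst real_sqrt_mult) simp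
    finally show ?thesis .
  qed
  moreover have "1 \<le> sqrt (2 * ln K)" using l1 by simp
  ultimately have "9 * (1 + sqrt (2 * ln (real (card ?I)))) \<le> 27 * sqrt (2 * ln K)" by blast
  then have "9 * (1 + sqrt (2 * ln (real (card ?I)))) * (b - a) \<le> 27 * sqrt (2 * ln K) * (b - a)" using ab by (intro mult_right_mono) auto
  moreover have mxe: "mx ?I (lin L' {1..K} \<xi>) = mxa {1..K} (lin L {1..K} \<xi>)" for \<xi>
    unfolding e by (rule mx_signed[OF IK])
  moreover note gauss_anticoncentration[OF I IK(1) u ab, unfolded mxe]
  ultimately show ?thesis by linarith
qed

text \<open>Anticoncentration makes the distribution function Lipschitz, hence continuous; it is 0
  at -1 and tends to 1, so the intermediate value theorem applies.\<close>

lemma gaussian_cdf_attains: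
  fixes K :: nat
  assumes K: "3 \<le> K" and unit: "\<forall>k\<in>{1..K}. (\<Sum>m\<in>{1..K}. L k m * L k m) = 1" and c: "0 < c" "c < 1"
  shows "\<exists>t. measure (gstd {1..K}) {\<xi>\<in>space (gstd {1..K}). mxa {1..K} (lin L {1..K} \<xi>) \<le> t} = c"
proof -
  define F where "F t = measure (gstd {1..K}) {\<xi>\<in>space (gstd {1..K}). mxa {1..K} (lin L {1..K} \<xi>) \<le> t}" for t
  have K0: "0 < K" using K by simp
  interpret D: real_distribution "distr (gstd {1..K}) borel (\<lambda>\<xi>. mxa {1..K} (lin L {1..K} \<xi>))"
    by (rule max_abs_distribution(1)[OF K0])
  have cdf: "cdf (distr (gstd {1..K}) borel (\<lambda>\<xi>. mxa {1..K} (lin L {1..K} \<xi>))) t = F t" for t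
    unfolding cdf_def F_def by (rule max_abs_distribution(2)[OF K0])
  have mono: "F a \<le> F b" if "a \<le> b" for a b using D.cdf_nondecreasing[OF that] unfolding cdf .
  define \<Lambda> where "\<Lambda> = 27 * sqrt (2 * ln K)"
  have \<Lambda>: "0 \<le> \<Lambda>" using K by (simp add: \<Lambda>_def)
  have lip: "F b - F a \<le> \<Lambda> * (b - a)" if "a \<le> b" for a b
    unfolding F_def \<Lambda>_def by (rule gaussian_cdf_lipschitz[OF K unit that])
  have "\<bar>F b - F a\<bar> \<le> \<Lambda> * \<bar>b - a\<bar>" for a b
    using lip[of a b] lip[of b a] mono[of a b] mono[of b a] by (cases "a \<le> b") (auto simp: abs_if)
  then have "\<Lambda>-lipschitz_on UNIV F" using \<Lambda> by (intro lipschitz_onI) (auto simp: dist_real_def abs_minus_commute)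
  then have cont: "continuous_on UNIV F" by (rule lipschitz_on_continuous_on)
  have "eventually (\<lambda>t. c < F t) at_top"
    using D.cdf_lim_at_top_prob c unfolding cdf by (intro order_tendstoD) auto
  then obtain t1 where t1: "\<And>t. t1 \<le> t \<Longrightarrow> c < F t" by (auto simp: eventually_at_top_linorder)
  have F1: "F (-1) = 0" unfolding F_def by (rule max_abs_distribution(3)[OF K0]) simp
  have "\<exists>t\<ge>-1. t \<le> max t1 0 \<and> F t = c"
    using F1 c t1[of "max t1 0"] by (intro IVT' continuous_on_subset[OF cont]) auto
  then show ?thesis unfolding F_def by blast
qed

lemma max_abs_gaussian_approximation:
  fixes n K :: nat
  assumes X: "rvec {1..K} M X D" and K: "0 < K" and n: "0 < n"
    and D4: "integrable M (\<lambda>m. D m ^ 4)" and m3: "(\<integral>m. D m ^ 3 \<partial>M) \<le> q" and m4: "(\<integral>m. D m ^ 4 \<partial>M) \<le> q\<^sup>2" and q: "0 < q"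
    and lam: "1 \<le> lam" "ln (2 * K) \<le> lam" and s: "0 < s" "s \<le> 1"
    and small: "q * (lam ^ 3 * sqrt lam) \<le> s ^ 4 * sqrt n"
    and unit: "\<forall>k\<in>{1..K}. (\<integral>m. X m k * X m k \<partial>M) = 1"
    and cov: "\<forall>k\<in>{1..K}. \<forall>j\<in>{1..K}. (\<Sum>m\<in>{1..K}. L k m * L j m) = (\<integral>m. X m k * X m j \<partial>M)"
  shows "\<bar>measure (PiM {..<n} (\<lambda>_. M)) {\<omega>\<in>space (PiM {..<n} (\<lambda>_. M)). mxa {1..K} (\<lambda>k. (\<Sum>l<n. X (\<omega> l) k) / sqrt n) \<le> t}
     - measure (gstd {1..K}) {\<xi>\<in>space (gstd {1..K}). mxa {1..K} (lin L {1..K} \<xi>) \<le> t}\<bar> \<le> 16000 * s"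
proof -
  let ?I = "{1..K} \<times> (UNIV :: bool set)"
  have IK: "finite {1..K}" "{1..K} \<noteq> {}" using K by auto
  have I: "finite ?I" "?I \<noteq> {}" using K by auto
  define L' where "L' p m = signed (\<lambda>k. L k m) p" for p m
  define X' where "X' m p = signed (X m) p" for m p
  have e: "lin L' {1..K} \<xi> = signed (lin L {1..K} \<xi>)" for \<xi>
    by (auto simp: fun_eq_iff lin_def L'_def signed_def sum_negf)
  have mxe: "mx ?I (lin L' {1..K} \<xi>) = mxa {1..K} (lin L {1..K} \<xi>)" for \<xi>
    unfolding e by (rule mx_signed[OF IK])
  have e': "(\<lambda>p. (\<Sum>l<n. X' (\<omega> l) p) / sqrt n) = signed (\<lambda>k. (\<Sum>l<n. X (\<omega> l) k) / sqrt n)" for \<omega>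
    by (auto simp: fun_eq_iff X'_def signed_def sum_negf)
  have mxe': "mx ?I (\<lambda>p. (\<Sum>l<n. X' (\<omega> l) p) / sqrt n) = mxa {1..K} (\<lambda>k. (\<Sum>l<n. X (\<omega> l) k) / sqrt n)" for \<omega>
    unfolding e' by (rule mx_signed[OF IK])
  have X': "rvec ?I M X' D"
  proof -
    have "(\<lambda>m. X' m p) \<in> borel_measurable M \<and> (\<integral>m. X' m p \<partial>M) = 0 \<and> (\<forall>m\<in>space M. \<bar>X' m p\<bar> \<le> D m)" if "p \<in> ?I" for p
    proof (cases "snd p")
      case True
      then have "X' m p = X m (fst p)" for m by (simp add: X'_def signed_def)
      then show ?thesis using X that unfolding rvec_def by auto
    next
      case False
      then have "X' m p = - X m (fst p)" for m by (simp add: X'_def signed_def)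
      then show ?thesis using X that unfolding rvec_def by auto
    qed
    then show ?thesis using X unfolding rvec_def by blast
  qed
  have lc: "ln (real (card ?I)) \<le> lam" unfolding card_signed using lam by simp
  have XX: "(\<integral>m. X' m p * X' m p' \<partial>M) = (if snd p = snd p' then 1 else -1) * (\<integral>m. X m (fst p) * X m (fst p') \<partial>M)" for p p'
    by (cases "snd p"; cases "snd p'") (simp_all add: X'_def signed_def)
  have LL: "(\<Sum>m\<in>{1..K}. L' p m * L' p' m) = (if snd p = snd p' then 1 else -1) * (\<Sum>m\<in>{1..K}. L (fst p) m * L (fst p') m)" for p p'
    by (cases "snd p"; cases "snd p'") (simp_all add: L'_def signed_def sum_negf)
  have u: "\<forall>p\<in>?I. (\<integral>m. X' m p * X' m p \<partial>M) = 1" unfolding XX using unit by auto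
  have c: "\<forall>p\<in>?I. \<forall>p'\<in>?I. (\<Sum>m\<in>{1..K}. L' p m * L' p' m) = (\<integral>m. X' m p * X' m p' \<partial>M)"
    unfolding XX LL using cov by (simp add: mem_Times_iff)
  show ?thesis
    using gaussian_approximation[OF X' I n D4 m3 m4 q lam(1) lc s small u IK(1) c, of t] unfolding mxe mxe' .
qed

lemma gaussian_max_compare:
  fixes K :: nat
  assumes K: "0 < K" and J: "finite J" "finite J'" and lam: "1 \<le> lam" "ln (2 * K) \<le> lam" and del: "0 < del" and \<Delta>: "0 \<le> \<Delta>"
    and cov: "\<forall>k\<in>{1..K}. \<forall>j\<in>{1..K}. \<bar>(\<Sum>m\<in>J. L k m * L j m) - (\<Sum>m\<in>J'. L' k m * L' j m)\<bar> \<le> \<Delta>"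
  shows "measure (gstd J) {\<xi>\<in>space (gstd J). mxa {1..K} (lin L J \<xi>) \<le> t}
    \<le> measure (gstd J') {\<xi>\<in>space (gstd J'). mxa {1..K} (lin L' J' \<xi>) \<le> t + 2 * del} + 350 * lam / del\<^sup>2 * \<Delta>"
proof -
  let ?I = "{1..K} \<times> (UNIV :: bool set)"
  have IK: "finite {1..K}" "{1..K} \<noteq> {}" using K by auto
  have I: "finite ?I" "?I \<noteq> {}" using K by auto
  define V where "V L p m = signed (\<lambda>k. L k m) p" for L :: "nat \<Rightarrow> nat \<Rightarrow> real" and p m
  have e: "mxa {1..K} (lin L J \<xi>) \<le> c \<longleftrightarrow> (\<forall>p\<in>?I. lin (V L) J \<xi> p \<le> c)" for c \<xi> L J
  proof -
    have "lin (V L) J \<xi> = signed (lin L J \<xi>)" by (auto simp: fun_eq_iff lin_def V_def signed_def sum_negf)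
    then have "mx ?I (lin (V L) J \<xi>) = mxa {1..K} (lin L J \<xi>)" using mx_signed[OF IK] by metis
    then show ?thesis using mx_le_iff[OF I] by metis
  qed
  have lc: "ln (real (card ?I)) \<le> lam" unfolding card_signed using lam by simp
  have c: "\<bar>(\<Sum>m\<in>J. V L p m * V L p' m) - (\<Sum>m\<in>J'. V L' p m * V L' p' m)\<bar> \<le> \<Delta>" if "p \<in> ?I" "p' \<in> ?I" for p p'
  proof -
    have "\<bar>(\<Sum>m\<in>J. L (fst p) m * L (fst p') m) - (\<Sum>m\<in>J'. L' (fst p) m * L' (fst p') m)\<bar> \<le> \<Delta>" using cov that by auto
    then show ?thesis
      by (cases "snd p"; cases "snd p'") (simp_all add: V_def signed_def sum_negf abs_minus_commute)
  qed
  show ?thesis unfolding e by (rule gauss_cdf_compare[OF I J lam(1) lc del \<Delta> c])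
qed

text \<open>Only \<open>F\<close> needs to take the levels \<open>\<alpha> \<plusminus> (\<eta> + \<delta>)\<close>; the bootstrap distribution \<open>Fh\<close> may have
  atoms, since the quantile event is expressed through values of \<open>Fh\<close> strictly below \<open>S\<close>.\<close>

lemma bootstrap_coverage:
  fixes S T :: "'a \<Rightarrow> real" and F :: "real \<Rightarrow> real" and Fh :: "'a \<Rightarrow> real \<Rightarrow> real"
  assumes M: "prob_space M" and T: "T \<in> borel_measurable M" and S: "S \<in> borel_measurable M"
    and A: "A \<in> sets M" and Bs: "N \<in> sets M" "measure M N \<le> e3"
    and att: "\<And>c. 0 < c \<Longrightarrow> c < 1 \<Longrightarrow> \<exists>t. F t = c" and mono: "mono F"
    and lip: "\<And>t. F (t + r) - F t \<le> e1"
    and TF: "\<And>t. \<bar>measure M {\<omega>\<in>space M. T \<omega> \<le> t} - F t\<bar> \<le> e2"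
    and ST: "\<And>\<omega>. \<omega> \<in> space M \<Longrightarrow> \<omega> \<notin> N \<Longrightarrow> \<bar>S \<omega> - T \<omega>\<bar> \<le> r"
    and Fh: "\<And>\<omega> t. \<omega> \<in> space M \<Longrightarrow> \<omega> \<notin> N \<Longrightarrow> \<bar>Fh \<omega> t - F t\<bar> \<le> \<eta>"
    and AS: "\<And>\<omega>. \<omega> \<in> space M \<Longrightarrow> \<omega> \<in> A \<longleftrightarrow> (\<forall>t<S \<omega>. Fh \<omega> t < \<alpha>)"
    and \<alpha>: "0 < \<alpha>" "\<alpha> < 1" and pos: "0 < \<delta>" "0 \<le> \<eta>" "0 \<le> e1" "0 \<le> e2"
  shows "\<bar>measure M A - \<alpha>\<bar> \<le> e1 + e2 + e3 + \<eta> + \<delta>"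
proof -
  interpret prob_space M by fact
  note T[measurable] S[measurable] A[measurable] Bs(1)[measurable]
  have e3: "0 \<le> e3" using Bs(2) measure_nonneg order_trans by blast
  \<comment> \<open>When the shifted level leaves the unit interval the bound is trivial. Otherwise
    the point \<open>t0\<close> where \<open>F\<close> takes that level confines \<open>S\<close>,
    on the event and off \<open>N\<close>, to values at most \<open>t0\<close>, and \<open>T\<close>
    to values at most \<open>t0 + r\<close>.\<close>
  have "measure M A \<le> \<alpha> + (e1 + e2 + e3 + \<eta> + \<delta>)"
  proof (cases "\<alpha> + \<eta> + \<delta> < 1")
    case True
    then obtain t0 where t0: "F t0 = \<alpha> + \<eta> + \<delta>" using att[of "\<alpha> + \<eta> + \<delta>"] \<alpha> pos by auto
    have "A \<subseteq> N \<union> {\<omega>\<in>space M. T \<omega> \<le> t0 + r}"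
    proof
      fix \<omega> assume w: "\<omega> \<in> A"
      then have sp: "\<omega> \<in> space M" using sets.sets_into_space[OF A] by auto
      show "\<omega> \<in> N \<union> {\<omega>\<in>space M. T \<omega> \<le> t0 + r}"
      proof (cases "\<omega> \<in> N")
        case False
        have "\<not> t0 < S \<omega>"
        proof
          assume "t0 < S \<omega>"
          then have "Fh \<omega> t0 < \<alpha>" using AS[OF sp] w by blast
          then show False using Fh[OF sp False, of t0] t0 pos by linarith
        qed
        then have "T \<omega> \<le> t0 + r" using ST[OF sp False] by linarith
        then show ?thesis using sp by simp
      qed simp
    qed
    then have "measure M A \<le> measure M (N \<union> {\<omega>\<in>space M. T \<omega> \<le> t0 + r})" by (intro finite_measure_mono) auto
    also have "\<dots> \<le> measure M N + measure M {\<omega>\<in>space M. T \<omega> \<le> t0 + r}" by (intro measure_Un_le) auto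
    finally show ?thesis using Bs(2) TF[of "t0 + r"] lip[of t0] t0 by linarith
  next
    case False
    then show ?thesis using prob_le_1[of A] pos e3 by linarith
  qed
  moreover have "\<alpha> \<le> measure M A + (e1 + e2 + e3 + \<eta> + \<delta>)"
  proof (cases "0 < \<alpha> - \<eta> - \<delta>")
    case True
    \<comment> \<open>The slack \<delta> provides the strict inequality
      \<open>Fh \<omega> t < \<alpha>\<close> that membership in \<open>A\<close> demands.\<close>
    then obtain t0 where t0: "F t0 = \<alpha> - \<eta> - \<delta>" using att[of "\<alpha> - \<eta> - \<delta>"] \<alpha> pos by auto
    have "{\<omega>\<in>space M. T \<omega> \<le> t0 - r} \<subseteq> N \<union> A"
    proof
      fix \<omega> assume "\<omega> \<in> {\<omega>\<in>space M. T \<omega> \<le> t0 - r}"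
      then have sp: "\<omega> \<in> space M" and T: "T \<omega> \<le> t0 - r" by auto
      show "\<omega> \<in> N \<union> A"
      proof (cases "\<omega> \<in> N")
        case False
        have "S \<omega> \<le> t0" using ST[OF sp False] T by linarith
        have "Fh \<omega> t < \<alpha>" if "t < S \<omega>" for t
        proof -
          have "F t \<le> F t0" using that \<open>S \<omega> \<le> t0\<close> by (intro monoD[OF mono]) simp
          then show ?thesis using Fh[OF sp False, of t] t0 pos by linarith
        qed
        then show ?thesis using AS[OF sp] by blast
      qed simp
    qed
    then have "measure M {\<omega>\<in>space M. T \<omega> \<le> t0 - r} \<le> measure M (N \<union> A)" by (intro finite_measure_mono) auto
    also have "\<dots> \<le> measure M N + measure M A" by (intro measure_Un_le) auto
    finally show ?thesis using Bs(2) TF[of "t0 - r"] lip[of "t0 - r"] t0 by simp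
  next
    case False
    then show ?thesis using pos e3 measure_nonneg[of M A] by linarith
  qed
  ultimately show ?thesis by linarith
qed

section \<open>Oracle summands, their normalisation and their moments\<close>

definition res_prod :: "('z \<Rightarrow> real) \<Rightarrow> ('z \<Rightarrow> real) \<Rightarrow> 'z obs \<Rightarrow> real" where
  "res_prod f g m = (obsX m - f (obsZ m)) * (obsY m - g (obsZ m))"

definition weight_sd :: "'z obs measure \<Rightarrow> ('z \<Rightarrow> real) \<Rightarrow> ('z \<Rightarrow> real) \<Rightarrow> (nat \<Rightarrow> 'z \<Rightarrow> real) \<Rightarrow> nat \<Rightarrow> real" where
  "weight_sd P f g w k = sqrt (\<integral>m. (res_prod f g m)\<^sup>2 * (w k (obsZ m))\<^sup>2 \<partial>P)"

lemma integrable_of_nn_bound: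
  assumes "h \<in> borel_measurable M" "\<And>x. 0 \<le> h x" "(\<integral>\<^sup>+x. ennreal (h x) \<partial>M) \<le> ennreal c" "0 \<le> c"
  shows "integrable M h" "(\<integral>x. h x \<partial>M) \<le> c"
proof -
  show i: "integrable M h"
    using assms by (intro integrableI_nonneg) (auto intro: le_less_trans)
  have "ennreal (\<integral>x. h x \<partial>M) \<le> ennreal c" using nn_integral_eq_integral[OF i] assms by simp
  then show "(\<integral>x. h x \<partial>M) \<le> c" using assms(4) by simp
qed

text \<open>The deviations are at least \<open>sqrt c1\<close>, so one constant \<kappa> bounds all
  normalised weights and \<open>\<kappa> * \<bar>res_prod f g m\<bar>\<close> is a common envelope
  for every \<open>k\<close>. Centring is the orthogonality of the first residual to functions of
  (Y, Z), one of which is the second residual times a weight. The value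
  \<open>4 * B * \<kappa>^3\<close> is generous enough for its square to dominate the fourth moment
  as well.\<close>

lemma weighted_residuals:
  fixes P :: "('z::euclidean_space) obs measure" and K :: nat
  assumes P: "P \<in> P0" and f: "cond_mean P obsX f" and g: "cond_mean P obsY g" and B: "1 \<le> B"
    and m3: "(\<integral>\<^sup>+m. ennreal (\<bar>res_prod f g m\<bar> ^ 3) \<partial>P) \<le> ennreal (4 * B)"
    and m4: "(\<integral>\<^sup>+m. ennreal (\<bar>res_prod f g m\<bar> ^ 4) \<partial>P) \<le> ennreal (4 * B\<^sup>2)"
    and w: "\<forall>k. w k \<in> borel_measurable borel" "\<forall>k\<in>{1..K}. \<forall>z. \<bar>w k z\<bar> \<le> C1"
    and low: "\<forall>k\<in>{1..K}. ennreal c1 \<le> (\<integral>\<^sup>+m. ennreal ((res_prod f g m)\<^sup>2 * (w k (obsZ m))\<^sup>2) \<partial>P)" and c1: "0 < c1"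
    and \<kappa>: "1 \<le> \<kappa>" "1 \<le> \<kappa> * sqrt c1" "C1 \<le> \<kappa> * sqrt c1"
  defines "X \<equiv> \<lambda>m k. res_prod f g m * (w k (obsZ m) / weight_sd P f g w k)" and "D \<equiv> \<lambda>m. \<kappa> * \<bar>res_prod f g m\<bar>"
  shows "\<forall>k\<in>{1..K}. 0 < weight_sd P f g w k" "\<forall>k\<in>{1..K}. 1 \<le> \<kappa> * weight_sd P f g w k"
    and "\<forall>k\<in>{1..K}. \<forall>z. \<bar>w k z\<bar> \<le> \<kappa> * weight_sd P f g w k"
    and "rvec {1..K} P X D" "integrable P (\<lambda>m. D m ^ 4)"
    and "(\<integral>m. D m ^ 3 \<partial>P) \<le> 4 * B * \<kappa> ^ 3" "(\<integral>m. D m ^ 4 \<partial>P) \<le> (4 * B * \<kappa> ^ 3)\<^sup>2"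
    and "\<forall>k\<in>{1..K}. (\<integral>m. X m k * X m k \<partial>P) = 1"
    and "\<forall>k\<in>{1..K}. \<forall>j\<in>{1..K}. \<bar>\<integral>m. X m k * X m j \<partial>P\<bar> \<le> 1"
    and "\<exists>L. \<forall>k\<in>{1..K}. \<forall>j\<in>{1..K}. (\<Sum>m\<in>{1..K}. L k m * L j m) = (\<integral>m. X m k * X m j \<partial>P)"
proof -
  note P0 = P0_model[OF P]
  interpret prob_space P by (rule P0)
  note obs_measurable[OF P0(2), measurable]
  have [measurable]: "f \<in> borel_measurable borel" "g \<in> borel_measurable borel" using f g by (auto simp: cond_mean_def)
  have [measurable]: "w k \<in> borel_measurable borel" for k using w by blast
  let ?p = "res_prod f g"
  let ?\<sigma> = "weight_sd P f g w"
  have pm[measurable]: "?p \<in> borel_measurable P" unfolding res_prod_def[abs_def] by measurable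
  have i3: "integrable P (\<lambda>m. \<bar>?p m\<bar> ^ 3)" and b3: "(\<integral>m. \<bar>?p m\<bar> ^ 3 \<partial>P) \<le> 4 * B"
    using m3 B by (auto intro!: integrable_of_nn_bound)
  have i4: "integrable P (\<lambda>m. \<bar>?p m\<bar> ^ 4)" and b4: "(\<integral>m. \<bar>?p m\<bar> ^ 4 \<partial>P) \<le> 4 * B\<^sup>2"
    using m4 B by (auto intro!: integrable_of_nn_bound)
  have i2: "integrable P (\<lambda>m. (?p m)\<^sup>2)"
  proof (rule Bochner_Integration.integrable_bound)
    show "integrable P (\<lambda>m. 1 + \<bar>?p m\<bar> ^ 4)" using i4 by simp
    have "x\<^sup>2 \<le> 1 + x ^ 4" for x :: real
    proof -
      have "0 \<le> (x\<^sup>2 - 1)\<^sup>2 + x ^ 4 + 1" by simp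
      then show ?thesis by (simp add: power2_eq_square algebra_simps power_numeral_reduce)
    qed
    then show "AE m in P. norm ((?p m)\<^sup>2) \<le> norm (1 + \<bar>?p m\<bar> ^ 4)" by (simp add: power_even_abs)
  qed simp
  have iw: "integrable P (\<lambda>m. (?p m)\<^sup>2 * (w k (obsZ m))\<^sup>2)" if k: "k \<in> {1..K}" for k
  proof (rule Bochner_Integration.integrable_bound)
    show "integrable P (\<lambda>m. C1\<^sup>2 * (?p m)\<^sup>2)" using i2 by simp
    have "(w k z)\<^sup>2 \<le> C1\<^sup>2" for z using w(2) k abs_le_square_iff[of "w k z" C1] abs_ge_self[of C1] by (meson order_trans)
    then show "AE m in P. norm ((?p m)\<^sup>2 * (w k (obsZ m))\<^sup>2) \<le> norm (C1\<^sup>2 * (?p m)\<^sup>2)"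
      by (auto simp: mult.commute[of "C1\<^sup>2"] intro!: AE_I2 mult_left_mono)
  qed measurable
  have sc: "sqrt c1 \<le> ?\<sigma> k" if k: "k \<in> {1..K}" for k
  proof -
    have "ennreal c1 \<le> ennreal (\<integral>m. (?p m)\<^sup>2 * (w k (obsZ m))\<^sup>2 \<partial>P)"
      using low[rule_format, OF k] nn_integral_eq_integral[OF iw[OF k]] by simp
    then have "c1 \<le> (\<integral>m. (?p m)\<^sup>2 * (w k (obsZ m))\<^sup>2 \<partial>P)" using c1 by (auto simp: ennreal_le_iff2)
    then show ?thesis unfolding weight_sd_def by simp
  qed
  have c1s: "0 < sqrt c1" using c1 by simp
  show s0: "\<forall>k\<in>{1..K}. 0 < ?\<sigma> k" using sc c1s by (meson less_le_trans)
  have mk: "\<kappa> * sqrt c1 \<le> \<kappa> * ?\<sigma> k" if "k \<in> {1..K}" for k using sc[OF that] \<kappa> by (intro mult_left_mono) auto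
  show "\<forall>k\<in>{1..K}. 1 \<le> \<kappa> * ?\<sigma> k" using mk \<kappa>(2) by (meson order_trans)
  show wk: "\<forall>k\<in>{1..K}. \<forall>z. \<bar>w k z\<bar> \<le> \<kappa> * ?\<sigma> k" using mk \<kappa>(3) w(2) by (meson order_trans)
  have v: "\<bar>w k z / ?\<sigma> k\<bar> \<le> \<kappa>" if "k \<in> {1..K}" for k z
  proof -
    have "0 < ?\<sigma> k" "\<bar>w k z\<bar> \<le> \<kappa> * ?\<sigma> k" using wk s0 that by blast+
    then show ?thesis by (simp add: abs_divide divide_le_eq)
  qed
  have XD: "\<bar>X m k\<bar> \<le> D m" if "k \<in> {1..K}" for m k
    unfolding X_def D_def abs_mult mult.commute[of \<kappa>] by (intro mult_left_mono v that) simp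
  have mean: "(\<integral>m. X m k \<partial>P) = 0" for k
  proof -
    define h where "h q = (fst q - g (snd q)) * (w k (snd q) / ?\<sigma> k)" for q
    have "h \<in> borel_measurable (borel \<Otimes>\<^sub>M borel)" unfolding h_def[abs_def] by measurable
    then have "(\<integral>m. (obsX m - f (obsZ m)) * h (obsY m, obsZ m) \<partial>P) = 0"
      by (rule residual_orthogonal[OF P0 obs_measurable(1,2)[OF P0(2)] f])
    then show ?thesis by (simp add: X_def h_def res_prod_def mult.assoc)
  qed
  have D3: "D m ^ 3 = \<kappa> ^ 3 * \<bar>?p m\<bar> ^ 3" and D4: "D m ^ 4 = \<kappa> ^ 4 * \<bar>?p m\<bar> ^ 4" for m
    by (simp_all add: D_def power_mult_distrib)
  show rv: "rvec {1..K} P X D"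
    unfolding rvec_def
  proof (intro conjI ballI)
    show "integrable P (\<lambda>m. D m ^ 3)" unfolding D3 using i3 by simp
    show "(\<lambda>m. X m k) \<in> borel_measurable P" for k unfolding X_def by measurable
    show "D \<in> borel_measurable P" unfolding D_def by measurable
    show "0 \<le> D m" for m using \<kappa> by (simp add: D_def)
  qed (use P0 XD mean in auto)
  show "integrable P (\<lambda>m. D m ^ 4)" unfolding D4 using i4 by simp
  have "(\<integral>m. D m ^ 3 \<partial>P) = \<kappa> ^ 3 * (\<integral>m. \<bar>?p m\<bar> ^ 3 \<partial>P)" unfolding D3 by simp
  also have "\<dots> \<le> \<kappa> ^ 3 * (4 * B)" using b3 \<kappa> by (intro mult_left_mono) auto
  finally show "(\<integral>m. D m ^ 3 \<partial>P) \<le> 4 * B * \<kappa> ^ 3" by (simp add: mult.commute)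
  have "(\<integral>m. D m ^ 4 \<partial>P) = \<kappa> ^ 4 * (\<integral>m. \<bar>?p m\<bar> ^ 4 \<partial>P)" unfolding D4 by simp
  also have "\<dots> \<le> \<kappa> ^ 6 * (16 * B\<^sup>2)"
  proof (rule mult_mono)
    have "4 * B\<^sup>2 \<le> 16 * B\<^sup>2" by simp
    then show "(\<integral>m. \<bar>?p m\<bar> ^ 4 \<partial>P) \<le> 16 * B\<^sup>2" using b4 by linarith
  qed (use \<kappa> power_increasing[of 4 6 \<kappa>] in auto)
  also have "\<dots> = (4 * B * \<kappa> ^ 3)\<^sup>2" by (simp add: power_mult_distrib power_mult[symmetric])
  finally show "(\<integral>m. D m ^ 4 \<partial>P) \<le> (4 * B * \<kappa> ^ 3)\<^sup>2" .
  have XX: "integrable P (\<lambda>m. X m k * X m j)" if "k \<in> {1..K}" "j \<in> {1..K}" for k j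
    using rvec_integrable(2)[OF rv that] .
  show unit: "\<forall>k\<in>{1..K}. (\<integral>m. X m k * X m k \<partial>P) = 1"
  proof
    fix k assume k: "k \<in> {1..K}"
    have "X m k * X m k = ((?p m)\<^sup>2 * (w k (obsZ m))\<^sup>2) / (?\<sigma> k)\<^sup>2" for m
      by (simp add: X_def power2_eq_square)
    then have "(\<integral>m. X m k * X m k \<partial>P) = (\<integral>m. (?p m)\<^sup>2 * (w k (obsZ m))\<^sup>2 \<partial>P) / (?\<sigma> k)\<^sup>2" by simp
    also have "(\<integral>m. (?p m)\<^sup>2 * (w k (obsZ m))\<^sup>2 \<partial>P) = (?\<sigma> k)\<^sup>2"
      unfolding weight_sd_def by (subst real_sqrt_pow2) auto
    finally show "(\<integral>m. X m k * X m k \<partial>P) = 1" using s0 k by fastforce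
  qed
  show "\<forall>k\<in>{1..K}. \<forall>j\<in>{1..K}. \<bar>\<integral>m. X m k * X m j \<partial>P\<bar> \<le> 1"
  proof (intro ballI)
    fix k j assume kj: "k \<in> {1..K}" "j \<in> {1..K}"
    have "\<bar>\<integral>m. X m k * X m j \<partial>P\<bar> \<le> (\<integral>m. \<bar>X m k * X m j\<bar> \<partial>P)" by (rule integral_abs_bound)
    also have "\<dots> \<le> (\<integral>m. (X m k * X m k + X m j * X m j) / 2 \<partial>P)"
    proof (rule integral_mono)
      show "\<bar>X m k * X m j\<bar> \<le> (X m k * X m k + X m j * X m j) / 2" for m
        using sum_squares_bound[of "\<bar>X m k\<bar>" "\<bar>X m j\<bar>"] by (simp add: power2_eq_square abs_mult)
    qed (use XX kj in auto)
    also have "\<dots> = ((\<integral>m. X m k * X m k \<partial>P) + (\<integral>m. X m j * X m j \<partial>P)) / 2"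
      using XX[OF kj(1) kj(1)] XX[OF kj(2) kj(2)] by simp
    also have "\<dots> = 1" using unit kj by simp
    finally show "\<bar>\<integral>m. X m k * X m j \<partial>P\<bar> \<le> 1" .
  qed
  show "\<exists>L. \<forall>k\<in>{1..K}. \<forall>j\<in>{1..K}. (\<Sum>m\<in>{1..K}. L k m * L j m) = (\<integral>m. X m k * X m j \<partial>P)"
  proof (rule psd_factorization)
    show "(\<integral>m. X m i * X m j \<partial>P) = (\<integral>m. X m j * X m i \<partial>P)" for i j by (simp add: mult.commute)
    fix c :: "nat \<Rightarrow> real"
    have "(\<Sum>i\<in>{1..K}. \<Sum>j\<in>{1..K}. c i * c j * (\<integral>m. X m i * X m j \<partial>P)) = (\<Sum>i\<in>{1..K}. \<Sum>j\<in>{1..K}. \<integral>m. c i * c j * (X m i * X m j) \<partial>P)"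
      by simp
    also have "\<dots> = (\<integral>m. (\<Sum>i\<in>{1..K}. \<Sum>j\<in>{1..K}. c i * c j * (X m i * X m j)) \<partial>P)"
      using XX by (simp add: Bochner_Integration.integral_sum Bochner_Integration.integrable_sum del: atLeastAtMost_iff integral_mult_right_zero)
    also have "\<dots> = (\<integral>m. (\<Sum>i\<in>{1..K}. c i * X m i)\<^sup>2 \<partial>P)"
      by (simp add: power2_eq_square sum_product mult.assoc mult.left_commute)
    finally show "0 \<le> (\<Sum>i\<in>{1..K}. \<Sum>j\<in>{1..K}. c i * c j * (\<integral>m. X m i * X m j \<partial>P))" by simp
  qed simp
qed

text \<open>The condition behind the Gaussian approximation also makes the centring term of the
  empirical covariance negligible, and brings the bound on the expected covariance error into the
  form threshold times \<open>7 * s\<close>, ready for Markov's inequality.\<close>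

lemma moment_rate_consequences:
  fixes n :: nat and l q s :: real
  assumes l: "1 \<le> l" and q: "1 \<le> q" and s: "0 < s" and n: "0 < n"
    and small: "q * ((2 * l) ^ 3 * sqrt (2 * l)) \<le> s ^ 4 * sqrt n"
  shows "l ^ 3 \<le> s ^ 8 * n" "7 * sqrt (2 * l * q\<^sup>2 / n) \<le> s ^ 3 / l\<^sup>2 * (7 * s)"
proof -
  have sn: "0 < sqrt n" "(sqrt n)\<^sup>2 = n" using n by auto
  have r: "1 \<le> sqrt (2 * l)" using l by simp
  have l3: "l\<^sup>2 \<le> (2 * l) ^ 3"
  proof -
    have "l\<^sup>2 \<le> l ^ 3" using l by (intro power_increasing) auto
    also have "\<dots> \<le> (2 * l) ^ 3" using l by (intro power_mono) auto
    finally show ?thesis .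
  qed
  have "l\<^sup>2 * 1 \<le> (2 * l) ^ 3 * sqrt (2 * l)" using l3 r l by (intro mult_mono) auto
  moreover have "1 * ((2 * l) ^ 3 * sqrt (2 * l)) \<le> q * ((2 * l) ^ 3 * sqrt (2 * l))" using q l by (intro mult_right_mono) auto
  ultimately have "l\<^sup>2 \<le> s ^ 4 * sqrt n" using small by linarith
  then have "(l\<^sup>2)\<^sup>2 \<le> (s ^ 4 * sqrt n)\<^sup>2" using l by (intro power_mono) auto
  also have "\<dots> = s ^ 8 * n" using sn by (simp add: power_mult_distrib power_mult[symmetric])
  finally have "l ^ 4 \<le> s ^ 8 * n" by (simp add: power_mult[symmetric])
  moreover have "l ^ 3 \<le> l ^ 4" using l by (intro power_increasing) auto
  ultimately show "l ^ 3 \<le> s ^ 8 * n" by linarith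
  have "sqrt (2 * l * q\<^sup>2 / n) = q * sqrt (2 * l) / sqrt n" using q l by (simp add: real_sqrt_mult real_sqrt_divide)
  also have "\<dots> \<le> s ^ 4 / l\<^sup>2"
  proof -
    have "q * sqrt (2 * l) * l\<^sup>2 \<le> q * sqrt (2 * l) * (2 * l) ^ 3" using l3 q l by (intro mult_left_mono) auto
    also have "\<dots> \<le> s ^ 4 * sqrt n" using small by (simp only: mult.assoc mult.commute)
    finally have "q * sqrt (2 * l) * l\<^sup>2 \<le> s ^ 4 * sqrt n" .
    moreover have "0 < l\<^sup>2" using l by simp
    ultimately show ?thesis using sn(1) by (simp add: divide_le_eq le_divide_eq)
  qed
  finally have "7 * sqrt (2 * l * q\<^sup>2 / n) \<le> 7 * (s ^ 4 / l\<^sup>2)" by simp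
  also have "\<dots> = s ^ 3 / l\<^sup>2 * (7 * s)" by (simp add: power_numeral_reduce)
  finally show "7 * sqrt (2 * l * q\<^sup>2 / n) \<le> s ^ 3 / l\<^sup>2 * (7 * s)" .
qed

text \<open>At height \<open>sqrt (ln K) / s\<close> the Gaussian exponent outweighs the union bound
  over \<open>K\<close> coordinates, leaving a remainder that vanishes with
  \<open>s\<close>.\<close>

lemma gaussian_tail_rate:
  fixes K :: nat
  assumes K: "0 < K" and l: "1 \<le> ln K" and s: "0 < s" "100 * s \<le> 1"
  shows "K * (2 * exp (- (sqrt (ln K) / s)\<^sup>2 / 4)) \<le> 16 * s"
proof -
  let ?l = "ln (real K)"
  have s2: "s\<^sup>2 \<le> s" "8 * s\<^sup>2 \<le> 1"
  proof -
    show "s\<^sup>2 \<le> s" using s by (simp add: power2_eq_square mult_left_le)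
    then show "8 * s\<^sup>2 \<le> 1" using s by linarith
  qed
  \<comment> \<open>Half the exponent: one half compensates \<open>K\<close>, since
    \<open>ln K \<le> y\<close>, and the other gives \<open>exp (- y) \<le> 1 / y\<close>, which is
    of order \<open>s^2\<close>.\<close>
  define y where "y = ?l / (8 * s\<^sup>2)"
  have y1: "?l \<le> y"
  proof -
    have "?l * (8 * s\<^sup>2) \<le> ?l * 1" using l s2 by (intro mult_left_mono) auto
    then show ?thesis using s by (simp add: y_def le_divide_eq)
  qed
  have y0: "0 < y" using y1 l by linarith
  have "(sqrt ?l / s)\<^sup>2 / 4 = 2 * y" using l by (simp add: y_def power_divide)
  then have "K * (2 * exp (- (sqrt ?l / s)\<^sup>2 / 4)) = 2 * (exp ?l * exp (- (2 * y)))" using K by simp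
  also have "\<dots> = 2 * exp (?l - 2 * y)" by (simp add: exp_diff exp_minus divide_inverse)
  also have "\<dots> \<le> 2 * exp (- y)" using y1 by simp
  also have "\<dots> \<le> 2 * (1 / y)"
  proof -
    have "y \<le> exp y" using exp_ge_add_one_self[of y] by linarith
    then have "1 / exp y \<le> 1 / y" using y0 by (intro divide_left_mono) auto
    then show ?thesis by (simp add: exp_minus divide_inverse)
  qed
  also have "\<dots> = 16 * s\<^sup>2 / ?l" by (simp add: y_def)
  also have "\<dots> \<le> 16 * s\<^sup>2" using l by (simp add: divide_le_eq mult_le_cancel_left1)
  also have "\<dots> \<le> 16 * s" using s2 by simp
  finally show ?thesis .
qed

text \<open>Everything is evaluated at a single \<open>n\<close> and a single level
  \<open>s\<close>, and the bound involves \<open>P\<close> and \<alpha> only through the fixed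
  constant \<kappa>; uniformity over the family and over the levels is thereby automatic.\<close>

lemma finite_sample:
  fixes P :: "('z::euclidean_space) obs measure" and n K :: nat and f g u v :: "'z obs measure \<Rightarrow> 'z \<Rightarrow> real"
  assumes P: "P \<in> P0" and f: "cond_mean P obsX (f P)" and g: "cond_mean P obsY (g P)"
    and u: "cond_mean_nn P (\<lambda>w. (obsX w - f P (obsZ w))\<^sup>2) (u P)" and v: "cond_mean_nn P (\<lambda>w. (obsY w - g P (obsZ w))\<^sup>2) (v P)"
    and K: "3 \<le> K" and n: "0 < n"
    and fh: "\<And>i. i < n \<Longrightarrow> (\<lambda>\<omega>. fhat fh n \<omega> (obsZ (\<omega> i))) \<in> borel_measurable (PiM {..<n} (\<lambda>_. borel))"
    and gh: "\<And>i. i < n \<Longrightarrow> (\<lambda>\<omega>. ghat gh n \<omega> (obsZ (\<omega> i))) \<in> borel_measurable (PiM {..<n} (\<lambda>_. borel))"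
    and B: "1 \<le> B"
    and m3: "(\<integral>\<^sup>+m. ennreal (\<bar>epsxi f g P m\<bar> ^ 3) \<partial>P) \<le> ennreal (4 * B)"
    and m4: "(\<integral>\<^sup>+m. ennreal (\<bar>epsxi f g P m\<bar> ^ 4) \<partial>P) \<le> ennreal (4 * B\<^sup>2)"
    and w: "\<forall>k. w k \<in> borel_measurable borel" "\<forall>k\<in>{1..K}. \<forall>z. \<bar>w k z\<bar> \<le> C1"
    and low: "\<forall>k\<in>{1..K}. ennreal c1 \<le> (\<integral>\<^sup>+m. ennreal ((epsxi f g P m)\<^sup>2 * (w k (obsZ m))\<^sup>2) \<partial>P)" and c1: "0 < c1"
    and \<kappa>: "1 \<le> \<kappa>" "1 \<le> \<kappa> * sqrt c1" "C1 \<le> \<kappa> * sqrt c1" "C1 \<le> \<kappa>"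
    and s: "0 < s" "100 * \<kappa>\<^sup>2 * s \<le> 1"
    and small: "4 * B * \<kappa> ^ 3 * ((2 * ln K) ^ 3 * sqrt (2 * ln K)) \<le> s ^ 4 * sqrt n"
    and AfAg: "probn n P (\<lambda>\<omega>. s ^ 8 < \<bar>Af f fh n P \<omega> * Ag g gh n P \<omega> / (1 / (real n * (ln (real K))\<^sup>2))\<bar>) \<le> s"
    and Bf: "probn n P (\<lambda>\<omega>. s ^ 8 < \<bar>Bf f fh v n P \<omega> / (1 / (ln (real K)) ^ 4)\<bar>) \<le> s"
    and Bg: "probn n P (\<lambda>\<omega>. s ^ 8 < \<bar>Bg g gh u n P \<omega> / (1 / (ln (real K)) ^ 4)\<bar>) \<le> s"
    and \<alpha>: "0 < \<alpha>" "\<alpha> < 1"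
  shows "\<bar>probn n P (\<lambda>\<omega>. Sstat fh gh w K n \<omega> \<le> Ghat fh gh w K n \<omega> \<alpha>) - \<alpha>\<bar> \<le> 1000000 * \<kappa>\<^sup>2 * s"
proof -
  define l where "l = ln (real K)"
  define Pn where "Pn = PiM {..<n} (\<lambda>_. P)"
  define e where "e \<omega> i = obsX (\<omega> i) - f P (obsZ (\<omega> i))" for \<omega> :: "nat \<Rightarrow> 'z obs" and i
  define x where "x \<omega> i = obsY (\<omega> i) - g P (obsZ (\<omega> i))" for \<omega> :: "nat \<Rightarrow> 'z obs" and i
  define a where "a \<omega> i = f P (obsZ (\<omega> i)) - fhat fh n \<omega> (obsZ (\<omega> i))" for \<omega> :: "nat \<Rightarrow> 'z obs" and i
  define b where "b \<omega> i = g P (obsZ (\<omega> i)) - ghat gh n \<omega> (obsZ (\<omega> i))" for \<omega> :: "nat \<Rightarrow> 'z obs" and i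
  define \<sigma> where "\<sigma> = weight_sd P (f P) (g P) w"
  define X where "X m k = res_prod (f P) (g P) m * (w k (obsZ m) / \<sigma> k)" for m k
  define D where "D m = \<kappa> * \<bar>res_prod (f P) (g P) m\<bar>" for m
  define \<Sigma> where "\<Sigma> k j = (\<integral>m. X m k * X m j \<partial>P)" for k j
  define T where "T \<omega> = mxa {1..K} (\<lambda>k. (\<Sum>i<n. X (\<omega> i) k) / sqrt n)" for \<omega>
  define q where "q = 4 * B * \<kappa> ^ 3"
  have ep: "epsxi f g P = res_prod (f P) (g P)" by (simp add: fun_eq_iff epsxi_def res_prod_def)
  note P0 = P0_model[OF P]
  interpret P: prob_space P by (rule P0)
  have PS: "prob_space Pn" unfolding Pn_def by (rule prob_space_PiM_const[OF P.prob_space_axioms])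
  interpret S: prob_space Pn by (rule PS)
  note rm = residual_models[OF P f g u v]
  have WR: "\<forall>k\<in>{1..K}. 0 < \<sigma> k" "\<forall>k\<in>{1..K}. 1 \<le> \<kappa> * \<sigma> k" "\<forall>k\<in>{1..K}. \<forall>z. \<bar>w k z\<bar> \<le> \<kappa> * \<sigma> k"
    "rvec {1..K} P X D" "integrable P (\<lambda>m. D m ^ 4)" "(\<integral>m. D m ^ 3 \<partial>P) \<le> q" "(\<integral>m. D m ^ 4 \<partial>P) \<le> q\<^sup>2"
    "\<forall>k\<in>{1..K}. (\<integral>m. X m k * X m k \<partial>P) = 1" "\<forall>k\<in>{1..K}. \<forall>j\<in>{1..K}. \<bar>\<Sigma> k j\<bar> \<le> 1"
    "\<exists>L. \<forall>k\<in>{1..K}. \<forall>j\<in>{1..K}. (\<Sum>m\<in>{1..K}. L k m * L j m) = \<Sigma> k j"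
    using weighted_residuals[OF P f g B m3[unfolded ep] m4[unfolded ep] w low[unfolded ep] c1 \<kappa>(1-3)]
    unfolding X_def[abs_def] D_def[abs_def] \<sigma>_def q_def \<Sigma>_def by blast+
  then obtain L where L: "\<forall>k\<in>{1..K}. \<forall>j\<in>{1..K}. (\<Sum>m\<in>{1..K}. L k m * L j m) = \<Sigma> k j" by blast
  have unit: "\<forall>k\<in>{1..K}. (\<Sum>m\<in>{1..K}. L k m * L k m) = 1" using L WR(8) by (simp add: \<Sigma>_def)
  have K0: "0 < K" and IK: "finite {1..K}" "{1..K} \<noteq> {}" using K by auto
  have l1: "1 \<le> l"
  proof -
    have "exp 1 \<le> real K" using exp_le K by linarith
    then show ?thesis unfolding l_def using K by (subst ln_ge_iff) auto
  qed
  have l2K: "ln (real (2 * K)) \<le> 2 * l"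
  proof -
    have "ln (real (2 * K)) = ln 2 + l" unfolding l_def using K by (simp add: ln_mult)
    then show ?thesis using l1 ln_2_less_1 by linarith
  qed
  have lK: "ln (real (card {1..K})) \<le> 2 * l" using l1 by (simp add: l_def)
  have lam: "1 \<le> 2 * l" using l1 by simp
  have k2: "1 \<le> \<kappa>\<^sup>2" using \<kappa> by simp
  have s100: "100 * s \<le> 1"
  proof -
    have "100 * s * 1 \<le> 100 * s * \<kappa>\<^sup>2" using k2 s by (intro mult_left_mono) auto
    then show ?thesis using s(2) by (simp add: mult.commute mult.left_commute)
  qed
  have s1: "s \<le> 1" using s100 s by linarith
  have ks: "s \<le> \<kappa>\<^sup>2 * s" using k2 s by simp
  have q1: "1 \<le> q"
  proof -
    have "1 * 1 \<le> (4 * B) * \<kappa> ^ 3" using B \<kappa> by (intro mult_mono) auto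
    then show ?thesis by (simp add: q_def)
  qed
  have q0: "0 < q" "0 < q\<^sup>2" using q1 by auto
  have C1: "C1\<^sup>2 \<le> \<kappa>\<^sup>2"
  proof -
    have "\<bar>w 1 undefined\<bar> \<le> C1" using w(2) K by auto
    then show ?thesis using \<kappa> by (intro power_mono) auto
  qed
  have small': "q * ((2 * l) ^ 3 * sqrt (2 * l)) \<le> s ^ 4 * sqrt n" using small by (simp only: q_def l_def)
  note rates = moment_rate_consequences[OF l1 q1 s(1) n small']
  have eqs: "sets (PiM {..<n} (\<lambda>_. borel)) = sets Pn" unfolding Pn_def using P0(2) by (intro sets_PiM_cong) auto
  have fhm: "(\<lambda>\<omega>. fhat fh n \<omega> (obsZ (\<omega> i))) \<in> borel_measurable Pn" if "i < n" for i
    using fh[OF that] measurable_cong_sets[OF eqs refl] by blast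
  have ghm: "(\<lambda>\<omega>. ghat gh n \<omega> (obsZ (\<omega> i))) \<in> borel_measurable Pn" if "i < n" for i
    using gh[OF that] measurable_cong_sets[OF eqs refl] by blast
  note obs_measurable[OF P0(2), measurable]
  have [measurable]: "f P \<in> borel_measurable borel" "g P \<in> borel_measurable borel" "u P \<in> borel_measurable borel" "v P \<in> borel_measurable borel"
    using f g u v by (auto simp: cond_mean_def cond_mean_nn_def)
  have u0: "\<And>z. 0 \<le> u P z" "\<And>z. 0 \<le> v P z" using u v by (auto simp: cond_mean_nn_def)
  have crd: "(\<lambda>\<omega>. h (\<omega> i)) \<in> borel_measurable Pn" if "h \<in> borel_measurable P" "i < n" for h :: "'z obs \<Rightarrow> real" and i
    unfolding Pn_def by (rule PiM_coordinate(3)[OF P.prob_space_axioms that(2) that(1)])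
  have am: "(\<lambda>\<omega>. a \<omega> i) \<in> borel_measurable Pn" if "i < n" for i
  proof -
    have "(\<lambda>m. f P (obsZ m)) \<in> borel_measurable P" by measurable
    from crd[OF this that] show ?thesis unfolding a_def using fhm[OF that] by (rule borel_measurable_diff)
  qed
  have bm: "(\<lambda>\<omega>. b \<omega> i) \<in> borel_measurable Pn" if "i < n" for i
  proof -
    have "(\<lambda>m. g P (obsZ m)) \<in> borel_measurable P" by measurable
    from crd[OF this that] show ?thesis unfolding b_def using ghm[OF that] by (rule borel_measurable_diff)
  qed
  have um: "(\<lambda>\<omega>. u P (obsZ (\<omega> i))) \<in> borel_measurable Pn" "(\<lambda>\<omega>. v P (obsZ (\<omega> i))) \<in> borel_measurable Pn" if "i < n" for i
  proof -
    have "(\<lambda>m. u P (obsZ m)) \<in> borel_measurable P" "(\<lambda>m. v P (obsZ m)) \<in> borel_measurable P" by measurable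
    from this[THEN crd, OF that] show "(\<lambda>\<omega>. u P (obsZ (\<omega> i))) \<in> borel_measurable Pn" "(\<lambda>\<omega>. v P (obsZ (\<omega> i))) \<in> borel_measurable Pn" .
  qed
  have Xm: "(\<lambda>\<omega>. X (\<omega> i) k) \<in> borel_measurable Pn" if "i < n" "k \<in> {1..K}" for i k
    using crd[of "\<lambda>m. X m k", OF _ that(1)] WR(4) that(2) unfolding rvec_def by blast
  have Tm: "T \<in> borel_measurable Pn"
    unfolding T_def[abs_def] using Xm by (intro mxa_measurable IK borel_measurable_divide borel_measurable_sum) auto

  \<comment> \<open>The bad events. The first three come from the assumptions on the regression
    errors, the quantity in \<open>NA\<close> being \<open>n\<close> times the product of
    \<open>Af\<close> and \<open>Ag\<close>; \<open>N4\<close> to \<open>N7\<close> concern cross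
    terms while the weighted errors are small; \<open>N8\<close> and \<open>N9\<close> concern the
    oracle covariance and the size of the oracle statistic.\<close>
  define NA where "NA = {\<omega>\<in>space Pn. s ^ 8 / l\<^sup>2 < (\<Sum>i<n. (a \<omega> i)\<^sup>2) * (\<Sum>i<n. (b \<omega> i)\<^sup>2) / n}"
  define NBf where "NBf = {\<omega>\<in>space Pn. s ^ 8 / l ^ 4 < (\<Sum>i<n. (a \<omega> i)\<^sup>2 * v P (obsZ (\<omega> i))) / n}"
  define NBg where "NBg = {\<omega>\<in>space Pn. s ^ 8 / l ^ 4 < (\<Sum>i<n. (b \<omega> i)\<^sup>2 * u P (obsZ (\<omega> i))) / n}"
  define N4 where "N4 = {\<omega>\<in>space Pn. (\<Sum>i<n. (b \<omega> i)\<^sup>2 * u P (obsZ (\<omega> i))) / n \<le> s ^ 8 / l ^ 4 \<and> s ^ 6 / l ^ 4 < (\<Sum>i<n. (e \<omega> i)\<^sup>2 * (b \<omega> i)\<^sup>2) / n}"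
  define N5 where "N5 = {\<omega>\<in>space Pn. (\<Sum>i<n. (b \<omega> i)\<^sup>2 * u P (obsZ (\<omega> i))) / n \<le> s ^ 8 / l ^ 4 \<and>
    s / sqrt l < mxa {1..K} (\<lambda>k. (\<Sum>i<n. e \<omega> i * b \<omega> i * w k (obsZ (\<omega> i))) / sqrt n)}"
  define N6 where "N6 = {\<omega>\<in>space Pn. (\<Sum>i<n. (a \<omega> i)\<^sup>2 * v P (obsZ (\<omega> i))) / n \<le> s ^ 8 / l ^ 4 \<and> s ^ 6 / l ^ 4 < (\<Sum>i<n. (x \<omega> i)\<^sup>2 * (a \<omega> i)\<^sup>2) / n}"
  define N7 where "N7 = {\<omega>\<in>space Pn. (\<Sum>i<n. (a \<omega> i)\<^sup>2 * v P (obsZ (\<omega> i))) / n \<le> s ^ 8 / l ^ 4 \<and>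
    s / sqrt l < mxa {1..K} (\<lambda>k. (\<Sum>i<n. x \<omega> i * a \<omega> i * w k (obsZ (\<omega> i))) / sqrt n)}"
  define CV where "CV \<omega> = mxa ({1..K} \<times> {1..K}) (\<lambda>(k, j). (\<Sum>i<n. X (\<omega> i) k * X (\<omega> i) j) / n - \<Sigma> k j)" for \<omega>
  define N8 where "N8 = {\<omega>\<in>space Pn. s ^ 3 / l\<^sup>2 < CV \<omega>}"
  define N9 where "N9 = {\<omega>\<in>space Pn. sqrt l / s < T \<omega>}"
  define F where "F t = measure (gstd {1..K}) {\<xi>\<in>space (gstd {1..K}). mxa {1..K} (lin L {1..K} \<xi>) \<le> t}" for t
  have sp: "0 < s ^ 3 / l\<^sup>2" "0 < s ^ 8 / l ^ 4" "0 < sqrt l" "sqrt l * sqrt l = l" using s l1 by auto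

  have TF: "\<bar>measure Pn {\<omega>\<in>space Pn. T \<omega> \<le> t} - F t\<bar> \<le> 16000 * s" for t
    unfolding Pn_def T_def F_def
    using max_abs_gaussian_approximation[OF WR(4) K0 n WR(5-7) q0(1) lam l2K s(1) s1 small' WR(8) L[unfolded \<Sigma>_def]] .
  have mA: "NA \<in> sets Pn" "measure Pn NA \<le> s"
  proof -
    have [measurable]: "(\<lambda>\<omega>. \<Sum>i<n. (a \<omega> i)\<^sup>2) \<in> borel_measurable Pn" "(\<lambda>\<omega>. \<Sum>i<n. (b \<omega> i)\<^sup>2) \<in> borel_measurable Pn"
      using am bm by (auto intro!: borel_measurable_sum)
    show "NA \<in> sets Pn" unfolding NA_def by measurable
    have "s ^ 8 < \<bar>Af f fh n P \<omega> * Ag g gh n P \<omega> / (1 / (real n * (ln (real K))\<^sup>2))\<bar> \<longleftrightarrow>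
      s ^ 8 / l\<^sup>2 < (\<Sum>i<n. (a \<omega> i)\<^sup>2) * (\<Sum>i<n. (b \<omega> i)\<^sup>2) / n" for \<omega>
    proof -
      define y where "y = (\<Sum>i<n. (a \<omega> i)\<^sup>2) * (\<Sum>i<n. (b \<omega> i)\<^sup>2) / n"
      have y0: "0 \<le> y" unfolding y_def by (intro divide_nonneg_nonneg mult_nonneg_nonneg sum_nonneg) auto
      have "Af f fh n P \<omega> * Ag g gh n P \<omega> = y / n" by (simp add: Af_def Ag_def a_def b_def y_def)
      then have "Af f fh n P \<omega> * Ag g gh n P \<omega> / (1 / (real n * (ln (real K))\<^sup>2)) = y * l\<^sup>2" using n by (simp add: l_def)
      moreover have "0 < l\<^sup>2" using l1 by simp
      ultimately show ?thesis unfolding y_def[symmetric] using y0 by (simp add: divide_less_eq)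
    qed
    then show "measure Pn NA \<le> s" using AfAg by (simp add: probn_def sample_def Pn_def NA_def)
  qed
  have mBf: "NBf \<in> sets Pn" "measure Pn NBf \<le> s"
  proof -
    have [measurable]: "(\<lambda>\<omega>. \<Sum>i<n. (a \<omega> i)\<^sup>2 * v P (obsZ (\<omega> i))) \<in> borel_measurable Pn"
      using am um by (auto intro!: borel_measurable_sum borel_measurable_times borel_measurable_power)
    show "NBf \<in> sets Pn" unfolding NBf_def by measurable
    have "s ^ 8 < \<bar>Bf f fh v n P \<omega> / (1 / (ln (real K)) ^ 4)\<bar> \<longleftrightarrow> s ^ 8 / l ^ 4 < (\<Sum>i<n. (a \<omega> i)\<^sup>2 * v P (obsZ (\<omega> i))) / n" for \<omega>
    proof -
      define y where "y = (\<Sum>i<n. (a \<omega> i)\<^sup>2 * v P (obsZ (\<omega> i))) / n"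
      have y0: "0 \<le> y" unfolding y_def using u0 by (intro divide_nonneg_nonneg mult_nonneg_nonneg sum_nonneg) auto
      have "Bf f fh v n P \<omega> = y" by (simp add: Bf_def a_def y_def)
      moreover have "0 < l ^ 4" using l1 by simp
      ultimately show ?thesis unfolding y_def[symmetric] l_def[symmetric] using y0 by (simp add: divide_less_eq)
    qed
    then show "measure Pn NBf \<le> s" using Bf by (simp add: probn_def sample_def Pn_def NBf_def)
  qed
  have mBg: "NBg \<in> sets Pn" "measure Pn NBg \<le> s"
  proof -
    have [measurable]: "(\<lambda>\<omega>. \<Sum>i<n. (b \<omega> i)\<^sup>2 * u P (obsZ (\<omega> i))) \<in> borel_measurable Pn"
      using bm um by (auto intro!: borel_measurable_sum borel_measurable_times borel_measurable_power)
    show "NBg \<in> sets Pn" unfolding NBg_def by measurable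
    have "s ^ 8 < \<bar>Bg g gh u n P \<omega> / (1 / (ln (real K)) ^ 4)\<bar> \<longleftrightarrow> s ^ 8 / l ^ 4 < (\<Sum>i<n. (b \<omega> i)\<^sup>2 * u P (obsZ (\<omega> i))) / n" for \<omega>
    proof -
      define y where "y = (\<Sum>i<n. (b \<omega> i)\<^sup>2 * u P (obsZ (\<omega> i))) / n"
      have y0: "0 \<le> y" unfolding y_def using u0 by (intro divide_nonneg_nonneg mult_nonneg_nonneg sum_nonneg) auto
      have "Bg g gh u n P \<omega> = y" by (simp add: Bg_def b_def y_def)
      moreover have "0 < l ^ 4" using l1 by simp
      ultimately show ?thesis unfolding y_def[symmetric] l_def[symmetric] using y0 by (simp add: divide_less_eq)
    qed
    then show "measure Pn NBg \<le> s" using Bg by (simp add: probn_def sample_def Pn_def NBg_def)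
  qed
  have wm: "w k \<in> borel_measurable borel" for k using w by blast
  have wb: "\<bar>w k z\<bar> \<le> C1" if "k \<in> {1..K}" for k z using w that by blast
  have ib: "ignores_at obsY (\<lambda>(y, z). (0, y, z)) k (\<lambda>\<omega>. b \<omega> i)" if "i < n" "k < n" for i k
    unfolding b_def by (rule ignores_at_ghat)
  have ia: "ignores_at obsX (\<lambda>(x, z). (x, 0, z)) k (\<lambda>\<omega>. a \<omega> i)" if "i < n" "k < n" for i k
    unfolding a_def by (rule ignores_at_fhat)
  note ce1 = cross_events[where b=b and w=w, OF rm(1) n K0 l1 l2K bm[unfolded Pn_def] ib wm wb s(1) s1]
  note ce2 = cross_events[where b=a and w=w, OF rm(2) n K0 l1 l2K am[unfolded Pn_def] ia wm wb s(1) s1]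
  have "N4 \<in> sets Pn \<and> measure Pn N4 \<le> s \<and> N5 \<in> sets Pn \<and> measure Pn N5 \<le> (2 + C1\<^sup>2) * s"
    unfolding N4_def N5_def e_def Pn_def by (intro conjI; rule ce1; assumption)
  then have m4: "N4 \<in> sets Pn" "measure Pn N4 \<le> s" "N5 \<in> sets Pn" "measure Pn N5 \<le> (2 + C1\<^sup>2) * s" by blast+
  have "N6 \<in> sets Pn \<and> measure Pn N6 \<le> s \<and> N7 \<in> sets Pn \<and> measure Pn N7 \<le> (2 + C1\<^sup>2) * s"
    unfolding N6_def N7_def x_def Pn_def by (intro conjI; rule ce2; assumption)
  then have m6: "N6 \<in> sets Pn" "measure Pn N6 \<le> s" "N7 \<in> sets Pn" "measure Pn N7 \<le> (2 + C1\<^sup>2) * s" by blast+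
  have m8: "N8 \<in> sets Pn" "measure Pn N8 \<le> 7 * s"
  proof -
    note cc = covariance_concentration[OF WR(4) IK WR(5,7) q0(2) lam lK n, folded \<Sigma>_def, folded Pn_def, folded CV_def]
    have [measurable]: "CV \<in> borel_measurable Pn" using cc(1) by auto
    show "N8 \<in> sets Pn" unfolding N8_def by measurable
    show "measure Pn N8 \<le> 7 * s" unfolding N8_def
    proof (rule markov_gt[OF PS cc(1) _ _ sp(1)])
      show "0 \<le> CV \<omega>" for \<omega> unfolding CV_def using IK by (intro mxa_nonneg) auto
      show "(\<integral>\<omega>. CV \<omega> \<partial>Pn) \<le> s ^ 3 / l\<^sup>2 * (7 * s)" using cc(2) rates(2) by linarith
    qed
  qed
  \<comment> \<open>The tail of the oracle statistic is read off its Gaussian counterpart: 16000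
    from the approximation plus 16 from the Gaussian tail.\<close>
  have m9: "N9 \<in> sets Pn" "measure Pn N9 \<le> 16016 * s"
  proof -
    note Tm[measurable]
    show "N9 \<in> sets Pn" unfolding N9_def by measurable
    let ?t = "sqrt l / s"
    have "N9 = space Pn - {\<omega>\<in>space Pn. T \<omega> \<le> ?t}" unfolding N9_def by auto
    then have p9: "measure Pn N9 = 1 - measure Pn {\<omega>\<in>space Pn. T \<omega> \<le> ?t}"
      by (simp only:) (intro S.prob_compl, measurable)
    interpret G: prob_space "gstd {1..K}" by (rule prob_space_gstd)
    note mxa_lin_measurable[OF K0, of L "{1..K}", measurable]
    have "{\<xi>\<in>space (gstd {1..K}). ?t < mxa {1..K} (lin L {1..K} \<xi>)} = space (gstd {1..K}) - {\<xi>\<in>space (gstd {1..K}). mxa {1..K} (lin L {1..K} \<xi>) \<le> ?t}"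
      by auto
    then have "measure (gstd {1..K}) {\<xi>\<in>space (gstd {1..K}). ?t < mxa {1..K} (lin L {1..K} \<xi>)} = 1 - F ?t"
      unfolding F_def by (simp only:) (intro G.prob_compl, measurable)
    moreover have "measure (gstd {1..K}) {\<xi>\<in>space (gstd {1..K}). ?t < mxa {1..K} (lin L {1..K} \<xi>)} \<le> card {1..K} * (2 * exp (- ?t\<^sup>2 / 4))"
      using sp(3) s(1) by (intro gauss_max_tail[OF IK IK(1) unit]) simp
    moreover have "card {1..K} * (2 * exp (- ?t\<^sup>2 / 4)) \<le> 16 * s"
      using gaussian_tail_rate[OF K0 l1[unfolded l_def] s(1) s100] by (simp add: l_def)
    ultimately show "measure Pn N9 \<le> 16016 * s" using p9 TF[of ?t] by linarith
  qed
  define N where "N = NA \<union> NBf \<union> NBg \<union> N4 \<union> N5 \<union> N6 \<union> N7 \<union> N8 \<union> N9"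
  have N: "N \<in> sets Pn" unfolding N_def using mA mBf mBg m4 m6 m8 m9 by auto
  have mN: "measure Pn N \<le> 16040 * \<kappa>\<^sup>2 * s"
  proof -
    have U: "measure Pn (A \<union> C) \<le> x + y" if "A \<in> sets Pn \<and> measure Pn A \<le> x" "C \<in> sets Pn \<and> measure Pn C \<le> y" for A C x y
      using measure_Un_le[of A Pn C] that by linarith
    have U': "A \<union> C \<in> sets Pn \<and> measure Pn (A \<union> C) \<le> x + y" if "A \<in> sets Pn \<and> measure Pn A \<le> x" "C \<in> sets Pn \<and> measure Pn C \<le> y" for A C x y
      using U[OF that] that by auto
    have "measure Pn N \<le> s + s + s + s + (2 + C1\<^sup>2) * s + s + (2 + C1\<^sup>2) * s + 7 * s + 16016 * s"
      unfolding N_def using mA mBf mBg m4 m6 m8 m9 by (intro U U' conjI)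
    moreover have "(2 + C1\<^sup>2) * s \<le> 3 * (\<kappa>\<^sup>2 * s)"
    proof -
      have "C1\<^sup>2 * s \<le> \<kappa>\<^sup>2 * s" using C1 s by (intro mult_right_mono) auto
      then show ?thesis using ks by (simp add: distrib_right)
    qed
    moreover have "p \<le> 16040 * y" if "p \<le> s + s + s + s + z + s + z + 7 * s + 16016 * s" "z \<le> 3 * y" "s \<le> y" for p y z :: real
      using that s(1) by linarith
    ultimately have "measure Pn N \<le> 16040 * (\<kappa>\<^sup>2 * s)" using ks by blast
    then show ?thesis by (simp only: mult.assoc)
  qed
  have mono: "mono F"
  proof
    fix t t' :: real assume "t \<le> t'"
    interpret G: prob_space "gstd {1..K}" by (rule prob_space_gstd)
    note mxa_lin_measurable[OF K0, of L "{1..K}", measurable]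
    show "F t \<le> F t'" unfolding F_def
    proof (rule G.finite_measure_mono)
      show "{\<xi>\<in>space (gstd {1..K}). mxa {1..K} (lin L {1..K} \<xi>) \<le> t'} \<in> sets (gstd {1..K})" by measurable
    qed (use \<open>t \<le> t'\<close> in auto)
  qed
  have lip: "F t' - F t \<le> 27 * sqrt (2 * l) * (t' - t)" if "t \<le> t'" for t t'
    unfolding F_def l_def by (rule gaussian_cdf_lipschitz[OF K unit that])
  define r where "r = 74 * \<kappa>\<^sup>2 * s / sqrt l"
  have ksp: "0 \<le> \<kappa>\<^sup>2 * s" using s by simp
  have r0: "0 \<le> r" using s sp by (simp add: r_def)
  have lipr: "F (t + r) - F t \<le> 3000 * \<kappa>\<^sup>2 * s" for t
  proof -
    have "F (t + r) - F t \<le> 27 * sqrt (2 * l) * r" using lip[of t "t + r"] r0 by simp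
    also have "\<dots> = 1998 * sqrt 2 * (\<kappa>\<^sup>2 * s)" using sp(3) by (simp add: r_def real_sqrt_mult)
    also have "\<dots> \<le> 3000 * (\<kappa>\<^sup>2 * s)"
    proof (rule mult_right_mono[OF _ ksp])
      have "sqrt 2 \<le> (1.5 :: real)" by (rule real_le_lsqrt) (simp_all add: power2_eq_square)
      then show "1998 * sqrt 2 \<le> (3000 :: real)" by linarith
    qed
    finally show ?thesis by simp
  qed
  define Fh where "Fh \<omega> t = measure (gstd {..<n}) {\<xi>\<in>space (gstd {..<n}). mxa {1..K} (lin (standardized fh gh w n \<omega>) {..<n} \<xi>) \<le> t}" for \<omega> t
  have good: "\<bar>Sstat fh gh w K n \<omega> - T \<omega>\<bar> \<le> r"
    "k \<in> {1..K} \<Longrightarrow> j \<in> {1..K} \<Longrightarrow> \<bar>Sigma_hat fh gh w n \<omega> k j - \<Sigma> k j\<bar> \<le> 340 * \<kappa>\<^sup>2 * (s ^ 3 / l\<^sup>2)"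
    if "\<omega> \<in> space Pn" "\<omega> \<notin> N" for \<omega> k j
  proof -
    have nb: "\<omega> \<notin> NA" "\<omega> \<notin> NBf" "\<omega> \<notin> NBg" "\<omega> \<notin> N4" "\<omega> \<notin> N5" "\<omega> \<notin> N6" "\<omega> \<notin> N7" "\<omega> \<notin> N8" "\<omega> \<notin> N9"
      using that(2) unfolding N_def by auto
    have hf: "(\<Sum>i<n. (a \<omega> i)\<^sup>2 * v P (obsZ (\<omega> i))) / n \<le> s ^ 8 / l ^ 4" using nb(2) that(1) unfolding NBf_def by auto
    have hg: "(\<Sum>i<n. (b \<omega> i)\<^sup>2 * u P (obsZ (\<omega> i))) / n \<le> s ^ 8 / l ^ 4" using nb(3) that(1) unfolding NBg_def by auto
    have Xe: "X (\<omega> i) k = e \<omega> i * x \<omega> i * (w k (obsZ (\<omega> i)) / \<sigma> k)" for i k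
      by (simp add: X_def res_prod_def e_def x_def)
    have h0: "Rk fh gh w n \<omega> k i = (e \<omega> i + a \<omega> i) * (x \<omega> i + b \<omega> i) * w k (obsZ (\<omega> i))" for k i
      by (simp add: Rk_def e_def a_def x_def b_def)
    have h1: "(\<Sum>i<n. (a \<omega> i)\<^sup>2) * (\<Sum>i<n. (b \<omega> i)\<^sup>2) / n \<le> s ^ 8 / l\<^sup>2" using nb(1) that(1) unfolding NA_def by auto
    have h2: "(\<Sum>i<n. (e \<omega> i)\<^sup>2 * (b \<omega> i)\<^sup>2) / n \<le> s ^ 6 / l ^ 4" using nb(4) hg that(1) unfolding N4_def by auto
    have h3: "(\<Sum>i<n. (x \<omega> i)\<^sup>2 * (a \<omega> i)\<^sup>2) / n \<le> s ^ 6 / l ^ 4" using nb(6) hf that(1) unfolding N6_def by auto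
    have h4': "mxa {1..K} (\<lambda>k. (\<Sum>i<n. e \<omega> i * b \<omega> i * w k (obsZ (\<omega> i))) / sqrt n) \<le> s / sqrt l" using nb(5) hg that(1) unfolding N5_def by auto
    have h5': "mxa {1..K} (\<lambda>k. (\<Sum>i<n. x \<omega> i * a \<omega> i * w k (obsZ (\<omega> i))) / sqrt n) \<le> s / sqrt l" using nb(7) hf that(1) unfolding N7_def by auto
    have h6': "CV \<omega> \<le> s ^ 3 / l\<^sup>2" using nb(8) that(1) unfolding N8_def by auto
    have h7': "T \<omega> \<le> sqrt l / s" using nb(9) that(1) unfolding N9_def by auto
    have h4: "\<bar>(\<Sum>i<n. e \<omega> i * b \<omega> i * w k (obsZ (\<omega> i))) / sqrt n\<bar> \<le> s / sqrt l" if "k \<in> {1..K}" for k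
      using h4' that unfolding mxa_le_iff[OF IK] by blast
    have h5: "\<bar>(\<Sum>i<n. x \<omega> i * a \<omega> i * w k (obsZ (\<omega> i))) / sqrt n\<bar> \<le> s / sqrt l" if "k \<in> {1..K}" for k
      using h5' that unfolding mxa_le_iff[OF IK] by blast
    have h6: "\<bar>(\<Sum>i<n. (e \<omega> i * x \<omega> i * (w k (obsZ (\<omega> i)) / \<sigma> k)) * (e \<omega> i * x \<omega> i * (w j (obsZ (\<omega> i)) / \<sigma> j))) / n - \<Sigma> k j\<bar> \<le> s ^ 3 / l\<^sup>2"
      if "k \<in> {1..K}" "j \<in> {1..K}" for k j
    proof -
      have "finite ({1..K} \<times> {1..K})" "(k, j) \<in> {1..K} \<times> {1..K}" using that by auto
      from mxa_ge[OF this, of "\<lambda>(k, j). (\<Sum>i<n. X (\<omega> i) k * X (\<omega> i) j) / n - \<Sigma> k j", folded CV_def]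
      have "\<bar>(\<Sum>i<n. X (\<omega> i) k * X (\<omega> i) j) / n - \<Sigma> k j\<bar> \<le> CV \<omega>" by simp
      then show ?thesis unfolding Xe using h6' by linarith
    qed
    have h7: "\<bar>(\<Sum>i<n. e \<omega> i * x \<omega> i * (w k (obsZ (\<omega> i)) / \<sigma> k)) / sqrt n\<bar> \<le> sqrt l / s" if "k \<in> {1..K}" for k
      using h7' that unfolding T_def mxa_le_iff[OF IK] Xe by blast
    have S1: "\<Sigma> k k = 1" if "k \<in> {1..K}" for k using WR(8) that unfolding \<Sigma>_def by blast
    have S2: "\<bar>\<Sigma> k j\<bar> \<le> 1" if "k \<in> {1..K}" "j \<in> {1..K}" for k j using WR(9) that by blast
    have s0: "0 < \<sigma> k" "1 \<le> \<kappa> * \<sigma> k" "\<bar>w k y\<bar> \<le> \<kappa> * \<sigma> k" if "k \<in> {1..K}" for k y using WR(1-3) that by blast+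
    note ge = good_event[where e="e \<omega>" and x="x \<omega>" and a="a \<omega>" and b="b \<omega>" and z="\<lambda>i. obsZ (\<omega> i)" and \<omega>=\<omega> and fh=fh and gh=gh and w=w
        and \<Sigma>=\<Sigma> and \<sigma>=\<sigma> and l=l and s=s and \<kappa>=\<kappa>, OF n K0 l1 s \<kappa>(1) h0 s0 S1 S2 h1 h2 h3 h4 h5 h6 h7 rates(1)]
    show "\<bar>Sstat fh gh w K n \<omega> - T \<omega>\<bar> \<le> r" unfolding T_def Xe r_def by (rule ge(1); assumption)
    show "\<bar>Sigma_hat fh gh w n \<omega> k j - \<Sigma> k j\<bar> \<le> 340 * \<kappa>\<^sup>2 * (s ^ 3 / l\<^sup>2)" if "k \<in> {1..K}" "j \<in> {1..K}" by (rule ge(2)) (assumption | rule that)+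
  qed
  have FF: "\<bar>Fh \<omega> t - F t\<bar> \<le> (476000 * \<kappa>\<^sup>2 + 54) * s" if \<omega>: "\<omega> \<in> space Pn" "\<omega> \<notin> N" for \<omega> t
  proof -
    \<comment> \<open>The same smoothing width as in the Gaussian approximation, now for comparing
      the bootstrap law with its target.\<close>
    define del where "del = s / sqrt (2 * l)"
    define \<Delta> where "\<Delta> = 340 * \<kappa>\<^sup>2 * (s ^ 3 / l\<^sup>2)"
    have del: "0 < del" using s l1 by (simp add: del_def)
    have \<Delta>0: "0 \<le> \<Delta>" unfolding \<Delta>_def using sp(1) by (intro mult_nonneg_nonneg) auto
    have c1: "\<forall>k\<in>{1..K}. \<forall>j\<in>{1..K}. \<bar>(\<Sum>i\<in>{..<n}. standardized fh gh w n \<omega> k i * standardized fh gh w n \<omega> j i) - (\<Sum>m\<in>{1..K}. L k m * L j m)\<bar> \<le> \<Delta>"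
    proof (intro ballI)
      fix k j assume kj: "k \<in> {1..K}" "j \<in> {1..K}"
      have "(\<Sum>m\<in>{1..K}. L k m * L j m) = \<Sigma> k j" using L kj by blast
      then show "\<bar>(\<Sum>i\<in>{..<n}. standardized fh gh w n \<omega> k i * standardized fh gh w n \<omega> j i) - (\<Sum>m\<in>{1..K}. L k m * L j m)\<bar> \<le> \<Delta>"
        using good(2)[OF \<omega> kj] unfolding Sigma_hat_gram[OF n] \<Delta>_def by (simp only:)
    qed
    then have c2: "\<forall>k\<in>{1..K}. \<forall>j\<in>{1..K}. \<bar>(\<Sum>m\<in>{1..K}. L k m * L j m) - (\<Sum>i\<in>{..<n}. standardized fh gh w n \<omega> k i * standardized fh gh w n \<omega> j i)\<bar> \<le> \<Delta>"
      by (simp only: abs_minus_commute)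
    \<comment> \<open>The powers of \<open>l\<close> and \<open>s\<close> cancel down to a single
      \<open>s\<close>; the number is 350 times 4 times 340.\<close>
    have cst: "350 * (2 * l) / del\<^sup>2 * \<Delta> = 476000 * (\<kappa>\<^sup>2 * s)"
      using s l1 unfolding del_def \<Delta>_def by (simp add: power_divide power2_eq_square power3_eq_cube field_simps)
    have "Fh \<omega> t \<le> F (t + 2 * del) + 476000 * (\<kappa>\<^sup>2 * s)"
      using gaussian_max_compare[OF K0 finite_lessThan IK(1) lam l2K del \<Delta>0 c1, of t] unfolding cst F_def Fh_def .
    moreover have "F (t - 2 * del) \<le> Fh \<omega> t + 476000 * (\<kappa>\<^sup>2 * s)"
      using gaussian_max_compare[OF K0 IK(1) finite_lessThan lam l2K del \<Delta>0 c2, of "t - 2 * del"] unfolding cst F_def Fh_def by simp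
    moreover have "27 * sqrt (2 * l) * (2 * del) = 54 * s" using l1 by (simp add: del_def)
    then have "F (t + 2 * del) - F t \<le> 54 * s" "F t - F (t - 2 * del) \<le> 54 * s"
      using lip[of t "t + 2 * del"] lip[of "t - 2 * del" t] del by auto
    moreover have "(476000 * \<kappa>\<^sup>2 + 54) * s = 476000 * (\<kappa>\<^sup>2 * s) + 54 * s" by (simp add: distrib_right)
    ultimately show ?thesis by linarith
  qed
  note qe = quantile_event_sets[OF P0(1,2) wm fhm[unfolded Pn_def] ghm[unfolded Pn_def] K0 n \<alpha>, folded Pn_def]
  have "\<bar>measure Pn {\<omega>\<in>space Pn. Sstat fh gh w K n \<omega> \<le> Ghat fh gh w K n \<omega> \<alpha>} - \<alpha>\<bar>
    \<le> 3000 * \<kappa>\<^sup>2 * s + 16000 * s + 16040 * \<kappa>\<^sup>2 * s + (476000 * \<kappa>\<^sup>2 + 54) * s + s"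
  proof (rule bootstrap_coverage[OF PS Tm qe N mN _ mono lipr TF good(1) FF _ \<alpha> s(1)])
    show "\<exists>t. F t = c" if "0 < c" "c < 1" for c
      unfolding F_def by (rule gaussian_cdf_attains[OF K unit that])
    show "\<omega> \<in> {\<omega>\<in>space Pn. Sstat fh gh w K n \<omega> \<le> Ghat fh gh w K n \<omega> \<alpha>} \<longleftrightarrow> (\<forall>t<Sstat fh gh w K n \<omega>. Fh \<omega> t < \<alpha>)"
      if "\<omega> \<in> space Pn" for \<omega>
      unfolding Fh_def using that Ghat_characterization[OF K0 n \<alpha>] by blast
  qed (use s ksp in auto)
  also have "\<dots> \<le> 1000000 * (\<kappa>\<^sup>2 * s)"
  proof -
    have "(476000 * \<kappa>\<^sup>2 + 54) * s = 476000 * (\<kappa>\<^sup>2 * s) + 54 * s" by (simp add: distrib_right)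
    then show ?thesis using ks ksp by linarith
  qed
  finally show ?thesis unfolding probn_def sample_def Pn_def by (simp only: mult.assoc)
qed

section \<open>From the asymptotic assumptions to the finite-sample bound\<close>

lemma nn_integral_scale_le:
  assumes h: "h \<in> borel_measurable M" and c: "0 < c" and le: "(\<integral>\<^sup>+x. ennreal (h x / c) \<partial>M) \<le> 4"
  shows "(\<integral>\<^sup>+x. ennreal (h x) \<partial>M) \<le> ennreal (4 * c)"
proof -
  have "ennreal (h x) = ennreal c * ennreal (h x / c)" for x
    using c by (subst ennreal_mult'[symmetric]) auto
  then have "(\<integral>\<^sup>+x. ennreal (h x) \<partial>M) = ennreal c * (\<integral>\<^sup>+x. ennreal (h x / c) \<partial>M)"
    using h by (simp add: nn_integral_cmult)
  also have "\<dots> \<le> ennreal c * ennreal 4" using le by (intro mult_left_mono) auto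
  also have "\<dots> = ennreal (4 * c)" using c by (subst ennreal_mult[symmetric]) (auto simp: mult.commute)
  finally show ?thesis .
qed

text \<open>Both alternatives meet in one pair of moment bounds. Under \<open>A1b\<close> the third
  moment carries \<open>sqrt B\<close>, which is at most \<open>B\<close> as
  \<open>B \<ge> 1\<close>, and the fourth moment bound is the separate last summand; under
  \<open>A1a\<close> both bounds come from the maximum.\<close>

lemma A1_moments:
  assumes m: "epsxi f g P \<in> borel_measurable P" and B: "1 \<le> B" and A: "A1a f g P B \<or> A1b f g P B"
  shows "(\<integral>\<^sup>+m. ennreal (\<bar>epsxi f g P m\<bar> ^ 3) \<partial>P) \<le> ennreal (4 * B)"
    and "(\<integral>\<^sup>+m. ennreal (\<bar>epsxi f g P m\<bar> ^ 4) \<partial>P) \<le> ennreal (4 * B\<^sup>2)"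
proof -
  note m[measurable]
  have le1: "x \<le> 4 \<and> y \<le> 4 \<and> z \<le> 4" if "max x y + z \<le> 4" for x y z :: ennreal
  proof -
    have "max x y \<le> max x y + z" "z \<le> max x y + z" by (auto intro: add_increasing add_increasing2)
    then have "max x y \<le> 4" "z \<le> 4" using that by (meson order_trans)+
    then show ?thesis by simp
  qed
  have m4: "(\<integral>\<^sup>+m. ennreal (\<bar>epsxi f g P m\<bar> ^ 4 / B\<^sup>2) \<partial>P) \<le> 4"
    using A le1 unfolding A1a_def A1b_def by blast
  show "(\<integral>\<^sup>+m. ennreal (\<bar>epsxi f g P m\<bar> ^ 4) \<partial>P) \<le> ennreal (4 * B\<^sup>2)"
    using B by (intro nn_integral_scale_le m4) auto
  from A show "(\<integral>\<^sup>+m. ennreal (\<bar>epsxi f g P m\<bar> ^ 3) \<partial>P) \<le> ennreal (4 * B)"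
  proof
    assume "A1a f g P B"
    then have "(\<integral>\<^sup>+m. ennreal (\<bar>epsxi f g P m\<bar> ^ 3 / B) \<partial>P) \<le> 4" using le1 unfolding A1a_def by blast
    then show ?thesis using B by (intro nn_integral_scale_le) auto
  next
    assume "A1b f g P B"
    then have "(\<integral>\<^sup>+m. ennreal (\<bar>epsxi f g P m\<bar> ^ 3 / B powr (1/2)) \<partial>P) \<le> 4" using le1 unfolding A1b_def by blast
    then have "(\<integral>\<^sup>+m. ennreal (\<bar>epsxi f g P m\<bar> ^ 3) \<partial>P) \<le> ennreal (4 * B powr (1/2))"
      using B by (intro nn_integral_scale_le) auto
    also have "\<dots> \<le> ennreal (4 * B)"
      using B powr_mono[of "1/2" 1 B] by (intro ennreal_leI) simp
    finally show ?thesis .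
  qed
qed

text \<open>Squaring the target gives \<open>16 * 128 = 2048\<close> times
  \<open>\<kappa>^6 * B^2 * (ln K)^7\<close> on the left and \<open>s^8 * n\<close> on the right,
  which is the growth condition up to constants.\<close>

lemma rate_condition:
  fixes n K :: nat and B C c s \<kappa> :: real
  assumes K: "3 \<le> K" and n: "0 < n" and B: "1 \<le> B" and \<kappa>: "1 \<le> \<kappa>" and s: "0 < s"
    and A2: "B\<^sup>2 * (ln (real K * real n)) ^ 7 / real n \<le> C * real n powr (- c)"
    and small: "2048 * \<kappa> ^ 6 * (C * real n powr (- c)) \<le> s ^ 8"
  shows "4 * B * \<kappa> ^ 3 * ((2 * ln K) ^ 3 * sqrt (2 * ln K)) \<le> s ^ 4 * sqrt n"
proof (rule power2_le_imp_le)
  have l: "0 \<le> ln (real K)" using K by simp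
  have "ln (real K) \<le> ln (real K * real n)" using K n by (simp add: ln_mult)
  then have "(ln (real K)) ^ 7 \<le> (ln (real K * real n)) ^ 7" using l by (intro power_mono) auto
  then have "B\<^sup>2 * (ln (real K)) ^ 7 \<le> B\<^sup>2 * (ln (real K * real n)) ^ 7" by (intro mult_left_mono) auto
  also have "\<dots> \<le> C * real n powr (- c) * n" using A2 n by (simp add: divide_le_eq)
  finally have "2048 * \<kappa> ^ 6 * (B\<^sup>2 * (ln (real K)) ^ 7) \<le> 2048 * \<kappa> ^ 6 * (C * real n powr (- c) * n)"
    using \<kappa> by (intro mult_left_mono) auto
  also have "\<dots> = 2048 * \<kappa> ^ 6 * (C * real n powr (- c)) * n" by simp
  also have "\<dots> \<le> s ^ 8 * n" using small by (intro mult_right_mono) auto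
  finally have le: "2048 * \<kappa> ^ 6 * (B\<^sup>2 * (ln (real K)) ^ 7) \<le> s ^ 8 * n" .
  have "(4 * B * \<kappa> ^ 3 * ((2 * y) ^ 3 * sqrt (2 * y)))\<^sup>2 = 2048 * \<kappa> ^ 6 * (B\<^sup>2 * y ^ 7)" if "0 \<le> y" for y
  proof -
    have "(sqrt (2 * y))\<^sup>2 = 2 * y" using that by simp
    then show ?thesis by (simp add: power_mult_distrib power_mult[symmetric] power_numeral_reduce)
  qed
  note sq = this[OF l]
  have "(s ^ 4 * sqrt n)\<^sup>2 = s ^ 8 * n" by (simp add: power_mult_distrib power_mult[symmetric])
  then show "(4 * B * \<kappa> ^ 3 * ((2 * ln K) ^ 3 * sqrt (2 * ln K)))\<^sup>2 \<le> (s ^ 4 * sqrt n)\<^sup>2"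
    using le unfolding sq by (simp only:)
qed (use s in simp)

lemma powr_neg_eventually_small:
  assumes "0 < c" "0 < d"
  shows "\<exists>N. \<forall>n\<ge>N. M * real n powr (- c) \<le> d"
proof -
  have "(\<lambda>n. M * real n powr (- c)) \<longlonglongrightarrow> M * 0"
    using assms by (intro tendsto_mult_left tendsto_neg_powr filterlim_real_sequentially) auto
  then have "eventually (\<lambda>n. M * real n powr (- c) < d) sequentially"
    using assms by (intro order_tendstoD) auto
  then show ?thesis unfolding eventually_sequentially by (meson less_imp_le)
qed

theorem theorem5:
  fixes \<P> :: "('z::euclidean_space) obs measure set"
    and f g u v :: "'z obs measure \<Rightarrow> 'z \<Rightarrow> real"
    and fh gh :: "'z regr"
    and w :: "nat \<Rightarrow> 'z \<Rightarrow> real"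
    and K :: "nat \<Rightarrow> nat"
    and \<tau>f \<tau>g :: "nat \<Rightarrow> real"
  assumes sub: "\<P> \<subseteq> P0"
    and f_P: "\<forall>P\<in>\<P>. cond_mean P obsX (f P)"
    and g_P: "\<forall>P\<in>\<P>. cond_mean P obsY (g P)"
    and u_P: "\<forall>P\<in>\<P>. cond_mean_nn P (\<lambda>w. (obsX w - f P (obsZ w))\<^sup>2) (u P)"
    and v_P: "\<forall>P\<in>\<P>. cond_mean_nn P (\<lambda>w. (obsY w - g P (obsZ w))\<^sup>2) (v P)"
    and K3: "\<forall>n. 3 \<le> K n"
    and w_meas: "\<forall>k. w k \<in> borel_measurable borel"
    and fh_meas: "\<forall>n. \<forall>i<n. (\<lambda>\<omega>. fhat fh n \<omega> (obsZ (\<omega> i))) \<in> borel_measurable (PiM {..<n} (\<lambda>_. borel))"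
    and gh_meas: "\<forall>n. \<forall>i<n. (\<lambda>\<omega>. ghat gh n \<omega> (obsZ (\<omega> i))) \<in> borel_measurable (PiM {..<n} (\<lambda>_. borel))"
    and A12: "\<exists>C>0. \<exists>c>0. \<forall>n. \<forall>P\<in>\<P>. \<exists>B\<ge>1.
               (A1a f g P B \<or> A1b f g P B) \<and>
               B\<^sup>2 * (ln (real (K n) * real n)) ^ 7 / real n \<le> C * real n powr (- c)"
    and weights: "\<exists>C1>0. \<exists>c1>0. \<forall>n. \<forall>k\<in>{1..K n}. (\<forall>z. \<bar>w k z\<bar> \<le> C1) \<and>
               (\<forall>P\<in>\<P>. ennreal c1 \<le> (\<integral>\<^sup>+x. ennreal ((epsxi f g P x)\<^sup>2 * (w k (obsZ x))\<^sup>2) \<partial>P))"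
    and AfAg: "smallo_P \<P> (\<lambda>n P \<omega>. Af f fh n P \<omega> * Ag g gh n P \<omega>)
                 (\<lambda>n. 1 / (real n * (ln (real (K n)))\<^sup>2))"
    and Bf: "smallo_P \<P> (Bf f fh v) (\<lambda>n. 1 / (ln (real (K n)))^4)"
    and Bg: "smallo_P \<P> (Bg g gh u) (\<lambda>n. 1 / (ln (real (K n)))^4)"
    and tau_pos: "\<forall>n. 0 < \<tau>f n" "\<forall>n. 0 < \<tau>g n"
    and eps_max: "bigO_P \<P> (\<lambda>n P \<omega>. Max (insert 0 ((\<lambda>i. \<bar>obsX (\<omega> i) - f P (obsZ (\<omega> i))\<bar>) ` {..<n}))) \<tau>g"
    and Ag_tau: "smallo_P \<P> (Ag g gh) (\<lambda>n. 1 / ((\<tau>g n)\<^sup>2 * (ln (real (K n)))\<^sup>2))"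
    and xi_max: "bigO_P \<P> (\<lambda>n P \<omega>. Max (insert 0 ((\<lambda>i. \<bar>obsY (\<omega> i) - g P (obsZ (\<omega> i))\<bar>) ` {..<n}))) \<tau>f"
    and Af_tau: "smallo_P \<P> (Af f fh) (\<lambda>n. 1 / ((\<tau>f n)\<^sup>2 * (ln (real (K n)))\<^sup>2))"
  shows "\<forall>\<epsilon>>0. \<exists>N. \<forall>n\<ge>N. \<forall>P\<in>\<P>. \<forall>\<alpha>\<in>{0<..<1}.
           \<bar>probn n P (\<lambda>\<omega>. Sstat fh gh w (K n) n \<omega> \<le> Ghat fh gh w (K n) n \<omega> \<alpha>) - \<alpha>\<bar> \<le> \<epsilon>"
proof (intro allI impI)
  fix \<epsilon> :: real assume \<epsilon>: "0 < \<epsilon>"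
  obtain C c where Cc: "0 < C" "0 < c" and A12': "\<forall>n. \<forall>P\<in>\<P>. \<exists>B\<ge>1. (A1a f g P B \<or> A1b f g P B) \<and>
      B\<^sup>2 * (ln (real (K n) * real n)) ^ 7 / real n \<le> C * real n powr (- c)"
    using A12 by blast
  obtain C1 c1 where c1: "0 < C1" "0 < c1" and wts: "\<forall>n. \<forall>k\<in>{1..K n}. (\<forall>z. \<bar>w k z\<bar> \<le> C1) \<and>
      (\<forall>P\<in>\<P>. ennreal c1 \<le> (\<integral>\<^sup>+x. ennreal ((epsxi f g P x)\<^sup>2 * (w k (obsZ x))\<^sup>2) \<partial>P))"
    using weights by blast
  \<comment> \<open>One summand for each of the four lower bounds required of \<kappa>.\<close>
  define \<kappa> where "\<kappa> = 1 + C1 + 1 / sqrt c1 + C1 / sqrt c1"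
  have sc: "0 < sqrt c1" using c1 by simp
  have \<kappa>: "1 \<le> \<kappa>" "1 \<le> \<kappa> * sqrt c1" "C1 \<le> \<kappa> * sqrt c1" "C1 \<le> \<kappa>"
  proof -
    have "\<kappa> * sqrt c1 = sqrt c1 + C1 * sqrt c1 + 1 + C1" using sc by (simp add: \<kappa>_def distrib_right)
    moreover have "0 < C1 * sqrt c1" "0 < 1 / sqrt c1" "0 < C1 / sqrt c1" using sc c1 by auto
    ultimately show "1 \<le> \<kappa>" "1 \<le> \<kappa> * sqrt c1" "C1 \<le> \<kappa> * sqrt c1" "C1 \<le> \<kappa>"
      using c1 sc unfolding \<kappa>_def by linarith+
  qed
  \<comment> \<open>The first entry satisfies the smallness condition of the finite-sample bound,
    the second brings its conclusion down to \<epsilon>.\<close>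
  define s where "s = min (1 / (100 * \<kappa>\<^sup>2)) (\<epsilon> / (1000000 * \<kappa>\<^sup>2))"
  have k2: "0 < \<kappa>\<^sup>2" using \<kappa>(1) by simp
  have s0: "0 < s" using \<epsilon> k2 by (simp add: s_def)
  have s1: "100 * \<kappa>\<^sup>2 * s \<le> 1"
  proof -
    have "s \<le> 1 / (100 * \<kappa>\<^sup>2)" by (simp add: s_def)
    then show ?thesis using k2 by (simp add: le_divide_eq mult.commute)
  qed
  have s\<epsilon>: "1000000 * \<kappa>\<^sup>2 * s \<le> \<epsilon>"
  proof -
    have "s \<le> \<epsilon> / (1000000 * \<kappa>\<^sup>2)" by (simp add: s_def)
    then show ?thesis using k2 by (simp add: le_divide_eq mult.commute)
  qed
  have s8: "0 < s ^ 8" using s0 by simp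
  obtain N1 where N1: "\<forall>n\<ge>N1. 2048 * \<kappa> ^ 6 * C * real n powr (- c) \<le> s ^ 8"
    using powr_neg_eventually_small[OF Cc(2) s8] by blast
  \<comment> \<open>The stochastic orders are evaluated with tolerance \<open>s^8\<close> for the
    values and \<open>s\<close> for the probabilities.\<close>
  obtain N2 where N2: "\<forall>n\<ge>N2. \<forall>P\<in>\<P>. probn n P (\<lambda>\<omega>. \<bar>Af f fh n P \<omega> * Ag g gh n P \<omega> / (1 / (real n * (ln (real (K n)))\<^sup>2))\<bar> > s ^ 8) \<le> s"
    using AfAg s8 s0 unfolding smallo_P_def by blast
  obtain N3 where N3: "\<forall>n\<ge>N3. \<forall>P\<in>\<P>. probn n P (\<lambda>\<omega>. \<bar>Bf f fh v n P \<omega> / (1 / (ln (real (K n))) ^ 4)\<bar> > s ^ 8) \<le> s"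
    using Bf s8 s0 unfolding smallo_P_def by blast
  obtain N4 where N4: "\<forall>n\<ge>N4. \<forall>P\<in>\<P>. probn n P (\<lambda>\<omega>. \<bar>Bg g gh u n P \<omega> / (1 / (ln (real (K n))) ^ 4)\<bar> > s ^ 8) \<le> s"
    using Bg s8 s0 unfolding smallo_P_def by blast
  show "\<exists>N. \<forall>n\<ge>N. \<forall>P\<in>\<P>. \<forall>\<alpha>\<in>{0<..<1}.
      \<bar>probn n P (\<lambda>\<omega>. Sstat fh gh w (K n) n \<omega> \<le> Ghat fh gh w (K n) n \<omega> \<alpha>) - \<alpha>\<bar> \<le> \<epsilon>"
  \<comment> \<open>The leading 1 guarantees a nonempty sample; summing the indices dominates each
    of them.\<close>
  proof (intro exI[of _ "1 + N1 + N2 + N3 + N4"] allI impI ballI)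
    fix n P \<alpha> assume nn: "1 + N1 + N2 + N3 + N4 \<le> n" and P: "P \<in> \<P>" and \<alpha>: "\<alpha> \<in> {0<..<1::real}"
    have n: "0 < n" "N1 \<le> n" "N2 \<le> n" "N3 \<le> n" "N4 \<le> n" using nn by auto
    have P0: "P \<in> P0" and fP: "cond_mean P obsX (f P)" and gP: "cond_mean P obsY (g P)"
      and uP: "cond_mean_nn P (\<lambda>w. (obsX w - f P (obsZ w))\<^sup>2) (u P)" and vP: "cond_mean_nn P (\<lambda>w. (obsY w - g P (obsZ w))\<^sup>2) (v P)"
      using sub f_P g_P u_P v_P P by auto
    have K: "3 \<le> K n" using K3 by blast
    obtain B where B: "1 \<le> B" "A1a f g P B \<or> A1b f g P B" "B\<^sup>2 * (ln (real (K n) * real n)) ^ 7 / real n \<le> C * real n powr (- c)"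
      using A12' P by blast
    note obs_measurable[OF P0_model(2)[OF P0], measurable]
    have [measurable]: "f P \<in> borel_measurable borel" "g P \<in> borel_measurable borel" using fP gP by (auto simp: cond_mean_def)
    have "epsxi f g P \<in> borel_measurable P" unfolding epsxi_def[abs_def] by measurable
    note mom = A1_moments[OF this B(1,2)]
    have "2048 * \<kappa> ^ 6 * (C * real n powr (- c)) \<le> s ^ 8" using N1 n(2) by (simp add: mult.assoc)
    note small = rate_condition[OF K n(1) B(1) \<kappa>(1) s0 B(3) this]
    have wb: "\<forall>k\<in>{1..K n}. \<forall>z. \<bar>w k z\<bar> \<le> C1" using wts by blast
    have low: "\<forall>k\<in>{1..K n}. ennreal c1 \<le> (\<integral>\<^sup>+x. ennreal ((epsxi f g P x)\<^sup>2 * (w k (obsZ x))\<^sup>2) \<partial>P)" using wts P by blast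
    have fm: "(\<lambda>\<omega>. fhat fh n \<omega> (obsZ (\<omega> i))) \<in> borel_measurable (PiM {..<n} (\<lambda>_. borel))" if "i < n" for i using fh_meas that by blast
    have gm: "(\<lambda>\<omega>. ghat gh n \<omega> (obsZ (\<omega> i))) \<in> borel_measurable (PiM {..<n} (\<lambda>_. borel))" if "i < n" for i using gh_meas that by blast
    have a: "0 < \<alpha>" "\<alpha> < 1" using \<alpha> by auto
    have "\<bar>probn n P (\<lambda>\<omega>. Sstat fh gh w (K n) n \<omega> \<le> Ghat fh gh w (K n) n \<omega> \<alpha>) - \<alpha>\<bar> \<le> 1000000 * \<kappa>\<^sup>2 * s"
      by (rule finite_sample[OF P0 fP gP uP vP K n(1) fm gm B(1) mom w_meas wb low c1(2) \<kappa> s0 s1 small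
            N2[rule_format, OF n(3) P] N3[rule_format, OF n(4) P] N4[rule_format, OF n(5) P] a])
    then show "\<bar>probn n P (\<lambda>\<omega>. Sstat fh gh w (K n) n \<omega> \<le> Ghat fh gh w (K n) n \<omega> \<alpha>) - \<alpha>\<bar> \<le> \<epsilon>" using s\<epsilon> by linarith
  qed
qed

end
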